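(* Let $t>0$, $\beta>0$ and $a<2\sqrt t$. For $N\ge1$ let $\mathcal{P}_N(a)$ be the probability that $\max_i\lambda_i\le a$ when $(\lambda_1,\dots,\lambda_N)\in\mathbb{R}^N$ has density proportional to $\prod_{i<j}|\lambda_i-\lambda_j|^{2\beta}\prod_{i=1}^N e^{-\frac{N\beta}{2t}\lambda_i^2}$. Assume that the constrained partition function has a $1/N$ expansion (spelled out in the context). Put $$\alpha=\tfrac13\big(2a-\sqrt{a^2+12t}\big),\qquad \gamma=\tfrac16\big(a+\sqrt{a^2+12t}\big),\qquad s=\frac{2\gamma-\alpha+\sqrt{\alpha(\alpha-4\gamma)}}{2\gamma}.$$ Then, as $N\to\infty$, $$\ln\mathcal{P}_N(a)=\frac{N^2\beta}{t^2}F^{0,0}(a)+\frac{N(\beta-1)}{t}F^{0,1}(a)+F^{1,0}(a)+(\beta+\beta^{-1}-2)F^{0,2}(a)+\beta N^2\Big(\frac34-\frac{\ln t}{2}\Big)$$ $$\qquad+N(\beta-1)\Big(-\frac12+\ln(2\pi)+\frac{\ln t}{2}\Big)+\frac{\beta+\beta^{-1}-3}{12}\ln N+\frac{5-2(\beta+\beta^{-1})}{6}\ln2-\frac{\ln(2\pi)}2-\frac{\ln\beta}2+\kappa_\beta+o(1),$$ where $$F^{0,0}(a)=\frac{\alpha^2\gamma^2}{2}+\frac{\gamma^4}{4}-t\Big(\gamma^2+\frac{\alpha^2}{2}\Big)+t^2\ln\gamma,$$ $$F^{0,1}(a)=t\ln\Big(\frac{\gamma s}{2\pi t}\Big)-\Big(\alpha\gamma+\frac{\gamma^2}{2}\Big)+\Big(\frac{\alpha\gamma}{2}+\gamma^2\Big)\frac1s,$$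 $$F^{1,0}(a)=-\frac1{24}\ln\big[16\,t^{-4}\gamma^4\alpha^3(\alpha-4\gamma)\big],$$ $$F^{0,2}(a)=\frac1{12}\ln\Big(16\,t^{-2}\gamma^4\,\frac{s^{10}(s-1)^3}{(s+1)^{11}}\Big),$$ and $$\kappa_\beta=\frac{\ln(2\pi)}4+\beta\Big(\frac1{12}-\zeta'(-1)\Big)+\frac{\gamma_E}{12\beta}+\int_0^\infty\frac{d\sigma}{\sigma^2}\,\frac{1}{e^{\beta\sigma}-1}\Big(\frac{\sigma}{e^\sigma-1}-1+\frac\sigma2-\frac{\sigma^2}{12}\Big).$$
   Context: $\zeta$ is the Riemann zeta function and $\gamma_E$ the Euler–Mascheroni constant. (For $a<2\sqrt t$ one has $\alpha<0<\gamma$ and $s>1$, so all logarithms are real.) Assumption of a $1/N$ expansion: for a real polynomial $V$, $t>0$, $a\in\mathbb{R}$ and $\beta>0$ let $Z_{N,\beta}(a)=\int_{]-\infty,a]^N}\prod_{i<j}|\lambda_i-\lambda_j|^{2\beta}\prod_i e^{-\frac{N\beta}{t}V(\lambda_i)}d\lambda_i$. The assumption is that for all $(a,t,V)$ whose limiting eigenvalue density on $]-\infty,a]$ is supported on a single interval $[b,a]$, diverges like $(a-x)^{-1/2}$ at $a$, vanishes like $(x-b)^{1/2}$ at $b$ and is positive in between (for $V(x)=x^2/2$ this is the case for $a<2\sqrt t$), and for all $\beta>0$, as $N\to\infty$ there is an asymptotic expansion $$\ln Z_{N,\beta}(a)=D_{N,\beta}+\sum_{g,k\ge0}\Big(\frac{N\sqrt\beta}{t}\Big)^{2-2g-k}\Big(\sqrt\beta-\frac1{\sqrt\beta}\Big)^kF^{g,k},$$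 with $F^{g,k}$ depending on $(a,t,V)$ but not on $N,\beta$, and $D_{N,\beta}$ depending only on $N,\beta$. *)

theory Defs
  imports "HOL-Analysis.Analysis" "HOL-Computational_Algebra.Polynomial" "HOL-Library.Landau_Symbols"
begin

section \<open>The log-gas on a subset of the real line\<close>

text \<open>Points of \<open>\<real>\<^sup>N\<close> are extensional functions on \<open>{..<N}\<close>, and Lebesgue measure on \<open>\<real>\<^sup>N\<close> is
  the product measure \<open>\<Pi>\<^sub>M i\<in>{..<N}. lborel\<close>.\<close>

definition gas_weight :: "nat \<Rightarrow> real \<Rightarrow> real \<Rightarrow> real poly \<Rightarrow> (nat \<Rightarrow> real) \<Rightarrow> real" where
  "gas_weight N \<beta> t V x =
     (\<Prod>(i, j) \<in> {(i, j). i < j \<and> j < N}. \<bar>x i - x j\<bar> powr (2 * \<beta>)) *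
     (\<Prod>i<N. exp (- (real N * \<beta> / t) * poly V (x i)))"

definition gas_integrable :: "nat \<Rightarrow> real \<Rightarrow> real \<Rightarrow> real poly \<Rightarrow> real set \<Rightarrow> bool" where
  "gas_integrable N \<beta> t V A \<longleftrightarrow>
     set_integrable (\<Pi>\<^sub>M i\<in>{..<N}. lborel) (\<Pi>\<^sub>E i\<in>{..<N}. A) (gas_weight N \<beta> t V)"

definition gas_partition :: "nat \<Rightarrow> real \<Rightarrow> real \<Rightarrow> real poly \<Rightarrow> real set \<Rightarrow> real" where
  "gas_partition N \<beta> t V A =
     set_lebesgue_integral (\<Pi>\<^sub>M i\<in>{..<N}. lborel) (\<Pi>\<^sub>E i\<in>{..<N}. A) (gas_weight N \<beta> t V)"

text \<open>The law of \<open>N\<close> eigenvalues all confined to \<open>A\<close>.\<close>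

definition gas_law :: "nat \<Rightarrow> real \<Rightarrow> real \<Rightarrow> real poly \<Rightarrow> real set \<Rightarrow> (nat \<Rightarrow> real) measure" where
  "gas_law N \<beta> t V A = density (\<Pi>\<^sub>M i\<in>{..<N}. lborel)
     (\<lambda>x. ennreal (indicator (\<Pi>\<^sub>E i\<in>{..<N}. A) x * gas_weight N \<beta> t V x / gas_partition N \<beta> t V A))"

definition gauss_potential :: "real poly" where
  "gauss_potential = [:0, 0, 1 / 2:]"

definition max_cdf :: "nat \<Rightarrow> real \<Rightarrow> real \<Rightarrow> real \<Rightarrow> real" where
  "max_cdf N \<beta> t a =
     (let M = gas_law N \<beta> t gauss_potential UNIV
      in measure M {x \<in> space M. Max (x ` {..<N}) \<le> a})"


section \<open>The assumption of a 1/N expansion\<close>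

text \<open>\<open>\<rho>\<close> is the limiting eigenvalue density on \<open>{..a}\<close>: the mean empirical measure of the
  constrained eigenvalues converges weakly to \<open>\<rho>(x) dx\<close>.  The scaling of the weight makes the
  limit independent of \<open>\<beta>\<close>.\<close>

definition limiting_density :: "real \<Rightarrow> real \<Rightarrow> real poly \<Rightarrow> (real \<Rightarrow> real) \<Rightarrow> bool" where
  "limiting_density a t V \<rho> \<longleftrightarrow>
     (\<forall>x. 0 \<le> \<rho> x) \<and> integrable lborel \<rho> \<and>
     (\<forall>\<beta>>0. (\<forall>N\<ge>1. gas_integrable N \<beta> t V {..a}) \<and>
        (\<forall>f :: real \<Rightarrow> real. continuous_on UNIV f \<and> bounded (range f) \<longrightarrow>
           (\<lambda>N. \<integral>x. (\<Sum>i<N. f (x i)) / real N \<partial>gas_law N \<beta> t V {..a})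
             \<longlonglongrightarrow> (\<integral>y. f y * \<rho> y \<partial>lborel)))"

text \<open>A density is only determined almost everywhere, so without continuity in the interior an
  interior zero could be hidden by changing \<open>\<rho>\<close> at one point.\<close>

definition one_cut_hard_edge :: "real \<Rightarrow> real \<Rightarrow> real poly \<Rightarrow> bool" where
  "one_cut_hard_edge a t V \<longleftrightarrow>
     (\<exists>\<rho> b. limiting_density a t V \<rho> \<and> b < a \<and>
        (\<forall>x. x \<notin> {b..a} \<longrightarrow> \<rho> x = 0) \<and>
        continuous_on {b<..<a} \<rho> \<and> (\<forall>x\<in>{b<..<a}. 0 < \<rho> x) \<and>
        (\<exists>c>0. ((\<lambda>x. \<rho> x / (a - x) powr (- 1 / 2)) \<longlongrightarrow> c) (at_left a)) \<and>
        (\<exists>c>0. ((\<lambda>x. \<rho> x / (x - b) powr (1 / 2)) \<longlongrightarrow> c) (at_right b)))"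

text \<open>The asymptotic expansion is in Poincare's sense.  The order in \<open>N\<close> of the \<open>(g, k)\<close> term is
  \<open>2 - 2g - k\<close>; terms are grouped by the value of \<open>2g + k\<close>.\<close>

definition has_topological_expansion ::
  "(nat \<Rightarrow> real) \<Rightarrow> real \<Rightarrow> real \<Rightarrow> (nat \<Rightarrow> nat \<Rightarrow> real) \<Rightarrow> bool" where
  "has_topological_expansion h \<beta> t F \<longleftrightarrow>
     (\<forall>K::nat. (\<lambda>N. h N -
         (\<Sum>(g, k) \<in> {(g, k). 2 * g + k \<le> K}.
            (real N * sqrt \<beta> / t) powi (2 - 2 * int g - int k) *
            (sqrt \<beta> - 1 / sqrt \<beta>) ^ k * F g k))
       \<in> o(\<lambda>N. real N powi (2 - int K)))"

definition one_over_N_expansion :: bool where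
  "one_over_N_expansion \<longleftrightarrow>
     (\<exists>D :: nat \<Rightarrow> real \<Rightarrow> real. \<forall>a t V. 0 < t \<and> one_cut_hard_edge a t V \<longrightarrow>
        (\<exists>F :: nat \<Rightarrow> nat \<Rightarrow> real. \<forall>\<beta>>0.
           has_topological_expansion (\<lambda>N. ln (gas_partition N \<beta> t V {..a}) - D N \<beta>) \<beta> t F))"


section \<open>The Gaussian coefficients and the constant term\<close>

definition alpha_par :: "real \<Rightarrow> real \<Rightarrow> real" where
  "alpha_par t a = (2 * a - sqrt (a\<^sup>2 + 12 * t)) / 3"

definition gamma_par :: "real \<Rightarrow> real \<Rightarrow> real" where
  "gamma_par t a = (a + sqrt (a\<^sup>2 + 12 * t)) / 6"

definition s_par :: "real \<Rightarrow> real \<Rightarrow> real" where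
  "s_par t a = (let \<alpha> = alpha_par t a; \<gamma> = gamma_par t a
     in (2 * \<gamma> - \<alpha> + sqrt (\<alpha> * (\<alpha> - 4 * \<gamma>))) / (2 * \<gamma>))"

definition F00 :: "real \<Rightarrow> real \<Rightarrow> real" where
  "F00 t a = (let \<alpha> = alpha_par t a; \<gamma> = gamma_par t a
     in \<alpha>\<^sup>2 * \<gamma>\<^sup>2 / 2 + \<gamma> ^ 4 / 4 - t * (\<gamma>\<^sup>2 + \<alpha>\<^sup>2 / 2) + t\<^sup>2 * ln \<gamma>)"

definition F01 :: "real \<Rightarrow> real \<Rightarrow> real" where
  "F01 t a = (let \<alpha> = alpha_par t a; \<gamma> = gamma_par t a; s = s_par t a
     in t * ln (\<gamma> * s / (2 * pi * t)) - (\<alpha> * \<gamma> + \<gamma>\<^sup>2 / 2) + (\<alpha> * \<gamma> / 2 + \<gamma>\<^sup>2) * (1 / s))"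

definition F10 :: "real \<Rightarrow> real \<Rightarrow> real" where
  "F10 t a = (let \<alpha> = alpha_par t a; \<gamma> = gamma_par t a
     in - (1 / 24) * ln (16 * t powi (- 4) * \<gamma> ^ 4 * \<alpha> ^ 3 * (\<alpha> - 4 * \<gamma>)))"

definition F02 :: "real \<Rightarrow> real \<Rightarrow> real" where
  "F02 t a = (let \<gamma> = gamma_par t a; s = s_par t a
     in (1 / 12) * ln (16 * t powi (- 2) * \<gamma> ^ 4 * (s ^ 10 * (s - 1) ^ 3 / (s + 1) ^ 11)))"

text \<open>The Riemann zeta function, as the analytic continuation of its Dirichlet series.  It is unique
  away from the pole; the value at \<open>1\<close> is unspecified.\<close>

definition riemann_zeta :: "complex \<Rightarrow> complex" where
  "riemann_zeta = (SOME f. f holomorphic_on (- {1}) \<and>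
     (\<forall>s. 1 < Re s \<longrightarrow> (\<lambda>n. of_nat (Suc n) powr (- s)) sums f s))"

text \<open>The derivative of zeta at \<open>-1\<close> is real, so \<open>Re\<close> only adjusts the type.\<close>

definition kappa :: "real \<Rightarrow> real" where
  "kappa \<beta> = ln (2 * pi) / 4 + \<beta> * (1 / 12 - Re (deriv riemann_zeta (- 1)))
     + euler_mascheroni / (12 * \<beta>)
     + (LBINT \<sigma>:{0<..}. 1 / \<sigma>\<^sup>2 * (1 / (exp (\<beta> * \<sigma>) - 1)) *
          (\<sigma> / (exp \<sigma> - 1) - 1 + \<sigma> / 2 - \<sigma>\<^sup>2 / 12))"

end

theory Submission
 imports Defs "HOL-Probability.Probability" "HOL-Complex_Analysis.Complex_Analysis" "HOL-Real_Asymp.Real_Asymp"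
begin

text \<open>With \<open>x = a - \<gamma> y\<close> and \<open>\<theta> = \<gamma>\<^sup>2 / t\<close> the constrained gas becomes a gas on \<open>y > 0\<close> with potential
 \<open>(1 - 3 \<theta>) y + \<theta> y\<^sup>2 / 2\<close> at inverse temperature \<open>N \<beta>\<close>, and \<open>a < 2 \<surd>t\<close> becomes \<open>\<theta> < 1\<close>. At \<open>\<theta> = 0\<close> this is a Laguerre
 ensemble, whose partition function is a product of Gamma functions by Aomoto's recursion; a limit of
 it also gives Mehta's integral, the normalisation of the unconstrained gas. The logarithmic derivative
 of the partition function in \<open>\<theta>\<close> is a multiple of the first moment up to explicit terms, so it suffices to
 know that moment up to \<open>o(N\<^sup>-\<^sup>2)\<close>, with an error that stays integrable at \<open>\<theta> = 0\<close>.

 The loop equations for the averages of \<open>(1 + u y)\<^sup>-\<^sup>k\<close> determine it. Their quadratic discriminant has a double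
 root in the limit; at the points where its derivative vanishes before the limit, the equations close
 on the first moment, given bounds for the covariances of linear statistics. Those come from the
 Prekopa-Leindler inequality on the chamber \<open>x\<^sub>0 < x\<^sub>1 < ...\<close>, where the gas is log-concave, for every \<open>\<beta> > 0\<close>.

 The asymptotics of the Gamma product follow from Binet's formula, which produces the integral in
 \<open>\<kappa>\<^sub>\<beta>\<close>, and from Euler-Maclaurin summation, which produces \<open>\<zeta>'(-1)\<close>.\<close>

section \<open>The Prekopa-Leindler inequality\<close>

text \<open>In the variable \<open>y\<close> the limiting density is (1 - th + th y) sqrt((4 - y) /
  y) / (2 pi) on [0, 4] for every \<open>th\<close>, and its factor 1 - th + th y vanishes at y =
  -(1 - th) / th, a point that reaches the wall as th tends to 1. The double root is u = -1/y for
  this y, that is u = th / (1 - th). There the linear operator of the loop equations degenerates in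
  the limit; for finite N an exact zero of it is supplied by the intermediate value theorem, and at
  that zero the equations become triangular. Since the root is double, the unknown displacement of
  the zero enters the first moment only squared. One variance remains, fixed to leading order by a
  loop equation with a linear statistic inserted, in which third cumulants need only be bounded. So
  concentration with constants independent of N suffices, and the midpoint form f(x) g(y) <= h((x +
  y) / 2)^2 of Prekopa-Leindler bounds E exp(s X) E exp(-s X) in a single application. These bounds
  carry a factor \<open>th\<close>, which pays for the 1 / th in the logarithmic derivative.\<close>

lemma nn_integral_layer_cake_real:
 fixes f :: "real => ennreal"
 assumes [measurable]: "f \<in> borel_measurable borel"
 shows "(\<integral>\<^sup>+u. emeasure lborel {x. ennreal u < f x} * indicator {0<..<1} u \<partial>lborel) <= (\<integral>\<^sup>+x. f x \<partial>lborel)"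
  and "(!!x. f x <= 1) ==> (\<integral>\<^sup>+x. f x \<partial>lborel) = (\<integral>\<^sup>+u. emeasure lborel {x. ennreal u < f x} * indicator {0<..<1} u \<partial>lborel)"
proof -
 have eq: "(\<integral>\<^sup>+u. emeasure lborel {x. ennreal u < f x} * indicator {0<..<1::real} u \<partial>lborel)
   = (\<integral>\<^sup>+x. emeasure lborel {u. u \<in> {0<..<1} \<and> ennreal u < f x} \<partial>lborel)"
 proof -
  have "(\<integral>\<^sup>+u. emeasure lborel {x. ennreal u < f x} * indicator {0<..<1::real} u \<partial>lborel)
    = (\<integral>\<^sup>+u. (\<integral>\<^sup>+x. indicator {x. ennreal u < f x} x * indicator {0<..<1} u \<partial>lborel) \<partial>lborel)"
   by (intro nn_integral_cong) (simp add: nn_integral_multc)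
  also have "... = (\<integral>\<^sup>+x. (\<integral>\<^sup>+u. indicator {x. ennreal u < f x} x * indicator {0<..<1::real} u \<partial>lborel) \<partial>lborel)"
  proof (rule lborel_pair.Fubini')
   have "(%(x,u). indicator {p. ennreal (snd p) < f (fst p)} (x,u) * indicator {0<..<1::real} u :: ennreal) \<in> borel_measurable (lborel \<Otimes>\<^sub>M lborel)"
    unfolding split_beta' by measurable
   then show "(%(x, u). indicator {x. ennreal u < f x} x * indicator {0<..<1::real} u :: ennreal) \<in> borel_measurable (lborel \<Otimes>\<^sub>M lborel)"
    by (rule measurable_cong[THEN iffD1, rotated]) (auto simp: indicator_def)
  qed
  also have "... = (\<integral>\<^sup>+x. emeasure lborel {u. u \<in> {0<..<1} \<and> ennreal u < f x} \<partial>lborel)"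
  proof (intro nn_integral_cong)
   fix x
   have "(\<integral>\<^sup>+u. indicator {x. ennreal u < f x} x * indicator {0<..<1::real} u \<partial>lborel)
    = (\<integral>\<^sup>+u. indicator {u. u \<in> {0<..<1} \<and> ennreal u < f x} u \<partial>lborel)"
    by (intro nn_integral_cong) (auto simp: indicator_def)
   also have "... = emeasure lborel {u. u \<in> {0<..<1} \<and> ennreal u < f x}"
    by (rule nn_integral_indicator) measurable
   finally show "(\<integral>\<^sup>+u. indicator {x. ennreal u < f x} x * indicator {0<..<1::real} u \<partial>lborel) = emeasure lborel {u. u \<in> {0<..<1} \<and> ennreal u < f x}" .
  qed
  finally show ?thesis .
 qed
 \<comment> \<open>Cutting the levels off at 1 replaces \<open>f\<close> by its minimum with 1:
   harmless for functions bounded by 1, and an inequality in the useful direction for all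
   others.\<close>
 have le: "emeasure lborel {u. u \<in> {0<..<1} \<and> ennreal u < f x} = min 1 (f x)" for x
 proof (cases "f x >= 1")
  case True
  then have "{u. u \<in> {0<..<1} \<and> ennreal u < f x} = {0<..<1}"
   by (auto intro: less_le_trans[of "ennreal _" 1] simp: ennreal_less_one_iff)
  then show ?thesis using True by (simp add: min_def)
 next
  case False
  then obtain r where r: "f x = ennreal r" "0 <= r" by (cases "f x") auto
  with False have "r < 1" using ennreal_le_iff2[of 1 r] by (simp add: not_le ennreal_less_one_iff)
  then have "{u. u \<in> {0<..<1} \<and> ennreal u < f x} = {0<..<r}"
   using r by (auto simp: ennreal_less_iff)
  with False r show ?thesis by (simp add: min_def)
 qed
 show "(\<integral>\<^sup>+u. emeasure lborel {x. ennreal u < f x} * indicator {0<..<1} u \<partial>lborel) <= (\<integral>\<^sup>+x. f x \<partial>lborel)"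
  unfolding eq le by (intro nn_integral_mono) simp
 show "(\<integral>\<^sup>+x. f x \<partial>lborel) = (\<integral>\<^sup>+u. emeasure lborel {x. ennreal u < f x} * indicator {0<..<1} u \<partial>lborel)" if "!!x. f x <= 1"
  unfolding eq le using that by (intro nn_integral_cong) (simp add: min_absorb2)
qed

text \<open>The cut points in \<open>brunn_minkowski_real\<close> have to be elements of the set,
  whose supremum may be infinite or not attained. Segments ending at elements still exhaust the
  measure, because a largest point is a null set.\<close>

lemma emeasure_le_if_initial_segments_le:
 fixes A :: "real set"
 assumes [measurable]: "A \<in> sets borel" and le: "!!a. a \<in> A ==> emeasure lborel (A \<inter> {..a}) <= c"
 shows "emeasure lborel A <= c"
proof (cases "A = {}")
 case False
 show ?thesis
 proof (cases "bdd_above A")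
  case True
  define S where "S = Sup A"
  have ub: "x <= S" if "x \<in> A" for x using that True unfolding S_def by (rule cSup_upper)
  have "emeasure lborel A = emeasure lborel (A - {S})"
   by (rule emeasure_Diff_null_set[symmetric]) (auto simp: null_sets_def)
  also have "A - {S} = (\<Union>n. A \<inter> {..S - 1 / Suc n})"
  proof (intro equalityI subsetI)
   fix x assume x: "x \<in> A - {S}"
   then have "x < S" using ub by force
   then obtain n where "inverse (real (Suc n)) < S - x" using reals_Archimedean[of "S - x"] by auto
   then have "x <= S - 1 / Suc n" by (simp add: inverse_eq_divide)
   with x show "x \<in> (\<Union>n. A \<inter> {..S - 1 / Suc n})" by auto
  next
   fix x assume "x \<in> (\<Union>n. A \<inter> {..S - 1 / Suc n})"
   then obtain n where "x \<in> A" "x <= S - 1 / Suc n" by auto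
   moreover have "1 / real (Suc n) > 0" by simp
   ultimately show "x \<in> A - {S}" by auto
  qed
  also have "emeasure lborel ... = (SUP n. emeasure lborel (A \<inter> {..S - 1 / Suc n}))"
  proof (rule SUP_emeasure_incseq[symmetric])
   show "incseq (%n. A \<inter> {..S - 1 / real (Suc n)})"
   proof (rule incseq_SucI)
    fix n
    have "1 / real (Suc (Suc n)) <= 1 / real (Suc n)" by (simp add: frac_le)
    then show "A \<inter> {..S - 1 / real (Suc n)} \<subseteq> A \<inter> {..S - 1 / real (Suc (Suc n))}" by auto
   qed
  qed auto
  also have "... <= c"
  proof (rule SUP_least)
   fix n
   have "S - 1 / Suc n < S" by simp
   then obtain a where a: "a \<in> A" "S - 1 / Suc n < a" using less_cSup_iff[OF False True] S_def by auto
   have "emeasure lborel (A \<inter> {..S - 1 / real (Suc n)}) <= emeasure lborel (A \<inter> {..a})"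
    using a by (intro emeasure_mono) auto
   also have "... <= c" using a le by auto
   finally show "emeasure lborel (A \<inter> {..S - 1 / real (Suc n)}) <= c" .
  qed
  finally show ?thesis .
 next
  case unb: False
  have "A = (\<Union>n. A \<inter> {..real n})" by (auto simp: real_arch_simple)
  also have "emeasure lborel ... = (SUP n. emeasure lborel (A \<inter> {..real n}))"
   by (rule SUP_emeasure_incseq[symmetric]) (auto simp: incseq_def)
  also have "... <= c"
  proof (rule SUP_least)
   fix n
   obtain a where a: "a \<in> A" "real n < a" using unb by (force simp: bdd_above_def not_le)
   have "emeasure lborel (A \<inter> {..real n}) <= emeasure lborel (A \<inter> {..a})"
    using a by (intro emeasure_mono) auto
   also have "... <= c" using a le by auto
   finally show "emeasure lborel (A \<inter> {..real n}) <= c" .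
  qed
  finally show ?thesis .
 qed
qed auto

lemma emeasure_lborel_affine_vimage:
 fixes A :: "real set"
 assumes [measurable]: "A \<in> sets borel" and "c ~= 0"
 shows "emeasure lborel A = ennreal \<bar>c\<bar> * emeasure lborel ((%x. d + c * x) -` A)"
proof -
 have m [measurable]: "(%x. d + c * x) -` A \<in> sets borel"
  using measurable_sets_borel[of "%x. d + c * x" borel A] by simp
 have "emeasure lborel A = (\<integral>\<^sup>+x. indicator A x \<partial>lborel)" by simp
 also have "... = \<bar>c\<bar> * (\<integral>\<^sup>+x. indicator A (d + c * x) \<partial>lborel)"
  using assms by (intro nn_integral_real_affine) auto
 also have "(\<integral>\<^sup>+x. indicator A (d + c * x) \<partial>lborel) = (\<integral>\<^sup>+x. indicator ((%x. d + c * x) -` A) x \<partial>lborel)"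
  by (intro nn_integral_cong) (auto simp: indicator_def)
 finally show ?thesis using m by simp
qed

text \<open>For \<open>a\<close> in \<open>A\<close> and \<open>b\<close> in \<open>B\<close>, the
  part of \<open>A\<close> up to \<open>a\<close> averaged with \<open>b\<close> and the part of
  \<open>B\<close> from \<open>b\<close> on averaged with \<open>a\<close> both lie in
  \<open>C\<close>, and they meet at most in (a + b) / 2. Exhausting \<open>A\<close> and
  \<open>B\<close> by such parts gives the claim. \<open>C\<close> is any measurable set containing
  the midpoints, since the set of midpoints itself may fail to be measurable.\<close>

lemma brunn_minkowski_real:
 fixes A B C :: "real set"
 assumes [measurable]: "A \<in> sets borel" "B \<in> sets borel" "C \<in> sets borel"
  and ne: "A ~= {}" "B ~= {}"
  and mid: "!!x y. x \<in> A ==> y \<in> B ==> (x + y) / 2 \<in> C"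
 shows "emeasure lborel A + emeasure lborel B <= 2 * emeasure lborel C"
proof -
 have key: "emeasure lborel (A \<inter> {..a}) + emeasure lborel (B \<inter> {b..}) <= 2 * emeasure lborel C"
  if a: "a \<in> A" and b: "b \<in> B" for a b
 proof -
  define A' where "A' = (%x. - b + 2 * x) -` (A \<inter> {..a})"
  define B' where "B' = (%x. - a + 2 * x) -` (B \<inter> {b..})"
  have mA [measurable]: "A' \<in> sets borel" "B' \<in> sets borel"
   unfolding A'_def B'_def
   using measurable_sets_borel[of "%x. - b + 2 * x" borel "A \<inter> {..a}"]
    measurable_sets_borel[of "%x. - a + 2 * x" borel "B \<inter> {b..}"] by auto
  have "emeasure lborel (A \<inter> {..a}) = 2 * emeasure lborel A'"
   "emeasure lborel (B \<inter> {b..}) = 2 * emeasure lborel B'"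
   using emeasure_lborel_affine_vimage[of "A \<inter> {..a}" 2 "- b"] emeasure_lborel_affine_vimage[of "B \<inter> {b..}" 2 "- a"]
   unfolding A'_def B'_def by simp_all
  then have "emeasure lborel (A \<inter> {..a}) + emeasure lborel (B \<inter> {b..}) = 2 * (emeasure lborel A' + emeasure lborel B')"
   by (simp add: distrib_left)
  also have "emeasure lborel A' + emeasure lborel B' = emeasure lborel (A' - {(a+b)/2}) + emeasure lborel B'"
   by (subst emeasure_Diff_null_set) (auto simp: null_sets_def)
  also have "... = emeasure lborel ((A' - {(a+b)/2}) \<union> B')"
   by (rule plus_emeasure) (auto simp: A'_def B'_def)
  also have "... <= emeasure lborel C"
  proof (rule emeasure_mono)
   have "x \<in> C" if "x \<in> A'" for x using mid[of "-b + 2*x" b] that b unfolding A'_def by simp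
   moreover have "x \<in> C" if "x \<in> B'" for x using mid[of a "-a + 2*x"] that a unfolding B'_def by simp
   ultimately show "A' - {(a + b) / 2} \<union> B' \<subseteq> C" by auto
  qed simp
  finally show ?thesis by (simp add: mult_left_mono)
 qed
 have swap: "emeasure lborel (uminus -` X) = emeasure lborel X" if "X \<in> sets borel" for X :: "real set"
  using emeasure_lborel_affine_vimage[OF that, of "-1" 0] by (simp add: vimage_def)
 have k2: "emeasure lborel (A \<inter> {..a}) + emeasure lborel B <= 2 * emeasure lborel C" if a: "a \<in> A" for a
 proof (cases "emeasure lborel (A \<inter> {..a}) = \<infinity>")
  case True
  obtain b where "b \<in> B" using ne by auto
  from key[OF a this] True have "2 * emeasure lborel C = top" by (simp add: top_unique)
  then show ?thesis by simp
 next
  case False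
  \<comment> \<open>Reflection turns the upper parts of \<open>B\<close> into initial segments of
    its mirror image, so the same exhaustion lemma applies; the infinite case was split off to allow
    subtraction in \<open>ennreal\<close>.\<close>
  have "emeasure lborel (uminus -` B) <= 2 * emeasure lborel C - emeasure lborel (A \<inter> {..a})"
  proof (rule emeasure_le_if_initial_segments_le)
   show "uminus -` B \<in> sets borel" using measurable_sets_borel[of uminus borel B] by simp
   fix c assume "c \<in> uminus -` B"
   then have c: "-c \<in> B" by simp
   have "uminus -` B \<inter> {..c} = uminus -` (B \<inter> {-c..})" by auto
   then have "emeasure lborel (uminus -` B \<inter> {..c}) = emeasure lborel (B \<inter> {-c..})"
    using swap[of "B \<inter> {-c..}"] by simp
   moreover have "emeasure lborel (A \<inter> {..a}) + emeasure lborel (B \<inter> {-c..}) <= 2 * emeasure lborel C"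
    by (rule key[OF a c])
   ultimately show "emeasure lborel (uminus -` B \<inter> {..c}) <= 2 * emeasure lborel C - emeasure lborel (A \<inter> {..a})"
    using False by (simp add: ennreal_le_minus_iff add.commute)
  qed
  moreover have "emeasure lborel (A \<inter> {..a}) <= 2 * emeasure lborel C"
  proof -
   obtain b where "b \<in> B" using ne by auto
   from key[OF a this] show ?thesis by (rule order_trans[rotated]) simp
  qed
  ultimately show ?thesis using False swap[of B]
   by (auto simp: ennreal_le_minus_iff add.commute)
 qed
 show ?thesis
 proof (cases "emeasure lborel B = \<infinity>")
  case True
  obtain a where "a \<in> A" using ne by auto
  from k2[OF this] True have "2 * emeasure lborel C = top" by (simp add: top_unique)
  then show ?thesis by simp
 next
  case False
  have "emeasure lborel A <= 2 * emeasure lborel C - emeasure lborel B"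
   by (rule emeasure_le_if_initial_segments_le) (use k2 False in \<open>auto simp: ennreal_le_minus_iff add.commute\<close>)
  moreover have "emeasure lborel B <= 2 * emeasure lborel C"
  proof -
   obtain a where "a \<in> A" using ne by auto
   from k2[OF this] show ?thesis by (rule order_trans[rotated]) simp
  qed
  ultimately show ?thesis using False by (auto simp: ennreal_le_minus_iff add.commute)
 qed
qed


lemma ennreal_mult_le_power2_of_add_le:
 fixes a b c :: ennreal
 assumes "a + b <= 2 * c"
 shows "a * b <= c\<^sup>2"
proof (cases "c = top")
 case False
 then have "2 * c < top" by (simp add: less_top ennreal_mult_less_top)
 with assms have "a + b < top" by (rule le_less_trans)
 then obtain a' b' c' where abc: "a = ennreal a'" "b = ennreal b'" "c = ennreal c'" "0 <= a'" "0 <= b'" "0 <= c'"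
  using False by (cases a; cases b; cases c) auto
 with assms have "ennreal (a' + b') <= ennreal (2 * c')" by (simp add: ennreal_mult)
 then have "a' + b' <= 2 * c'" using abc by (subst (asm) ennreal_le_iff) auto
 moreover have "4 * (a' * b') <= (a' + b')\<^sup>2" using zero_le_power2[of "a' - b'"] by (simp add: power2_eq_square algebra_simps)
 moreover have "(a' + b')\<^sup>2 <= (2 * c')\<^sup>2" using calculation(1) abc by (intro power_mono) auto
 ultimately have "a' * b' <= c'\<^sup>2" by (simp add: power_mult_distrib)
 then show ?thesis using abc by (simp add: ennreal_mult[symmetric] ennreal_power ennreal_le_iff)
qed simp

text \<open>With both suprema equal to 1 the superlevel sets of \<open>f\<close> and
  \<open>g\<close> are nonempty for the same levels u < 1, as Brunn-Minkowski requires. Integrating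
  over the levels gives an additive inequality, the sum of the integrals of \<open>f\<close> and
  \<open>g\<close> against twice that of \<open>h\<close>, which is stronger than the product form
  by the inequality of the means.\<close>

lemma prekopa_leindler_real_normalized:
 fixes f g h :: "real => ennreal"
 assumes [measurable]: "f \<in> borel_measurable borel" "g \<in> borel_measurable borel" "h \<in> borel_measurable borel"
  and le1: "!!x. f x <= 1" "!!x. g x <= 1"
  and sup1: "!!u. 0 < u ==> u < 1 ==> \<exists>x. ennreal u < f x" "!!u. 0 < u ==> u < 1 ==> \<exists>x. ennreal u < g x"
  and mid: "!!x y. f x * g y <= (h ((x + y) / 2))\<^sup>2"
 shows "(\<integral>\<^sup>+x. f x \<partial>lborel) * (\<integral>\<^sup>+x. g x \<partial>lborel) <= (\<integral>\<^sup>+x. h x \<partial>lborel)\<^sup>2"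
proof (rule ennreal_mult_le_power2_of_add_le)
 have lev: "emeasure lborel {x. ennreal u < f x} + emeasure lborel {x. ennreal u < g x} <= 2 * emeasure lborel {x. ennreal u < h x}"
  if u: "0 < u" "u < 1" for u
 proof (rule brunn_minkowski_real)
  show "(x + y) / 2 \<in> {x. ennreal u < h x}" if "x \<in> {x. ennreal u < f x}" "y \<in> {x. ennreal u < g x}" for x y
  proof (rule ccontr)
   assume "(x + y) / 2 \<notin> {x. ennreal u < h x}"
   then have "h ((x + y) / 2) <= ennreal u" by simp
   then have "(h ((x + y) / 2))\<^sup>2 <= (ennreal u)\<^sup>2" by (intro power_mono) auto
   with mid[of x y] have le: "f x * g y <= ennreal (u\<^sup>2)" using u by (simp add: ennreal_power)
   obtain a b where ab: "f x = ennreal a" "g y = ennreal b" "0 <= a" "0 <= b"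
    using le1(1)[of x] le1(2)[of y] by (cases "f x"; cases "g y") (auto simp: top_unique)
   have "u < a" "u < b" using that ab u by (auto simp: ennreal_less_iff)
   then have "u * u < a * b" using u by (intro mult_strict_mono) auto
   moreover have "a * b <= u\<^sup>2" using le ab by (simp add: ennreal_mult[symmetric])
   ultimately show False by (simp add: power2_eq_square)
  qed
 qed (use sup1 u in auto)
 have "(\<integral>\<^sup>+x. f x \<partial>lborel) + (\<integral>\<^sup>+x. g x \<partial>lborel)
   = (\<integral>\<^sup>+u. (emeasure lborel {x. ennreal u < f x} + emeasure lborel {x. ennreal u < g x}) * indicator {0<..<1::real} u \<partial>lborel)"
  by (subst (1 2) nn_integral_layer_cake_real(2)) (use le1 in \<open>auto simp: distrib_right nn_integral_add\<close>)
 also have "... <= (\<integral>\<^sup>+u. 2 * (emeasure lborel {x. ennreal u < h x} * indicator {0<..<1::real} u) \<partial>lborel)"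
  using lev by (intro nn_integral_mono) (auto simp: indicator_def)
 also have "... = 2 * (\<integral>\<^sup>+u. emeasure lborel {x. ennreal u < h x} * indicator {0<..<1::real} u \<partial>lborel)"
  by (rule nn_integral_cmult) measurable
 also have "... <= 2 * (\<integral>\<^sup>+x. h x \<partial>lborel)"
  by (intro mult_left_mono nn_integral_layer_cake_real(1)) auto
 finally show "(\<integral>\<^sup>+x. f x \<partial>lborel) + (\<integral>\<^sup>+x. g x \<partial>lborel) <= 2 * (\<integral>\<^sup>+x. h x \<partial>lborel)" .
qed

text \<open>Dividing \<open>f\<close> and \<open>g\<close> by their suprema and \<open>h\<close> by
  the geometric mean of the two suprema keeps the midpoint hypothesis and reduces to the normalised
  case; boundedness makes the suprema finite.\<close>

lemma prekopa_leindler_real_bounded: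
 fixes f g h :: "real => ennreal"
 assumes [measurable]: "f \<in> borel_measurable borel" "g \<in> borel_measurable borel" "h \<in> borel_measurable borel"
  and bd: "!!x. f x <= of_nat n" "!!x. g x <= of_nat m"
  and mid: "!!x y. f x * g y <= (h ((x + y) / 2))\<^sup>2"
 shows "(\<integral>\<^sup>+x. f x \<partial>lborel) * (\<integral>\<^sup>+x. g x \<partial>lborel) <= (\<integral>\<^sup>+x. h x \<partial>lborel)\<^sup>2"
proof -
 define F where "F = (SUP x. f x)"
 define G where "G = (SUP x. g x)"
 have fF: "f x <= F" and gG: "g x <= G" for x unfolding F_def G_def by (auto intro: SUP_upper)
 show ?thesis
 proof (cases "F = 0 \<or> G = 0")
  case True
  with fF gG have "(\<integral>\<^sup>+x. f x \<partial>lborel) = 0 \<or> (\<integral>\<^sup>+x. g x \<partial>lborel) = 0"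
   by (auto simp: nn_integral_0_iff_AE)
  then show ?thesis by auto
 next
  case False
  have "F <= of_nat n" "G <= of_nat m" unfolding F_def G_def using bd by (auto intro: SUP_least)
  then have "F < top" "G < top" by (auto intro: le_less_trans simp: of_nat_less_top)
  then obtain F' G' where FG: "F = ennreal F'" "G = ennreal G'" "0 <= F'" "0 <= G'"
   by (cases F; cases G) auto
  with False have pos: "0 < F'" "0 < G'" by (auto simp: less_le)
  define c where "c = sqrt (F' * G')"
  have c: "0 < c" "c * c = F' * G'" using pos by (auto simp: c_def)
  have inv: "ennreal F' * ennreal (1 / F') = 1" "ennreal G' * ennreal (1 / G') = 1"
   using pos by (auto simp: ennreal_mult[symmetric])
  have "(\<integral>\<^sup>+x. ennreal (1 / F') * f x \<partial>lborel) * (\<integral>\<^sup>+x. ennreal (1 / G') * g x \<partial>lborel) <= (\<integral>\<^sup>+x. ennreal (1 / c) * h x \<partial>lborel)\<^sup>2"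
  proof (rule prekopa_leindler_real_normalized)
   show "ennreal (1 / F') * f x <= 1" for x
    using mult_left_mono[OF fF[of x], of "ennreal (1 / F')"] inv FG by (simp add: mult.commute)
   show "ennreal (1 / G') * g x <= 1" for x
    using mult_left_mono[OF gG[of x], of "ennreal (1 / G')"] inv FG by (simp add: mult.commute)
   have gen: "\<exists>x. ennreal u < ennreal (1 / K) * k x" if "0 < K" "(SUP x. k x) = ennreal K" "0 < u" "u < 1" for u K and k :: "real => ennreal"
   proof -
    have "ennreal (u * K) < (SUP x. k x)" using that by (simp add: ennreal_less_iff)
    then obtain x where x: "ennreal (u * K) < k x" by (auto simp: less_SUP_iff)
    have "k x <= ennreal K" using SUP_upper[of x UNIV k] that by simp
    then obtain r where r: "k x = ennreal r" "0 <= r" by (cases "k x") (auto simp: top_unique)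
    with x have "u * K < r" using that by (simp add: ennreal_less_iff)
    then have "ennreal u < ennreal (1 / K * r)" using that by (simp add: ennreal_less_iff field_simps)
    then show ?thesis using r that by (intro exI[of _ x]) (simp add: ennreal_mult'[symmetric])
   qed
   show "\<exists>x. ennreal u < ennreal (1 / F') * f x" "\<exists>x. ennreal u < ennreal (1 / G') * g x" if "0 < u" "u < 1" for u
    using gen[of F' f u] gen[of G' g u] that pos FG F_def G_def by auto
   show "ennreal (1 / F') * f x * (ennreal (1 / G') * g y) <= (ennreal (1 / c) * h ((x + y) / 2))\<^sup>2" for x y
   proof -
    have "ennreal (1 / F') * f x * (ennreal (1 / G') * g y) = ennreal (1 / F' * (1 / G')) * (f x * g y)"
     using pos by (subst ennreal_mult) (simp_all add: mult_ac)
    also have "1 / F' * (1 / G') = (1 / c)\<^sup>2" using c by (simp add: power2_eq_square)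
    also have "ennreal ((1 / c)\<^sup>2) * (f x * g y) <= ennreal ((1 / c)\<^sup>2) * (h ((x + y) / 2))\<^sup>2"
     by (intro mult_left_mono mid) auto
    also have "... = (ennreal (1 / c) * h ((x + y) / 2))\<^sup>2" using c by (simp add: power_mult_distrib ennreal_power)
    finally show ?thesis .
   qed
  qed auto
  then have "ennreal (1 / F') * (\<integral>\<^sup>+x. f x \<partial>lborel) * (ennreal (1 / G') * (\<integral>\<^sup>+x. g x \<partial>lborel)) <= (ennreal (1 / c) * (\<integral>\<^sup>+x. h x \<partial>lborel))\<^sup>2"
   by (simp add: nn_integral_cmult)
  then have "(ennreal c)\<^sup>2 * (ennreal (1 / F') * (\<integral>\<^sup>+x. f x \<partial>lborel) * (ennreal (1 / G') * (\<integral>\<^sup>+x. g x \<partial>lborel)))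
    <= (ennreal c)\<^sup>2 * (ennreal (1 / c) * (\<integral>\<^sup>+x. h x \<partial>lborel))\<^sup>2"
   by (rule mult_left_mono) simp
  also have "... = (\<integral>\<^sup>+x. h x \<partial>lborel)\<^sup>2"
  proof -
   have "ennreal c * ennreal (1 / c) = 1" using c by (simp add: ennreal_mult[symmetric])
   then show ?thesis by (metis (no_types, lifting) mult.assoc mult_1 power_mult_distrib)
  qed
  also have "(ennreal c)\<^sup>2 * (ennreal (1 / F') * (\<integral>\<^sup>+x. f x \<partial>lborel) * (ennreal (1 / G') * (\<integral>\<^sup>+x. g x \<partial>lborel)))
   = (\<integral>\<^sup>+x. f x \<partial>lborel) * (\<integral>\<^sup>+x. g x \<partial>lborel)"
  proof -
   have "(ennreal c)\<^sup>2 = ennreal F' * ennreal G'"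
    using c pos by (simp add: power2_eq_square ennreal_mult[symmetric])
   then have "(ennreal c)\<^sup>2 * (ennreal (1 / F') * (\<integral>\<^sup>+x. f x \<partial>lborel) * (ennreal (1 / G') * (\<integral>\<^sup>+x. g x \<partial>lborel)))
    = (ennreal F' * ennreal (1 / F')) * (ennreal G' * ennreal (1 / G')) * ((\<integral>\<^sup>+x. f x \<partial>lborel) * (\<integral>\<^sup>+x. g x \<partial>lborel))"
    by (simp only: mult_ac)
   then show ?thesis unfolding inv by simp
  qed
  finally show ?thesis .
 qed
qed

text \<open>Truncating \<open>f\<close> and \<open>g\<close>, at independent levels, leaves the
  midpoint hypothesis intact with the same \<open>h\<close>, so monotone convergence removes the
  bounds.\<close>

theorem prekopa_leindler_real:
 fixes f g h :: "real => ennreal"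
 assumes [measurable]: "f \<in> borel_measurable borel" "g \<in> borel_measurable borel" "h \<in> borel_measurable borel"
  and mid: "!!x y. f x * g y <= (h ((x + y) / 2))\<^sup>2"
 shows "(\<integral>\<^sup>+x. f x \<partial>lborel) * (\<integral>\<^sup>+x. g x \<partial>lborel) <= (\<integral>\<^sup>+x. h x \<partial>lborel)\<^sup>2"
proof -
 have conv: "(\<integral>\<^sup>+x. k x \<partial>lborel) = (SUP n. \<integral>\<^sup>+x. min (k x) (of_nat n) \<partial>lborel)" if [measurable]: "k \<in> borel_measurable borel" for k :: "real => ennreal"
 proof -
  have "k x = (SUP n. min (k x) (of_nat n))" for x
  proof (cases "k x = top")
   case True
   then show ?thesis by (simp add: ennreal_SUP_of_nat_eq_top)
  next
   case False
   then obtain r where r: "k x = ennreal r" "0 <= r" by (cases "k x") auto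
   obtain N :: nat where "r < real N" using reals_Archimedean2 by blast
   with r have N: "k x < of_nat N" by (simp add: ennreal_of_nat_eq_real_of_nat ennreal_less_iff)
   show ?thesis
   proof (rule antisym)
    show "k x <= (SUP n. min (k x) (of_nat n))" using N by (intro SUP_upper2[of N]) auto
   qed (auto intro: SUP_least)
  qed
  then have "(\<integral>\<^sup>+x. k x \<partial>lborel) = (\<integral>\<^sup>+x. (SUP n. min (k x) (of_nat n)) \<partial>lborel)" by simp
  also have "... = (SUP n. \<integral>\<^sup>+x. min (k x) (of_nat n) \<partial>lborel)"
   by (rule nn_integral_monotone_convergence_SUP) (auto simp: incseq_def le_fun_def intro: min.coboundedI2 of_nat_mono)
  finally show ?thesis .
 qed
 have "(\<integral>\<^sup>+x. min (f x) (of_nat n) \<partial>lborel) * (\<integral>\<^sup>+x. min (g x) (of_nat m) \<partial>lborel) <= (\<integral>\<^sup>+x. h x \<partial>lborel)\<^sup>2" for n m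
  by (rule prekopa_leindler_real_bounded[where n = n and m = m])
    (auto intro: order_trans[OF mult_mono mid])
 then show ?thesis
  unfolding conv[of f, simplified] conv[of g, simplified] conv[OF assms(1)] conv[OF assms(2)]
  by (auto simp: SUP_mult_right_ennreal SUP_mult_left_ennreal intro!: SUP_least)
qed

text \<open>Tensorisation: when the last coordinate is integrated out, the one-dimensional
  inequality turns the hypothesis for \<open>f\<close>, \<open>g\<close>, \<open>h\<close> into the
  same hypothesis for their marginals.\<close>

theorem prekopa_leindler_PiM:
 fixes f g h :: "(nat => real) => ennreal"
 assumes "f \<in> borel_measurable (\<Pi>\<^sub>M i\<in>{..<N}. lborel)" "g \<in> borel_measurable (\<Pi>\<^sub>M i\<in>{..<N}. lborel)"
  "h \<in> borel_measurable (\<Pi>\<^sub>M i\<in>{..<N}. lborel)"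
  and "!!x y. x \<in> extensional {..<N} ==> y \<in> extensional {..<N} ==> f x * g y <= (h (%i. (x i + y i) / 2))\<^sup>2"
 shows "(\<integral>\<^sup>+x. f x \<partial>(\<Pi>\<^sub>M i\<in>{..<N}. lborel)) * (\<integral>\<^sup>+x. g x \<partial>(\<Pi>\<^sub>M i\<in>{..<N}. lborel)) <= (\<integral>\<^sup>+x. h x \<partial>(\<Pi>\<^sub>M i\<in>{..<N}. lborel))\<^sup>2"
 using assms
proof (induction N arbitrary: f g h)
 case 0
 interpret product_sigma_finite "%i::nat. lborel :: real measure" ..
 show ?case using 0(4)[of "%_. undefined" "%_. undefined"] by (simp add: nn_integral_empty)
next
 case (Suc N)
 interpret product_sigma_finite "%i::nat. lborel :: real measure" ..
 have ins: "{..<Suc N} = insert N {..<N}" by auto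
 note [measurable] = Suc.prems(1-3)[unfolded ins]
 have mid_upd: "(%i. ((x(N := s)) i + (y(N := t)) i) / 2) = (%i. (x i + y i) / 2)(N := (s + t) / 2)" for x y :: "nat => real" and s t
  by auto
 have "(\<integral>\<^sup>+x. (\<integral>\<^sup>+s. f (x(N := s)) \<partial>lborel) \<partial>(\<Pi>\<^sub>M i\<in>{..<N}. lborel)) * (\<integral>\<^sup>+x. (\<integral>\<^sup>+s. g (x(N := s)) \<partial>lborel) \<partial>(\<Pi>\<^sub>M i\<in>{..<N}. lborel))
  <= (\<integral>\<^sup>+x. (\<integral>\<^sup>+s. h (x(N := s)) \<partial>lborel) \<partial>(\<Pi>\<^sub>M i\<in>{..<N}. lborel))\<^sup>2"
 proof (rule Suc.IH)
  fix x y :: "nat => real" assume xy: "x \<in> extensional {..<N}" "y \<in> extensional {..<N}"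
  have sec: "(%s. k (z(N := s))) \<in> borel_measurable borel" if [measurable]: "k \<in> borel_measurable (\<Pi>\<^sub>M i\<in>insert N {..<N}. lborel)" and z: "z \<in> extensional {..<N}" for k :: "(nat => real) => ennreal" and z
  proof -
   have [measurable]: "z \<in> space (\<Pi>\<^sub>M i\<in>{..<N}. lborel)" using z by (auto simp: space_PiM PiE_def)
   have "(%s. k (z(N := s))) \<in> borel_measurable lborel" by measurable
   then show ?thesis by simp
  qed
  \<comment> \<open>Off the index set the midpoint is (undefined + undefined) / 2 = undefined, so
    midpoints of extensional points are extensional.\<close>
  have "(%i. (x i + y i) / 2) \<in> extensional {..<N}" using xy by (auto simp: extensional_def)
  with xy show "(\<integral>\<^sup>+s. f (x(N := s)) \<partial>lborel) * (\<integral>\<^sup>+s. g (y(N := s)) \<partial>lborel) <= (\<integral>\<^sup>+s. h ((%i. (x i + y i) / 2)(N := s)) \<partial>lborel)\<^sup>2"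
  proof (intro prekopa_leindler_real sec)
   fix s t
   have "x(N := s) \<in> extensional {..<Suc N}" "y(N := t) \<in> extensional {..<Suc N}" using xy by (auto simp: extensional_def)
   from Suc.prems(4)[OF this] show "f (x(N := s)) * g (y(N := t)) <= (h ((%i. (x i + y i) / 2)(N := (s + t) / 2)))\<^sup>2"
    unfolding mid_upd .
  qed (simp_all, measurable)
 qed measurable
 then show ?case unfolding ins by (subst (1 2 3) product_nn_integral_insert) simp_all
qed

section \<open>Repulsive gases on the line\<close>

abbreviation leb :: "nat => (nat => real) measure" where
 "leb N \<equiv> (\<Pi>\<^sub>M i\<in>{..<N}. lborel)"

lemma leb_component_measurable [measurable (raw)]:
 assumes "f \<in> borel_measurable borel" "i < N"
 shows "(%x. f (x i)) \<in> borel_measurable (leb N)"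
 using assms by (intro measurable_compose[OF measurable_component_singleton]) auto

text \<open>A one-dimensional change of variables, in the abstract form \<open>sub\<close>, applied
  coordinate by coordinate through Fubini. The abstract form serves three uses: the flow of a vector
  field on the half line, affine maps, and, with \<open>T\<close> the identity, a change of the
  weight on a null set.\<close>

lemma nn_integral_leb_substitution:
 fixes T :: "real => real" and J I :: "real => ennreal"
 assumes [measurable]: "T \<in> borel_measurable borel" "J \<in> borel_measurable borel" "I \<in> borel_measurable borel"
  and sub: "!!g :: real => ennreal. g \<in> borel_measurable borel ==> (\<integral>\<^sup>+y. g (T y) * J y \<partial>lborel) = (\<integral>\<^sup>+y. g y * I y \<partial>lborel)"
  and "G \<in> borel_measurable (leb N)"
 shows "(\<integral>\<^sup>+x. G (\<lambda>i\<in>{..<N}. T (x i)) * (\<Prod>i<N. J (x i)) \<partial>leb N) = (\<integral>\<^sup>+x. G x * (\<Prod>i<N. I (x i)) \<partial>leb N)"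
 using assms(5)
proof (induction N arbitrary: G)
 case 0
 interpret product_sigma_finite "%i::nat. lborel :: real measure" ..
 show ?case by (simp add: PiM_empty nn_integral_count_space_finite restrict_def)
next
 case (Suc N)
 interpret product_sigma_finite "%i::nat. lborel :: real measure" ..
 have ins: "{..<Suc N} = insert N {..<N}" by auto
 have G [measurable]: "G \<in> borel_measurable (\<Pi>\<^sub>M i\<in>insert N {..<N}. lborel)" using Suc.prems unfolding ins .
 have sec: "(%s. G (z(N := s))) \<in> borel_measurable borel" if z: "z \<in> space (leb N)" for z
 proof -
  note z[measurable]
  have "(%s. G (z(N := s))) \<in> borel_measurable lborel" by measurable
  then show ?thesis by simp
 qed
 have upd: "(\<lambda>i\<in>{..<Suc N}. T ((x(N := s)) i)) = (\<lambda>i\<in>{..<N}. T (x i))(N := T s)" for x s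
  by (auto simp: restrict_def)
 have prodJ: "(\<Prod>i<Suc N. K ((x(N := s)) i)) = (\<Prod>i<N. K (x i)) * K s" for K :: "real => ennreal" and x s
  by (simp add: prod.lessThan_Suc)
 have "(\<integral>\<^sup>+x. G (\<lambda>i\<in>{..<Suc N}. T (x i)) * (\<Prod>i<Suc N. J (x i)) \<partial>leb (Suc N))
   = (\<integral>\<^sup>+x. (\<integral>\<^sup>+s. G (\<lambda>i\<in>{..<Suc N}. T ((x(N := s)) i)) * (\<Prod>i<Suc N. J ((x(N := s)) i)) \<partial>lborel) \<partial>leb N)"
  unfolding ins by (rule product_nn_integral_insert) (auto intro!: borel_measurable_times_ennreal borel_measurable_prod_ennreal measurable_compose[OF _ G] measurable_restrict)
 also have "... = (\<integral>\<^sup>+x. (\<integral>\<^sup>+s. G ((\<lambda>i\<in>{..<N}. T (x i))(N := s)) * I s \<partial>lborel) * (\<Prod>i<N. J (x i)) \<partial>leb N)"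
 proof (rule nn_integral_cong)
  fix x assume "x \<in> space (leb N)"
  have m: "(%s. G ((\<lambda>i\<in>{..<N}. T (x i))(N := s))) \<in> borel_measurable borel"
   by (rule sec) (auto simp: space_PiM)
  then have "(\<integral>\<^sup>+s. G (\<lambda>i\<in>{..<Suc N}. T ((x(N := s)) i)) * (\<Prod>i<Suc N. J ((x(N := s)) i)) \<partial>lborel)
   = (\<integral>\<^sup>+s. (G ((\<lambda>i\<in>{..<N}. T (x i))(N := T s)) * J s) * (\<Prod>i<N. J (x i)) \<partial>lborel)"
   unfolding upd prodJ by (simp add: mult_ac)
  also have "... = (\<integral>\<^sup>+s. G ((\<lambda>i\<in>{..<N}. T (x i))(N := T s)) * J s \<partial>lborel) * (\<Prod>i<N. J (x i))"
   by (rule nn_integral_multc) (use m in \<open>auto intro!: borel_measurable_times_ennreal measurable_compose[OF _ m]\<close>)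
  also have "(\<integral>\<^sup>+s. G ((\<lambda>i\<in>{..<N}. T (x i))(N := T s)) * J s \<partial>lborel) = (\<integral>\<^sup>+s. G ((\<lambda>i\<in>{..<N}. T (x i))(N := s)) * I s \<partial>lborel)"
   using sub[OF m] .
  finally show "(\<integral>\<^sup>+s. G (\<lambda>i\<in>{..<Suc N}. T ((x(N := s)) i)) * (\<Prod>i<Suc N. J ((x(N := s)) i)) \<partial>lborel)
   = (\<integral>\<^sup>+s. G ((\<lambda>i\<in>{..<N}. T (x i))(N := s)) * I s \<partial>lborel) * (\<Prod>i<N. J (x i))" .
 qed
 also have "... = (\<integral>\<^sup>+x. (\<integral>\<^sup>+s. G (x(N := s)) * I s \<partial>lborel) * (\<Prod>i<N. I (x i)) \<partial>leb N)"
  by (rule Suc.IH) measurable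
 also have "... = (\<integral>\<^sup>+x. (\<integral>\<^sup>+s. G (x(N := s)) * (\<Prod>i<Suc N. I ((x(N := s)) i)) \<partial>lborel) \<partial>leb N)"
 proof (rule nn_integral_cong)
  fix x assume x: "x \<in> space (leb N)"
  have "(\<integral>\<^sup>+s. G (x(N := s)) * (\<Prod>i<Suc N. I ((x(N := s)) i)) \<partial>lborel) = (\<integral>\<^sup>+s. (G (x(N := s)) * I s) * (\<Prod>i<N. I (x i)) \<partial>lborel)"
   unfolding prodJ by (simp add: mult_ac)
  also have "... = (\<integral>\<^sup>+s. G (x(N := s)) * I s \<partial>lborel) * (\<Prod>i<N. I (x i))"
   by (rule nn_integral_multc) (use sec[OF x] in \<open>auto intro!: borel_measurable_times_ennreal\<close>)
  finally show "(\<integral>\<^sup>+s. G (x(N := s)) * I s \<partial>lborel) * (\<Prod>i<N. I (x i)) = (\<integral>\<^sup>+s. G (x(N := s)) * (\<Prod>i<Suc N. I ((x(N := s)) i)) \<partial>lborel)" by simp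
 qed
 also have "... = (\<integral>\<^sup>+x. G x * (\<Prod>i<Suc N. I (x i)) \<partial>leb (Suc N))"
  unfolding ins by (rule product_nn_integral_insert[symmetric]) (auto intro!: borel_measurable_times_ennreal borel_measurable_prod_ennreal)
 finally show ?case .
qed

lemma nn_integral_leb_permute:
 fixes G :: "(nat => real) => ennreal"
 assumes ss: "ss permutes {..<N}" and [measurable]: "G \<in> borel_measurable (leb N)"
 shows "(\<integral>\<^sup>+x. G (\<lambda>i\<in>{..<N}. x (ss i)) \<partial>leb N) = (\<integral>\<^sup>+x. G x \<partial>leb N)"
proof -
 interpret product_sigma_finite "%i::nat. lborel :: real measure" ..
 have ssl: "ss i < N" if "i < N" for i using permutes_in_image[OF ss, of i] that by simp
 have m [measurable]: "(%x. \<lambda>i\<in>{..<N}. x (ss i)) \<in> leb N \<rightarrow>\<^sub>M leb N"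
  by (intro measurable_restrict) (use ssl in \<open>auto intro!: measurable_component_singleton\<close>)
 have "distr (leb N) (leb N) (%x. \<lambda>i\<in>{..<N}. x (ss i)) = leb N"
 proof (rule PiM_eqI)
  fix A :: "nat => real set" assume A: "!!i. i \<in> {..<N} ==> A i \<in> sets lborel"
  have inv: "inv ss permutes {..<N}" using ss by (rule permutes_inv)
  have il: "inv ss i < N" if "i < N" for i using permutes_in_image[OF inv, of i] that by simp
  have "(%x. \<lambda>i\<in>{..<N}. x (ss i)) -` (\<Pi>\<^sub>E i\<in>{..<N}. A i) \<inter> space (leb N) = (\<Pi>\<^sub>E i\<in>{..<N}. A (inv ss i))"
  proof (intro equalityI subsetI)
   fix x assume x: "x \<in> (%x. \<lambda>i\<in>{..<N}. x (ss i)) -` (\<Pi>\<^sub>E i\<in>{..<N}. A i) \<inter> space (leb N)"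
   then have "x (ss i) \<in> A i" if "i < N" for i using that by (auto simp: PiE_iff)
   from this[of "inv ss _"] have "x i \<in> A (inv ss i)" if "i < N" for i
    using il[OF that] permutes_inverses(1)[OF ss, of i] by metis
   then show "x \<in> (\<Pi>\<^sub>E i\<in>{..<N}. A (inv ss i))" using x by (auto simp: space_PiM PiE_iff)
  next
   fix x assume x: "x \<in> (\<Pi>\<^sub>E i\<in>{..<N}. A (inv ss i))"
   have "x (ss i) \<in> A i" if "i < N" for i
    using PiE_mem[OF x, of "ss i"] ssl[OF that] permutes_inverses(2)[OF ss, of i] by simp
   then show "x \<in> (%x. \<lambda>i\<in>{..<N}. x (ss i)) -` (\<Pi>\<^sub>E i\<in>{..<N}. A i) \<inter> space (leb N)"
    using x by (auto simp: space_PiM PiE_iff)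
  qed
  moreover have "(\<Pi>\<^sub>E i\<in>{..<N}. A i) \<in> sets (leb N)" using A by (intro sets_PiM_I_finite) auto
  ultimately have "emeasure (distr (leb N) (leb N) (%x. \<lambda>i\<in>{..<N}. x (ss i))) (\<Pi>\<^sub>E i\<in>{..<N}. A i) = emeasure (leb N) (\<Pi>\<^sub>E i\<in>{..<N}. A (inv ss i))"
   by (simp add: emeasure_distr)
  also have "... = (\<Prod>i<N. emeasure lborel (A (inv ss i)))"
   by (rule emeasure_PiM) (use A il in auto)
  also have "... = (\<Prod>i<N. emeasure lborel (A i))"
   using prod.permute[OF inv, of "%i. emeasure lborel (A i)"] by (simp add: o_def)
  finally show "emeasure (distr (leb N) (leb N) (%x. \<lambda>i\<in>{..<N}. x (ss i))) (\<Pi>\<^sub>E i\<in>{..<N}. A i) = (\<Prod>i\<in>{..<N}. emeasure lborel (A i))" .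
 qed auto
 then have "(\<integral>\<^sup>+x. G x \<partial>leb N) = (\<integral>\<^sup>+x. G x \<partial>distr (leb N) (leb N) (%x. \<lambda>i\<in>{..<N}. x (ss i)))" by simp
 also have "... = (\<integral>\<^sup>+x. G (\<lambda>i\<in>{..<N}. x (ss i)) \<partial>leb N)" by (rule nn_integral_distr) measurable
 finally show ?thesis by simp
qed

text \<open>Obtained from the rule on compact intervals by exhausting the half line with [0, n]; the
  images [0, T n] exhaust it as well because \<open>T\<close> is unbounded.\<close>

lemma nn_integral_substitution_pos:
 fixes g :: "real => ennreal"
 assumes [measurable]: "g \<in> borel_measurable borel" "T \<in> borel_measurable borel" "T' \<in> borel_measurable borel"
  and der: "!!x. x >= 0 ==> (T has_real_derivative T' x) (at x)"
  and cont: "continuous_on {0..} T'" and nonneg: "!!x. x >= 0 ==> T' x >= 0"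
  and T0: "T 0 = 0" and lim: "filterlim T at_top at_top"
 shows "(\<integral>\<^sup>+y. g (T y) * (ennreal (T' y) * indicator {0<..} y) \<partial>lborel) = (\<integral>\<^sup>+y. g y * indicator {0<..} y \<partial>lborel)"
proof -
 have ae: "(\<integral>\<^sup>+y. h y * indicator {0<..} y \<partial>lborel) = (\<integral>\<^sup>+y. h y * indicator {0..} y \<partial>lborel)" for h :: "real => ennreal"
  by (rule nn_integral_cong_AE) (use AE_lborel_singleton[of 0] in \<open>auto simp: indicator_def elim!: eventually_mono\<close>)
 have mono: "T x <= T y" if "0 <= x" "x <= y" for x y
  using DERIV_nonneg_imp_nondecreasing[OF that(2), of T] der nonneg that by (meson order_trans)
 have step: "(\<integral>\<^sup>+x. g x * indicator {0..T (real n)} x \<partial>lborel) = (\<integral>\<^sup>+x. g (T x) * T' x * indicator {0..real n} x \<partial>lborel)" for n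
 proof (cases "n = 0")
  case True
  have "(\<integral>\<^sup>+x. h x * indicator {0..0::real} x \<partial>lborel) = (\<integral>\<^sup>+(x::real). 0 \<partial>lborel)" for h :: "real => ennreal"
   by (rule nn_integral_cong_AE) (use AE_lborel_singleton[of 0] in \<open>auto simp: indicator_def elim!: eventually_mono\<close>)
  then show ?thesis using True T0 by simp
 next
  case False
  then show ?thesis
   using nn_integral_substitution_aux[of g 0 "real n" T T'] der nonneg T0 continuous_on_subset[OF cont, of "{0..real n}"]
   by auto
 qed
 have "(\<integral>\<^sup>+y. g y * indicator {0..} y \<partial>lborel) = (\<integral>\<^sup>+y. (SUP n. g y * indicator {0..T (real n)} y) \<partial>lborel)"
 proof (intro nn_integral_cong)
  fix y :: real
  show "g y * indicator {0..} y = (SUP n. g y * indicator {0..T (real n)} y)"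
  proof (cases "y >= 0")
   case True
   have "eventually (%n. T (real n) >= y) sequentially"
    using filterlim_compose[OF lim filterlim_real_sequentially] by (simp add: filterlim_at_top)
   then obtain n where "T (real n) >= y" by (auto simp: eventually_sequentially)
   with True show ?thesis
    by (intro antisym SUP_upper2[of n] SUP_least) (auto simp: indicator_def)
  qed auto
 qed
 also have "... = (SUP n. \<integral>\<^sup>+y. g y * indicator {0..T (real n)} y \<partial>lborel)"
 proof (rule nn_integral_monotone_convergence_SUP)
  have "T (real m) <= T (real n)" if "m <= n" for m n using that by (intro mono) auto
  then show "incseq (%n y. g y * indicator {0..T (real n)} y)"
   by (fastforce simp: incseq_def le_fun_def indicator_def)
 qed auto
 also have "... = (SUP n. \<integral>\<^sup>+x. g (T x) * T' x * indicator {0..real n} x \<partial>lborel)"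
  using step by simp
 also have "... = (\<integral>\<^sup>+x. (SUP n. g (T x) * T' x * indicator {0..real n} x) \<partial>lborel)"
  by (rule nn_integral_monotone_convergence_SUP[symmetric])
    (auto simp: incseq_def le_fun_def indicator_def)
 also have "... = (\<integral>\<^sup>+x. (g (T x) * T' x) * indicator {0..} x \<partial>lborel)"
 proof (intro nn_integral_cong)
  fix y :: real
  show "(SUP n. g (T y) * ennreal (T' y) * indicator {0..real n} y) = g (T y) * ennreal (T' y) * indicator {0..} y"
  proof (cases "y >= 0")
   case True
   obtain n :: nat where "real n >= y" using real_arch_simple by blast
   with True show ?thesis
    by (intro antisym SUP_upper2[of n] SUP_least) (auto simp: indicator_def)
  qed auto
 qed
 finally show ?thesis using ae[of g] ae[of "%y. g (T y) * ennreal (T' y)"] by (simp add: mult.assoc)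
qed

section \<open>Weights, polynomial bounds and integrability of the gas\<close>

definition vdm :: "nat => real => (nat => real) => real" where
 "vdm N b x = (\<Prod>(i, j) \<in> {(i, j). i < j \<and> j < N}. \<bar>x i - x j\<bar> powr (2 * b))"

definition gasw :: "nat => real => (real => real) => (nat => real) => real" where
 "gasw N b w x = vdm N b x * (\<Prod>i<N. w (x i))"

definition all_moments :: "(real => real) => bool" where
 "all_moments w \<longleftrightarrow> w \<in> borel_measurable borel \<and> (\<forall>x. 0 <= w x) \<and> (\<forall>m::nat. integrable lborel (%x. (1 + \<bar>x\<bar>) ^ m * w x))"

text \<open>A product and not a norm: polynomial bounds in it factor over the coordinates, so that
  integrability on the product space reduces to one-particle moments.\<close>

definition spread :: "nat => (nat => real) => real" where
 "spread N x = (\<Prod>i<N. 1 + \<bar>x i\<bar>)"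

lemma finite_pairs [simp]: "finite {(i, j). i < j \<and> j < (N::nat)}"
 by (rule finite_subset[of _ "{..<N} \<times> {..<N}"]) auto

lemma vdm_nonneg: "0 <= vdm N b x"
 unfolding vdm_def by (intro prod_nonneg) auto

lemma gasw_nonneg: "(!!y. 0 <= w y) ==> 0 <= gasw N b w x"
 unfolding gasw_def by (intro mult_nonneg_nonneg vdm_nonneg prod_nonneg) auto

lemma spread_ge_one: "1 <= spread N x"
 unfolding spread_def by (rule prod_ge_1) auto

lemma spread_ge: "i < N ==> 1 + \<bar>x i\<bar> <= spread N x"
proof -
 assume i: "i < N"
 have "spread N x = (1 + \<bar>x i\<bar>) * (\<Prod>j\<in>{..<N} - {i}. 1 + \<bar>x j\<bar>)"
  unfolding spread_def using i by (subst prod.remove[of _ i]) auto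
 moreover have "1 <= (\<Prod>j\<in>{..<N} - {i}. 1 + \<bar>x j\<bar>)" by (rule prod_ge_1) auto
 ultimately show ?thesis using mult_left_mono[of 1 _ "1 + \<bar>x i\<bar>"] by simp
qed

lemma vdm_le_spread:
 assumes "b >= 0"
 obtains m where "!!x. vdm N b x <= spread N x ^ m"
proof
 fix x :: "nat => real"
 define M where "M = nat \<lceil>2 * b\<rceil>"
 let ?P = "{(i, j). i < j \<and> j < N}"
 have "vdm N b x <= (\<Prod>(i, j)\<in>?P. spread N x ^ (2 * M))"
  unfolding vdm_def
 proof (rule prod_mono, clarify, intro conjI)
  fix i j assume ij: "i < j" "j < N"
  have "\<bar>x i - x j\<bar> <= (1 + \<bar>x i\<bar>) * (1 + \<bar>x j\<bar>)"
   using abs_triangle_ineq4[of "x i" "x j"] mult_nonneg_nonneg[of "\<bar>x i\<bar>" "\<bar>x j\<bar>"] by (simp add: algebra_simps del: mult_nonneg_nonneg)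
  also have "... <= spread N x * spread N x"
   using ij spread_ge[of i N x] spread_ge[of j N x] spread_ge_one[of N x] by (intro mult_mono) auto
  finally have "\<bar>x i - x j\<bar> powr (2 * b) <= (spread N x * spread N x) powr (2 * b)"
   using assms by (intro powr_mono2) auto
  also have "... <= (spread N x * spread N x) powr real M"
   using mult_mono[OF spread_ge_one[of N x] spread_ge_one[of N x]] spread_ge_one[of N x]
   by (intro powr_mono) (auto simp: M_def intro: real_nat_ceiling_ge)
  also have "... = spread N x ^ (2 * M)"
   using spread_ge_one[of N x] by (subst powr_realpow) (auto simp: power_mult power2_eq_square)
  finally show "\<bar>x i - x j\<bar> powr (2 * b) <= spread N x ^ (2 * M)" .
 qed auto
 also have "... = spread N x ^ (2 * M * card ?P)" by (simp add: power_mult split_beta')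
 finally show "vdm N b x <= spread N x ^ (2 * nat \<lceil>2 * b\<rceil> * card {(i, j). i < j \<and> j < N})" unfolding M_def .
qed

lemma vdm_measurable [measurable]: "vdm N b \<in> borel_measurable (leb N)"
proof -
 have "(%x. \<Prod>p\<in>{(i, j). i < j \<and> j < N}. \<bar>x (fst p) - x (snd p)\<bar> powr (2 * b)) \<in> borel_measurable (leb N)"
  by (intro borel_measurable_prod) (auto intro!: measurable_abs_powr borel_measurable_diff leb_component_measurable[of "%x. x"])
 then show ?thesis unfolding vdm_def[abs_def] by (simp add: split_beta')
qed

lemma gasw_measurable [measurable (raw)]:
 assumes "w \<in> borel_measurable borel"
 shows "gasw N b w \<in> borel_measurable (leb N)"
 unfolding gasw_def[abs_def]
 by (intro borel_measurable_times vdm_measurable borel_measurable_prod leb_component_measurable assms) auto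

lemma spread_measurable [measurable]: "spread N \<in> borel_measurable (leb N)"
 unfolding spread_def[abs_def] by (intro borel_measurable_prod leb_component_measurable[of "%y. 1 + \<bar>y\<bar>"]) auto

lemma integrable_spread_gasw:
 assumes "b >= 0" "all_moments w"
 shows "integrable (leb N) (%x. spread N x ^ k * gasw N b w x)"
proof -
 interpret product_sigma_finite "%i::nat. lborel :: real measure" ..
 have w [measurable]: "w \<in> borel_measurable borel" and w0: "!!y. 0 <= w y" using assms by (auto simp: all_moments_def)
 obtain m where m: "!!x. vdm N b x <= spread N x ^ m" using vdm_le_spread[OF assms(1)] by blast
 have "integrable (leb N) (%x. \<Prod>i<N. (1 + \<bar>x i\<bar>) ^ (k + m) * w (x i))"
  by (rule product_integrable_prod) (use assms in \<open>auto simp: all_moments_def\<close>)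
 then show ?thesis
 proof (rule Bochner_Integration.integrable_bound)
  show "AE x in leb N. norm (spread N x ^ k * gasw N b w x) <= norm (\<Prod>i<N. (1 + \<bar>x i\<bar>) ^ (k + m) * w (x i))"
  proof (rule AE_I2)
   fix x
   have "spread N x ^ k * gasw N b w x <= spread N x ^ k * (spread N x ^ m * (\<Prod>i<N. w (x i)))"
    unfolding gasw_def using spread_ge_one[of N x] by (intro mult_left_mono mult_right_mono m prod_nonneg) (auto simp: w0)
   also have "... = (\<Prod>i<N. (1 + \<bar>x i\<bar>) ^ (k + m) * w (x i))"
    by (simp add: prod.distrib spread_def power_add prod_power_distrib)
   finally show "norm (spread N x ^ k * gasw N b w x) <= norm (\<Prod>i<N. (1 + \<bar>x i\<bar>) ^ (k + m) * w (x i))"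
    using gasw_nonneg[of w N b x] w0 spread_ge_one[of N x] by simp
  qed
 qed measurable
qed

lemma integrable_gasw_bounded:
 assumes "b >= 0" "all_moments w" and [measurable]: "F \<in> borel_measurable (leb N)"
  and le: "!!x. gasw N b w x ~= 0 ==> \<bar>F x\<bar> <= C * spread N x ^ k"
 shows "integrable (leb N) (%x. F x * gasw N b w x)"
proof (rule Bochner_Integration.integrable_bound)
 show "integrable (leb N) (%x. C * (spread N x ^ k * gasw N b w x))"
  using assms by (intro integrable_mult_right integrable_spread_gasw) auto
 have [measurable]: "w \<in> borel_measurable borel" and w0: "!!y. 0 <= w y" using assms by (auto simp: all_moments_def)
 show "(%x. F x * gasw N b w x) \<in> borel_measurable (leb N)" by measurable
 show "AE x in leb N. norm (F x * gasw N b w x) <= norm (C * (spread N x ^ k * gasw N b w x))"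
 proof (rule AE_I2)
  fix x
  have "norm (F x * gasw N b w x) = \<bar>F x\<bar> * gasw N b w x" using gasw_nonneg[of w N b x] w0 by (simp add: abs_mult)
  also have "... <= (C * spread N x ^ k) * gasw N b w x"
   using gasw_nonneg[of w N b x] w0 le[of x] by (cases "gasw N b w x = 0") (auto intro!: mult_right_mono)
  finally show "norm (F x * gasw N b w x) <= norm (C * (spread N x ^ k * gasw N b w x))" by (simp add: mult.assoc)
 qed
qed

lemma integral_gasw_pos:
 assumes "b >= 0" "all_moments w" and wpos: "!!y. y > 0 ==> w y > 0"
 shows "0 < (\<integral>x. gasw N b w x \<partial>leb N)"
proof -
 interpret product_sigma_finite "%i::nat. lborel :: real measure" ..
 have [measurable]: "w \<in> borel_measurable borel" and w0: "!!y. 0 <= w y" using assms by (auto simp: all_moments_def)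
 have int: "integrable (leb N) (gasw N b w)" using integrable_spread_gasw[OF assms(1,2), of N 0] by simp
 \<comment> \<open>Coordinates at least 1 apart and bounded away from the wall: a box of volume 1 on
   which the weight is positive.\<close>
 let ?B = "\<Pi>\<^sub>E i\<in>{..<N}. {2 * real i + 1 .. 2 * real i + 2}"
 have B: "emeasure (leb N) ?B = 1" "?B \<in> sets (leb N)"
  by (subst emeasure_PiM) (auto intro!: sets_PiM_I_finite)
 have posB: "gasw N b w x > 0" if "x \<in> ?B" for x
 proof -
  have xi: "2 * real i + 1 <= x i" "x i <= 2 * real i + 2" if "i < N" for i
   using \<open>x \<in> ?B\<close> that by (auto simp: PiE_iff)
  have "x i ~= x j" if "i < j" "j < N" for i j
  proof -
   have "real i + 1 <= real j" using that by simp
   then show ?thesis using xi[of i] xi[of j] that by linarith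
  qed
  moreover have "w (x i) > 0" if "i < N" for i using xi[OF that] by (intro wpos) (use of_nat_0_le_iff[of i] in linarith)
  ultimately show ?thesis unfolding gasw_def vdm_def by (intro mult_pos_pos prod_pos) auto
 qed
 have "(\<integral>x. gasw N b w x \<partial>leb N) ~= 0"
 proof
  assume "(\<integral>x. gasw N b w x \<partial>leb N) = 0"
  then have "AE x in leb N. gasw N b w x = 0"
   using integral_nonneg_eq_0_iff_AE[OF int] gasw_nonneg[OF w0] by auto
  then have "AE x in leb N. x \<notin> ?B"
  proof (rule eventually_mono)
   fix x assume "gasw N b w x = 0"
   then show "x \<notin> ?B" using posB[of x] by (metis less_irrefl)
  qed
  then have "emeasure (leb N) ?B = 0" using B(2) AE_iff_null_sets[of ?B "leb N"] by auto
  with B show False by simp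
 qed
 moreover have "(\<integral>x. gasw N b w x \<partial>leb N) >= 0" by (intro Bochner_Integration.integral_nonneg gasw_nonneg w0)
 ultimately show ?thesis by simp
qed

section \<open>The loop equation\<close>

text \<open>The integral of \<open>k\<close> times the weight does not change under the substitution
  y -> y + e phi y of all coordinates, and the claim says that its derivative at e = 0 vanishes.
  Nothing is differentiated under the integral: a pointwise lower bound of the transformed
  integrand, exact to first order in \<open>e\<close> with an error of order e^2, integrates to e Q
  <= e^2 R for small \<open>e\<close> of both signs, which forces Q = 0. Accordingly the hypotheses
  \<open>lam\<close> and \<open>k_der\<close> are lower bounds only. The function \<open>kap\<close>
  is the derivative of \<open>k\<close> along the flow, and \<open>phi0\<close> keeps the wall
  fixed.\<close>

lemma gas_loop_equation:
 fixes b :: real and N m :: nat and w L lam phi dphi :: "real => real" and D :: "real => real => real" and k kap :: "(nat => real) => real"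
 defines "LA \<equiv> %x. (\<Sum>i<N. dphi (x i)) + 2 * b * (\<Sum>(i, j)\<in>{(i, j). i < j \<and> j < N}. D (x i) (x j)) + (\<Sum>i<N. lam (x i))"
 assumes b: "b >= 0" and w: "all_moments w"
  and wL: "!!y. y > 0 ==> w y = exp (L y)" and w_nonpos: "!!y. y <= 0 ==> w y = 0"
  and [measurable]: "phi \<in> borel_measurable borel" "dphi \<in> borel_measurable borel" "lam \<in> borel_measurable borel"
   "k \<in> borel_measurable (leb N)" "kap \<in> borel_measurable (leb N)"
   "(%p. D (fst p) (snd p)) \<in> borel_measurable (borel \<Otimes>\<^sub>M borel)"
  and der: "!!y. y >= 0 ==> (phi has_real_derivative dphi y) (at y)"
  and cont: "continuous_on {0..} dphi" and phi0: "phi 0 = 0"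
  and C: "C > 0" and e0: "e0 > 0"
  and dphi_le: "!!y. y >= 0 ==> \<bar>dphi y\<bar> <= C" and phi_le: "!!y. y >= 0 ==> \<bar>phi y\<bar> <= C * y"
  and D: "!!y z. y > 0 ==> z > 0 ==> phi y - phi z = (y - z) * D y z" and D_le: "!!y z. y > 0 ==> z > 0 ==> \<bar>D y z\<bar> <= C"
  and lam: "!!y e. y > 0 ==> \<bar>e\<bar> <= e0 ==> L (y + e * phi y) - L y >= e * lam y - e\<^sup>2 * (C * (1 + y) ^ m)"
  and lam_le: "!!y. y > 0 ==> \<bar>lam y\<bar> <= C * (1 + y) ^ m"
  and k_bd: "!!x. (!!i. i < N ==> x i > 0) ==> 0 <= k x \<and> k x <= K"
  and kap_bd: "!!x. (!!i. i < N ==> x i > 0) ==> \<bar>kap x\<bar> <= K"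
  and k_lip: "!!x e. (!!i. i < N ==> x i > 0) ==> \<bar>e\<bar> <= e0 ==> \<bar>k (\<lambda>i\<in>{..<N}. x i + e * phi (x i)) - k x\<bar> <= K * \<bar>e\<bar>"
  and k_der: "!!x e. (!!i. i < N ==> x i > 0) ==> \<bar>e\<bar> <= e0 ==> k (\<lambda>i\<in>{..<N}. x i + e * phi (x i)) - k x >= e * kap x - K * e\<^sup>2"
 shows "(\<integral>x. (k x * LA x + kap x) * gasw N b w x \<partial>leb N) = 0"
proof -
 define P where "P = {(i, j). i < j \<and> j < N}"
 have finP: "finite P" by (simp add: P_def)
 have PD: "i < j" "j < N" "i < N" if "(i, j) \<in> P" for i j using that by (auto simp: P_def)
 have vdm_P: "vdm N b x = (\<Prod>(i, j)\<in>P. \<bar>x i - x j\<bar> powr (2 * b))" for x by (simp add: vdm_def P_def)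
 have Lam_P: "LA x = (\<Sum>i<N. dphi (x i)) + 2 * b * (\<Sum>(i, j)\<in>P. D (x i) (x j)) + (\<Sum>i<N. lam (x i))" for x
  by (simp add: LA_def P_def)
 define pos where "pos x \<longleftrightarrow> (\<forall>i<N. x i > 0)" for x :: "nat => real"
 have w_meas [measurable]: "w \<in> borel_measurable borel" and w0: "!!y. 0 <= w y" using w by (auto simp: all_moments_def)
 have g0: "0 <= gasw N b w x" for x by (rule gasw_nonneg) (rule w0)
 have gasw0: "gasw N b w x = 0" if np: "\<not> pos x" for x
 proof -
  obtain i where "i < N" "x i <= 0" using np by (auto simp: pos_def not_less)
  then have "(\<Prod>i<N. w (x i)) = 0" using w_nonpos[of "x i"] by (auto simp: prod_zero_iff)
  then show ?thesis by (simp add: gasw_def)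
 qed
 have K0: "K >= 0" using k_bd[of "%_. 1"] by simp
 have [measurable]: "LA \<in> borel_measurable (leb N)"
 proof -
  have "(%x. D (x i) (x j)) \<in> borel_measurable (leb N)" if "(i, j) \<in> P" for i j
   using PD[OF that] measurable_compose[OF measurable_Pair[OF leb_component_measurable[of "%x. x" i N] leb_component_measurable[of "%x. x" j N]] assms(11)] by simp
  then have m2: "(%x. \<Sum>(i, j)\<in>P. D (x i) (x j)) \<in> borel_measurable (leb N)"
   by (intro borel_measurable_sum) auto
  have m1: "(%x. \<Sum>i<N. h (x i)) \<in> borel_measurable (leb N)" if "h \<in> borel_measurable borel" for h :: "real => real"
   by (intro borel_measurable_sum leb_component_measurable that) auto
  have "(%x. (\<Sum>i<N. dphi (x i)) + 2 * b * (\<Sum>(i, j)\<in>P. D (x i) (x j)) + (\<Sum>i<N. lam (x i))) \<in> borel_measurable (leb N)"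
   by (intro borel_measurable_add m1 borel_measurable_times borel_measurable_const m2) auto
  then show ?thesis unfolding Lam_P[symmetric] by (simp add: LA_def)
 qed
 \<comment> \<open>The second-order loss in the logarithm of the transformed weight: 2 C^2 from the
   logarithm of each factor 1 + e z with |z| <= C, once per particle for the Jacobian and 2 b times
   per pair, and the loss granted by \<open>lam\<close>.\<close>
 define TH where "TH x = 2 * b * (real (card P) * (2 * C\<^sup>2)) + (\<Sum>i<N. C * (1 + x i) ^ m) + real N * (2 * C\<^sup>2)" for x :: "nat => real"
 have [measurable]: "TH \<in> borel_measurable (leb N)"
  unfolding TH_def[abs_def] by (intro borel_measurable_add borel_measurable_sum borel_measurable_const leb_component_measurable) auto
 \<comment> \<open>The full coefficient of e^2: the loss in \<open>k_der\<close>, the product of the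
   first-order changes of \<open>k\<close> and of the weight, and \<open>TH\<close> weighted by the
   bound \<open>K\<close> of \<open>k\<close>.\<close>
 define XI where "XI x = K + \<bar>LA x\<bar> * K + TH x * K" for x
 have [measurable]: "XI \<in> borel_measurable (leb N)" unfolding XI_def[abs_def] by measurable
 define M where "M = real N * C + 2 * b * (real (card P) * C) + real N * C"
 define M' where "M' = 2 * b * (real (card P) * (2 * C\<^sup>2)) + real N * C + real N * (2 * C\<^sup>2)"
 have M0: "M >= 0" "M' >= 0" using b C by (auto simp: M_def M'_def)
 have sp: "(1 + x i) ^ m <= spread N x ^ m" "1 <= spread N x ^ m" if "pos x" "i < N" for x i
  using spread_ge[OF that(2), of x] that spread_ge_one[of N x] by (auto simp: pos_def intro!: power_mono)
 have sp1: "1 <= spread N x ^ m" for x using spread_ge_one[of N x] by simp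
 have Lam_le: "\<bar>LA x\<bar> <= M * spread N x ^ m" if x: "pos x" for x
 proof -
  have "\<bar>\<Sum>i<N. dphi (x i)\<bar> <= (\<Sum>i<N. C)"
   by (rule order_trans[OF sum_abs sum_mono]) (use x dphi_le in \<open>auto simp: pos_def\<close>)
  moreover have "\<bar>\<Sum>(i, j)\<in>P. D (x i) (x j)\<bar> <= (\<Sum>p\<in>P. C)"
   by (rule order_trans[OF sum_abs sum_mono]) (use x D_le PD in \<open>auto simp: pos_def\<close>)
  moreover have "\<bar>\<Sum>i<N. lam (x i)\<bar> <= (\<Sum>i<N. C * spread N x ^ m)"
  proof (rule order_trans[OF sum_abs], rule sum_mono)
   fix i assume "i \<in> {..<N}"
   then have "\<bar>lam (x i)\<bar> <= C * (1 + x i) ^ m" using x by (intro lam_le) (auto simp: pos_def)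
   also have "... <= C * spread N x ^ m" using sp[OF x, of i] \<open>i \<in> {..<N}\<close> C by (intro mult_left_mono) auto
   finally show "\<bar>lam (x i)\<bar> <= C * spread N x ^ m" .
  qed
  moreover have "\<bar>2 * b * (\<Sum>(i, j)\<in>P. D (x i) (x j))\<bar> <= 2 * b * (real (card P) * C)"
   using calculation(2) b by (simp add: abs_mult mult_left_mono)
  ultimately have "\<bar>LA x\<bar> <= real N * C + 2 * b * (real (card P) * C) + real N * C * spread N x ^ m"
   unfolding Lam_P by simp
  also have "... <= (real N * C + 2 * b * (real (card P) * C)) * spread N x ^ m + real N * C * spread N x ^ m"
   using mult_left_mono[OF sp1[of x], of "real N * C + 2 * b * (real (card P) * C)"] b C by simp
  also have "... = M * spread N x ^ m" by (simp add: M_def algebra_simps)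
  finally show ?thesis .
 qed
 have The: "0 <= TH x" "TH x <= M' * spread N x ^ m" if x: "pos x" for x
 proof -
  have "0 <= C * (1 + x i) ^ m" if "i < N" for i
   using x that C by (intro mult_nonneg_nonneg zero_le_power) (auto simp: pos_def less_imp_le)
  then show "0 <= TH x" unfolding TH_def using b C by (intro add_nonneg_nonneg sum_nonneg) auto
  have "(\<Sum>i<N. C * (1 + x i) ^ m) <= (\<Sum>i<N. C * spread N x ^ m)"
   using sp[OF x] C by (intro sum_mono mult_left_mono) auto
  then have "TH x <= (2 * b * (real (card P) * (2 * C\<^sup>2)) + real N * (2 * C\<^sup>2)) * 1 + real N * C * spread N x ^ m"
   unfolding TH_def by simp
  also have "... <= (2 * b * (real (card P) * (2 * C\<^sup>2)) + real N * (2 * C\<^sup>2)) * spread N x ^ m + real N * C * spread N x ^ m"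
   using sp1[of x] b by (intro add_right_mono mult_left_mono) auto
  also have "... = M' * spread N x ^ m" by (simp add: M'_def algebra_simps)
  finally show "TH x <= M' * spread N x ^ m" .
 qed
 have posI: "pos x" if "gasw N b w x ~= 0" for x using gasw0 that by blast
 have int_k: "integrable (leb N) (%x. k x * gasw N b w x)"
  by (rule integrable_gasw_bounded[where C = K and k = 0, OF b w])
    (use k_bd posI in \<open>auto simp: pos_def\<close>)
 have int_main: "integrable (leb N) (%x. (k x * LA x + kap x) * gasw N b w x)"
 proof (rule integrable_gasw_bounded[where C = "K * M + K" and k = m, OF b w])
  fix x assume "gasw N b w x ~= 0"
  then have x: "pos x" by (rule posI)
  have "\<bar>k x * LA x + kap x\<bar> <= K * (M * spread N x ^ m) + K * 1"
   using k_bd[of x] kap_bd[of x] x Lam_le[OF x] K0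
   by (intro order_trans[OF abs_triangle_ineq] add_mono) (auto simp: pos_def abs_mult intro!: mult_mono)
  also have "... <= K * (M * spread N x ^ m) + K * spread N x ^ m"
   using sp1[of x] K0 by (intro add_left_mono mult_left_mono) auto
  finally show "\<bar>k x * LA x + kap x\<bar> <= (K * M + K) * spread N x ^ m" by (simp add: algebra_simps)
 qed measurable
 have int_Xi: "integrable (leb N) (%x. XI x * gasw N b w x)"
 proof (rule integrable_gasw_bounded[where C = "K + M * K + M' * K" and k = m, OF b w])
  fix x assume "gasw N b w x ~= 0"
  then have x: "pos x" by (rule posI)
  have "0 <= XI x" unfolding XI_def using The[OF x] K0 by (intro add_nonneg_nonneg mult_nonneg_nonneg) auto
  moreover have "XI x <= K * spread N x ^ m + M * spread N x ^ m * K + M' * spread N x ^ m * K"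
   unfolding XI_def using The[OF x] K0 Lam_le[OF x] mult_left_mono[OF sp1[of x] K0]
   by (intro add_mono mult_right_mono) auto
  ultimately show "\<bar>XI x\<bar> <= (K + M * K + M' * K) * spread N x ^ m" by (simp add: algebra_simps)
 qed measurable
 define A where "A = (\<integral>x. k x * gasw N b w x \<partial>leb N)"
 define Q where "Q = (\<integral>x. (k x * LA x + kap x) * gasw N b w x \<partial>leb N)"
 define R where "R = (\<integral>x. XI x * gasw N b w x \<partial>leb N)"
 \<comment> \<open>With e1 C <= 1/2 every factor 1 + e z stays at least 1/2, so the substitution is
   increasing, maps the half line onto itself and keeps the order of the particles.\<close>
 define e1 where "e1 = min e0 (1 / (2 * C))"
 have e1: "e1 > 0" "e1 <= e0" "e1 * C <= 1/2" using e0 C by (auto simp: e1_def field_simps min_def)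
 have main: "e * Q <= e\<^sup>2 * R" if e: "\<bar>e\<bar> <= e1" for e
 proof -
  have ee0: "\<bar>e\<bar> <= e0" using e e1 by simp
  have eC: "\<bar>e * z\<bar> <= 1/2" if "\<bar>z\<bar> <= C" for z
  proof -
   have "\<bar>e * z\<bar> <= e1 * C" unfolding abs_mult using e that by (intro mult_mono) auto
   with e1 show ?thesis by simp
  qed
  define T where "T y = y + e * phi y" for y
  define T' where "T' y = 1 + e * dphi y" for y
  have [measurable]: "T \<in> borel_measurable borel" "T' \<in> borel_measurable borel" unfolding T_def[abs_def] T'_def[abs_def] by measurable
  have T'pos: "T' y >= 1/2" if "y >= 0" for y using eC[OF dphi_le[OF that]] unfolding T'_def by linarith
  have Tge: "T y >= y / 2" if "y >= 0" for y
  proof -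
   have "\<bar>e * phi y\<bar> <= e1 * (C * y)" unfolding abs_mult using e phi_le[OF that] by (intro mult_mono) auto
   also have "... <= 1/2 * y" using e1(3) that mult_right_mono[of "e1 * C" "1/2" y] by (simp add: mult.assoc)
   finally show ?thesis unfolding T_def by linarith
  qed
  define Tx where "Tx x = (\<lambda>i\<in>{..<N}. T (x i))" for x :: "nat => real"
  have [measurable]: "Tx \<in> leb N \<rightarrow>\<^sub>M leb N"
   unfolding Tx_def[abs_def] by (intro measurable_restrict) (auto intro!: leb_component_measurable)
  have sub: "(\<integral>\<^sup>+y. g (T y) * (ennreal (T' y) * indicator {0<..} y) \<partial>lborel) = (\<integral>\<^sup>+y. g y * indicator {0<..} y \<partial>lborel)"
   if [measurable]: "g \<in> borel_measurable borel" for g :: "real => ennreal"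
  proof (rule nn_integral_substitution_pos)
   show "(T has_real_derivative T' x) (at x)" if "0 <= x" for x
    unfolding T_def[abs_def] T'_def using der[OF that] by (auto intro!: derivative_eq_intros)
   show "continuous_on {0..} T'" unfolding T'_def[abs_def] by (intro continuous_intros cont)
   show "0 <= T' x" if "0 <= x" for x using T'pos[OF that] by simp
   show "T 0 = 0" by (simp add: T_def phi0)
   have "filterlim (%y::real. 1/2 * y) at_top at_top" by (rule filterlim_tendsto_pos_mult_at_top[OF tendsto_const]) (auto intro: filterlim_ident)
   then show "filterlim T at_top at_top"
    by (rule filterlim_at_top_mono) (use Tge in \<open>auto intro!: eventually_mono[OF eventually_ge_at_top[of 0]]\<close>)
  qed measurable
  \<comment> \<open>Set to 0 off the positive orthant, where the substitution is not controlled and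
    the original weight vanishes.\<close>
  define F where "F x = (if pos x then k (Tx x) * gasw N b w (Tx x) * (\<Prod>i<N. T' (x i)) else 0)" for x
  have posTx: "!!i. i < N ==> Tx x i > 0" if "pos x" for x
  proof -
   fix i assume "i < N"
   then have "x i > 0" using that by (simp add: pos_def)
   with Tge[of "x i"] \<open>i < N\<close> show "Tx x i > 0" by (simp add: Tx_def)
  qed
  have [measurable]: "Measurable.pred (leb N) pos"
  proof -
   have "Measurable.pred (leb N) (%x. \<forall>i\<in>{..<N}. x i > 0)"
    by (intro pred_intros_finite) (auto intro!: borel_measurable_pred_less leb_component_measurable[of "%x. x"])
   then show ?thesis by (simp add: pos_def[abs_def])
  qed
  have [measurable]: "F \<in> borel_measurable (leb N)"
  proof -
   have [measurable]: "(%x. \<Prod>i<N. T' (x i)) \<in> borel_measurable (leb N)"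
    by (intro borel_measurable_prod leb_component_measurable) auto
   have "(%x. k (Tx x)) \<in> borel_measurable (leb N)" "(%x. gasw N b w (Tx x)) \<in> borel_measurable (leb N)"
    by (rule measurable_compose[of Tx "leb N" "leb N"]; measurable)+
   then show ?thesis unfolding F_def[abs_def] by measurable
  qed
  have F0: "0 <= F x" for x
  proof (cases "pos x")
   case True
   have "0 <= T' (x i)" if "i < N" for i using T'pos[of "x i"] True that by (force simp: pos_def)
   then have "0 <= (\<Prod>i<N. T' (x i))" by (intro prod_nonneg) auto
   moreover have "0 <= k (Tx x)" using k_bd[of "Tx x"] posTx[OF True] by auto
   ultimately show ?thesis using True g0 unfolding F_def by auto
  qed (simp add: F_def)
  have "(\<integral>\<^sup>+x. ennreal (F x) \<partial>leb N) = (\<integral>\<^sup>+x. ennreal (k (Tx x) * gasw N b w (Tx x)) * (\<Prod>i<N. ennreal (T' (x i)) * indicator {0<..} (x i)) \<partial>leb N)"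
  proof (rule nn_integral_cong)
   fix x
   show "ennreal (F x) = ennreal (k (Tx x) * gasw N b w (Tx x)) * (\<Prod>i<N. ennreal (T' (x i)) * indicator {0<..} (x i))"
   proof (cases "pos x")
    case True
    then have "(\<Prod>i<N. ennreal (T' (x i)) * indicator {0<..} (x i)) = (\<Prod>i<N. ennreal (T' (x i)))"
     by (intro prod.cong) (auto simp: pos_def)
    also have "... = ennreal (\<Prod>i<N. T' (x i))"
    proof (rule prod_ennreal)
     fix i assume "i \<in> {..<N}"
     then show "0 <= T' (x i)" using T'pos[of "x i"] True by (force simp: pos_def)
    qed
    finally show ?thesis using True k_bd[of "Tx x"] posTx[OF True] g0
     by (simp add: F_def ennreal_mult')
   next
    case False
    then obtain i where "i < N" "x i <= 0" by (auto simp: pos_def not_less)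
    then have "(\<Prod>i<N. ennreal (T' (x i)) * indicator {0<..} (x i)) = 0" by (intro prod_zero bexI[of _ i]) auto
    with False show ?thesis by (simp add: F_def)
   qed
  qed
  also have "... = (\<integral>\<^sup>+x. ennreal (k x * gasw N b w x) * (\<Prod>i<N. indicator {0<..} (x i)) \<partial>leb N)"
   using nn_integral_leb_substitution[of T "%y. ennreal (T' y) * indicator {0<..} y" "indicator {0<..}" "%x. ennreal (k x * gasw N b w x)" N] sub
   unfolding Tx_def by simp
  also have "... = (\<integral>\<^sup>+x. ennreal (k x * gasw N b w x) \<partial>leb N)"
  proof (rule nn_integral_cong)
   fix x
   show "ennreal (k x * gasw N b w x) * (\<Prod>i<N. indicator {0<..} (x i)) = ennreal (k x * gasw N b w x)"
    by (cases "pos x") (auto simp: pos_def gasw0)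
  qed
  also have "... = ennreal A"
   unfolding A_def
  proof (rule nn_integral_eq_integral[OF int_k])
   show "AE x in leb N. 0 <= k x * gasw N b w x"
   proof (rule AE_I2)
    fix x show "0 <= k x * gasw N b w x"
     using k_bd[of x] g0[of x] by (cases "pos x") (auto simp: pos_def gasw0)
   qed
  qed
  finally have nnF: "(\<integral>\<^sup>+x. ennreal (F x) \<partial>leb N) = ennreal A" .
  have A0: "A >= 0" unfolding A_def
  proof (rule Bochner_Integration.integral_nonneg)
   fix x show "0 <= k x * gasw N b w x"
    using k_bd[of x] g0[of x] by (cases "pos x") (auto simp: pos_def gasw0)
  qed
  have intF: "integrable (leb N) F" using nnF F0 by (intro integrableI_nonneg) auto
  have "(\<integral>x. F x \<partial>leb N) = A"
   using F0 A0 by (subst integral_eq_nn_integral) (auto simp: nnF)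
  \<comment> \<open>The transformed weight times the Jacobian is exp l times the original weight,
    and exp l >= 1 + l linearises it from below, so no upper bound on \<open>l\<close> is
    required.\<close>
  have low: "F x >= k x * gasw N b w x + e * ((k x * LA x + kap x) * gasw N b w x) - e\<^sup>2 * (XI x * gasw N b w x)" for x
  proof (cases "pos x")
   case x: True
   have xp: "x i > 0" if "i < N" for i using x that by (simp add: pos_def)
   define l where "l = (\<Sum>i<N. ln (T' (x i))) + 2 * b * (\<Sum>(i, j)\<in>P. ln (1 + e * D (x i) (x j))) + (\<Sum>i<N. L (T (x i)) - L (x i))"
   have "gasw N b w (Tx x) * (\<Prod>i<N. T' (x i)) = gasw N b w x * exp l"
   proof -
    have "vdm N b (Tx x) = (\<Prod>(i, j)\<in>P. \<bar>x i - x j\<bar> powr (2 * b) * exp (2 * b * ln (1 + e * D (x i) (x j))))"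
     unfolding vdm_P
    proof (rule prod.cong[OF refl], clarify)
     fix i j assume "(i, j) \<in> P"
     note ij = PD[OF this]
     have "Tx x i - Tx x j = (x i - x j) + e * (phi (x i) - phi (x j))" using ij by (simp add: Tx_def T_def algebra_simps)
     also have "... = (x i - x j) * (1 + e * D (x i) (x j))"
      by (subst D) (use xp ij in \<open>auto simp: algebra_simps\<close>)
     finally have eq: "Tx x i - Tx x j = (x i - x j) * (1 + e * D (x i) (x j))" .
     have "1 + e * D (x i) (x j) > 0" using eC[OF D_le[OF xp[OF ij(3)] xp[OF ij(2)]]] by linarith
     then show "\<bar>Tx x i - Tx x j\<bar> powr (2 * b) = \<bar>x i - x j\<bar> powr (2 * b) * exp (2 * b * ln (1 + e * D (x i) (x j)))"
      unfolding eq abs_mult by (subst powr_mult) (auto simp: powr_def[of "1 + _"])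
    qed
    also have "... = vdm N b x * exp (2 * b * (\<Sum>(i, j)\<in>P. ln (1 + e * D (x i) (x j))))"
     using finP by (simp add: vdm_P case_prod_unfold prod.distrib exp_sum sum_distrib_left)
    finally have v: "vdm N b (Tx x) = vdm N b x * exp (2 * b * (\<Sum>(i, j)\<in>P. ln (1 + e * D (x i) (x j))))" .
    have "(\<Prod>i<N. w (Tx x i)) = (\<Prod>i<N. w (x i) * exp (L (T (x i)) - L (x i)))"
    proof (rule prod.cong[OF refl])
     fix i assume i: "i \<in> {..<N}"
     have "T (x i) > 0" using Tge[of "x i"] xp[of i] i by auto
     then show "w (Tx x i) = w (x i) * exp (L (T (x i)) - L (x i))"
      using wL xp[of i] i by (simp add: Tx_def exp_diff)
    qed
    also have "... = (\<Prod>i<N. w (x i)) * exp (\<Sum>i<N. L (T (x i)) - L (x i))"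
     by (simp add: prod.distrib exp_sum)
    finally have ww: "(\<Prod>i<N. w (Tx x i)) = (\<Prod>i<N. w (x i)) * exp (\<Sum>i<N. L (T (x i)) - L (x i))" .
    have "(\<Prod>i<N. T' (x i)) = (\<Prod>i<N. exp (ln (T' (x i))))"
     using T'pos xp by (intro prod.cong) (auto simp: less_imp_le less_le_trans[of 0 "1/2"])
    also have "... = exp (\<Sum>i<N. ln (T' (x i)))" by (simp add: exp_sum)
    finally have tt: "(\<Prod>i<N. T' (x i)) = exp (\<Sum>i<N. ln (T' (x i)))" .
    show ?thesis unfolding gasw_def v ww tt l_def by (simp add: exp_add mult_ac)
   qed
   then have F: "F x = gasw N b w x * (k (Tx x) * exp l)" using x by (simp add: F_def mult_ac)
   have lnb: "ln (1 + e * z) >= e * z - e\<^sup>2 * (2 * C\<^sup>2)" if "\<bar>z\<bar> <= C" for z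
   proof -
    have "\<bar>ln (1 + e * z) - e * z\<bar> <= 2 * (e * z)\<^sup>2" by (rule abs_ln_one_plus_x_minus_x_bound[OF eC[OF that]])
    moreover have "(e * z)\<^sup>2 <= e\<^sup>2 * C\<^sup>2"
     unfolding power_mult_distrib using power_mono[OF that, of 2] by (intro mult_left_mono) auto
    ultimately show ?thesis by linarith
   qed
   have "(\<Sum>i<N. ln (T' (x i))) >= (\<Sum>i<N. e * dphi (x i) - e\<^sup>2 * (2 * C\<^sup>2))"
    unfolding T'_def by (intro sum_mono lnb dphi_le) (use xp in \<open>auto simp: less_imp_le\<close>)
   moreover have "(\<Sum>(i, j)\<in>P. ln (1 + e * D (x i) (x j))) >= (\<Sum>(i, j)\<in>P. e * D (x i) (x j) - e\<^sup>2 * (2 * C\<^sup>2))"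
    by (intro sum_mono) (auto intro!: lnb D_le xp dest: PD)
   then have "2 * b * (\<Sum>(i, j)\<in>P. ln (1 + e * D (x i) (x j))) >= 2 * b * (\<Sum>(i, j)\<in>P. e * D (x i) (x j) - e\<^sup>2 * (2 * C\<^sup>2))"
    using b by (intro mult_left_mono) auto
   moreover have "(\<Sum>i<N. L (T (x i)) - L (x i)) >= (\<Sum>i<N. e * lam (x i) - e\<^sup>2 * (C * (1 + x i) ^ m))"
    unfolding T_def by (intro sum_mono lam[OF xp ee0]) auto
   moreover have "(\<Sum>i<N. e * dphi (x i) - e\<^sup>2 * (2 * C\<^sup>2)) + 2 * b * (\<Sum>(i, j)\<in>P. e * D (x i) (x j) - e\<^sup>2 * (2 * C\<^sup>2)) + (\<Sum>i<N. e * lam (x i) - e\<^sup>2 * (C * (1 + x i) ^ m))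
    = e * LA x - e\<^sup>2 * TH x"
    unfolding Lam_P TH_def by (simp add: case_prod_unfold sum_subtractf sum_distrib_left algebra_simps)
   ultimately have "l >= e * LA x - e\<^sup>2 * TH x" unfolding l_def by linarith
   then have el: "exp l >= 1 + (e * LA x - e\<^sup>2 * TH x)" using exp_ge_add_one_self[of l] by linarith
   have kT: "0 <= k (Tx x)" "k (Tx x) <= K" using k_bd[of "Tx x"] posTx[OF x] by auto
   have k1: "\<bar>k (Tx x) - k x\<bar> <= K * \<bar>e\<bar>" and k2: "k (Tx x) - k x >= e * kap x - K * e\<^sup>2"
    using k_lip[of x e] k_der[of x e] xp ee0 by (auto simp: Tx_def T_def)
   have "k (Tx x) * exp l >= k (Tx x) * (1 + (e * LA x - e\<^sup>2 * TH x))" using el kT by (intro mult_left_mono) auto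
   also have "k (Tx x) * (1 + (e * LA x - e\<^sup>2 * TH x)) = k (Tx x) + e * LA x * k x + e * LA x * (k (Tx x) - k x) - e\<^sup>2 * (TH x * k (Tx x))"
    by (simp add: algebra_simps)
   finally have 1: "k (Tx x) * exp l >= k (Tx x) + e * LA x * k x + e * LA x * (k (Tx x) - k x) - e\<^sup>2 * (TH x * k (Tx x))" .
   have "\<bar>e * LA x * (k (Tx x) - k x)\<bar> <= \<bar>e * LA x\<bar> * (K * \<bar>e\<bar>)" unfolding abs_mult[of "e * LA x"] using k1 by (intro mult_left_mono) auto
   also have "... = e\<^sup>2 * (\<bar>LA x\<bar> * K)" by (simp add: abs_mult power2_eq_square)
   finally have 2: "e * LA x * (k (Tx x) - k x) >= - (e\<^sup>2 * (\<bar>LA x\<bar> * K))" by linarith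
   have 3: "e\<^sup>2 * (TH x * k (Tx x)) <= e\<^sup>2 * (TH x * K)" using The[OF x] kT by (intro mult_left_mono) auto
   have "k (Tx x) * exp l >= k x + e * (k x * LA x + kap x) - e\<^sup>2 * XI x"
    using 1 2 3 k2 unfolding XI_def by (simp add: algebra_simps)
   then have "gasw N b w x * (k (Tx x) * exp l) >= gasw N b w x * (k x + e * (k x * LA x + kap x) - e\<^sup>2 * XI x)"
    by (intro mult_left_mono g0)
   then show ?thesis unfolding F by (simp add: algebra_simps)
  qed (simp add: gasw0 F_def)
  have "(\<integral>x. k x * gasw N b w x + e * ((k x * LA x + kap x) * gasw N b w x) - e\<^sup>2 * (XI x * gasw N b w x) \<partial>leb N) <= (\<integral>x. F x \<partial>leb N)"
   by (intro integral_mono intF low Bochner_Integration.integrable_diff Bochner_Integration.integrable_add int_k integrable_mult_right int_main int_Xi)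
  also have "(\<integral>x. F x \<partial>leb N) = A" by fact
  also have "(\<integral>x. k x * gasw N b w x + e * ((k x * LA x + kap x) * gasw N b w x) - e\<^sup>2 * (XI x * gasw N b w x) \<partial>leb N)
   = A + e * Q - e\<^sup>2 * R"
   unfolding A_def Q_def R_def using int_k int_main int_Xi
   by (simp add: Bochner_Integration.integral_diff Bochner_Integration.integral_add)
  finally show ?thesis by simp
 qed
 have "Q = 0"
 proof (rule ccontr)
  assume "Q ~= 0"
  \<comment> \<open>The sign of \<open>e\<close> makes e Q positive; its size, at most |Q| / (2 (|R|
    + 1)), then contradicts e Q <= e^2 R.\<close>
  define e where "e = sgn Q * min e1 (\<bar>Q\<bar> / (2 * (\<bar>R\<bar> + 1)))"
  define d where "d = min e1 (\<bar>Q\<bar> / (2 * (\<bar>R\<bar> + 1)))"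
  have d: "d > 0" "d <= e1" "d <= \<bar>Q\<bar> / (2 * (\<bar>R\<bar> + 1))" using e1 \<open>Q ~= 0\<close> by (auto simp: d_def)
  have "e * Q = d * \<bar>Q\<bar>" unfolding e_def d_def by (simp add: sgn_mult_abs abs_sgn mult_ac)
  moreover have "\<bar>e\<bar> = d" "e\<^sup>2 = d\<^sup>2" using d \<open>Q ~= 0\<close> unfolding e_def d_def[symmetric] by (auto simp: abs_mult power_mult_distrib sgn_if)
  ultimately have "d * \<bar>Q\<bar> <= d\<^sup>2 * R" using main[of e] d by simp
  then have "\<bar>Q\<bar> <= d * R" using d by (simp add: power2_eq_square)
  also have "... <= d * (\<bar>R\<bar> + 1)" using d by (intro mult_left_mono) auto
  also have "... <= \<bar>Q\<bar> / (2 * (\<bar>R\<bar> + 1)) * (\<bar>R\<bar> + 1)" using d by (intro mult_right_mono) auto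
  also have "... = \<bar>Q\<bar> / 2"
  proof -
   have "\<bar>R\<bar> + 1 > 0" by simp
   then show ?thesis by (simp add: divide_simps)
  qed
  finally show False using \<open>Q ~= 0\<close> by simp
 qed
 then show ?thesis unfolding Q_def .
qed

section \<open>Exponential moments of linear statistics\<close>

text \<open>Over ordered pairs with distinct entries a permutation acts by reindexing, which it does
  not over the pairs i < j that define \<open>vdm\<close>.\<close>

lemma prod_off_diagonal:
 fixes g :: "nat => nat => real"
 shows "(\<Prod>(i, j)\<in>{(i, j). i < N \<and> j < N \<and> i ~= j}. g i j) = (\<Prod>(i, j)\<in>{(i, j). i < j \<and> j < N}. g i j * g j i)"
proof -
 let ?P = "{(i, j). i < j \<and> j < N}"
 have split: "{(i, j). i < N \<and> j < N \<and> i ~= j} = ?P \<union> prod.swap ` ?P"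
  by (auto simp: image_iff)
 have "finite (prod.swap ` ?P)" by (intro finite_imageI finite_pairs)
 then have "(\<Prod>(i, j)\<in>{(i, j). i < N \<and> j < N \<and> i ~= j}. g i j) = (\<Prod>(i, j)\<in>?P. g i j) * (\<Prod>(i, j)\<in>prod.swap ` ?P. g i j)"
  unfolding split by (intro prod.union_disjoint) auto
 also have "(\<Prod>(i, j)\<in>prod.swap ` ?P. g i j) = (\<Prod>(i, j)\<in>?P. g j i)"
  by (subst prod.reindex) (auto simp: inj_on_def o_def case_prod_unfold)
 finally show ?thesis by (simp add: prod.distrib case_prod_unfold)
qed

lemma vdm_permute:
 assumes ss: "ss permutes {..<N}"
 shows "vdm N b (\<lambda>i\<in>{..<N}. x (ss i)) = vdm N b x"
proof -
 let ?O = "{(i, j). i < N \<and> j < N \<and> i ~= j}"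
 have eq: "vdm N b y = (\<Prod>(i, j)\<in>?O. \<bar>y i - y j\<bar> powr b)" for y
  unfolding vdm_def prod_off_diagonal
  by (intro prod.cong) (auto simp: abs_minus_commute powr_add[symmetric])
 have bij: "bij_betw (map_prod ss ss) ?O ?O"
 proof (rule bij_betwI[where g = "map_prod (inv ss) (inv ss)"])
  have in1: "ss i < N \<longleftrightarrow> i < N" and in2: "inv ss i < N \<longleftrightarrow> i < N" for i
   using permutes_in_image[OF ss, of i] permutes_in_image[OF permutes_inv[OF ss], of i] by auto
  have inj: "ss i = ss j \<longleftrightarrow> i = j" "inv ss i = inv ss j \<longleftrightarrow> i = j" for i j
   using permutes_inj[OF ss] permutes_inj[OF permutes_inv[OF ss]] by (auto simp: inj_eq)
  show "map_prod ss ss \<in> ?O \<rightarrow> ?O" "map_prod (inv ss) (inv ss) \<in> ?O \<rightarrow> ?O" using in1 in2 inj by auto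
  show "map_prod (inv ss) (inv ss) (map_prod ss ss p) = p" "map_prod ss ss (map_prod (inv ss) (inv ss) p) = p" for p
   using permutes_inverses[OF ss] by (cases p; simp)+
 qed
 have "vdm N b (\<lambda>i\<in>{..<N}. x (ss i)) = (\<Prod>(i, j)\<in>?O. \<bar>x (ss i) - x (ss j)\<bar> powr b)"
  unfolding eq by (rule prod.cong) auto
 also have "... = (\<Prod>p\<in>?O. (%(i, j). \<bar>x i - x j\<bar> powr b) (map_prod ss ss p))"
  by (rule prod.cong) auto
 also have "... = (\<Prod>(i, j)\<in>?O. \<bar>x i - x j\<bar> powr b)"
  by (rule prod.reindex_bij_betw[OF bij])
 finally show ?thesis unfolding eq .
qed

lemma gasw_permute:
 assumes ss: "ss permutes {..<N}"
 shows "gasw N b w (\<lambda>i\<in>{..<N}. x (ss i)) = gasw N b w x"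
proof -
 have "(\<Prod>i<N. w ((\<lambda>i\<in>{..<N}. x (ss i)) i)) = (\<Prod>i<N. w (x (ss i)))" by (intro prod.cong) auto
 also have "... = (\<Prod>i<N. w (x i))" using prod.permute[OF ss, of "%i. w (x i)"] by (simp add: o_def)
 finally show ?thesis unfolding gasw_def vdm_permute[OF ss] by simp
qed

definition chamber :: "nat => (nat => real) set" where
 "chamber N = {x. \<forall>i j. i < j \<and> j < N --> x i < x j}"

text \<open>The sorting permutation is the inverse of the rank map, which counts smaller entries;
  any sorting permutation must send i to the index of rank i, hence uniqueness.\<close>

lemma ex1_sorting_permutation:
 fixes x :: "nat => real"
 assumes inj: "inj_on x {..<N}"
 shows "\<exists>!ss. ss permutes {..<N} \<and> (\<lambda>i\<in>{..<N}. x (ss i)) \<in> chamber N"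
proof -
 define r where "r i = card {j\<in>{..<N}. x j < x i}" for i
 have r_mono: "r i < r j" if "i < N" "x i < x j" for i j
  unfolding r_def using that by (intro psubset_card_mono) (auto intro: less_trans)
 have "card {j\<in>{..<N}. x j < x i} < card {..<N}" if "i < N" for i
  using that by (intro psubset_card_mono) auto
 then have r_le: "r i < N" if "i < N" for i using that by (simp add: r_def)
 have r_inj: "inj_on r {..<N}"
 proof (rule inj_onI)
  fix i j assume ij: "i \<in> {..<N}" "j \<in> {..<N}" "r i = r j"
  then have "\<not> x i < x j" "\<not> x j < x i" using r_mono[of i j] r_mono[of j i] by auto
  then have "x i = x j" by simp
  then show "i = j" using inj ij by (auto dest: inj_onD)
 qed
 have r_bij: "bij_betw r {..<N} {..<N}"
  unfolding bij_betw_def using r_inj r_le endo_inj_surj[of "{..<N}" r] by auto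
 define \<rho> where "\<rho> i = (if i < N then r i else i)" for i
 have \<rho>: "\<rho> permutes {..<N}"
  by (rule bij_imp_permutes) (use r_bij bij_betw_cong[of "{..<N}" r \<rho>] in \<open>auto simp: \<rho>_def\<close>)
 have key: "ss = inv \<rho>" if ss: "ss permutes {..<N}" and ch: "(\<lambda>i\<in>{..<N}. x (ss i)) \<in> chamber N" for ss
 proof -
  have in1: "ss i < N \<longleftrightarrow> i < N" for i using permutes_in_image[OF ss, of i] by auto
  have lt: "x (ss k) < x (ss i) \<longleftrightarrow> k < i" if "k < N" "i < N" for k i
  proof -
   have "x (ss i) < x (ss j)" if "i < j" "j < N" for i j
    using ch that unfolding chamber_def by (auto dest!: spec[of _ i] spec[of _ j])
   from this[of k i] this[of i k] that show ?thesis by (cases "k = i"; cases "k < i") (auto simp: not_less)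
  qed
  have "\<rho> (ss i) = i" for i
  proof (cases "i < N")
   case True
   have "{j\<in>{..<N}. x j < x (ss i)} = ss ` {k\<in>{..<N}. x (ss k) < x (ss i)}"
   proof (intro equalityI subsetI)
    fix j assume j: "j \<in> {j\<in>{..<N}. x j < x (ss i)}"
    then have "j = ss (inv ss j)" "inv ss j < N"
     using permutes_inverses[OF ss] permutes_in_image[OF permutes_inv[OF ss], of j] by auto
    with j show "j \<in> ss ` {k\<in>{..<N}. x (ss k) < x (ss i)}" by auto
   qed (auto simp: in1)
   also have "{k\<in>{..<N}. x (ss k) < x (ss i)} = {..<i}" using lt True by auto
   finally have "r (ss i) = card (ss ` {..<i})" by (simp add: r_def)
   also have "... = i" by (subst card_image) (auto intro: inj_on_subset[OF permutes_inj[OF ss]])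
   finally show ?thesis using True in1 by (simp add: \<rho>_def)
  next
   case False
   then have "ss i = i" using permutes_not_in[OF ss, of i] by simp
   with False show ?thesis by (simp add: \<rho>_def)
  qed
  then show ?thesis using permutes_inverses[OF \<rho>] by (metis ext)
 qed
 have "(\<lambda>i\<in>{..<N}. x (inv \<rho> i)) \<in> chamber N"
  unfolding chamber_def
 proof (clarify)
  fix i j assume ij: "i < j" "j < N"
  have in2: "inv \<rho> k < N" if "k < N" for k using permutes_in_image[OF permutes_inv[OF \<rho>], of k] that by auto
  have rr: "r (inv \<rho> k) = k" if "k < N" for k
   using permutes_inverses(1)[OF \<rho>, of k] in2[OF that] by (simp add: \<rho>_def)
  have "x (inv \<rho> i) < x (inv \<rho> j)"
  proof (rule ccontr)
   assume "\<not> x (inv \<rho> i) < x (inv \<rho> j)"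
   then have "x (inv \<rho> j) < x (inv \<rho> i) \<or> x (inv \<rho> i) = x (inv \<rho> j)" by auto
   then show False
   proof
    assume "x (inv \<rho> j) < x (inv \<rho> i)"
    then have "r (inv \<rho> j) < r (inv \<rho> i)" using in2 ij by (intro r_mono) auto
    then show False using rr[of i] rr[of j] ij by simp
   next
    assume "x (inv \<rho> i) = x (inv \<rho> j)"
    then have "inv \<rho> i = inv \<rho> j" using inj in2 ij by (auto dest: inj_onD)
    then show False using rr[of i] rr[of j] ij by simp
   qed
  qed
  then show "(\<lambda>i\<in>{..<N}. x (inv \<rho> i)) i < (\<lambda>i\<in>{..<N}. x (inv \<rho> i)) j" using ij by simp
 qed
 with permutes_inv[OF \<rho>] show ?thesis
  by (intro ex1I[of _ "inv \<rho>"] conjI; (elim conjE)?) (rule key | assumption)+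
qed

lemma chamber_pred [measurable]: "Measurable.pred (leb N) (%x. x \<in> chamber N)"
proof -
 have "Measurable.pred (leb N) (%x. \<forall>p\<in>{(i, j). i < j \<and> j < N}. x (fst p) < x (snd p))"
  by (intro pred_intros_finite borel_measurable_pred_less leb_component_measurable[of "%x. x"]) auto
 moreover have "x \<in> chamber N \<longleftrightarrow> (\<forall>p\<in>{(i, j). i < j \<and> j < N}. x (fst p) < x (snd p))" for x :: "nat => real"
  by (auto simp: chamber_def)
 ultimately show ?thesis by simp
qed

text \<open>A point with distinct coordinates has exactly one of its \<open>fact N\<close>
  rearrangements in the chamber; at all other points the weight vanishes.\<close>

lemma nn_integral_gasw_chamber:
 fixes F :: "(nat => real) => ennreal"
 assumes [measurable]: "F \<in> borel_measurable (leb N)" "w \<in> borel_measurable borel"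
  and sym: "!!ss x. ss permutes {..<N} ==> F (\<lambda>i\<in>{..<N}. x (ss i)) = F x"
 shows "(\<integral>\<^sup>+x. F x * ennreal (gasw N b w x) \<partial>leb N) = fact N * (\<integral>\<^sup>+x. F x * ennreal (gasw N b w x) * indicator (chamber N) x \<partial>leb N)"
proof -
 define S where "S = {ss. ss permutes {..<N}}"
 have S: "finite S" "card S = fact N" unfolding S_def by (auto simp: finite_permutations card_permutations)
 define G where "G x = F x * ennreal (gasw N b w x) * indicator (chamber N) x" for x
 have [measurable]: "G \<in> borel_measurable (leb N)"
 proof -
  have "(%x. if x \<in> chamber N then F x * ennreal (gasw N b w x) else 0) \<in> borel_measurable (leb N)" by measurable
  moreover have "G = (%x. if x \<in> chamber N then F x * ennreal (gasw N b w x) else 0)" by (auto simp: G_def fun_eq_iff)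
  ultimately show ?thesis by simp
 qed
 have "(\<integral>\<^sup>+x. F x * ennreal (gasw N b w x) \<partial>leb N) = (\<integral>\<^sup>+x. (\<Sum>ss\<in>S. G (\<lambda>i\<in>{..<N}. x (ss i))) \<partial>leb N)"
 proof (rule nn_integral_cong)
  fix x
  have "(\<Sum>ss\<in>S. G (\<lambda>i\<in>{..<N}. x (ss i))) = (\<Sum>ss\<in>S. F x * ennreal (gasw N b w x) * indicator (chamber N) (\<lambda>i\<in>{..<N}. x (ss i)))"
   by (intro sum.cong) (auto simp: G_def S_def sym gasw_permute)
  also have "... = F x * ennreal (gasw N b w x)"
  proof (cases "inj_on x {..<N}")
   case True
   from ex1_sorting_permutation[OF this] obtain \<tau> where \<tau>: "\<tau> \<in> S" "(\<lambda>i\<in>{..<N}. x (\<tau> i)) \<in> chamber N"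
    and u: "!!ss. ss \<in> S ==> (\<lambda>i\<in>{..<N}. x (ss i)) \<in> chamber N ==> ss = \<tau>"
    unfolding S_def by blast
   have "(\<Sum>ss\<in>S. F x * ennreal (gasw N b w x) * indicator (chamber N) (\<lambda>i\<in>{..<N}. x (ss i)))
    = (\<Sum>ss\<in>S. if ss = \<tau> then F x * ennreal (gasw N b w x) else 0)"
   proof (rule sum.cong[OF refl])
    fix ss assume "ss \<in> S"
    show "F x * ennreal (gasw N b w x) * indicator (chamber N) (\<lambda>i\<in>{..<N}. x (ss i)) = (if ss = \<tau> then F x * ennreal (gasw N b w x) else 0)"
    proof (cases "ss = \<tau>")
     case True
     show ?thesis unfolding True indicator_eq_1_iff[THEN iffD2, OF \<tau>(2)] mult_1_right if_True refl[THEN eqTrueI] ..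
    next
     case False
     then have "(\<lambda>i\<in>{..<N}. x (ss i)) \<notin> chamber N" using u[OF \<open>ss \<in> S\<close>] by blast
     then have "indicator (chamber N) (\<lambda>i\<in>{..<N}. x (ss i)) = (0 :: ennreal)" unfolding indicator_eq_0_iff .
     then show ?thesis using False by (simp only: mult_zero_right if_False)
    qed
   qed
   then show ?thesis using S \<tau> by simp
  next
   case False
   then obtain i j where "i < N" "j < N" "i ~= j" "x i = x j" by (auto simp: inj_on_def)
   then obtain i j where "i < j" "j < N" "x i = x j" by (metis linorder_neqE_nat)
   \<comment> \<open>Valid even for b = 0, because \<open>0 powr 0 = 0\<close>: coincident points
     always get weight 0.\<close>
   then have "(%(i, j). \<bar>x i - x j\<bar> powr (2 * b)) (i, j) = 0 \<and> (i, j) \<in> {(i, j). i < j \<and> j < N}" by simp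
   then have "vdm N b x = 0" unfolding vdm_def by (intro prod_zero finite_pairs) blast
   then show ?thesis by (simp add: gasw_def)
  qed
  finally show "F x * ennreal (gasw N b w x) = (\<Sum>ss\<in>S. G (\<lambda>i\<in>{..<N}. x (ss i)))" by simp
 qed
 also have "... = (\<Sum>ss\<in>S. \<integral>\<^sup>+x. G (\<lambda>i\<in>{..<N}. x (ss i)) \<partial>leb N)"
 proof (rule nn_integral_sum)
  fix ss assume "ss \<in> S"
  then have "ss i < N" if "i < N" for i using permutes_in_image[of ss "{..<N}" i] that by (simp add: S_def)
  then have "(%x. \<lambda>i\<in>{..<N}. x (ss i)) \<in> leb N \<rightarrow>\<^sub>M leb N"
   by (intro measurable_restrict) (auto intro!: measurable_component_singleton)
  then show "(%x. G (\<lambda>i\<in>{..<N}. x (ss i))) \<in> borel_measurable (leb N)" by (rule measurable_compose) measurable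
 qed
 also have "... = (\<Sum>ss\<in>S. \<integral>\<^sup>+x. G x \<partial>leb N)"
  by (intro sum.cong nn_integral_leb_permute) (auto simp: S_def)
 also have "... = fact N * (\<integral>\<^sup>+x. G x \<partial>leb N)" using S by simp
 finally show ?thesis by (simp add: G_def)
qed

text \<open>On the chamber each difference has the same sign in \<open>x\<close> and in
  \<open>y\<close>, so the difference at the midpoint is, in absolute value, the arithmetic mean of
  the two, which dominates their geometric mean.\<close>

lemma vdm_midpoint:
 assumes "b >= 0" "x \<in> chamber N" "y \<in> chamber N"
 shows "vdm N b x * vdm N b y <= (vdm N b (%i. (x i + y i) / 2))\<^sup>2"
proof -
 let ?P = "{(i, j). i < j \<and> j < N}"
 have "vdm N b x * vdm N b y = (\<Prod>(i, j)\<in>?P. \<bar>x i - x j\<bar> powr (2 * b) * \<bar>y i - y j\<bar> powr (2 * b))"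
  by (simp add: vdm_def prod.distrib case_prod_unfold)
 also have "... <= (\<Prod>(i, j)\<in>?P. (\<bar>(x i + y i) / 2 - (x j + y j) / 2\<bar> powr (2 * b))\<^sup>2)"
 proof (rule prod_mono, clarify, intro conjI)
  fix i j assume ij: "i < j" "j < N"
  define c d where "c = x j - x i" and "d = y j - y i"
  have cd: "c > 0" "d > 0" using assms ij by (auto simp: chamber_def c_def d_def)
  have a: "\<bar>x i - x j\<bar> = c" "\<bar>y i - y j\<bar> = d" using cd by (auto simp: c_def d_def)
  have "(x i + y i) / 2 - (x j + y j) / 2 = - ((c + d) / 2)" by (simp add: c_def d_def field_simps)
  then have m: "\<bar>(x i + y i) / 2 - (x j + y j) / 2\<bar> = (c + d) / 2" using cd by simp
  have "c * d <= ((c + d) / 2)\<^sup>2" using zero_le_power2[of "c - d"] by (simp add: power2_eq_square field_simps)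
  then have "(c * d) powr (2 * b) <= (((c + d) / 2)\<^sup>2) powr (2 * b)" using assms cd by (intro powr_mono2) auto
  also have "... = (((c + d) / 2) powr (2 * b))\<^sup>2" unfolding power2_eq_square using cd by (subst powr_mult) auto
  finally show "\<bar>x i - x j\<bar> powr (2 * b) * \<bar>y i - y j\<bar> powr (2 * b) <= (\<bar>(x i + y i) / 2 - (x j + y j) / 2\<bar> powr (2 * b))\<^sup>2"
   unfolding a m using cd by (simp add: powr_mult)
 qed auto
 also have "... = (vdm N b (%i. (x i + y i) / 2))\<^sup>2" by (simp add: vdm_def prod_power_distrib case_prod_unfold)
 finally show ?thesis .
qed

text \<open>Prekopa-Leindler on the chamber, with the weight tilted by exp(s X) and by exp(-s X).
  The tilt costs at most |s| K |y - z| per particle, the strict convexity of \<open>V\<close> gains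
  c (y - z)^2 / 4, and the repulsion only helps by \<open>vdm_midpoint\<close>; maximising the
  difference over |y - z| leaves s^2 K^2 / c per particle. In the application \<open>c\<close> grows
  like N, so the bound does not depend on N.\<close>

theorem gas_laplace_bound:
 fixes w V f :: "real => real"
 assumes b: "b >= 0" and [measurable]: "w \<in> borel_measurable borel" "f \<in> borel_measurable borel"
  and wV: "!!y. y > 0 ==> w y = exp (- V y)" and w_nonpos: "!!y. y <= 0 ==> w y = 0"
  and c: "c > 0" and V: "!!y z. y > 0 ==> z > 0 ==> V y + V z - 2 * V ((y + z) / 2) >= c * (y - z)\<^sup>2 / 4"
  and f: "!!y z. y > 0 ==> z > 0 ==> \<bar>f y - f z\<bar> <= K * \<bar>y - z\<bar>"
 shows "(\<integral>\<^sup>+x. ennreal (exp (s * (\<Sum>i<N. f (x i)))) * ennreal (gasw N b w x) \<partial>leb N) *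
     (\<integral>\<^sup>+x. ennreal (exp (- s * (\<Sum>i<N. f (x i)))) * ennreal (gasw N b w x) \<partial>leb N)
   <= ennreal (exp (real N * s\<^sup>2 * K\<^sup>2 / c)) * (\<integral>\<^sup>+x. ennreal (gasw N b w x) \<partial>leb N)\<^sup>2"
proof -
 have w0: "0 <= w y" for y using wV[of y] w_nonpos[of y] by (cases "y > 0") auto
 define X where "X x = (\<Sum>i<N. f (x i))" for x :: "nat => real"
 \<comment> \<open>Half the exponent of the claim, because the right side of Prekopa-Leindler is
   squared.\<close>
 define E where "E = exp (real N * s\<^sup>2 * K\<^sup>2 / (2 * c))"
 have E2: "E\<^sup>2 = exp (real N * s\<^sup>2 * K\<^sup>2 / c)"
  unfolding E_def exp_double[symmetric] by simp
 have [measurable]: "X \<in> borel_measurable (leb N)"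
  unfolding X_def[abs_def] by (intro borel_measurable_sum leb_component_measurable) auto
 have Xsym: "X (\<lambda>i\<in>{..<N}. x (ss i)) = X x" if "ss permutes {..<N}" for ss x
  using sum.permute[OF that, of "%i. f (x i)"] by (simp add: X_def o_def)
 let ?I = "%F. \<integral>\<^sup>+x. ennreal (F x) * ennreal (gasw N b w x) * indicator (chamber N) x \<partial>leb N"
 have meas: "(%x. ennreal (F x) * ennreal (gasw N b w x) * indicator (chamber N) x) \<in> borel_measurable (leb N)"
  if F: "F \<in> borel_measurable (leb N)" for F
 proof -
  have "(%x. ennreal (F x) * ennreal (gasw N b w x)) \<in> borel_measurable (leb N)"
   by (intro borel_measurable_times_ennreal measurable_compose[OF _ measurable_ennreal] F gasw_measurable assms)
  then have "(%x. if x \<in> chamber N then ennreal (F x) * ennreal (gasw N b w x) else 0) \<in> borel_measurable (leb N)"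
   by (rule measurable_If[OF _ _ chamber_pred[unfolded pred_def]]) simp
  then show ?thesis by (rule measurable_cong[THEN iffD1, rotated]) auto
 qed
 have one: "w y * w z * exp (s * (f y - f z)) <= (w ((y + z) / 2))\<^sup>2 * exp (s\<^sup>2 * K\<^sup>2 / c)" for y z
 proof (cases "y > 0 \<and> z > 0")
  case True
  define d where "d = \<bar>y - z\<bar>"
  have "s * (f y - f z) <= \<bar>s * (f y - f z)\<bar>" by simp
  also have "... = \<bar>s\<bar> * \<bar>f y - f z\<bar>" by (rule abs_mult)
  also have "... <= \<bar>s\<bar> * (K * d)" using f True by (intro mult_left_mono) (auto simp: d_def)
  also have "... <= c * d\<^sup>2 / 4 + \<bar>s\<bar>\<^sup>2 * K\<^sup>2 / c"
  proof -
   have "0 <= (c * d / 2 - \<bar>s\<bar> * K)\<^sup>2 / c" using c by simp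
   also have "(c * d / 2 - \<bar>s\<bar> * K)\<^sup>2 = c * (c * d\<^sup>2 / 4 - \<bar>s\<bar> * (K * d)) + \<bar>s\<bar>\<^sup>2 * K\<^sup>2"
    unfolding power2_diff by (simp only: power2_eq_square) (simp add: algebra_simps)
   also have "... / c = c * d\<^sup>2 / 4 - \<bar>s\<bar> * (K * d) + \<bar>s\<bar>\<^sup>2 * K\<^sup>2 / c"
    using c by (simp add: add_divide_distrib)
   finally show ?thesis by simp
  qed
  finally have "s * (f y - f z) <= c * (y - z)\<^sup>2 / 4 + s\<^sup>2 * K\<^sup>2 / c" by (simp add: d_def)
  then have "- V y - V z + s * (f y - f z) <= - 2 * V ((y + z) / 2) + s\<^sup>2 * K\<^sup>2 / c" using V[of y z] True by linarith
  then have le: "exp (- V y - V z + s * (f y - f z)) <= exp (- 2 * V ((y + z) / 2) + s\<^sup>2 * K\<^sup>2 / c)" by simp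
  have "w y * w z * exp (s * (f y - f z)) = exp (- V y - V z + s * (f y - f z))"
   using True wV by (simp add: mult_exp_exp)
  moreover have "(w ((y + z) / 2))\<^sup>2 * exp (s\<^sup>2 * K\<^sup>2 / c) = exp (- 2 * V ((y + z) / 2) + s\<^sup>2 * K\<^sup>2 / c)"
   using True wV[of "(y + z) / 2"] by (simp add: power2_eq_square mult_exp_exp)
  ultimately show ?thesis using le by simp
 qed (use w_nonpos in \<open>auto simp: not_less\<close>)
 have "?I (%x. exp (s * X x)) * ?I (%x. exp (- s * X x)) <= (\<integral>\<^sup>+x. ennreal E * (ennreal 1 * ennreal (gasw N b w x) * indicator (chamber N) x) \<partial>leb N)\<^sup>2"
 proof (rule prekopa_leindler_PiM)
  show "(%x. ennreal E * (ennreal 1 * ennreal (gasw N b w x) * indicator (chamber N) x)) \<in> borel_measurable (leb N)"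
   by (intro borel_measurable_times_ennreal meas) auto
  fix x y :: "nat => real"
  let ?m = "%i. (x i + y i) / 2"
  show "ennreal (exp (s * X x)) * ennreal (gasw N b w x) * indicator (chamber N) x * (ennreal (exp (- s * X y)) * ennreal (gasw N b w y) * indicator (chamber N) y)
   <= (ennreal E * (ennreal 1 * ennreal (gasw N b w ?m) * indicator (chamber N) ?m))\<^sup>2"
  proof (cases "x \<in> chamber N \<and> y \<in> chamber N")
   case True
   then have m: "?m \<in> chamber N" by (auto simp: chamber_def intro!: divide_strict_right_mono add_strict_mono)
   have "(\<Prod>i<N. w (x i)) * (\<Prod>i<N. w (y i)) * exp (s * (X x - X y)) = (\<Prod>i<N. w (x i) * w (y i) * exp (s * (f (x i) - f (y i))))"
    by (simp add: prod.distrib X_def exp_sum[symmetric] sum_distrib_left[symmetric] sum_subtractf)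
   also have "... <= (\<Prod>i<N. (w ((x i + y i) / 2))\<^sup>2 * exp (s\<^sup>2 * K\<^sup>2 / c))"
    by (intro prod_mono) (use one w0 in \<open>auto intro!: mult_nonneg_nonneg\<close>)
   also have "... = (\<Prod>i<N. w ((x i + y i) / 2))\<^sup>2 * E\<^sup>2"
   proof -
    have "exp (s\<^sup>2 * K\<^sup>2 / c) ^ N = E\<^sup>2"
     unfolding E2 exp_of_nat_mult[symmetric] by (simp add: mult.assoc)
    then show ?thesis by (simp add: prod.distrib prod_power_distrib)
   qed
   finally have p: "(\<Prod>i<N. w (x i)) * (\<Prod>i<N. w (y i)) * exp (s * (X x - X y)) <= (\<Prod>i<N. w ((x i + y i) / 2))\<^sup>2 * E\<^sup>2" .
   have "exp (s * X x) * gasw N b w x * (exp (- s * X y) * gasw N b w y)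
    = (vdm N b x * vdm N b y) * ((\<Prod>i<N. w (x i)) * (\<Prod>i<N. w (y i)) * exp (s * (X x - X y)))"
    by (simp add: gasw_def right_diff_distrib exp_diff exp_minus field_simps)
   also have "... <= (vdm N b ?m)\<^sup>2 * ((\<Prod>i<N. w ((x i + y i) / 2))\<^sup>2 * E\<^sup>2)"
    using True b by (intro mult_mono[OF vdm_midpoint p]) (auto intro!: mult_nonneg_nonneg vdm_nonneg prod_nonneg w0)
   also have "... = (E * gasw N b w ?m)\<^sup>2" by (simp add: gasw_def power_mult_distrib)
   finally have "exp (s * X x) * gasw N b w x * (exp (- s * X y) * gasw N b w y) <= (E * gasw N b w ?m)\<^sup>2" .
   then have "ennreal (exp (s * X x) * gasw N b w x * (exp (- s * X y) * gasw N b w y)) <= ennreal ((E * gasw N b w ?m)\<^sup>2)"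
    by (rule ennreal_leI)
   moreover have g0: "0 <= gasw N b w z" for z by (rule gasw_nonneg) (rule w0)
   have "ennreal ((E * gasw N b w ?m)\<^sup>2) = (ennreal E * (ennreal 1 * ennreal (gasw N b w ?m) * indicator (chamber N) ?m))\<^sup>2"
    using m g0[of ?m] by (simp add: ennreal_mult'[symmetric] ennreal_power[symmetric] E_def)
   moreover have "ennreal (exp (s * X x) * gasw N b w x * (exp (- s * X y) * gasw N b w y)) = ennreal (exp (s * X x)) * ennreal (gasw N b w x) * (ennreal (exp (- s * X y)) * ennreal (gasw N b w y))"
    using g0[of x] g0[of y] by (simp add: ennreal_mult)
   ultimately show ?thesis using True by simp
  qed auto
 qed (intro meas, measurable)+
 also have "(\<integral>\<^sup>+x. ennreal E * (ennreal 1 * ennreal (gasw N b w x) * indicator (chamber N) x) \<partial>leb N) = ennreal E * ?I (%x. 1)"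
  by (rule nn_integral_cmult) (intro meas, measurable)
 finally have le: "?I (%x. exp (s * X x)) * ?I (%x. exp (- s * X x)) <= (ennreal E * ?I (%x. 1))\<^sup>2" .
 have scale: "(k * u) * (k * v) <= e\<^sup>2 * (k * z)\<^sup>2" if "u * v <= (e * z)\<^sup>2" for k u v e z :: ennreal
 proof -
  have "(k * u) * (k * v) = k\<^sup>2 * (u * v)" by (simp only: power2_eq_square mult_ac)
  also have "... <= k\<^sup>2 * (e * z)\<^sup>2" using that by (rule mult_left_mono) simp
  also have "... = e\<^sup>2 * (k * z)\<^sup>2" by (simp only: power_mult_distrib mult_ac)
  finally show ?thesis .
 qed
 have EE: "(ennreal E)\<^sup>2 = ennreal (exp (real N * s\<^sup>2 * K\<^sup>2 / c))"
  unfolding E2[symmetric] by (simp add: ennreal_power E_def)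
 have ch: "(\<integral>\<^sup>+x. ennreal (exp (r * X x)) * ennreal (gasw N b w x) \<partial>leb N) = fact N * ?I (%x. exp (r * X x))" for r
  by (rule nn_integral_gasw_chamber) (auto simp: Xsym)
 have ch1: "(\<integral>\<^sup>+x. ennreal (gasw N b w x) \<partial>leb N) = fact N * ?I (%x. 1)"
  using nn_integral_gasw_chamber[of "%x. ennreal 1" N w b] by simp
 show ?thesis
  unfolding X_def[symmetric] ch ch1 EE[symmetric] by (rule scale[OF le])
qed

section \<open>The gas next to a hard wall\<close>

lemma power_le_fact_mult_exp:
 fixes x :: real
 assumes "x >= 0"
 shows "x ^ m <= fact m * exp x"
proof -
 have "(%n. x ^ n / fact n) sums exp x" using exp_converges[of x] by (simp add: scaleR_conv_of_real field_simps)
 then have "(\<Sum>n\<in>{m}. x ^ n / fact n) <= exp x"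
  using sum_le_suminf[of "%n. x ^ n / fact n" "{m}"] assms by (simp add: sums_iff)
 then show ?thesis by (simp add: field_simps)
qed

lemma integrable_exp_minus_abs:
 assumes "c > 0"
 shows "integrable lborel (%x::real. exp (- (c * \<bar>x\<bar>)))"
proof -
 have 1: "integrable lborel (%x. indicator {0<..} x *\<^sub>R exp (- (x * c)))"
  using integrable_I0i_exp_mscale[OF assms] unfolding set_integrable_def .
 have 2: "integrable lborel (%x. indicator {0<..} (0 + -1 * x) *\<^sub>R exp (- ((0 + -1 * x) * c)))"
  using 1 by (subst lborel_integrable_real_affine_iff) auto
 have "integrable lborel (%x. indicator {0<..} x *\<^sub>R exp (- (x * c)) + indicator {0<..} (0 + -1 * x) *\<^sub>R exp (- ((0 + -1 * x) * c)))"
  using 1 2 by (rule Bochner_Integration.integrable_add)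
 then show ?thesis
 proof (rule integrable_cong_AE_imp)
  show "AE x in lborel. indicator {0<..} x *\<^sub>R exp (- (x * c)) + indicator {0<..} (0 + -1 * x) *\<^sub>R exp (- ((0 + -1 * x) * c)) = exp (- (c * \<bar>x\<bar>))"
   using AE_lborel_singleton[of 0] by eventually_elim (auto simp: indicator_def mult.commute)
 qed measurable
qed

lemma all_moments_exp_bound:
 assumes [measurable]: "w \<in> borel_measurable borel" and w0: "!!x. 0 <= w x"
  and le: "!!x. w x <= C * exp (- (c * \<bar>x\<bar>))" and c: "c > 0"
 shows "all_moments w"
 unfolding all_moments_def
proof (intro conjI allI w0)
 fix m :: nat
 have C: "C >= 0" using w0[of 0] le[of 0] by simp
 show "integrable lborel (%x. (1 + \<bar>x\<bar>) ^ m * w x)"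
 proof (rule Bochner_Integration.integrable_bound)
  show "integrable lborel (%x. fact m * (2 / c) ^ m * exp (c / 2) * C * exp (- (c / 2 * \<bar>x\<bar>)))"
   using c by (intro integrable_mult_right integrable_exp_minus_abs) auto
  show "AE x in lborel. norm ((1 + \<bar>x\<bar>) ^ m * w x) <= norm (fact m * (2 / c) ^ m * exp (c / 2) * C * exp (- (c / 2 * \<bar>x\<bar>)))"
  proof (rule AE_I2)
   fix x :: real
   have "(c / 2 * (1 + \<bar>x\<bar>)) ^ m <= fact m * exp (c / 2 * (1 + \<bar>x\<bar>))" using c by (intro power_le_fact_mult_exp) auto
   then have "(2 / c) ^ m * (c / 2 * (1 + \<bar>x\<bar>)) ^ m <= (2 / c) ^ m * (fact m * exp (c / 2 * (1 + \<bar>x\<bar>)))" using c by (intro mult_left_mono) auto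
   also have "(2 / c) ^ m * (c / 2 * (1 + \<bar>x\<bar>)) ^ m = (1 + \<bar>x\<bar>) ^ m"
   proof -
    have "2 / c * (c / 2 * (1 + \<bar>x\<bar>)) = 1 + \<bar>x\<bar>" using c by simp
    then show ?thesis by (simp only: power_mult_distrib[symmetric])
   qed
   finally have p: "(1 + \<bar>x\<bar>) ^ m <= (2 / c) ^ m * (fact m * exp (c / 2 * (1 + \<bar>x\<bar>)))" .
   have "(1 + \<bar>x\<bar>) ^ m * w x <= (2 / c) ^ m * (fact m * exp (c / 2 * (1 + \<bar>x\<bar>))) * (C * exp (- (c * \<bar>x\<bar>)))"
    using p le[of x] w0[of x] c by (intro mult_mono) auto
   also have "... = fact m * (2 / c) ^ m * C * (exp (c / 2 * (1 + \<bar>x\<bar>)) * exp (- (c * \<bar>x\<bar>)))" by (simp only: mult_ac)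
   also have "exp (c / 2 * (1 + \<bar>x\<bar>)) * exp (- (c * \<bar>x\<bar>)) = exp (c / 2) * exp (- (c / 2 * \<bar>x\<bar>))"
    unfolding mult_exp_exp by (simp add: field_simps)
   finally show "norm ((1 + \<bar>x\<bar>) ^ m * w x) <= norm (fact m * (2 / c) ^ m * exp (c / 2) * C * exp (- (c / 2 * \<bar>x\<bar>)))"
    using w0[of x] c C by (simp add: abs_mult mult_ac)
  qed
 qed measurable
qed measurable

lemma sum_pairs_symmetric:
 fixes f :: "nat => nat => real"
 assumes sym: "!!i j. i < N ==> j < N ==> f i j = f j i"
 shows "2 * (\<Sum>(i, j)\<in>{(i, j). i < j \<and> j < N}. f i j) = (\<Sum>i<N. \<Sum>j<N. f i j) - (\<Sum>i<N. f i i)"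
 using sym
proof (induction N)
 case (Suc N)
 have split: "{(i, j). i < j \<and> j < Suc N} = {(i, j). i < j \<and> j < N} \<union> (%i. (i, N)) ` {..<N}"
  by (auto simp: less_Suc_eq)
 have "(\<Sum>(i, j)\<in>{(i, j). i < j \<and> j < Suc N}. f i j) = (\<Sum>(i, j)\<in>{(i, j). i < j \<and> j < N}. f i j) + (\<Sum>(i, j)\<in>(%i. (i, N)) ` {..<N}. f i j)"
  unfolding split by (intro sum.union_disjoint) auto
 also have "(\<Sum>(i, j)\<in>(%i. (i, N)) ` {..<N}. f i j) = (\<Sum>i<N. f i N)"
  by (subst sum.reindex) (auto simp: inj_on_def)
 finally have "2 * (\<Sum>(i, j)\<in>{(i, j). i < j \<and> j < Suc N}. f i j) = (\<Sum>i<N. \<Sum>j<N. f i j) - (\<Sum>i<N. f i i) + 2 * (\<Sum>i<N. f i N)"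
  using Suc by simp
 also have "(\<Sum>i<N. f i N) = (\<Sum>i<N. f N i)" using Suc.prems by (intro sum.cong) auto
 then have "(\<Sum>i<N. \<Sum>j<N. f i j) - (\<Sum>i<N. f i i) + 2 * (\<Sum>i<N. f i N) = (\<Sum>i<Suc N. \<Sum>j<Suc N. f i j) - (\<Sum>i<Suc N. f i i)"
  by (simp add: sum.distrib)
 finally show ?case .
qed simp

text \<open>The potential in the variable \<open>y = (a - x) / \<gamma>\<close>, with \<open>th = \<gamma>\<^sup>2 / t\<close>.\<close>

definition gpot :: "real => real => real" where
 "gpot th y = (1 - 3 * th) * y + th * y\<^sup>2 / 2"

definition gwt :: "nat => real => real => real => real" where
 "gwt N b th y = (if y > 0 then exp (- (real N * b * gpot th y)) else 0)"

definition gZ :: "nat => real => real => real" where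
 "gZ N b th = (\<integral>x. gasw N b (gwt N b th) x \<partial>leb N)"

definition gP :: "nat => real => real => (nat => real) measure" where
 "gP N b th = density (leb N) (%x. ennreal (gasw N b (gwt N b th) x / gZ N b th))"

text \<open>The resolvent kernel 1 / (z - y) at the point z = -1/u behind the wall is -u times this
  function. On the half line it lies in (0, 1], and its powers stand for derivatives of the
  resolvent.\<close>

definition tt :: "real => real => real" where
 "tt u y = 1 / (1 + u * y)"

definition psum :: "nat => real => nat => (nat => real) => real" where
 "psum N u j x = (\<Sum>i<N. tt u (x i) ^ j)"

text \<open>Mixed powers of total degree j + 1 with both exponents positive. Differences of
  consecutive sums are the divided differences of y tt^(j+1), and summed over all pairs of particles
  they factor into products of power sums.\<close>

fun tE :: "real => nat => real => real => real" where
 "tE u j y z = (\<Sum>a<j. tt u y ^ Suc a * tt u z ^ (j - a))"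

text \<open>The slope 1/4 is arbitrary: for th > 0 the quadratic term beats any linear one, even
  where 1 - 3 th is negative, and for th = 0 the slope is 1.\<close>

lemma gpot_lower:
 assumes "0 <= th"
 obtains C where "!!y. y >= 0 ==> gpot th y >= y / 4 - C"
proof (cases "th = 0")
 case True
 show ?thesis by (rule that[of 0]) (auto simp: gpot_def True)
next
 case False
 with assms have th: "th > 0" by simp
 show ?thesis
 proof (rule that[of "(3/4 - 3 * th)\<^sup>2 / (2 * th)"])
  fix y :: real
  have "0 <= (th * y + (3/4 - 3 * th))\<^sup>2 / (2 * th)" using th by simp
  also have "... = th * y\<^sup>2 / 2 + (3/4 - 3 * th) * y + (3/4 - 3 * th)\<^sup>2 / (2 * th)"
   using th by (simp add: power2_eq_square field_simps)
  also have "(3/4 - 3 * th) * y = (1 - 3 * th) * y - y / 4" by (simp add: algebra_simps)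
  finally show "y / 4 - (3/4 - 3 * th)\<^sup>2 / (2 * th) <= gpot th y" by (simp add: gpot_def)
 qed
qed

lemma tt_bounds:
 assumes "u >= 0" "y > 0"
 shows "0 < tt u y" "tt u y <= 1"
proof -
 have "1 <= 1 + u * y" using assms by simp
 then show "0 < tt u y" "tt u y <= 1" by (auto simp: tt_def)
qed

lemma tt_measurable [measurable]: "tt u \<in> borel_measurable borel"
 unfolding tt_def[abs_def] by measurable

lemma psum_measurable [measurable]: "psum N u j \<in> borel_measurable (leb N)"
 unfolding psum_def[abs_def] by (intro borel_measurable_sum leb_component_measurable) auto

lemma tt_diff:
 assumes "u >= 0" "y >= 0" "z >= 0"
 shows "tt u y - tt u z = - (u * (y - z) * (tt u y * tt u z))"
proof -
 have "1 + u * y ~= 0" "1 + u * z ~= 0" using assms by (auto simp: add_nonneg_eq_0_iff)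
 then show ?thesis unfolding tt_def by (simp add: divide_simps) (simp add: algebra_simps)
qed

lemma ttE_Suc: "tE u (Suc j) y z = tt u y * tE u j y z + tt u y * tt u z ^ Suc j"
proof -
 have "tE u (Suc j) y z = tt u y * tt u z ^ Suc j + (\<Sum>a<j. tt u y ^ Suc (Suc a) * tt u z ^ (j - a))"
  by (simp add: sum.lessThan_Suc_shift del: sum.lessThan_Suc)
 also have "(\<Sum>a<j. tt u y ^ Suc (Suc a) * tt u z ^ (j - a)) = tt u y * tE u j y z"
  by (simp add: sum_distrib_left mult_ac)
 finally show ?thesis by simp
qed

declare tE.simps [simp del]

lemma tE_0 [simp]: "tE u 0 y z = 0" by (simp add: tE.simps)

text \<open>Induction on \<open>j\<close>; the relation u z tt = 1 - tt trades a factor of the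
  variable for a lower power, which is why two consecutive \<open>tE\<close> appear.\<close>

lemma power_tt_diff:
 assumes "u >= 0" "y >= 0" "z >= 0"
 shows "y * tt u y ^ Suc j - z * tt u z ^ Suc j = (y - z) * (tE u (Suc j) y z - tE u j y z)"
proof (induction j)
 case 0
 have "1 + u * y ~= 0" "1 + u * z ~= 0" using assms by (auto simp: add_nonneg_eq_0_iff)
 then show ?case by (simp add: ttE_Suc tt_def divide_simps) (simp add: algebra_simps)
next
 case (Suc j)
 have nz: "1 + u * z ~= 0" using assms by (auto simp: add_nonneg_eq_0_iff)
 then have uz: "u * z * tt u z = 1 - tt u z" unfolding tt_def by (simp add: divide_simps)
 have "y * tt u y ^ Suc (Suc j) - z * tt u z ^ Suc (Suc j) = tt u y * (y * tt u y ^ Suc j - z * tt u z ^ Suc j) + z * tt u z ^ Suc j * (tt u y - tt u z)"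
  by (simp add: algebra_simps)
 also have "... = (y - z) * (tt u y * (tE u (Suc j) y z - tE u j y z) - (u * z * tt u z) * tt u z ^ Suc j * tt u y)"
  unfolding Suc.IH tt_diff[OF assms] by (simp add: algebra_simps)
 also have "... = (y - z) * (tt u y * (tE u (Suc j) y z - tE u j y z) - (1 - tt u z) * tt u z ^ Suc j * tt u y)"
  unfolding uz ..
 also have "tt u y * (tE u (Suc j) y z - tE u j y z) - (1 - tt u z) * tt u z ^ Suc j * tt u y = tE u (Suc (Suc j)) y z - tE u (Suc j) y z"
  by (simp add: ttE_Suc algebra_simps)
 finally show ?case .
qed

lemma tE_sym: "tE u j y z = tE u j z y"
proof -
 have "tE u j y z = (\<Sum>a<j. tt u y ^ Suc (j - Suc a) * tt u z ^ (j - (j - Suc a)))"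
  unfolding tE.simps by (rule sum.nat_diff_reindex[symmetric])
 also have "... = tE u j z y"
  unfolding tE.simps by (rule sum.cong) (auto simp: Suc_diff_Suc mult.commute)
 finally show ?thesis .
qed

lemma tE_bounds:
 assumes "u >= 0" "y > 0" "z > 0"
 shows "0 <= tE u j y z" "tE u j y z <= real j"
proof -
 show "0 <= tE u j y z" unfolding tE.simps using tt_bounds(1)[OF assms(1,2)] tt_bounds(1)[OF assms(1,3)]
  by (intro sum_nonneg mult_nonneg_nonneg zero_le_power) auto
 have "tE u j y z <= (\<Sum>a<j. 1)" unfolding tE.simps
  using tt_bounds[OF assms(1,2)] tt_bounds[OF assms(1,3)]
  by (intro sum_mono mult_le_one power_le_one zero_le_power) auto
 then show "tE u j y z <= real j" by simp
qed

lemma tE_diag: "tE u j y y = real j * tt u y ^ Suc j"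
proof -
 have "tE u j y y = (\<Sum>a<j. tt u y ^ Suc j)"
  unfolding tE.simps by (rule sum.cong) (auto simp: power_add[symmetric] simp del: power_Suc)
 then show ?thesis by simp
qed

lemma tt_has_derivative:
 assumes "u >= 0" "y >= 0"
 shows "(tt u has_real_derivative - u * (tt u y)\<^sup>2) (at y)"
proof -
 have "1 + u * y > 0" using assms by (simp add: add_pos_nonneg)
 then show ?thesis unfolding tt_def[abs_def]
  by (auto intro!: derivative_eq_intros simp: power2_eq_square)
qed

lemma power_tt_has_derivative:
 assumes "u >= 0" "y >= 0"
 shows "((%y. y * tt u y ^ Suc j) has_real_derivative (real (Suc j) * tt u y ^ Suc (Suc j) - real j * tt u y ^ Suc j)) (at y)"
proof -
 have nz: "1 + u * y ~= 0" using assms by (auto simp: add_nonneg_eq_0_iff)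
 then have uy: "u * y * tt u y = 1 - tt u y" unfolding tt_def by (simp add: divide_simps)
 have "((%y. y * tt u y ^ Suc j) has_real_derivative (1 * tt u y ^ Suc j + (real (Suc j) * (- u * (tt u y)\<^sup>2) * tt u y ^ j) * y)) (at y)"
  by (rule derivative_eq_intros tt_has_derivative[OF assms] refl | simp)+
 also have "1 * tt u y ^ Suc j + (real (Suc j) * (- u * (tt u y)\<^sup>2) * tt u y ^ j) * y = tt u y ^ Suc j - real (Suc j) * (u * y * tt u y) * tt u y ^ Suc j"
  by (simp add: power2_eq_square algebra_simps)
 also have "... = real (Suc j) * tt u y ^ Suc (Suc j) - real j * tt u y ^ Suc j"
  unfolding uy by (simp add: algebra_simps)
 finally show ?thesis .
qed

lemma all_moments_gwt:
 assumes "N > 0" "b > 0" "0 <= th"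
 shows "all_moments (gwt N b th)"
proof -
 obtain C where C: "!!y. y >= 0 ==> gpot th y >= y / 4 - C" using gpot_lower[OF assms(3)] by blast
 show ?thesis
 proof (rule all_moments_exp_bound)
  show "gwt N b th \<in> borel_measurable borel" unfolding gwt_def[abs_def] gpot_def by measurable
  show "0 <= gwt N b th x" for x by (simp add: gwt_def)
  show "real N * b / 4 > 0" using assms by simp
  show "gwt N b th x <= exp (real N * b * C) * exp (- (real N * b / 4 * \<bar>x\<bar>))" for x
  proof (cases "x > 0")
   case True
   have "real N * b * (x / 4 - C) <= real N * b * gpot th x" using assms True C[of x] by (intro mult_left_mono) auto
   then have "- (real N * b * gpot th x) <= real N * b * C + - (real N * b / 4 * \<bar>x\<bar>)" using True by (simp add: algebra_simps)
   then show ?thesis using True by (simp add: gwt_def mult_exp_exp)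
  qed (simp add: gwt_def)
 qed
qed

text \<open>The value th = 0 is included as the exactly solvable end point; bounds that rest on
  strict convexity assume th > 0 separately, as \<open>th0\<close>.\<close>

locale wall_gas =
 fixes N :: nat and b th :: real
 assumes N: "N > 0" and b: "b > 0" and th: "0 <= th" "th < 1"
begin

abbreviation "W \<equiv> gasw N b (gwt N b th)"

lemma wm: "all_moments (gwt N b th)" by (rule all_moments_gwt[OF N b th(1)])

lemma gwt_nonneg: "0 <= gwt N b th y" by (simp add: gwt_def)

lemma W_nonneg: "0 <= W x" by (rule gasw_nonneg) (rule gwt_nonneg)

lemma gwt_measurable [measurable]: "gwt N b th \<in> borel_measurable borel"
 using wm by (simp add: all_moments_def)

lemma W_pos_imp: "W x ~= 0 ==> i < N ==> x i > 0"
proof (rule ccontr)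
 assume *: "W x ~= 0" "i < N" "\<not> x i > 0"
 then have "(\<Prod>i<N. gwt N b th (x i)) = 0" by (intro prod_zero) (auto simp: gwt_def intro!: bexI[of _ i])
 with * show False by (simp add: gasw_def)
qed

lemma Z_pos: "gZ N b th > 0"
 unfolding gZ_def using b by (intro integral_gasw_pos wm) (auto simp: gwt_def)

lemma W_integrable: "integrable (leb N) W"
 using integrable_spread_gasw[of b "gwt N b th" N 0] wm b by simp

lemma sets_gP [simp, measurable_cong]: "sets (gP N b th) = sets (leb N)" by (simp add: gP_def)
lemma space_gP [simp]: "space (gP N b th) = space (leb N)" by (simp add: gP_def)

lemma prob: "prob_space (gP N b th)"
proof
 have "emeasure (gP N b th) (space (gP N b th)) = (\<integral>\<^sup>+x. ennreal (W x / gZ N b th) \<partial>leb N)"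
  unfolding space_gP by (simp add: gP_def emeasure_density cong: nn_integral_cong)
 also have "... = ennreal (\<integral>x. W x / gZ N b th \<partial>leb N)"
  using W_integrable W_nonneg Z_pos by (intro nn_integral_eq_integral) auto
 also have "(\<integral>x. W x / gZ N b th \<partial>leb N) = 1" using Z_pos by (simp add: gZ_def)
 finally show "emeasure (gP N b th) (space (gP N b th)) = 1" by simp
qed

sublocale prob_space "gP N b th" by (rule prob)

lemma AE_pos: "AE x in gP N b th. \<forall>i<N. x i > 0"
proof -
 have "AE x in leb N. ennreal (W x / gZ N b th) > 0 --> (\<forall>i<N. x i > 0)"
  by (rule AE_I2) (use W_pos_imp in \<open>force simp: ennreal_zero_less_divide\<close>)
 then show ?thesis unfolding gP_def by (subst AE_density) auto
qed

lemma integrable_gP: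
 fixes F :: "(nat => real) => real"
 assumes [measurable]: "F \<in> borel_measurable (leb N)" and le: "!!x. (\<forall>i<N. x i > 0) ==> \<bar>F x\<bar> <= C * spread N x ^ k"
 shows "integrable (gP N b th) F"
proof -
 have "integrable (leb N) (%x. F x * W x)"
  by (rule integrable_gasw_bounded[OF _ wm, where C = C and k = k]) (use b le W_pos_imp in auto)
 then have "integrable (leb N) (%x. F x * W x / gZ N b th)" by simp
 then show ?thesis unfolding gP_def
  by (subst integrable_real_density) (use W_nonneg Z_pos in \<open>auto simp: mult_ac\<close>)
qed

lemma expectation_gP:
 fixes F :: "(nat => real) => real"
 assumes [measurable]: "F \<in> borel_measurable (leb N)"
 shows "expectation F = (\<integral>x. F x * W x \<partial>leb N) / gZ N b th"
proof -
 have "expectation F = (\<integral>x. W x / gZ N b th * F x \<partial>leb N)"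
  unfolding gP_def by (subst integral_real_density) (use W_nonneg Z_pos in auto)
 also have "... = (\<integral>x. (F x * W x) / gZ N b th \<partial>leb N)" by (simp add: mult_ac)
 finally show ?thesis by simp
qed

lemma integrable_bounded_gP:
 fixes F :: "(nat => real) => real"
 assumes [measurable]: "F \<in> borel_measurable (leb N)" and le: "!!x. (\<forall>i<N. x i > 0) ==> \<bar>F x\<bar> <= C"
 shows "integrable (gP N b th) F"
 using integrable_gP[of F C 0] le by simp

lemma expectation_cong_pos:
 fixes F G :: "(nat => real) => real"
 assumes "F \<in> borel_measurable (leb N)" "G \<in> borel_measurable (leb N)" "!!x. (\<forall>i<N. x i > 0) ==> F x = G x"
 shows "expectation F = expectation G"
 using AE_pos by (intro integral_cong_AE) (use assms in \<open>auto elim!: eventually_mono cong: measurable_cong_sets\<close>)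

lemma expectation_mono_pos:
 fixes F G :: "(nat => real) => real"
 assumes "integrable (gP N b th) F" "integrable (gP N b th) G" "!!x. (\<forall>i<N. x i > 0) ==> F x <= G x"
 shows "expectation F <= expectation G"
 using AE_pos by (intro integral_mono_AE assms) (use assms in \<open>auto elim!: eventually_mono\<close>)

text \<open>The integrand of the loop equation for the vector field \<open>y / (1 + u y)\<^sup>j\<^sup>+\<^sup>1\<close>.\<close>

definition Lam :: "real => nat => (nat => real) => real" where
 "Lam u j x = (1 - b) * (real (Suc j) * psum N u (Suc (Suc j)) x - real j * psum N u (Suc j) x)
  + b * ((\<Sum>a<Suc j. psum N u (Suc a) x * psum N u (Suc j - a) x) - (\<Sum>a<j. psum N u (Suc a) x * psum N u (j - a) x))
  - real N * b * (\<Sum>i<N. ((1 - 3 * th) + th * x i) * (x i * tt u (x i) ^ Suc j))"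

lemma Lam_measurable [measurable]: "Lam u j \<in> borel_measurable (leb N)"
proof -
 have "(%x. \<Sum>i<N. ((1 - 3 * th) + th * x i) * (x i * tt u (x i) ^ Suc j)) \<in> borel_measurable (leb N)"
  by (intro borel_measurable_sum leb_component_measurable[of "%y. ((1 - 3 * th) + th * y) * (y * tt u y ^ Suc j)"]) auto
 then show ?thesis unfolding Lam_def[abs_def] by measurable
qed

text \<open>Instance of \<open>gas_loop_equation\<close> rewritten in power sums. The double sum
  over all ordered pairs is a sum of products of power sums, and its diagonal consists of the
  derivatives of the vector field; adding and subtracting the diagonal produces the coefficient 1 -
  b.\<close>

lemma loop_equation:
 assumes u: "u >= 0"
  and [measurable]: "k \<in> borel_measurable (leb N)" "kap \<in> borel_measurable (leb N)"
  and k_bd: "!!x. (!!i. i < N ==> x i > 0) ==> 0 <= k x \<and> k x <= K"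
  and kap_bd: "!!x. (!!i. i < N ==> x i > 0) ==> \<bar>kap x\<bar> <= K"
  and k_lip: "!!x e. (!!i. i < N ==> x i > 0) ==> \<bar>e\<bar> <= 1/2 ==> \<bar>k (\<lambda>i\<in>{..<N}. x i + e * (x i * tt u (x i) ^ Suc j)) - k x\<bar> <= K * \<bar>e\<bar>"
  and k_der: "!!x e. (!!i. i < N ==> x i > 0) ==> \<bar>e\<bar> <= 1/2 ==> k (\<lambda>i\<in>{..<N}. x i + e * (x i * tt u (x i) ^ Suc j)) - k x >= e * kap x - K * e\<^sup>2"
 shows "expectation (%x. k x * Lam u j x + kap x) = 0"
proof -
 define phi where "phi y = y * tt u y ^ Suc j" for y
 define dphi where "dphi y = real (Suc j) * tt u y ^ Suc (Suc j) - real j * tt u y ^ Suc j" for y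
 define D where "D y z = tE u (Suc j) y z - tE u j y z" for y z
 define lam where "lam y = - (real N * b * (((1 - 3 * th) + th * y) * phi y))" for y
 define C where "C = 2 * real j + 2 + real N * b * (\<bar>1 - 3 * th\<bar> + th)"
 have C1: "C >= 2 * real j + 2" "C >= real N * b * (\<bar>1 - 3 * th\<bar> + th)" "C > 0"
 proof -
  have "0 <= real N * b * (\<bar>1 - 3 * th\<bar> + th)" using b th by simp
  then show "C >= 2 * real j + 2" "C >= real N * b * (\<bar>1 - 3 * th\<bar> + th)" "C > 0" unfolding C_def by (linarith, linarith, linarith)
 qed
 have phi_bd: "0 <= phi y" "phi y <= y" if "y > 0" for y
  using tt_bounds[OF u that] that unfolding phi_def
  by (auto intro!: mult_nonneg_nonneg mult_right_le_one_le power_le_one simp del: power_Suc)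
 have dphi_bd: "\<bar>dphi y\<bar> <= C" if "y >= 0" for y
 proof -
  have t: "0 <= tt u y" "tt u y <= 1" using u that by (auto simp: tt_def divide_simps add_nonneg_eq_0_iff intro: add_nonneg_nonneg) (smt (verit) mult_nonneg_nonneg)+
  have "0 <= tt u y ^ n" "tt u y ^ n <= 1" for n using t by (auto intro: power_le_one)
  then have "0 <= real (Suc j) * tt u y ^ Suc (Suc j)" "real (Suc j) * tt u y ^ Suc (Suc j) <= real (Suc j) * 1"
   "0 <= real j * tt u y ^ Suc j" "real j * tt u y ^ Suc j <= real j * 1"
   by (intro mult_nonneg_nonneg mult_left_mono; simp del: power_Suc)+
  moreover have "\<bar>A - B\<bar> <= C" if "0 <= A" "A <= real (Suc j) * 1" "0 <= B" "B <= real j * 1" for A B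
   using that C1(1) by simp
  ultimately show ?thesis unfolding dphi_def by blast
 qed
 have mD: "(%p. D (fst p) (snd p)) \<in> borel_measurable (borel \<Otimes>\<^sub>M borel)"
  unfolding D_def tE.simps by measurable
 have "(\<integral>x. (k x * ((\<Sum>i<N. dphi (x i)) + 2 * b * (\<Sum>(i, j)\<in>{(i, j). i < j \<and> j < N}. D (x i) (x j)) + (\<Sum>i<N. lam (x i))) + kap x) * W x \<partial>leb N) = 0"
 \<comment> \<open>The growth exponent 2 covers \<open>lam\<close>, the linear derivative of
   \<open>gpot\<close> times a vector field of at most linear growth. The potential being quadratic,
   its second-order expansion in \<open>e\<close> is exact.\<close>
 proof (rule gas_loop_equation[where L = "%y. - (real N * b * gpot th y)" and phi = phi and C = C and ?e0.0 = "1/2" and m = 2 and K = K])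
  show "0 <= b" using b by simp
  show "all_moments (gwt N b th)" by (rule wm)
  show "phi \<in> borel_measurable borel" unfolding phi_def[abs_def] by measurable
  then show "lam \<in> borel_measurable borel" unfolding lam_def[abs_def] by measurable
  show "dphi \<in> borel_measurable borel" unfolding dphi_def[abs_def] by measurable
  show "(phi has_real_derivative dphi y) (at y)" if "0 <= y" for y
   unfolding phi_def[abs_def] dphi_def by (rule power_tt_has_derivative[OF u that])
  have "continuous_on {0..} (tt u)"
   using tt_has_derivative[OF u] by (intro continuous_at_imp_continuous_on) (auto intro: DERIV_isCont)
  then show "continuous_on {0..} dphi" unfolding dphi_def[abs_def] by (intro continuous_intros)
  show "phi 0 = 0" by (simp add: phi_def)
  show "\<bar>dphi y\<bar> <= C" if "0 <= y" for y by (rule dphi_bd[OF that])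
  show "\<bar>phi y\<bar> <= C * y" if "0 <= y" for y
  proof (cases "y = 0")
   case False
   then have "\<bar>phi y\<bar> <= 1 * y" using phi_bd[of y] that by auto
   also have "... <= C * y" using C1(1) that by (intro mult_right_mono) auto
   finally show ?thesis .
  qed (simp add: phi_def)
  show "phi y - phi z = (y - z) * D y z" if "0 < y" "0 < z" for y z
   unfolding phi_def D_def using power_tt_diff[OF u, of y z j] that by simp
  show "\<bar>D y z\<bar> <= C" if "0 < y" "0 < z" for y z
   using tE_bounds[OF u that, of "Suc j"] tE_bounds[OF u that, of j] C1(1) unfolding D_def by linarith
  show "e * lam y - e\<^sup>2 * (C * (1 + y) ^ 2) <= - (real N * b * gpot th (y + e * phi y)) - - (real N * b * gpot th y)" if "0 < y" for y e
  proof -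
   have "th * (phi y)\<^sup>2 / 2 <= (\<bar>1 - 3 * th\<bar> + th) * (1 + y)\<^sup>2"
   proof -
    have "(phi y)\<^sup>2 <= (1 + y)\<^sup>2" using phi_bd[OF that] by (intro power_mono) auto
    then have "th * (phi y)\<^sup>2 <= th * (1 + y)\<^sup>2" using th by (intro mult_left_mono) auto
    also have "... <= (\<bar>1 - 3 * th\<bar> + th) * (1 + y)\<^sup>2" by (intro mult_right_mono) auto
    moreover have "0 <= th * (phi y)\<^sup>2" using th by simp
    ultimately show ?thesis by linarith
   qed
   then have "real N * b * (th * (phi y)\<^sup>2 / 2) <= real N * b * ((\<bar>1 - 3 * th\<bar> + th) * (1 + y)\<^sup>2)" using b by (intro mult_left_mono) auto
   also have "... <= C * (1 + y)\<^sup>2" unfolding mult.assoc[symmetric] using C1(2) by (intro mult_right_mono) (auto simp: mult.assoc)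
   finally have "e\<^sup>2 * (real N * b * (th * (phi y)\<^sup>2 / 2)) <= e\<^sup>2 * (C * (1 + y)\<^sup>2)" by (rule mult_left_mono) simp
   moreover have "- (real N * b * gpot th (y + e * phi y)) - - (real N * b * gpot th y) = e * lam y - e\<^sup>2 * (real N * b * (th * (phi y)\<^sup>2 / 2))"
    unfolding gpot_def lam_def by (simp add: power2_eq_square algebra_simps add_divide_distrib)
   ultimately show ?thesis by linarith
  qed
  show "\<bar>lam y\<bar> <= C * (1 + y) ^ 2" if "0 < y" for y
  proof -
   have "\<bar>(1 - 3 * th) + th * y\<bar> <= (\<bar>1 - 3 * th\<bar> + th) * (1 + y)"
   proof -
    have "\<bar>(1 - 3 * th) + th * y\<bar> <= \<bar>1 - 3 * th\<bar> + th * y" using th that by (intro order_trans[OF abs_triangle_ineq]) (auto simp: abs_mult)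
    moreover have "0 <= \<bar>1 - 3 * th\<bar> * y" "0 <= th" using th that by auto
    ultimately show ?thesis by (simp add: algebra_simps)
   qed
   then have "\<bar>(1 - 3 * th) + th * y\<bar> * \<bar>phi y\<bar> <= ((\<bar>1 - 3 * th\<bar> + th) * (1 + y)) * (1 + y)"
    using phi_bd[OF that] that th by (intro mult_mono) auto
   then have "real N * b * (\<bar>(1 - 3 * th) + th * y\<bar> * \<bar>phi y\<bar>) <= real N * b * (((\<bar>1 - 3 * th\<bar> + th) * (1 + y)) * (1 + y))" using b by (intro mult_left_mono) auto
   also have "... = (real N * b * (\<bar>1 - 3 * th\<bar> + th)) * (1 + y)\<^sup>2" by (simp only: power2_eq_square mult_ac)
   also have "... <= C * (1 + y)\<^sup>2" using C1(2) by (intro mult_right_mono) auto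
   finally show ?thesis using b by (simp add: lam_def abs_mult)
  qed
  show "!!y. 0 < y ==> gwt N b th y = exp (- (real N * b * gpot th y))" "!!y. y <= 0 ==> gwt N b th y = 0" by (auto simp: gwt_def)
 qed (use k_bd kap_bd k_lip k_der mD C1 in \<open>auto simp: phi_def\<close>)
 also have "(%x. (k x * ((\<Sum>i<N. dphi (x i)) + 2 * b * (\<Sum>(i, j)\<in>{(i, j). i < j \<and> j < N}. D (x i) (x j)) + (\<Sum>i<N. lam (x i))) + kap x) * W x)
  = (%x. (k x * Lam u j x + kap x) * W x)"
 proof
  fix x
  define S where "S = (\<Sum>(i, j)\<in>{(i, j). i < j \<and> j < N}. D (x i) (x j))"
  define A where "A n = (\<Sum>a<n. psum N u (Suc a) x * psum N u (n - a) x)" for n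
  have h1: "2 * S = (\<Sum>i<N. \<Sum>l<N. D (x i) (x l)) - (\<Sum>i<N. D (x i) (x i))"
   unfolding S_def by (rule sum_pairs_symmetric) (simp add: D_def tE_sym)
  have hA: "(\<Sum>i<N. \<Sum>l<N. tE u n (x i) (x l)) = A n" for n
  proof -
   have "(\<Sum>i<N. \<Sum>l<N. tE u n (x i) (x l)) = (\<Sum>i<N. \<Sum>a<n. \<Sum>l<N. tt u (x i) ^ Suc a * tt u (x l) ^ (n - a))"
    unfolding tE.simps by (intro sum.cong refl sum.swap)
   also have "... = (\<Sum>a<n. \<Sum>i<N. \<Sum>l<N. tt u (x i) ^ Suc a * tt u (x l) ^ (n - a))" by (rule sum.swap)
   also have "... = A n"
    unfolding psum_def A_def sum_product ..
   finally show ?thesis .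
  qed
  have h2: "(\<Sum>i<N. \<Sum>l<N. D (x i) (x l)) = A (Suc j) - A j" unfolding D_def sum_subtractf hA ..
  have h3: "(\<Sum>i<N. D (x i) (x i)) = (\<Sum>i<N. dphi (x i))" by (simp add: D_def dphi_def tE_diag)
  have h4: "(\<Sum>i<N. dphi (x i)) = real (Suc j) * psum N u (Suc (Suc j)) x - real j * psum N u (Suc j) x"
   unfolding dphi_def psum_def sum_subtractf sum_distrib_left ..
  have h5: "(\<Sum>i<N. lam (x i)) = - (real N * b * (\<Sum>i<N. ((1 - 3 * th) + th * x i) * (x i * tt u (x i) ^ Suc j)))"
   unfolding lam_def phi_def sum_negf sum_distrib_left ..
  have h6: "2 * b * S = b * (A (Suc j) - A j) - b * (\<Sum>i<N. dphi (x i))"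
   using h1 unfolding h2 h3 by (metis mult.assoc mult.commute right_diff_distrib)
  have "(\<Sum>i<N. dphi (x i)) + 2 * b * (\<Sum>(i, j)\<in>{(i, j). i < j \<and> j < N}. D (x i) (x j)) + (\<Sum>i<N. lam (x i)) = Lam u j x"
   unfolding S_def[symmetric] h6 h5 Lam_def A_def[symmetric] h4 by (simp only: left_diff_distrib mult_1_left)
  then show "(k x * ((\<Sum>i<N. dphi (x i)) + 2 * b * (\<Sum>(i, j)\<in>{(i, j). i < j \<and> j < N}. D (x i) (x j)) + (\<Sum>i<N. lam (x i))) + kap x) * W x = (k x * Lam u j x + kap x) * W x"
   by simp
 qed
 finally have "(\<integral>x. (k x * Lam u j x + kap x) * W x \<partial>leb N) = 0" .
 then show ?thesis by (subst expectation_gP) auto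
qed

end

section \<open>Variances and third cumulants\<close>

text \<open>The even Taylor terms up to degree 4; keeping the quartic one lets a single exponential
  moment bound both the second and the fourth moment.\<close>

lemma cosh_ge_quartic: "exp z + exp (- z) >= 2 + z\<^sup>2 + z ^ 4 / 12" for z :: real
proof -
 have s: "(%n. if even n then z ^ n /\<^sub>R fact n else 0) sums cosh z" by (rule cosh_converges)
 have "(\<Sum>n\<in>{0, 2, 4}. if even n then z ^ n /\<^sub>R fact n else 0) <= (\<Sum>n. if even n then z ^ n /\<^sub>R fact n else 0)"
  by (rule sum_le_suminf) (use s in \<open>auto simp: sums_iff zero_le_even_power\<close>)
 then have "(\<Sum>n\<in>{0, 2, 4}. if even n then z ^ n /\<^sub>R fact n else 0) <= cosh z" using s by (simp add: sums_iff)
 then show ?thesis by (simp add: cosh_def fact_numeral)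
qed

context prob_space
begin

text \<open>By Jensen both Laplace transforms of the centred variable are at least 1, so the bound
  on their product bounds each of them by exp(s^2 v). At s = 1 / sqrt v the two signs add up to at
  most 2 e <= 6; the constant term 2 of \<open>cosh_ge_quartic\<close> leaves 4 for the variance in
  units of v, and 12 times 4 = 48 for the fourth moment in units of v^2, weakened to 72.\<close>

lemma moments_of_laplace_bound:
 fixes X :: "'a => real"
 assumes [measurable]: "X \<in> borel_measurable M" and bd: "AE x in M. \<bar>X x\<bar> <= B" and v: "v > 0"
  and lap: "!!s. expectation (%x. exp (s * X x)) * expectation (%x. exp (- s * X x)) <= exp (s\<^sup>2 * v)"
 shows "expectation (%x. (X x - expectation X)\<^sup>2) <= 4 * v" "expectation (%x. (X x - expectation X) ^ 4) <= 72 * v\<^sup>2"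
proof -
 define m where "m = expectation X"
 define r where "r = sqrt v"
 have r: "r > 0" "r\<^sup>2 = v" using v by (auto simp: r_def)
 have intX: "integrable M X" by (rule integrable_const_bound[where B = B]) (use bd in auto)
 have int_exp: "integrable M (%x. exp (s * X x))" for s
 proof (rule integrable_const_bound[where B = "exp (\<bar>s\<bar> * B)"])
  show "AE x in M. norm (exp (s * X x)) <= exp (\<bar>s\<bar> * B)"
   using bd
  proof eventually_elim
   fix x assume "\<bar>X x\<bar> <= B"
   have "s * X x <= \<bar>s\<bar> * \<bar>X x\<bar>" by (metis abs_ge_self abs_mult)
   also have "... <= \<bar>s\<bar> * B" using \<open>\<bar>X x\<bar> <= B\<close> by (intro mult_left_mono) auto
   finally show "norm (exp (s * X x)) <= exp (\<bar>s\<bar> * B)" by simp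
  qed
 qed measurable
 have int_expm: "integrable M (%x. exp (s * (X x - m)))" for s
  using integrable_mult_right[OF int_exp[of s], of "exp (- s * m)"] by (simp add: mult_exp_exp algebra_simps)
 have E1: "expectation (%x. exp (s * (X x - m))) <= exp (s\<^sup>2 * v)" for s
 proof -
  have "1 = expectation (%x. 1 + - s * (X x - m))"
   using intX by (simp add: m_def prob_space right_diff_distrib)
  also have "... <= expectation (%x. exp (- s * (X x - m)))"
   by (intro integral_mono int_expm exp_ge_add_one_self) (use intX in auto)
  finally have j: "1 <= expectation (%x. exp (- s * (X x - m)))" .
  have ee: "expectation (%x. exp (s * (X x - m))) = exp (- s * m) * expectation (%x. exp (s * X x))" for s
  proof -
   have "expectation (%x. exp (s * (X x - m))) = expectation (%x. exp (- s * m) * exp (s * X x))"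
    by (simp add: mult_exp_exp algebra_simps)
   then show ?thesis by simp
  qed
  have "expectation (%x. exp (s * (X x - m))) * 1 <= expectation (%x. exp (s * (X x - m))) * expectation (%x. exp (- s * (X x - m)))"
   by (intro mult_left_mono j) simp
  also have "... = (exp (- s * m) * exp (- (- s) * m)) * (expectation (%x. exp (s * X x)) * expectation (%x. exp (- s * X x)))"
   unfolding ee[of s] ee[of "- s"] by (simp only: mult_ac)
  also have "exp (- s * m) * exp (- (- s) * m) = 1" by (simp add: mult_exp_exp)
  finally show ?thesis using lap[of s] by simp
 qed
 define Y where "Y x = (X x - m) / r" for x
 have [measurable]: "Y \<in> borel_measurable M" unfolding Y_def[abs_def] by measurable
 have intY: "integrable M (%x. exp (Y x))" "integrable M (%x. exp (- Y x))"
  using int_expm[of "1 / r"] int_expm[of "- 1 / r"] by (simp_all add: Y_def)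
 have "expectation (%x. exp (Y x)) <= exp 1" "expectation (%x. exp (- Y x)) <= exp 1"
  using E1[of "1 / r"] E1[of "- 1 / r"] r v by (simp_all add: Y_def power_divide)
 then have E: "expectation (%x. exp (Y x) + exp (- Y x)) <= 6"
  using intY exp_le by simp
 have bdY: "AE x in M. \<bar>Y x\<bar> <= (B + \<bar>m\<bar>) / r"
  using bd by eventually_elim (use r in \<open>auto simp: Y_def abs_divide intro!: divide_right_mono order_trans[OF abs_triangle_ineq4]\<close>)
 have intYn: "integrable M (%x. Y x ^ n)" for n
  by (rule integrable_const_bound[where B = "((B + \<bar>m\<bar>) / r) ^ n"])
    (use bdY in \<open>auto simp: power_abs intro!: power_mono elim!: eventually_mono\<close>)
 have "expectation (%x. 2 + (Y x)\<^sup>2 + Y x ^ 4 / 12) <= expectation (%x. exp (Y x) + exp (- Y x))"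
  using intY intYn by (intro integral_mono Bochner_Integration.integrable_add cosh_ge_quartic) auto
 then have le: "2 + expectation (%x. (Y x)\<^sup>2) + expectation (%x. Y x ^ 4) / 12 <= 6"
  using E intYn by (simp add: prob_space)
 have nn: "0 <= expectation (%x. (Y x)\<^sup>2)" "0 <= expectation (%x. Y x ^ 4)"
  by (auto intro!: Bochner_Integration.integral_nonneg zero_le_even_power)
 have "expectation (%x. (X x - m)\<^sup>2) = expectation (%x. v * (Y x)\<^sup>2)"
  using r v by (simp add: Y_def power_divide)
 also have "... <= 4 * v"
 proof -
  have "expectation (%x. (Y x)\<^sup>2) <= 4" using le nn by linarith
  then show ?thesis using v by simp
 qed
 finally show "expectation (%x. (X x - expectation X)\<^sup>2) <= 4 * v" unfolding m_def .
 have "r ^ 4 = v\<^sup>2" using r by (metis power_mult numeral_Bit0 mult_2 power_even_eq)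
 then have "expectation (%x. (X x - m) ^ 4) = expectation (%x. v\<^sup>2 * Y x ^ 4)"
  using r v by (simp add: Y_def power_divide)
 also have "... <= v\<^sup>2 * 48"
 proof -
  have "expectation (%x. Y x ^ 4) <= 48" using le nn by linarith
  then show ?thesis using v by simp
 qed
 also have "... <= 72 * v\<^sup>2" by simp
 finally show "expectation (%x. (X x - expectation X) ^ 4) <= 72 * v\<^sup>2" unfolding m_def .
qed

end

context wall_gas
begin

lemma prob_space_leb [simp]: "prob (space (leb N)) = 1"
 using prob_space by simp

lemma nn_integral_W:
 assumes [measurable]: "F \<in> borel_measurable (leb N)" and F: "!!x. (\<forall>i<N. x i > 0) ==> \<bar>F x\<bar> <= C" "!!x. 0 <= F x"
 shows "(\<integral>\<^sup>+x. ennreal (F x) * ennreal (W x) \<partial>leb N) = ennreal (gZ N b th * expectation F)"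
proof -
 have int: "integrable (leb N) (%x. F x * W x)"
  by (rule integrable_gasw_bounded[OF _ wm, where C = C and k = 0]) (use b F W_pos_imp in auto)
 have "(\<integral>\<^sup>+x. ennreal (F x) * ennreal (W x) \<partial>leb N) = (\<integral>\<^sup>+x. ennreal (F x * W x) \<partial>leb N)"
  using F W_nonneg by (simp add: ennreal_mult)
 also have "... = ennreal (\<integral>x. F x * W x \<partial>leb N)"
  using int F W_nonneg by (intro nn_integral_eq_integral) auto
 finally show ?thesis using Z_pos by (simp add: expectation_gP)
qed

text \<open>The one-particle potential \<open>N b gpot\<close> has convexity constant
  \<open>N b th\<close>, which cancels the N of \<open>gas_laplace_bound\<close>: the fluctuations
  of a sum of N terms stay bounded. For th = 0 the potential is linear and the argument gives
  nothing, whence \<open>th0\<close>.\<close>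

lemma linear_statistic_moments:
 fixes f :: "real => real"
 assumes th0: "th > 0" and [measurable]: "f \<in> borel_measurable borel"
  and lip: "!!y z. y > 0 ==> z > 0 ==> \<bar>f y - f z\<bar> <= K * \<bar>y - z\<bar>" and K: "K > 0"
  and bd: "!!y. y > 0 ==> \<bar>f y\<bar> <= B"
 defines "X \<equiv> %x. \<Sum>i<N. f (x i)"
 shows "expectation (%x. (X x - expectation X)\<^sup>2) <= 4 * (K\<^sup>2 / (b * th))"
  "expectation (%x. (X x - expectation X) ^ 4) <= 72 * (K\<^sup>2 / (b * th))\<^sup>2"
proof -
 have Xm [measurable]: "X \<in> borel_measurable (leb N)"
  unfolding X_def by (intro borel_measurable_sum leb_component_measurable) auto
 have Xbd: "\<bar>X x\<bar> <= real N * B" if "\<forall>i<N. x i > 0" for x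
 proof -
  have "\<bar>X x\<bar> <= (\<Sum>i<N. \<bar>f (x i)\<bar>)" unfolding X_def by (rule sum_abs)
  also have "... <= (\<Sum>i<N. B)" using that bd by (intro sum_mono) auto
  finally show ?thesis by simp
 qed
 have ebd: "\<bar>exp (s * X x)\<bar> <= exp (\<bar>s\<bar> * (real N * B))" if "\<forall>i<N. x i > 0" for s x
 proof -
  have "s * X x <= \<bar>s\<bar> * \<bar>X x\<bar>" by (metis abs_ge_self abs_mult)
  also have "... <= \<bar>s\<bar> * (real N * B)" using Xbd[OF that] by (intro mult_left_mono) auto
  finally show ?thesis by simp
 qed
 have lap: "expectation (%x. exp (s * X x)) * expectation (%x. exp (- s * X x)) <= exp (s\<^sup>2 * (K\<^sup>2 / (b * th)))" for s
 proof -
  have "(\<integral>\<^sup>+x. ennreal (exp (s * X x)) * ennreal (W x) \<partial>leb N) * (\<integral>\<^sup>+x. ennreal (exp (- s * X x)) * ennreal (W x) \<partial>leb N)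
   <= ennreal (exp (real N * s\<^sup>2 * K\<^sup>2 / (real N * b * th))) * (\<integral>\<^sup>+x. ennreal (W x) \<partial>leb N)\<^sup>2"
   unfolding X_def
  proof (rule gas_laplace_bound[where V = "%y. real N * b * gpot th y"])
   show "gwt N b th \<in> borel_measurable borel" by measurable
   show "!!y. 0 < y ==> gwt N b th y = exp (- (real N * b * gpot th y))" "!!y. y <= 0 ==> gwt N b th y = 0"
    by (auto simp: gwt_def)
   show "real N * b * gpot th y + real N * b * gpot th z - 2 * (real N * b * gpot th ((y + z) / 2)) >= real N * b * th * (y - z)\<^sup>2 / 4" for y z
   proof -
    have "gpot th y + gpot th z - 2 * gpot th ((y + z) / 2) = th * (y - z)\<^sup>2 / 4"
     unfolding gpot_def by (simp add: power2_eq_square field_simps)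
    then have "real N * b * (gpot th y + gpot th z - 2 * gpot th ((y + z) / 2)) = real N * b * (th * (y - z)\<^sup>2 / 4)" by simp
    then show ?thesis by (simp add: algebra_simps)
   qed
  qed (use b th0 N lip in auto)
  also have "real N * s\<^sup>2 * K\<^sup>2 / (real N * b * th) = s\<^sup>2 * (K\<^sup>2 / (b * th))" using N by simp
  also have "(\<integral>\<^sup>+x. ennreal (W x) \<partial>leb N) = ennreal (gZ N b th)"
   using nn_integral_W[of "%_. 1" 1] by (simp add: prob_space)
  finally have "ennreal (gZ N b th * expectation (%x. exp (s * X x))) * ennreal (gZ N b th * expectation (%x. exp (- s * X x)))
   <= ennreal (exp (s\<^sup>2 * (K\<^sup>2 / (b * th)))) * (ennreal (gZ N b th))\<^sup>2"
   using nn_integral_W[of "%x. exp (s * X x)", OF _ ebd] nn_integral_W[of "%x. exp (- s * X x)", OF _ ebd] by simp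
  then have "ennreal ((gZ N b th * expectation (%x. exp (s * X x))) * (gZ N b th * expectation (%x. exp (- s * X x))))
   <= ennreal (exp (s\<^sup>2 * (K\<^sup>2 / (b * th))) * (gZ N b th)\<^sup>2)"
   using Z_pos by (simp add: ennreal_mult ennreal_power)
  then have "(gZ N b th * expectation (%x. exp (s * X x))) * (gZ N b th * expectation (%x. exp (- s * X x))) <= exp (s\<^sup>2 * (K\<^sup>2 / (b * th))) * (gZ N b th)\<^sup>2"
   by (subst (asm) ennreal_le_iff) auto
  then have "(gZ N b th)\<^sup>2 * (expectation (%x. exp (s * X x)) * expectation (%x. exp (- s * X x))) <= (gZ N b th)\<^sup>2 * exp (s\<^sup>2 * (K\<^sup>2 / (b * th)))"
   by (simp only: power2_eq_square mult_ac)
  then show ?thesis using Z_pos by (subst (asm) mult_le_cancel_left_pos) auto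
 qed
 have ae: "AE x in gP N b th. \<bar>X x\<bar> <= real N * B" using AE_pos by eventually_elim (rule Xbd)
 have v: "K\<^sup>2 / (b * th) > 0" using K b th0 by simp
 have Xm': "X \<in> borel_measurable (gP N b th)" by measurable
 show "expectation (%x. (X x - expectation X)\<^sup>2) <= 4 * (K\<^sup>2 / (b * th))"
  "expectation (%x. (X x - expectation X) ^ 4) <= 72 * (K\<^sup>2 / (b * th))\<^sup>2"
  using moments_of_laplace_bound[OF Xm' ae v lap] by auto
qed

lemma psum_bounds:
 assumes "u >= 0" "\<forall>i<N. x i > 0"
 shows "0 <= psum N u j x" "psum N u j x <= real N"
proof -
 have t: "0 <= tt u (x i) ^ j" "tt u (x i) ^ j <= 1" if "i < N" for i
  using tt_bounds[OF assms(1), of "x i"] assms(2) that by (auto intro!: power_le_one)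
 show "0 <= psum N u j x" unfolding psum_def using t by (intro sum_nonneg) auto
 have "psum N u j x <= (\<Sum>i<N. 1)" unfolding psum_def using t by (intro sum_mono) auto
 then show "psum N u j x <= real N" by simp
qed

lemma psum_integrable: "u >= 0 ==> integrable (gP N b th) (psum N u j)"
 by (rule integrable_bounded_gP[where C = "real N"]) (use psum_bounds in auto)

lemma psum_mult_integrable: "u >= 0 ==> integrable (gP N b th) (%x. psum N u i x * psum N u j x)"
proof (rule integrable_bounded_gP[where C = "real N * real N"])
 fix x :: "nat => real" assume "u >= 0" "\<forall>i<N. x i > 0"
 then show "\<bar>psum N u i x * psum N u j x\<bar> <= real N * real N"
  using psum_bounds[of u x i] psum_bounds[of u x j] by (simp add: abs_mult mult_mono)
qed measurable

section \<open>Normalised moments and the loop equations between them\<close>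

definition sj :: "real => nat => real" where "sj u j = expectation (psum N u j) / real N"
definition ej :: "real => nat => nat => real" where "ej u i j = expectation (%x. psum N u i x * psum N u j x) / (real N)\<^sup>2"
definition xm :: "nat => real" where "xm k = expectation (%x. \<Sum>i<N. x i ^ k) / real N"
text \<open>The coefficient 1 - b of the diagonal terms after division of the loop equation by b
  N^2; it is the source of the 1/N corrections and vanishes for b = 1.\<close>

definition dl :: real where "dl = (1 / b - 1) / real N"

lemma psum_0 [simp]: "psum N u 0 = (%_. real N)" by (auto simp: psum_def)

lemma xpow_measurable [measurable]: "(%x. \<Sum>i<N. x i ^ k) \<in> borel_measurable (leb N)"
 by (intro borel_measurable_sum leb_component_measurable[of "%y. y ^ k"]) auto

lemma xpow_integrable: "integrable (gP N b th) (%x. \<Sum>i<N. x i ^ k)"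
proof (rule integrable_gP[where C = "real N" and k = k])
 fix x :: "nat => real" assume x: "\<forall>i<N. x i > 0"
 have "\<bar>\<Sum>i<N. x i ^ k\<bar> <= (\<Sum>i<N. \<bar>x i ^ k\<bar>)" by (rule sum_abs)
 also have "... <= (\<Sum>i<N. spread N x ^ k)"
 proof (rule sum_mono)
  fix i assume "i \<in> {..<N}"
  then have "\<bar>x i\<bar> <= spread N x" using spread_ge[of i N x] by simp
  then show "\<bar>x i ^ k\<bar> <= spread N x ^ k" unfolding power_abs by (rule power_mono) simp
 qed
 finally show "\<bar>\<Sum>i<N. x i ^ k\<bar> <= real N * spread N x ^ k" by simp
qed measurable

lemma sj_0: "sj u 0 = 1" using N by (simp add: sj_def prob_space)

lemma sj_bounds: "u >= 0 ==> 0 <= sj u j \<and> sj u j <= 1"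
proof -
 assume u: "u >= 0"
 have "expectation (%_. 0) <= expectation (psum N u j)" "expectation (psum N u j) <= expectation (%_. real N)"
  by (rule expectation_mono_pos; use psum_integrable[OF u] psum_bounds[OF u] in auto)+
 then show ?thesis using N by (auto simp: sj_def prob_space)
qed

lemma loop_one:
 assumes "u >= 0"
 shows "expectation (Lam u j) = 0"
proof -
 have "expectation (%x. 1 * Lam u j x + 0) = 0"
  by (rule loop_equation[OF assms, where K = 1]) auto
 then show ?thesis by simp
qed

definition pot :: "real => nat => (nat => real) => real" where
 "pot u j x = (\<Sum>i<N. ((1 - 3 * th) + th * x i) * (x i * tt u (x i) ^ Suc j))"

text \<open>The relation y tt = (1 - tt) / u removes both factors of the variable, so for positive
  index the potential term closes on power sums.\<close>

lemma pot_Suc: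
 assumes u: "u > 0" and x: "\<forall>i<N. x i > 0"
 shows "pot u (Suc j) x = (1 - 3 * th) / u * (psum N u (Suc j) x - psum N u (Suc (Suc j)) x)
   + th / u\<^sup>2 * (psum N u j x - 2 * psum N u (Suc j) x + psum N u (Suc (Suc j)) x)"
proof -
 have "((1 - 3 * th) + th * y) * (y * tt u y ^ Suc (Suc j)) = (1 - 3 * th) / u * (tt u y ^ Suc j - tt u y ^ Suc (Suc j))
   + th / u\<^sup>2 * (tt u y ^ j - 2 * tt u y ^ Suc j + tt u y ^ Suc (Suc j))" if "y > 0" for y
 proof -
  have "1 + u * y ~= 0" using u that by (auto simp: add_nonneg_eq_0_iff)
  then have yt: "y * tt u y = (1 - tt u y) / u" unfolding tt_def using u by (simp add: divide_simps)
  have "((1 - 3 * th) + th * y) * (y * tt u y ^ Suc (Suc j)) = (1 - 3 * th) * (y * tt u y) * tt u y ^ Suc j + th * (y * tt u y) * (y * tt u y) * tt u y ^ j"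
   by (simp add: algebra_simps)
  also have "... = (1 - 3 * th) / u * (tt u y ^ Suc j - tt u y ^ Suc (Suc j)) + th / u\<^sup>2 * (tt u y ^ j - 2 * tt u y ^ Suc j + tt u y ^ Suc (Suc j))"
   unfolding yt using u by (simp add: divide_simps power2_eq_square) (simp add: algebra_simps)
  finally show ?thesis .
 qed
 then have "pot u (Suc j) x = (\<Sum>i<N. (1 - 3 * th) / u * (tt u (x i) ^ Suc j - tt u (x i) ^ Suc (Suc j))
   + th / u\<^sup>2 * (tt u (x i) ^ j - 2 * tt u (x i) ^ Suc j + tt u (x i) ^ Suc (Suc j)))"
  unfolding pot_def using x by (intro sum.cong) auto
 then show ?thesis unfolding psum_def by (simp only: sum.distrib sum_subtractf sum_distrib_left[symmetric])
qed

text \<open>For index 0 there is only one power of \<open>tt\<close> for two factors of the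
  variable: the first moment survives, and this is where \<open>xm 1\<close> enters the loop
  equations.\<close>

lemma pot_0:
 assumes u: "u > 0" and x: "\<forall>i<N. x i > 0"
 shows "pot u 0 x = (1 - 3 * th) / u * (real N - psum N u 1 x) + th / u\<^sup>2 * (u * (\<Sum>i<N. x i ^ 1) - real N + psum N u 1 x)"
proof -
 have "((1 - 3 * th) + th * y) * (y * tt u y ^ Suc 0) = (1 - 3 * th) / u * (1 - tt u y ^ 1) + th / u\<^sup>2 * (u * y ^ 1 - 1 + tt u y ^ 1)" if "y > 0" for y
 proof -
  have "1 + u * y ~= 0" using u that by (auto simp: add_nonneg_eq_0_iff)
  then have yt: "y * tt u y = (1 - tt u y) / u" unfolding tt_def using u by (simp add: divide_simps)
  have "((1 - 3 * th) + th * y) * (y * tt u y ^ Suc 0) = (1 - 3 * th) * (y * tt u y) + th * y * (y * tt u y)"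
   by (simp add: algebra_simps)
  also have "th * y * (y * tt u y) = th * (y * ((1 - tt u y) / u))" by (simp only: yt mult.assoc)
  also have "... = th * (y - y * tt u y) / u" by (simp add: right_diff_distrib)
  also have "(1 - 3 * th) * (y * tt u y) = (1 - 3 * th) / u * (1 - tt u y)" unfolding yt by simp
  also have "th * (y - y * tt u y) / u = th / u\<^sup>2 * (u * y - 1 + tt u y)"
   unfolding yt using u by (simp add: divide_simps power2_eq_square)
  finally show ?thesis by simp
 qed
 then have "pot u 0 x = (\<Sum>i<N. (1 - 3 * th) / u * (1 - tt u (x i) ^ 1) + th / u\<^sup>2 * (u * x i ^ 1 - 1 + tt u (x i) ^ 1))"
  unfolding pot_def using x by (intro sum.cong) auto
 also have "... = (1 - 3 * th) / u * ((\<Sum>i<N. 1) - psum N u 1 x) + th / u\<^sup>2 * (u * (\<Sum>i<N. x i ^ 1) - (\<Sum>i<N. 1) + psum N u 1 x)"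
  unfolding psum_def by (simp only: sum.distrib sum_subtractf sum_distrib_left[symmetric])
 finally show ?thesis by simp
qed

lemma pot_measurable [measurable]: "pot u j \<in> borel_measurable (leb N)"
 unfolding pot_def[abs_def]
 by (intro borel_measurable_sum leb_component_measurable[of "%y. ((1 - 3 * th) + th * y) * (y * tt u y ^ Suc j)"]) auto

lemma expectation_pot_Suc:
 assumes u: "u > 0"
 shows "integrable (gP N b th) (pot u (Suc j))"
  "expectation (pot u (Suc j)) = real N * ((1 - 3 * th) / u * (sj u (Suc j) - sj u (Suc (Suc j))) + th / u\<^sup>2 * (sj u j - 2 * sj u (Suc j) + sj u (Suc (Suc j))))"
proof -
 let ?F = "%x. (1 - 3 * th) / u * (psum N u (Suc j) x - psum N u (Suc (Suc j)) x)
   + th / u\<^sup>2 * (psum N u j x - 2 * psum N u (Suc j) x + psum N u (Suc (Suc j)) x)"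
 have i: "integrable (gP N b th) (psum N u k)" for k using psum_integrable[of u k] u by simp
 have intF: "integrable (gP N b th) ?F"
  by (intro Bochner_Integration.integrable_add Bochner_Integration.integrable_diff integrable_mult_right i)
 show "integrable (gP N b th) (pot u (Suc j))"
  by (rule integrable_cong_AE_imp[OF intF]) (use AE_pos pot_Suc[OF u] in \<open>auto elim!: eventually_mono cong: measurable_cong_sets\<close>)
 have "expectation (pot u (Suc j)) = expectation ?F"
  by (rule expectation_cong_pos) (use pot_Suc[OF u] in auto)
 also have "... = (1 - 3 * th) / u * (expectation (psum N u (Suc j)) - expectation (psum N u (Suc (Suc j))))
   + th / u\<^sup>2 * (expectation (psum N u j) - 2 * expectation (psum N u (Suc j)) + expectation (psum N u (Suc (Suc j))))"
  using i by (simp add: Bochner_Integration.integral_add Bochner_Integration.integral_diff)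
 finally have *: "expectation (pot u (Suc j)) = (1 - 3 * th) / u * (expectation (psum N u (Suc j)) - expectation (psum N u (Suc (Suc j))))
   + th / u\<^sup>2 * (expectation (psum N u j) - 2 * expectation (psum N u (Suc j)) + expectation (psum N u (Suc (Suc j))))" .
 have Es: "expectation (psum N u k) = real N * sj u k" for k using N by (simp add: sj_def)
 from * show "expectation (pot u (Suc j)) = real N * ((1 - 3 * th) / u * (sj u (Suc j) - sj u (Suc (Suc j))) + th / u\<^sup>2 * (sj u j - 2 * sj u (Suc j) + sj u (Suc (Suc j))))"
  unfolding Es by (simp add: algebra_simps)
qed

lemma expectation_pot_0:
 assumes u: "u > 0"
 shows "integrable (gP N b th) (pot u 0)"
  "expectation (pot u 0) = real N * ((1 - 3 * th) / u * (1 - sj u 1) + th / u\<^sup>2 * (u * xm 1 - 1 + sj u 1))"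
proof -
 let ?F = "%x. (1 - 3 * th) / u * (real N - psum N u 1 x) + th / u\<^sup>2 * (u * (\<Sum>i<N. x i ^ 1) - real N + psum N u 1 x)"
 have i: "integrable (gP N b th) (psum N u k)" for k using psum_integrable[of u k] u by simp
 have ix: "integrable (gP N b th) (%x. \<Sum>i<N. x i)" using xpow_integrable[of 1] by simp
 have intF: "integrable (gP N b th) ?F" using i ix by auto
 show "integrable (gP N b th) (pot u 0)"
  by (rule integrable_cong_AE_imp[OF intF]) (use AE_pos pot_0[OF u] in \<open>auto elim!: eventually_mono cong: measurable_cong_sets\<close>)
 have "expectation (pot u 0) = expectation ?F"
  by (rule expectation_cong_pos) (use pot_0[OF u] in auto)
 also have "... = (1 - 3 * th) / u * (real N - expectation (psum N u 1)) + th / u\<^sup>2 * (u * expectation (%x. \<Sum>i<N. x i ^ 1) - real N + expectation (psum N u 1))"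
  using i ix by (simp add: Bochner_Integration.integral_add Bochner_Integration.integral_diff prob_space)
 also have "expectation (%x. \<Sum>i<N. x i ^ 1) = real N * xm 1" using N by (simp add: xm_def)
 finally have *: "expectation (pot u 0) = (1 - 3 * th) / u * (real N - expectation (psum N u 1)) + th / u\<^sup>2 * (u * (real N * xm 1) - real N + expectation (psum N u 1))" .
 have Es: "expectation (psum N u k) = real N * sj u k" for k using N by (simp add: sj_def)
 have alg: "c * (n - n * s) + d * (u * (n * y) - n + n * s) = n * (c * (1 - s) + d * (u * y - 1 + s))" for c d n s y :: real
  by (simp add: algebra_simps)
 from * show "expectation (pot u 0) = real N * ((1 - 3 * th) / u * (1 - sj u 1) + th / u\<^sup>2 * (u * xm 1 - 1 + sj u 1))"
  unfolding Es alg .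
qed

text \<open>Division by b N^2. Products of power sums are kept as mixed moments \<open>ej\<close>;
  later \<open>ej_eq\<close> splits them into products of means and covariances.\<close>

lemma loop_normalized:
 assumes u: "u >= 0" and int: "integrable (gP N b th) (pot u j)"
 shows "dl * (real (Suc j) * sj u (Suc (Suc j)) - real j * sj u (Suc j))
  + ((\<Sum>a<Suc j. ej u (Suc a) (Suc j - a)) - (\<Sum>a<j. ej u (Suc a) (j - a))) = expectation (pot u j) / real N"
proof -
 note i = psum_integrable[OF u] psum_mult_integrable[OF u]
 have Es: "expectation (psum N u k) = real N * sj u k" for k using N by (simp add: sj_def)
 have Ee: "expectation (%x. psum N u k x * psum N u l x) = (real N)\<^sup>2 * ej u k l" for k l using N by (simp add: ej_def)
 have "0 = expectation (%x. (1 - b) * (real (Suc j) * psum N u (Suc (Suc j)) x - real j * psum N u (Suc j) x)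
  + b * ((\<Sum>a<Suc j. psum N u (Suc a) x * psum N u (Suc j - a) x) - (\<Sum>a<j. psum N u (Suc a) x * psum N u (j - a) x))
  - real N * b * pot u j x)"
  using loop_one[OF u, of j] unfolding Lam_def[abs_def] pot_def by simp
 also have "... = (1 - b) * (real (Suc j) * expectation (psum N u (Suc (Suc j))) - real j * expectation (psum N u (Suc j)))
  + b * ((\<Sum>a<Suc j. expectation (%x. psum N u (Suc a) x * psum N u (Suc j - a) x)) - (\<Sum>a<j. expectation (%x. psum N u (Suc a) x * psum N u (j - a) x)))
  - real N * b * expectation (pot u j)"
  using i int by (simp add: Bochner_Integration.integral_add Bochner_Integration.integral_diff Bochner_Integration.integral_sum del: sum.lessThan_Suc)
 also have "... = (1 - b) * (real N * (real (Suc j) * sj u (Suc (Suc j)) - real j * sj u (Suc j)))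
  + b * ((real N)\<^sup>2 * ((\<Sum>a<Suc j. ej u (Suc a) (Suc j - a)) - (\<Sum>a<j. ej u (Suc a) (j - a)))) - real N * b * expectation (pot u j)"
  unfolding Es Ee sum_distrib_left[symmetric] by (simp only: right_diff_distrib mult_ac)
 finally have *: "0 = (1 - b) * (real N * (real (Suc j) * sj u (Suc (Suc j)) - real j * sj u (Suc j)))
  + b * ((real N)\<^sup>2 * ((\<Sum>a<Suc j. ej u (Suc a) (Suc j - a)) - (\<Sum>a<j. ej u (Suc a) (j - a)))) - real N * b * expectation (pot u j)" .
 have alg: "(1 / b - 1) / n * S + Q = T / n" if "0 = (1 - b) * (n * S) + b * (n\<^sup>2 * Q) - n * b * T" "n > 0" for n S Q T :: real
 proof -
  have "n * (b * T) = n * ((1 - b) * S + b * n * Q)" using that by (simp add: power2_eq_square algebra_simps)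
  then have "b * T = (1 - b) * S + b * n * Q" using that by simp
  then have T: "T = ((1 - b) * S + b * n * Q) / b" using b by (simp add: field_simps)
  show ?thesis unfolding T using that b by (simp add: field_simps)
 qed
 show ?thesis unfolding dl_def by (rule alg[OF *]) (use N in simp)
qed

text \<open>At u = 0 the vector field is the dilation y, and the loop equation is the virial
  identity; it eliminates the second moment from the derivative of the partition function in
  \<open>th\<close>.\<close>

lemma loop_0: "(1 - 3 * th) * xm 1 + th * xm 2 = 1 + dl"
proof -
 have tt0: "tt 0 y = 1" for y by (simp add: tt_def)
 have p: "pot 0 0 = (%x. (1 - 3 * th) * (\<Sum>i<N. x i ^ 1) + th * (\<Sum>i<N. x i ^ 2))"
  unfolding pot_def[abs_def] tt0 by (auto simp: sum_distrib_left sum.distrib[symmetric] power2_eq_square algebra_simps)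
 have int: "integrable (gP N b th) (pot 0 0)" unfolding p using xpow_integrable[of 1] xpow_integrable[of 2] by auto
 have E: "expectation (pot 0 0) = real N * ((1 - 3 * th) * xm 1 + th * xm 2)"
 proof -
  have e: "expectation (%x. \<Sum>i<N. x i ^ k) = real N * xm k" for k using N by (simp add: xm_def)
  have "expectation (pot 0 0) = (1 - 3 * th) * expectation (%x. \<Sum>i<N. x i ^ 1) + th * expectation (%x. \<Sum>i<N. x i ^ 2)"
   unfolding p using xpow_integrable[of 1] xpow_integrable[of 2] by (subst Bochner_Integration.integral_add) auto
  then show ?thesis unfolding e by (simp add: algebra_simps)
 qed
 have p0: "psum N 0 k = (%_. real N)" for k by (auto simp: psum_def tt0)
 have "sj 0 k = 1" for k using N by (simp add: sj_def p0)
 moreover have "ej 0 k l = 1" for k l using N by (simp add: ej_def p0 power2_eq_square)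
 ultimately show ?thesis using loop_normalized[OF order_refl int] E N by (simp add: add.commute)
qed


section \<open>Centred power sums, covariances and third cumulants\<close>

definition Xc :: "real => nat => (nat => real) => real" where "Xc u j x = psum N u j x - real N * sj u j"
text \<open>Not divided by N: covariances of power sums stay bounded as N grows.\<close>

definition cv :: "real => nat => nat => real" where "cv u i j = expectation (%x. Xc u i x * Xc u j x)"
definition k3 :: "real => nat => real" where "k3 u j = expectation (%x. Xc u 1 x * Xc u 1 x * Xc u j x)"

lemma Xc_measurable [measurable]: "Xc u j \<in> borel_measurable (leb N)"
 unfolding Xc_def[abs_def] by measurable

lemma Xc_bound:
 assumes "u >= 0" "\<forall>i<N. x i > 0"
 shows "\<bar>Xc u j x\<bar> <= real N"
proof -
 have "0 <= real N * sj u j" "real N * sj u j <= real N * 1" using sj_bounds[OF assms(1), of j] by (auto intro!: mult_left_mono simp del: mult_1_right)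
 then show ?thesis using psum_bounds[OF assms, of j] unfolding Xc_def by (simp add: abs_le_iff)
qed

lemma Xc_integrable: "u >= 0 ==> integrable (gP N b th) (Xc u j)"
 by (rule integrable_bounded_gP[where C = "real N"]) (use Xc_bound in auto)

lemma Xc_mean: "u >= 0 ==> expectation (Xc u j) = 0"
 unfolding Xc_def[abs_def] using psum_integrable[of u j] N by (simp add: sj_def)

lemma Xc2_integrable: "u >= 0 ==> integrable (gP N b th) (%x. Xc u i x * Xc u j x)"
proof (rule integrable_bounded_gP[where C = "real N * real N"])
 fix x :: "nat => real" assume "u >= 0" "\<forall>i<N. x i > 0"
 then show "\<bar>Xc u i x * Xc u j x\<bar> <= real N * real N"
  using Xc_bound[of u x i] Xc_bound[of u x j] by (simp add: abs_mult mult_mono)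
qed measurable

lemma Xc3_integrable: "u >= 0 ==> integrable (gP N b th) (%x. Xc u i x * Xc u j x * Xc u k x)"
proof (rule integrable_bounded_gP[where C = "real N * real N * real N"])
 fix x :: "nat => real" assume "u >= 0" "\<forall>i<N. x i > 0"
 then show "\<bar>Xc u i x * Xc u j x * Xc u k x\<bar> <= real N * real N * real N"
  using Xc_bound[of u x i] Xc_bound[of u x j] Xc_bound[of u x k] by (simp add: abs_mult mult_mono)
qed measurable

lemma Xc4_integrable: "u >= 0 ==> integrable (gP N b th) (%x. Xc u i x ^ 4)"
proof (rule integrable_bounded_gP[where C = "real N ^ 4"])
 fix x :: "nat => real" assume "u >= 0" "\<forall>i<N. x i > 0"
 then show "\<bar>Xc u i x ^ 4\<bar> <= real N ^ 4"
  unfolding power_abs using Xc_bound[of u x i] by (intro power_mono) auto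
qed measurable

lemma ej_eq: "u >= 0 ==> ej u i j = sj u i * sj u j + cv u i j / (real N)\<^sup>2"
proof -
 assume u: "u >= 0"
 have "expectation (%x. psum N u i x * psum N u j x) = expectation (%x. Xc u i x * Xc u j x + real N * sj u j * Xc u i x + real N * sj u i * Xc u j x + (real N)\<^sup>2 * (sj u i * sj u j))"
  by (rule arg_cong[where f = expectation]) (auto simp: Xc_def power2_eq_square algebra_simps)
 also have "... = cv u i j + (real N)\<^sup>2 * (sj u i * sj u j)"
  using Xc_integrable[OF u] Xc2_integrable[OF u] by (simp add: Xc_mean[OF u] cv_def)
 finally show ?thesis using N unfolding ej_def by (simp add: add_divide_distrib)
qed

lemma power_diff_le:
 fixes a c :: real
 assumes "0 <= a" "a <= 1" "0 <= c" "c <= 1"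
 shows "\<bar>a ^ j - c ^ j\<bar> <= real j * \<bar>a - c\<bar>"
proof (induction j)
 case (Suc j)
 have "a ^ Suc j - c ^ Suc j = a * (a ^ j - c ^ j) + c ^ j * (a - c)" by (simp add: algebra_simps)
 also have "\<bar>...\<bar> <= a * \<bar>a ^ j - c ^ j\<bar> + c ^ j * \<bar>a - c\<bar>"
  using assms by (intro order_trans[OF abs_triangle_ineq]) (simp add: abs_mult)
 also have "... <= 1 * (real j * \<bar>a - c\<bar>) + 1 * \<bar>a - c\<bar>"
  using assms Suc by (intro add_mono mult_mono power_le_one) auto
 finally show ?case by (simp add: algebra_simps)
qed simp

lemma Xc_moments:
 assumes th0: "th > 0" and u: "u > 0" and j: "j > 0"
 shows "expectation (%x. (Xc u j x)\<^sup>2) <= 4 * ((real j * u)\<^sup>2 / (b * th))"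
  "expectation (%x. Xc u j x ^ 4) <= 72 * ((real j * u)\<^sup>2 / (b * th))\<^sup>2"
proof -
 have lip: "\<bar>tt u y ^ j - tt u z ^ j\<bar> <= real j * u * \<bar>y - z\<bar>" if "y > 0" "z > 0" for y z
 proof -
  have t: "0 < tt u y" "tt u y <= 1" "0 < tt u z" "tt u z <= 1" using tt_bounds[of u] u that by auto
  have "\<bar>tt u y ^ j - tt u z ^ j\<bar> <= real j * \<bar>tt u y - tt u z\<bar>" using t by (intro power_diff_le) auto
  also have "\<bar>tt u y - tt u z\<bar> = u * \<bar>y - z\<bar> * (tt u y * tt u z)"
   using tt_diff[of u y z] u that t by (simp add: abs_mult)
  also have "... <= u * \<bar>y - z\<bar> * 1" using t u by (intro mult_left_mono mult_le_one) auto
  finally show ?thesis using j by (simp add: mult_left_mono mult.assoc)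
 qed
 have bd: "\<bar>tt u y ^ j\<bar> <= 1" if "y > 0" for y using tt_bounds[of u y] u that by (auto intro: power_le_one)
 have e: "real N * sj u j = expectation (psum N u j)" using N by (simp add: sj_def)
 have K: "real j * u > 0" using j u by simp
 show "expectation (%x. (Xc u j x)\<^sup>2) <= 4 * ((real j * u)\<^sup>2 / (b * th))"
  "expectation (%x. Xc u j x ^ 4) <= 72 * ((real j * u)\<^sup>2 / (b * th))\<^sup>2"
  using linear_statistic_moments[OF th0 _ lip K bd] unfolding Xc_def e psum_def[abs_def] by auto
qed

text \<open>At the arguments u = th v used later the right side is of order th v^2 / b: bounded in N
  and small with \<open>th\<close>.\<close>

lemma cv_bound:
 assumes th0: "th > 0" and u: "u > 0" and "i > 0" "j > 0"
 shows "\<bar>cv u i j\<bar> <= 2 * ((real i)\<^sup>2 + (real j)\<^sup>2) * (u\<^sup>2 / (b * th))"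
proof -
 have u0: "u >= 0" using u by simp
 have "\<bar>cv u i j\<bar> <= expectation (%x. \<bar>Xc u i x * Xc u j x\<bar>)" unfolding cv_def by (rule integral_abs_bound)
 also have "... <= expectation (%x. ((Xc u i x)\<^sup>2 + (Xc u j x)\<^sup>2) / 2)"
 proof (rule integral_mono)
  show "integrable (gP N b th) (%x. ((Xc u i x)\<^sup>2 + (Xc u j x)\<^sup>2) / 2)"
   using Xc2_integrable[OF u0, of i i] Xc2_integrable[OF u0, of j j] by (simp add: power2_eq_square)
  show "\<bar>Xc u i x * Xc u j x\<bar> <= ((Xc u i x)\<^sup>2 + (Xc u j x)\<^sup>2) / 2" for x
   using sum_squares_bound[of "\<bar>Xc u i x\<bar>" "\<bar>Xc u j x\<bar>"] by (simp add: abs_mult)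
 qed (use Xc2_integrable[OF u0] in auto)
 also have "... = (expectation (%x. (Xc u i x)\<^sup>2) + expectation (%x. (Xc u j x)\<^sup>2)) / 2"
  using Xc2_integrable[OF u0, of i i] Xc2_integrable[OF u0, of j j] by (simp add: power2_eq_square)
 also have "... <= (4 * ((real i * u)\<^sup>2 / (b * th)) + 4 * ((real j * u)\<^sup>2 / (b * th))) / 2"
  using assms by (intro divide_right_mono add_mono Xc_moments) auto
 also have "... = 2 * ((real i)\<^sup>2 + (real j)\<^sup>2) * (u\<^sup>2 / (b * th))"
  by (simp add: power_mult_distrib algebra_simps add_divide_distrib)
 finally show ?thesis .
qed

text \<open>The product X1^2 |Xj| is at most half of X1^4 + Xj^2; this is the purpose of the fourth
  moments.\<close>

lemma k3_bound:
 assumes th0: "th > 0" and u: "u > 0" and j: "j > 0"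
 shows "\<bar>k3 u j\<bar> <= 36 * (u\<^sup>2 / (b * th))\<^sup>2 + 2 * (real j)\<^sup>2 * (u\<^sup>2 / (b * th))"
proof -
 have u0: "u >= 0" using u by simp
 have "\<bar>k3 u j\<bar> <= expectation (%x. \<bar>Xc u 1 x * Xc u 1 x * Xc u j x\<bar>)" unfolding k3_def by (rule integral_abs_bound)
 also have "... <= expectation (%x. (Xc u 1 x ^ 4 + (Xc u j x)\<^sup>2) / 2)"
 proof (rule integral_mono)
  show "integrable (gP N b th) (%x. (Xc u 1 x ^ 4 + (Xc u j x)\<^sup>2) / 2)"
   using Xc4_integrable[OF u0, of 1] Xc2_integrable[OF u0, of j j] by (simp add: power2_eq_square)
  show "\<bar>Xc u 1 x * Xc u 1 x * Xc u j x\<bar> <= (Xc u 1 x ^ 4 + (Xc u j x)\<^sup>2) / 2" for x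
  proof -
   have "2 * (Xc u 1 x)\<^sup>2 * \<bar>Xc u j x\<bar> <= ((Xc u 1 x)\<^sup>2)\<^sup>2 + \<bar>Xc u j x\<bar>\<^sup>2" by (rule sum_squares_bound)
   moreover have "\<bar>Xc u 1 x * Xc u 1 x * Xc u j x\<bar> = (Xc u 1 x)\<^sup>2 * \<bar>Xc u j x\<bar>" by (simp add: abs_mult power2_eq_square)
   ultimately show ?thesis by simp
  qed
 qed (use Xc3_integrable[OF u0] in auto)
 also have "... = (expectation (%x. Xc u 1 x ^ 4) + expectation (%x. (Xc u j x)\<^sup>2)) / 2"
  using Xc4_integrable[OF u0, of 1] Xc2_integrable[OF u0, of j j] by (simp add: power2_eq_square)
 also have "... <= (72 * ((real 1 * u)\<^sup>2 / (b * th))\<^sup>2 + 4 * ((real j * u)\<^sup>2 / (b * th))) / 2"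
  using assms by (intro divide_right_mono add_mono Xc_moments) auto
 also have "... = 36 * (u\<^sup>2 / (b * th))\<^sup>2 + 2 * (real j)\<^sup>2 * (u\<^sup>2 / (b * th))"
  by (simp add: power_mult_distrib)
 finally show ?thesis .
qed

text \<open>The loop equation for the vector field y tt^2 with the observable
  \<open>psum N u 1\<close> inserted. Expanded around the means it is linear in the covariances, up
  to third cumulants. With P = (1 - 3 th) / u and Q = th / u^2, the factor of
  \<open>cv u 1 2\<close> at leading order is 2 s1 + P - Q, which vanishes at the zero chosen later,
  so that only \<open>cv u 1 1\<close> survives there.\<close>

lemma loop_variance:
 assumes u: "u > 0"
 shows "real N * b * (2 * sj u 1 * cv u 1 2 + 2 * sj u 2 * cv u 1 1 - 2 * sj u 1 * cv u 1 1
   - (1 - 3 * th) / u * (cv u 1 1 - cv u 1 2) - th / u\<^sup>2 * (cv u 1 2 - 2 * cv u 1 1))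
  + b * (2 * k3 u 2 - k3 u 1) + (1 - b) * (2 * cv u 1 3 - cv u 1 2) = real N * (sj u 3 - sj u 4)"
proof -
 have u0: "u >= 0" using u by simp
 define k where "k x = psum N u 1 x" for x
 \<comment> \<open>Derivative of tt along the field: -u tt^2 times y tt^2 is -(u y tt) tt^3 = tt^4 -
   tt^3.\<close>
 define kap where "kap x = (\<Sum>i<N. tt u (x i) ^ 4 - tt u (x i) ^ 3)" for x :: "nat => real"
 have kap_eq: "kap x = psum N u 4 x - psum N u 3 x" for x by (simp add: kap_def psum_def sum_subtractf)
 have [measurable]: "k \<in> borel_measurable (leb N)" "kap \<in> borel_measurable (leb N)"
  unfolding k_def[abs_def] kap_eq[abs_def] by measurable
 have T: "y + e * (y * tt u y ^ Suc 1) > 0"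
  "tt u (y + e * (y * tt u y ^ Suc 1)) - tt u y = - (e * (u * y * tt u y * tt u y * tt u y * tt u (y + e * (y * tt u y ^ Suc 1))))"
  "tt u y ^ 4 - tt u y ^ 3 = - (u * y * tt u y * tt u y * tt u y * tt u y)" "0 <= u * y * tt u y" "u * y * tt u y <= 1"
  if "y > 0" "\<bar>e\<bar> <= 1/2" for y e
 proof -
  have t: "0 < tt u y" "tt u y <= 1" using tt_bounds[OF u0 that(1)] by auto
  have nz: "1 + u * y ~= 0" using u that by (auto simp: add_nonneg_eq_0_iff)
  then have uy: "u * y * tt u y = 1 - tt u y" unfolding tt_def by (simp add: divide_simps)
  show "0 <= u * y * tt u y" "u * y * tt u y <= 1" using uy t by auto
  have "\<bar>e * (y * tt u y ^ Suc 1)\<bar> <= 1/2 * (y * 1)"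
   unfolding abs_mult using that t by (intro mult_mono) (auto simp: abs_mult power2_eq_square intro!: mult_le_one)
  then show pos: "y + e * (y * tt u y ^ Suc 1) > 0" using that by linarith
  show "tt u (y + e * (y * tt u y ^ Suc 1)) - tt u y = - (e * (u * y * tt u y * tt u y * tt u y * tt u (y + e * (y * tt u y ^ Suc 1))))"
   using tt_diff[OF u0, of "y + e * (y * tt u y ^ Suc 1)" y] pos that by (simp add: mult_ac)
  show "tt u y ^ 4 - tt u y ^ 3 = - (u * y * tt u y * tt u y * tt u y * tt u y)" unfolding uy by (simp add: algebra_simps power4_eq_xxxx power3_eq_cube)
 qed
 have Tb: "0 <= u * y * tt u y * tt u y * tt u y * z" "u * y * tt u y * tt u y * tt u y * z <= 1" if "y > 0" "0 <= z" "z <= 1" for y z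
 proof -
  have t: "0 <= tt u y" "tt u y <= 1" using tt_bounds[OF u0 that(1)] by auto
  have a: "0 <= u * y * tt u y" "u * y * tt u y <= 1" using T(4,5)[OF that(1), of 0] by auto
  define c where "c = u * y * tt u y"
  show "0 <= u * y * tt u y * tt u y * tt u y * z" using a t that by auto
  show "u * y * tt u y * tt u y * tt u y * z <= 1" unfolding c_def[symmetric] using a[folded c_def] t that by (intro mult_le_one) auto
 qed
 have "expectation (%x. k x * Lam u 1 x + kap x) = 0"
 proof (rule loop_equation[OF u0, where K = "real N"])
  fix x :: "nat => real" assume x: "!!i. i < N ==> x i > 0"
  show "0 <= k x \<and> k x <= real N" unfolding k_def using psum_bounds[OF u0] x by auto
  have "\<bar>kap x\<bar> <= (\<Sum>i<N. 1)" unfolding kap_def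
  proof (rule order_trans[OF sum_abs sum_mono])
   fix i assume "i \<in> {..<N}"
   then have xi: "x i > 0" using x by auto
   show "\<bar>tt u (x i) ^ 4 - tt u (x i) ^ 3\<bar> <= 1"
    unfolding T(3)[OF xi, of 0, simplified] using Tb[OF xi, of "tt u (x i)"] tt_bounds[OF u0 xi] by auto
  qed
  then show "\<bar>kap x\<bar> <= real N" by simp
  fix e :: real assume e: "\<bar>e\<bar> <= 1/2"
  have diff: "k (\<lambda>i\<in>{..<N}. x i + e * (x i * tt u (x i) ^ Suc 1)) - k x = (\<Sum>i<N. tt u (x i + e * (x i * tt u (x i) ^ Suc 1)) - tt u (x i))"
   unfolding k_def psum_def by (simp add: sum_subtractf)
  have z: "0 <= tt u (x i + e * (x i * tt u (x i) ^ Suc 1))" "tt u (x i + e * (x i * tt u (x i) ^ Suc 1)) <= 1" if "i < N" for i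
   using tt_bounds[OF u0 T(1)[OF x[OF that] e]] by auto
  have "\<bar>k (\<lambda>i\<in>{..<N}. x i + e * (x i * tt u (x i) ^ Suc 1)) - k x\<bar> <= (\<Sum>i<N. \<bar>e\<bar>)"
   unfolding diff
  proof (rule order_trans[OF sum_abs sum_mono])
   fix i assume "i \<in> {..<N}"
   then have i: "i < N" by simp
   show "\<bar>tt u (x i + e * (x i * tt u (x i) ^ Suc 1)) - tt u (x i)\<bar> <= \<bar>e\<bar>"
    unfolding T(2)[OF x[OF i] e] abs_minus_cancel abs_mult[of e]
    using Tb[OF x[OF i] z[OF i]] by (intro mult_left_le) auto
  qed
  then show "\<bar>k (\<lambda>i\<in>{..<N}. x i + e * (x i * tt u (x i) ^ Suc 1)) - k x\<bar> <= real N * \<bar>e\<bar>" by simp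
  have "e * kap x <= k (\<lambda>i\<in>{..<N}. x i + e * (x i * tt u (x i) ^ Suc 1)) - k x"
   unfolding diff kap_def sum_distrib_left
  proof (rule sum_mono)
   fix i assume "i \<in> {..<N}"
   then have i: "i < N" by simp
   define z1 where "z1 = tt u (x i + e * (x i * tt u (x i) ^ Suc 1))"
   define g where "g = u * x i * tt u (x i) * tt u (x i) * tt u (x i)"
   have h1: "z1 - tt u (x i) = - (e * (g * z1))" unfolding z1_def g_def using T(2)[OF x[OF i] e] by simp
   have h2: "tt u (x i) ^ 4 - tt u (x i) ^ 3 = - (g * tt u (x i))" unfolding g_def using T(3)[OF x[OF i] e] by simp
   have "0 <= z1" using z[OF i] by (simp add: z1_def)
   \<comment> \<open>The second-order remainder is e^2 g^2 z1 >= 0, so the lower bound required of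
     \<open>k\<close> holds without an error term.\<close>
   have "(z1 - tt u (x i)) - e * (tt u (x i) ^ 4 - tt u (x i) ^ 3) = e * g * (tt u (x i) - z1)"
    unfolding h1 h2 by (simp add: algebra_simps)
   also have "tt u (x i) - z1 = e * g * z1" using h1 by (simp add: mult.assoc)
   also have "e * g * (e * g * z1) = (e * g) * (e * g) * z1" by simp
   also have "... >= 0" using \<open>0 <= z1\<close> by (intro mult_nonneg_nonneg zero_le_square)
   finally show "e * (tt u (x i) ^ 4 - tt u (x i) ^ 3) <= tt u (x i + e * (x i * tt u (x i) ^ Suc 1)) - tt u (x i)" unfolding z1_def by simp
  qed
  then show "e * kap x - real N * e\<^sup>2 <= k (\<lambda>i\<in>{..<N}. x i + e * (x i * tt u (x i) ^ Suc 1)) - k x" by (rule order_trans[rotated]) simp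
 qed measurable
 define n where "n = real N"
 define p where "p = (1 - 3 * th) / u"
 define q where "q = th / u\<^sup>2"
 define s where "s = sj u"
 \<comment> \<open>\<open>c1\<close>, \<open>c2\<close> and \<open>c0\<close> are coefficients of
   \<open>Lam\<close> expanded in the centred power sums; the constant \<open>c0\<close> drops out
   after multiplication by a centred variable.\<close>
 define c1 where "c1 = b * (2 * n * s 2 - 2 * n * s 1) - n * b * (p - 2 * q)"
 define c2 where "c2 = - (1 - b) + 2 * b * n * s 1 - n * b * (q - p)"
 define c0 where "c0 = (1 - b) * (2 * n * s 3 - n * s 2) + b * (2 * n * s 1 * n * s 2 - n * s 1 * n * s 1) - n * b * (p * (n * s 1 - n * s 2) + q * (n - 2 * n * s 1 + n * s 2))"
 have Lam1: "Lam u 1 x = c0 + c1 * Xc u 1 x + c2 * Xc u 2 x + 2 * (1 - b) * Xc u 3 x + b * (2 * (Xc u 1 x * Xc u 2 x) - Xc u 1 x * Xc u 1 x)"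
  if x: "\<forall>i<N. x i > 0" for x
 proof -
  have P: "psum N u j x = Xc u j x + n * s j" for j by (simp add: Xc_def n_def s_def)
  have P0: "psum N u 0 x = n" by (simp add: n_def)
  have "Lam u 1 x = (1 - b) * (2 * psum N u 3 x - psum N u 2 x) + b * ((psum N u 1 x * psum N u 2 x + psum N u 2 x * psum N u 1 x) - psum N u 1 x * psum N u 1 x) - n * b * pot u (Suc 0) x"
   unfolding Lam_def pot_def n_def by (simp add: numeral_3_eq_3 numeral_2_eq_2)
  also have "pot u (Suc 0) x = p * (psum N u 1 x - psum N u 2 x) + q * (n - 2 * psum N u 1 x + psum N u 2 x)"
   unfolding pot_Suc[OF u x] P0 p_def q_def by (simp add: numeral_2_eq_2)
  finally show ?thesis unfolding P c0_def c1_def c2_def by (simp add: algebra_simps)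
 qed
 note i1 = Xc_integrable[OF u0] and i2 = Xc2_integrable[OF u0] and i3 = Xc3_integrable[OF u0]
 have "0 = expectation (%x. k x * Lam u 1 x + kap x)" using \<open>expectation (%x. k x * Lam u 1 x + kap x) = 0\<close> by simp
 also have "... = expectation (%x. (c0 * Xc u 1 x + c1 * (Xc u 1 x * Xc u 1 x) + c2 * (Xc u 1 x * Xc u 2 x) + 2 * (1 - b) * (Xc u 1 x * Xc u 3 x)
   + b * (2 * (Xc u 1 x * Xc u 1 x * Xc u 2 x) - Xc u 1 x * Xc u 1 x * Xc u 1 x)) + n * s 1 * Lam u 1 x + (psum N u 4 x - psum N u 3 x))"
 proof (rule expectation_cong_pos)
  fix x :: "nat => real" assume x: "\<forall>i<N. x i > 0"
  have kx: "k x = Xc u 1 x + n * s 1" by (simp add: k_def Xc_def n_def s_def)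
  show "k x * Lam u 1 x + kap x = (c0 * Xc u 1 x + c1 * (Xc u 1 x * Xc u 1 x) + c2 * (Xc u 1 x * Xc u 2 x) + 2 * (1 - b) * (Xc u 1 x * Xc u 3 x)
   + b * (2 * (Xc u 1 x * Xc u 1 x * Xc u 2 x) - Xc u 1 x * Xc u 1 x * Xc u 1 x)) + n * s 1 * Lam u 1 x + (psum N u 4 x - psum N u 3 x)"
   unfolding kx distrib_right kap_eq by (subst Lam1[OF x]) (simp add: algebra_simps)
 qed measurable
 also have "... = (c0 * 0 + c1 * cv u 1 1 + c2 * cv u 1 2 + 2 * (1 - b) * cv u 1 3 + b * (2 * k3 u 2 - k3 u 1)) + n * s 1 * 0 + (n * s 4 - n * s 3)"
 proof -
  have iL: "integrable (gP N b th) (Lam u 1)"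
  proof -
   have "integrable (gP N b th) (%x. c0 + c1 * Xc u 1 x + c2 * Xc u 2 x + 2 * (1 - b) * Xc u 3 x + b * (2 * (Xc u 1 x * Xc u 2 x) - Xc u 1 x * Xc u 1 x))"
    using i1 i2 by auto
   then show ?thesis
    by (rule integrable_cong_AE_imp) (use AE_pos Lam1 in \<open>auto elim!: eventually_mono cong: measurable_cong_sets\<close>)
  qed
  have Es: "expectation (psum N u j) = n * s j" for j using N by (simp add: sj_def n_def s_def)
  show ?thesis
   using i1 i2 i3 iL psum_integrable[OF u0]
   by (simp add: Bochner_Integration.integral_add Bochner_Integration.integral_diff Es loop_one[OF u0] Xc_mean[OF u0] cv_def k3_def)
 qed
 finally have "c1 * cv u 1 1 + c2 * cv u 1 2 + 2 * (1 - b) * cv u 1 3 + b * (2 * k3 u 2 - k3 u 1) = n * (s 3 - s 4)" by (simp add: algebra_simps)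
 moreover have "real N * b * (2 * sj u 1 * cv u 1 2 + 2 * sj u 2 * cv u 1 1 - 2 * sj u 1 * cv u 1 1
   - (1 - 3 * th) / u * (cv u 1 1 - cv u 1 2) - th / u\<^sup>2 * (cv u 1 2 - 2 * cv u 1 1))
  + b * (2 * k3 u 2 - k3 u 1) + (1 - b) * (2 * cv u 1 3 - cv u 1 2) = c1 * cv u 1 1 + c2 * cv u 1 2 + 2 * (1 - b) * cv u 1 3 + b * (2 * k3 u 2 - k3 u 1)"
  unfolding c1_def c2_def n_def[symmetric] p_def[symmetric] q_def[symmetric] s_def[symmetric] by (simp add: algebra_simps)
 ultimately show ?thesis unfolding n_def s_def by simp
qed

text \<open>If xm 1 exceeds 5, the inequality of its square with xm 2 makes th (xm 2 - 3 xm 1)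
  nonnegative, and \<open>loop_0\<close> then gives xm 1 <= 1 + dl.\<close>

lemma xm_bounds: "0 <= xm 1" "xm 1 <= max 5 (1 + dl)"
proof -
 have "expectation (%_. 0) <= expectation (%x. \<Sum>i<N. x i ^ 1)"
  by (rule expectation_mono_pos) (use xpow_integrable[of 1] in \<open>auto intro!: sum_nonneg simp: less_imp_le\<close>)
 then show 0: "0 <= xm 1" by (simp add: xm_def)
 have "(xm 1)\<^sup>2 <= xm 2"
 proof -
  have "0 <= expectation (%x. \<Sum>i<N. (x i - xm 1)\<^sup>2)" by (intro Bochner_Integration.integral_nonneg sum_nonneg) auto
  also have "(%x. \<Sum>i<N. (x i - xm 1)\<^sup>2) = (%x. (\<Sum>i<N. x i ^ 2) - 2 * xm 1 * (\<Sum>i<N. x i ^ 1) + real N * (xm 1)\<^sup>2)"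
  proof
   fix x :: "nat => real"
   have "(\<Sum>i<N. (x i - xm 1)\<^sup>2) = (\<Sum>i<N. x i ^ 2 - 2 * xm 1 * x i ^ 1 + (xm 1)\<^sup>2)"
    by (intro sum.cong) (simp_all add: power2_diff)
   then show "(\<Sum>i<N. (x i - xm 1)\<^sup>2) = (\<Sum>i<N. x i ^ 2) - 2 * xm 1 * (\<Sum>i<N. x i ^ 1) + real N * (xm 1)\<^sup>2"
    by (simp only: sum.distrib sum_subtractf sum_distrib_left[symmetric]) simp
  qed
  also have "expectation ... = expectation (%x. \<Sum>i<N. x i ^ 2) - 2 * xm 1 * expectation (%x. \<Sum>i<N. x i ^ 1) + real N * (xm 1)\<^sup>2"
   using xpow_integrable[of 1] xpow_integrable[of 2] by simp
  also have "... = real N * (xm 2 - (xm 1)\<^sup>2)"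
  proof -
   have e: "expectation (%x. \<Sum>i<N. x i ^ k) = real N * xm k" for k using N by (simp add: xm_def)
   show ?thesis unfolding e by (simp add: power2_eq_square algebra_simps)
  qed
  finally show ?thesis using N by (simp add: zero_le_mult_iff)
 qed
 show "xm 1 <= max 5 (1 + dl)"
 proof (rule ccontr)
  assume "\<not> xm 1 <= max 5 (1 + dl)"
  then have m: "xm 1 > 5" "xm 1 > 1 + dl" by auto
  have "th * (xm 1)\<^sup>2 <= th * xm 2" using th \<open>(xm 1)\<^sup>2 <= xm 2\<close> by (intro mult_left_mono) auto
  then have "xm 1 - 3 * th * xm 1 + th * (xm 1)\<^sup>2 <= 1 + dl" using loop_0 by (simp add: algebra_simps)
  moreover have "th * (xm 1 * (xm 1 - 3)) >= 0" using m th by auto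
  ultimately show False using m by (simp add: power2_eq_square algebra_simps)
 qed
qed

text \<open>Supplies the continuity in \<open>u\<close> needed to find a zero by the intermediate
  value theorem.\<close>

lemma sj1_lipschitz:
 assumes "u >= 0" "v >= 0"
 shows "\<bar>sj u 1 - sj v 1\<bar> <= \<bar>u - v\<bar> * xm 1"
proof -
 have d: "\<bar>psum N u 1 x - psum N v 1 x\<bar> <= \<bar>u - v\<bar> * (\<Sum>i<N. x i ^ 1)" if x: "\<forall>i<N. x i > 0" for x
 proof -
  have "\<bar>psum N u 1 x - psum N v 1 x\<bar> <= (\<Sum>i<N. \<bar>tt u (x i) - tt v (x i)\<bar>)"
   unfolding psum_def by (simp add: sum_subtractf[symmetric] sum_abs)
  also have "... <= (\<Sum>i<N. \<bar>u - v\<bar> * x i)"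
  proof (rule sum_mono)
   fix i assume "i \<in> {..<N}"
   then have xi: "x i > 0" using x by simp
   have nz: "1 + u * x i ~= 0" "1 + v * x i ~= 0" using assms xi by (auto simp: add_nonneg_eq_0_iff)
   then have "tt u (x i) - tt v (x i) = (v - u) * x i * (tt u (x i) * tt v (x i))"
    unfolding tt_def by (simp add: divide_simps) (simp add: algebra_simps)
   also have "\<bar>...\<bar> = \<bar>u - v\<bar> * x i * (tt u (x i) * tt v (x i))"
    using xi tt_bounds[OF assms(1) xi] tt_bounds[OF assms(2) xi] by (simp add: abs_mult abs_minus_commute)
   also have "... <= \<bar>u - v\<bar> * x i * 1"
    using xi tt_bounds[OF assms(1) xi] tt_bounds[OF assms(2) xi] by (intro mult_left_mono mult_le_one) auto
   finally show "\<bar>tt u (x i) - tt v (x i)\<bar> <= \<bar>u - v\<bar> * x i" by simp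
  qed
  finally show ?thesis by (simp add: sum_distrib_left)
 qed
 have "\<bar>expectation (psum N u 1) - expectation (psum N v 1)\<bar> = \<bar>expectation (%x. psum N u 1 x - psum N v 1 x)\<bar>"
  using psum_integrable[OF assms(1)] psum_integrable[OF assms(2)] by simp
 also have "... <= expectation (%x. \<bar>psum N u 1 x - psum N v 1 x\<bar>)" by (rule integral_abs_bound)
 also have "... <= expectation (%x. \<bar>u - v\<bar> * (\<Sum>i<N. x i ^ 1))"
  by (rule expectation_mono_pos) (use psum_integrable[OF assms(1), of 1] psum_integrable[OF assms(2), of 1] xpow_integrable[of 1] d in auto)
 also have "... = real N * (\<bar>u - v\<bar> * xm 1)" using N by (simp add: xm_def)
 finally have "\<bar>real N * sj u 1 - real N * sj v 1\<bar> <= real N * (\<bar>u - v\<bar> * xm 1)" using N by (simp add: sj_def)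
 then show ?thesis using N by (simp add: right_diff_distrib[symmetric] abs_mult)
qed

end

section \<open>The first moment\<close>

context wall_gas
begin

text \<open>\<open>ep1\<close> to \<open>ep5\<close> are the parts of the first five loop equations
  that vanish as N grows: a term of order 1/N proportional to \<open>dl\<close>, and covariances
  divided by N^2.\<close>

definition ep1 where "ep1 u = dl * sj u 2 + cv u 1 1 / (real N)\<^sup>2"
definition ep2 where "ep2 u = dl * (2 * sj u 3 - sj u 2) + (2 * cv u 1 2 - cv u 1 1) / (real N)\<^sup>2"
definition ep3 where "ep3 u = dl * (3 * sj u 4 - 2 * sj u 3) + (2 * cv u 1 3 + cv u 2 2 - 2 * cv u 1 2) / (real N)\<^sup>2"
definition ep4 where "ep4 u = dl * (4 * sj u 5 - 3 * sj u 4) + (2 * cv u 1 4 + 2 * cv u 2 3 - 2 * cv u 1 3 - cv u 2 2) / (real N)\<^sup>2"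
definition ep5 where "ep5 u = dl * (5 * sj u 6 - 4 * sj u 5) + (2 * cv u 1 5 + 2 * cv u 2 4 + cv u 3 3 - 2 * cv u 1 4 - 2 * cv u 2 3) / (real N)\<^sup>2"

lemma cv_sym: "cv u i j = cv u j i" by (simp add: cv_def mult.commute)

text \<open>In the equations with \<open>ep2\<close> to \<open>ep5\<close> the highest unknown,
  \<open>sj u 2\<close> to \<open>sj u 5\<close>, has the coefficient 2 s1 + P - Q, and this is also
  the derivative of the first equation in s1. Where it vanishes, each equation determines the
  unknown one index lower.\<close>

lemma loop_eqs:
 assumes u: "u > 0"
 defines "P \<equiv> (1 - 3 * th) / u" and "Q \<equiv> th / u\<^sup>2"
 shows "ep1 u + (sj u 1)\<^sup>2 = P * (1 - sj u 1) + Q * (u * xm 1 - 1 + sj u 1)"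
  "ep2 u + 2 * sj u 1 * sj u 2 - (sj u 1)\<^sup>2 = P * (sj u 1 - sj u 2) + Q * (1 - 2 * sj u 1 + sj u 2)"
  "ep3 u + 2 * sj u 1 * sj u 3 + (sj u 2)\<^sup>2 - 2 * sj u 1 * sj u 2 = P * (sj u 2 - sj u 3) + Q * (sj u 1 - 2 * sj u 2 + sj u 3)"
  "ep4 u + 2 * sj u 1 * sj u 4 + 2 * sj u 2 * sj u 3 - 2 * sj u 1 * sj u 3 - (sj u 2)\<^sup>2 = P * (sj u 3 - sj u 4) + Q * (sj u 2 - 2 * sj u 3 + sj u 4)"
  "ep5 u + 2 * sj u 1 * sj u 5 + 2 * sj u 2 * sj u 4 + (sj u 3)\<^sup>2 - 2 * sj u 1 * sj u 4 - 2 * sj u 2 * sj u 3 = P * (sj u 4 - sj u 5) + Q * (sj u 3 - 2 * sj u 4 + sj u 5)"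
proof -
 have u0: "u >= 0" using u by simp
 have N0: "real N ~= 0" using N by simp
 define s where "s = sj u"
 define c where "c i j = cv u i j / (real N)\<^sup>2" for i j
 have e: "ej u i j = s i * s j + c i j" for i j unfolding s_def c_def by (rule ej_eq[OF u0])
 have c_sym: "c i j = c j i" for i j unfolding c_def by (simp add: cv_sym)
 have L: "dl * (real (Suc (Suc j)) * s (Suc (Suc (Suc j))) - real (Suc j) * s (Suc (Suc j)))
  + ((\<Sum>a<Suc (Suc j). ej u (Suc a) (Suc (Suc j) - a)) - (\<Sum>a<Suc j. ej u (Suc a) (Suc j - a)))
   = P * (s (Suc j) - s (Suc (Suc j))) + Q * (s j - 2 * s (Suc j) + s (Suc (Suc j)))" for j
  using loop_normalized[OF u0 expectation_pot_Suc(1)[OF u, of j]] N0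
  unfolding expectation_pot_Suc(2)[OF u] P_def Q_def s_def by simp
 have L0: "dl * s 2 + ej u 1 1 = P * (1 - s 1) + Q * (u * xm 1 - 1 + s 1)"
  using loop_normalized[OF u0 expectation_pot_0(1)[OF u]] N0
  unfolding expectation_pot_0(2)[OF u] P_def Q_def s_def by (simp add: numeral_2_eq_2)
 note nums = eval_nat_numeral
 have s0: "s 0 = 1" by (simp add: s_def sj_0)
 show "ep1 u + (sj u 1)\<^sup>2 = P * (1 - sj u 1) + Q * (u * xm 1 - 1 + sj u 1)"
  using L0 unfolding e ep1_def s_def[symmetric] c_def by (simp add: power2_eq_square)
 have L1: "dl * (2 * s 3 - s 2) + (s 1 * s 2 + c 1 2 + (s 2 * s 1 + c 2 1)) - (s 1 * s 1 + c 1 1) = P * (s 1 - s 2) + Q * (1 - 2 * s 1 + s 2)"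
  using L[of 0] unfolding e s0 by (simp add: nums)
 then show "ep2 u + 2 * sj u 1 * sj u 2 - (sj u 1)\<^sup>2 = P * (sj u 1 - sj u 2) + Q * (1 - 2 * sj u 1 + sj u 2)"
  unfolding ep2_def s_def[symmetric] c_sym[of 2 1] unfolding c_def by (simp add: power2_eq_square add_divide_distrib diff_divide_distrib)
 have L2: "dl * (3 * s 4 - 2 * s 3) + (s 1 * s 3 + c 1 3 + (s 2 * s 2 + c 2 2) + (s 3 * s 1 + c 3 1)) - (s 1 * s 2 + c 1 2 + (s 2 * s 1 + c 2 1)) = P * (s 2 - s 3) + Q * (s 1 - 2 * s 2 + s 3)"
  using L[of 1] unfolding e by (simp add: nums)
 then show "ep3 u + 2 * sj u 1 * sj u 3 + (sj u 2)\<^sup>2 - 2 * sj u 1 * sj u 2 = P * (sj u 2 - sj u 3) + Q * (sj u 1 - 2 * sj u 2 + sj u 3)"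
  unfolding ep3_def s_def[symmetric] c_sym[of 2 1] c_sym[of 3 1] unfolding c_def by (simp add: power2_eq_square add_divide_distrib diff_divide_distrib)
 have L3: "dl * (4 * s 5 - 3 * s 4) + (s 1 * s 4 + c 1 4 + (s 2 * s 3 + c 2 3) + (s 3 * s 2 + c 3 2) + (s 4 * s 1 + c 4 1)) - (s 1 * s 3 + c 1 3 + (s 2 * s 2 + c 2 2) + (s 3 * s 1 + c 3 1)) = P * (s 3 - s 4) + Q * (s 2 - 2 * s 3 + s 4)"
  using L[of 2] unfolding e by (simp add: nums)
 then show "ep4 u + 2 * sj u 1 * sj u 4 + 2 * sj u 2 * sj u 3 - 2 * sj u 1 * sj u 3 - (sj u 2)\<^sup>2 = P * (sj u 3 - sj u 4) + Q * (sj u 2 - 2 * sj u 3 + sj u 4)"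
  unfolding ep4_def s_def[symmetric] c_sym[of 3 2] c_sym[of 3 1] c_sym[of 4 1] unfolding c_def by (simp add: power2_eq_square add_divide_distrib diff_divide_distrib)
 have L4: "dl * (5 * s 6 - 4 * s 5) + (s 1 * s 5 + c 1 5 + (s 2 * s 4 + c 2 4) + (s 3 * s 3 + c 3 3) + (s 4 * s 2 + c 4 2) + (s 5 * s 1 + c 5 1)) - (s 1 * s 4 + c 1 4 + (s 2 * s 3 + c 2 3) + (s 3 * s 2 + c 3 2) + (s 4 * s 1 + c 4 1)) = P * (s 4 - s 5) + Q * (s 3 - 2 * s 4 + s 5)"
  using L[of 3] unfolding e by (simp add: nums)
 then show "ep5 u + 2 * sj u 1 * sj u 5 + 2 * sj u 2 * sj u 4 + (sj u 3)\<^sup>2 - 2 * sj u 1 * sj u 4 - 2 * sj u 2 * sj u 3 = P * (sj u 4 - sj u 5) + Q * (sj u 3 - 2 * sj u 4 + sj u 5)"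
  unfolding ep5_def s_def[symmetric] c_sym[of 3 2] c_sym[of 4 2] c_sym[of 4 1] c_sym[of 5 1] unfolding c_def by (simp add: power2_eq_square add_divide_distrib diff_divide_distrib)
qed

text \<open>The numbers are those needed for \<open>ep5\<close>: 9 = 5 + 4, and 340 = 104 + 80 + 36
  + 68 + 52 from the constants of \<open>cv_bound\<close>.\<close>

definition EB where "EB u = (9 * \<bar>1 / b - 1\<bar> + 340 * (u\<^sup>2 / (b * th))) / real N"

lemma ep_bounds:
 assumes th0: "th > 0" and u: "u > 0"
 shows "\<bar>ep1 u\<bar> <= EB u" "\<bar>ep2 u\<bar> <= EB u" "\<bar>ep3 u\<bar> <= EB u" "\<bar>ep4 u\<bar> <= EB u" "\<bar>ep5 u\<bar> <= EB u"
proof -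
 define B where "B = \<bar>1 / b - 1\<bar>"
 define G where "G = u\<^sup>2 / (b * th)"
 have BG: "B >= 0" "G >= 0" using b th0 by (auto simp: B_def G_def)
 have dl: "\<bar>dl\<bar> = B / real N" using N by (simp add: dl_def B_def abs_divide)
 have gen: "\<bar>dl * a + c / (real N)\<^sup>2\<bar> <= EB u" if "\<bar>a\<bar> <= 9" "\<bar>c\<bar> <= 340 * G" for a c
 proof -
  have "\<bar>dl * a + c / (real N)\<^sup>2\<bar> <= \<bar>dl\<bar> * \<bar>a\<bar> + \<bar>c\<bar> / (real N)\<^sup>2"
   by (intro order_trans[OF abs_triangle_ineq]) (simp add: abs_mult abs_divide)
  also have "\<bar>dl\<bar> * \<bar>a\<bar> <= B / real N * 9" unfolding dl using that BG by (intro mult_left_mono) auto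
  also have "\<bar>c\<bar> / (real N)\<^sup>2 <= (340 * G) / real N"
  proof (rule frac_le)
   show "real N <= (real N)\<^sup>2" using N by (simp add: power2_eq_square)
  qed (use that BG N in auto)
  finally show ?thesis unfolding EB_def B_def[symmetric] G_def[symmetric] by (simp add: add_divide_distrib mult.commute)
 qed
 have s: "0 <= sj u j" "sj u j <= 1" for j using sj_bounds[of u j] u by auto
 have c: "\<bar>cv u i j\<bar> <= 2 * ((real i)\<^sup>2 + (real j)\<^sup>2) * G" if "i > 0" "j > 0" for i j
  unfolding G_def by (rule cv_bound[OF th0 u that])
 note c11 = c[of 1 1, simplified] and c12 = c[of 1 2, simplified] and c13 = c[of 1 3, simplified] and c14 = c[of 1 4, simplified] and c15 = c[of 1 5, simplified]
  and c22 = c[of 2 2, simplified] and c23 = c[of 2 3, simplified] and c24 = c[of 2 4, simplified] and c33 = c[of 3 3, simplified]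
 show "\<bar>ep1 u\<bar> <= EB u" unfolding ep1_def
  by (rule gen) (use s[of 2] c11 BG in \<open>auto simp: abs_le_iff\<close>)
 show "\<bar>ep2 u\<bar> <= EB u" unfolding ep2_def
 proof (rule gen)
  show "\<bar>2 * sj u 3 - sj u 2\<bar> <= 9" using s[of 2] s[of 3] by linarith
  show "\<bar>2 * cv u 1 2 - cv u 1 1\<bar> <= 340 * G" using c11 c12 BG by (simp add: abs_le_iff)
 qed
 show "\<bar>ep3 u\<bar> <= EB u" unfolding ep3_def
 proof (rule gen)
  show "\<bar>3 * sj u 4 - 2 * sj u 3\<bar> <= 9" using s[of 4] s[of 3] by linarith
  show "\<bar>2 * cv u 1 3 + cv u 2 2 - 2 * cv u 1 2\<bar> <= 340 * G" using c13 c12 c22 BG by (simp add: abs_le_iff)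
 qed
 show "\<bar>ep4 u\<bar> <= EB u" unfolding ep4_def
 proof (rule gen)
  show "\<bar>4 * sj u 5 - 3 * sj u 4\<bar> <= 9" using s[of 4] s[of 5] by linarith
  show "\<bar>2 * cv u 1 4 + 2 * cv u 2 3 - 2 * cv u 1 3 - cv u 2 2\<bar> <= 340 * G" using c13 c14 c22 c23 BG by (simp add: abs_le_iff)
 qed
 show "\<bar>ep5 u\<bar> <= EB u" unfolding ep5_def
 proof (rule gen)
  show "\<bar>5 * sj u 6 - 4 * sj u 5\<bar> <= 9" using s[of 6] s[of 5] by linarith
  show "\<bar>2 * cv u 1 5 + 2 * cv u 2 4 + cv u 3 3 - 2 * cv u 1 4 - 2 * cv u 2 3\<bar> <= 340 * G" using c15 c24 c33 c14 c23 BG by (simp add: abs_le_iff)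
 qed
qed

lemma loop_eq1_v:
 assumes th0: "th > 0" and v: "v > 0"
 shows "th * v\<^sup>2 * ((sj (th * v) 1)\<^sup>2 + ep1 (th * v)) = (1 - 3 * th) * v * (1 - sj (th * v) 1) + th * v * xm 1 - 1 + sj (th * v) 1"
proof -
 have alg: "t * v\<^sup>2 * (S\<^sup>2 + e) = p * v * (1 - S) + t * v * m - 1 + S"
  if "e + S\<^sup>2 = p / (t * v) * (1 - S) + t / (t * v)\<^sup>2 * (t * v * m - 1 + S)" "t > 0" "v > 0" for t e S p m :: real
 proof -
  have "t * v\<^sup>2 * (S\<^sup>2 + e) = t * v\<^sup>2 * (p / (t * v) * (1 - S) + t / (t * v)\<^sup>2 * (t * v * m - 1 + S))" using that by simp
  also have "... = p * v * (1 - S) + (t * v * m - 1 + S)" using that by (simp add: distrib_left power2_eq_square)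
  finally show ?thesis by simp
 qed
 show ?thesis by (rule alg[OF loop_eqs(1)]) (use th0 v in auto)
qed

text \<open>In the variable \<open>v = u / th\<close> the first loop equation is quadratic in \<open>s\<^sub>1\<close>; completing the square
 in it shows that its discriminant is nonnegative for every \<open>v\<close>, and evaluating that at the double
 root \<open>1 / (1 - th)\<close> of the limiting discriminant bounds the first moment from below.\<close>

lemma xm_lower:
 assumes th0: "th > 0"
 shows "xm 1 >= 1 + th + ep1 (th / (1 - th)) / (1 - th)"
proof -
 define v where "v = 1 / (1 - th)"
 have v: "v > 0" using th by (simp add: v_def)
 define S where "S = sj (th * v) 1"
 define e where "e = ep1 (th * v)"
 define p where "p = 1 - 3 * th"
 have eq: "th * v\<^sup>2 * (S\<^sup>2 + e) = p * v * (1 - S) + th * v * xm 1 - 1 + S"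
  unfolding S_def e_def p_def by (rule loop_eq1_v[OF th0 v])
 have "0 <= (2 * th * v\<^sup>2 * S + p * v - 1)\<^sup>2" by simp
 also have "... = 4 * th * v\<^sup>2 * (th * v\<^sup>2 * (S\<^sup>2 + e) - (p * v * (1 - S) - 1 + S)) + (p * v - 1)\<^sup>2 + 4 * th * v\<^sup>2 * (p * v - 1) - 4 * th\<^sup>2 * v ^ 4 * e"
  by (simp add: power2_eq_square power4_eq_xxxx algebra_simps)
 also have "th * v\<^sup>2 * (S\<^sup>2 + e) - (p * v * (1 - S) - 1 + S) = th * v * xm 1" using eq by simp
 also have "4 * th * v\<^sup>2 * (th * v * xm 1) + (p * v - 1)\<^sup>2 + 4 * th * v\<^sup>2 * (p * v - 1) - 4 * th\<^sup>2 * v ^ 4 * e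
  = 4 * th\<^sup>2 * v ^ 3 * (xm 1 - (1 + th) - v * e)"
 proof -
  have t: "th * v = v - 1" using th by (simp add: v_def field_simps)
  have "(p * v - 1)\<^sup>2 + 4 * th * v\<^sup>2 * (p * v - 1) = - 4 * th\<^sup>2 * v ^ 3 * (1 + th)"
  proof -
   have pv: "p * v - 1 = - 2 * (th * v)" unfolding p_def using t by (simp add: algebra_simps)
   have "(p * v - 1)\<^sup>2 + 4 * th * v\<^sup>2 * (p * v - 1) = 4 * (th * v) * (th * v) - 8 * (th * v) * (th * v) * v"
    unfolding pv by (simp add: power2_eq_square)
   also have "... = - 4 * (th * v) * (th * v) * (2 * v - 1)" by (simp add: algebra_simps)
   also have "2 * v - 1 = v + th * v" using t by simp
   also have "- 4 * (th * v) * (th * v) * (v + th * v) = - 4 * th\<^sup>2 * v ^ 3 * (1 + th)" by (simp add: power2_eq_square power3_eq_cube algebra_simps)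
   finally show ?thesis .
  qed
  then show ?thesis by (simp add: algebra_simps power2_eq_square power3_eq_cube power4_eq_xxxx)
 qed
 finally have "0 <= 4 * th\<^sup>2 * v ^ 3 * (xm 1 - (1 + th) - v * e)" .
 moreover have "0 < 4 * th\<^sup>2 * v ^ 3" using th0 v by simp
 ultimately have "0 <= xm 1 - (1 + th) - v * e" by (simp add: zero_le_mult_iff)
 then show ?thesis unfolding e_def v_def by simp
qed

text \<open>In the limit the function \<open>F\<close> of the proof is ((1 - th) v - 1) sqrt(1 + 4
  th v), which changes sign at 1 / (1 - th). For finite N it is -1 at 0. If it were negative at
  \<open>V\<close>, the first loop equation would give V ((1 - 3 th) + th xm 1) <= 1 + th V^2 ep1.
  With w = 1 - th, \<open>xm_lower\<close> makes the left side at least 2 - w/4, while the smallness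
  of \<open>EB\<close> keeps the right side at most 3/2. \<open>V\<close> is chosen so that V w^2 =
  2.\<close>

lemma zero_exists:
 assumes th0: "th > 0"
 defines "V \<equiv> 2 / (1 - th)\<^sup>2"
 assumes small: "EB (th * V) <= (1 - th) ^ 4 / 8"
 obtains v where "0 < v" "v <= V" "2 * th * v\<^sup>2 * sj (th * v) 1 + (1 - 3 * th) * v = 1"
proof -
 define F where "F v = 2 * th * v\<^sup>2 * sj (th * v) 1 + (1 - 3 * th) * v - 1" for v
 define w where "w = 1 - th"
 have w: "0 < w" "w <= 1" using th by (auto simp: w_def)
 have V: "V > 0" "V * w\<^sup>2 = 2" using w by (auto simp: V_def w_def)
 have V1: "1 / w <= V"
 proof -
  have "1 / w = w / w\<^sup>2" using w by (simp add: power2_eq_square)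
  also have "... <= 2 / w\<^sup>2" using w by (intro divide_right_mono) auto
  finally show ?thesis by (simp add: V_def w_def)
 qed
 have EBm: "EB u <= EB (th * V)" if "0 <= u" "u <= th * V" for u
 proof -
  have "u\<^sup>2 <= (th * V)\<^sup>2" using that by (intro power_mono) auto
  then show ?thesis unfolding EB_def using b th0 N by (intro divide_right_mono add_left_mono mult_left_mono) auto
 qed
 have e0: "\<bar>ep1 (th / w)\<bar> <= w ^ 4 / 8"
  using ep_bounds(1)[OF th0, of "th / w"] EBm[of "th / w"] small V1 th0 w mult_left_mono[OF V1, of th] by (simp add: w_def)
 have eV: "\<bar>ep1 (th * V)\<bar> <= w ^ 4 / 8" using ep_bounds(1)[OF th0, of "th * V"] small th0 V by (simp add: w_def)
 have m: "(1 - 3 * th) + th * xm 1 >= w\<^sup>2 - w ^ 3 / 8"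
 proof -
  have "ep1 (th / w) / w >= - (w ^ 4 / 8) / w" using e0 w by (intro divide_right_mono) auto
  also have "- (w ^ 4 / 8) / w = - (w ^ 3 / 8)" using w by (simp add: power4_eq_xxxx power3_eq_cube)
  finally have "xm 1 >= 1 + th - w ^ 3 / 8" using xm_lower[OF th0] by (simp add: w_def)
  then have "th * xm 1 >= th * (1 + th - w ^ 3 / 8)" using th0 by (intro mult_left_mono) auto
  also have "th * (1 + th - w ^ 3 / 8) = th + th\<^sup>2 - th * (w ^ 3 / 8)" by (simp add: algebra_simps power2_eq_square)
  finally have "th * xm 1 >= th + th\<^sup>2 - w ^ 3 / 8"
  proof -
   assume *: "th + th\<^sup>2 - th * (w ^ 3 / 8) <= th * xm 1"
   have "th * (w ^ 3 / 8) <= 1 * (w ^ 3 / 8)" using th w by (intro mult_right_mono) auto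
   with * show ?thesis by linarith
  qed
  then show ?thesis by (simp add: w_def power2_eq_square algebra_simps)
 qed
 have FV: "F V >= 0"
 proof (rule ccontr)
  assume "\<not> F V >= 0"
  define S where "S = sj (th * V) 1"
  define e where "e = ep1 (th * V)"
  have S: "0 <= S" unfolding S_def using sj_bounds[of "th * V" 1] th0 V by auto
  have neg: "2 * th * V\<^sup>2 * S + (1 - 3 * th) * V - 1 < 0" using \<open>\<not> F V >= 0\<close> by (simp add: F_def S_def)
  have eq: "th * V\<^sup>2 * (S\<^sup>2 + e) = (1 - 3 * th) * V * (1 - S) + th * V * xm 1 - 1 + S"
   unfolding S_def e_def by (rule loop_eq1_v[OF th0 V(1)])
  have "S * (2 * th * V\<^sup>2 * S + (1 - 3 * th) * V - 1) <= 0" using neg S by (simp add: mult_nonneg_nonpos)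
  moreover have "0 <= th * V\<^sup>2 * S\<^sup>2" using th0 by simp
  ultimately have "V * ((1 - 3 * th) + th * xm 1) - 1 - th * V\<^sup>2 * e <= 0" using eq by (simp add: algebra_simps power2_eq_square)
  moreover have "V * ((1 - 3 * th) + th * xm 1) >= V * (w\<^sup>2 - w ^ 3 / 8)" using m V by (intro mult_left_mono) auto
  moreover have "V * (w\<^sup>2 - w ^ 3 / 8) = 2 - w / 4"
  proof -
   have "V * (w\<^sup>2 - w ^ 3 / 8) = (V * w\<^sup>2) * (1 - w / 8)" by (simp add: power2_eq_square power3_eq_cube algebra_simps)
   then show ?thesis using V by simp
  qed
  moreover have "th * V\<^sup>2 * e <= 1 / 2"
  proof -
   have "th * V\<^sup>2 * e <= th * V\<^sup>2 * \<bar>e\<bar>" using th0 by (intro mult_left_mono) auto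
   also have "... <= 1 * V\<^sup>2 * (w ^ 4 / 8)" using eV th th0 unfolding e_def by (intro mult_mono) auto
   also have "... = (V * w\<^sup>2)\<^sup>2 / 8" by (simp add: power_mult_distrib)
   finally show ?thesis using V by simp
  qed
  ultimately show False using w by linarith
 qed
 have cont: "continuous_on {0..V} F"
 proof -
  have "continuous_on {0..V} (%v. sj (th * v) 1)"
  proof (rule lipschitz_onI[where L = "th * xm 1", THEN lipschitz_on_continuous_on])
   fix x y assume "x \<in> {0..V}" "y \<in> {0..V}"
   then have "\<bar>sj (th * x) 1 - sj (th * y) 1\<bar> <= \<bar>th * x - th * y\<bar> * xm 1" using th0 by (intro sj1_lipschitz) auto
   then show "dist (sj (th * x) 1) (sj (th * y) 1) <= th * xm 1 * dist x y"
    using th0 by (simp add: dist_real_def right_diff_distrib[symmetric] abs_mult mult_ac)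
  qed (use th0 xm_bounds in auto)
  then show ?thesis unfolding F_def[abs_def] by (intro continuous_intros)
 qed
 have "F 0 <= 0" by (simp add: F_def)
 from IVT'[of F 0 0 V, OF this FV _ cont] V obtain v where v: "0 <= v" "v <= V" "F v = 0" by auto
 moreover have "v ~= 0" using v by (auto simp: F_def)
 ultimately show ?thesis using that[of v] by (simp add: F_def)
qed

text \<open>At the zero, P = Q - 2 s1 and Q = 1 / z, and the hierarchy becomes triangular: a
  quadratic equation for s1, one for s2, then linear ones for s3 and s4, while the variance equation
  loses its \<open>cv 1 2\<close> term at leading order.\<close>

lemma eqs_at_zero:
 assumes th0: "th > 0" and v: "v > 0" and zero: "2 * th * v\<^sup>2 * sj (th * v) 1 + (1 - 3 * th) * v = 1"
 defines "s \<equiv> sj (th * v)" and "z \<equiv> th * v\<^sup>2"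
 shows "xm 1 = v * (2 * s 1 - (s 1)\<^sup>2 + ep1 (th * v))"
  "z * ((s 1)\<^sup>2 + ep2 (th * v)) = 1 - s 1"
  "z * ((s 2)\<^sup>2 + ep3 (th * v)) = s 1 - s 2"
  "z * (2 * s 2 * s 3 - (s 2)\<^sup>2 + ep4 (th * v)) = s 2 - s 3"
  "z * (2 * s 2 * s 4 + (s 3)\<^sup>2 - 2 * s 2 * s 3 + ep5 (th * v)) = s 3 - s 4"
  "real N * b * (2 * s 2 + 1 / z) * cv (th * v) 1 1 + b * (2 * k3 (th * v) 2 - k3 (th * v) 1) + (1 - b) * (2 * cv (th * v) 1 3 - cv (th * v) 1 2)
   = real N * (s 3 - s 4)"
proof -
 define u where "u = th * v"
 have u: "u > 0" using th0 v by (simp add: u_def)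
 define P where "P = (1 - 3 * th) / u"
 define Q where "Q = th / u\<^sup>2"
 have z: "z > 0" "Q = 1 / z" using th0 v by (auto simp: z_def Q_def u_def power2_eq_square)
 have PQ: "P = Q - 2 * s 1"
 proof -
  have "(1 - 3 * th) * v = 1 - 2 * z * s 1" using zero by (simp add: z_def s_def)
  moreover have "P = (1 - 3 * th) * v / z" using v th0 by (simp add: P_def u_def z_def power2_eq_square)
  ultimately have "P = (1 - 2 * z * s 1) / z" by simp
  also have "... = Q - 2 * s 1" using z by (simp add: diff_divide_distrib)
  finally show ?thesis .
 qed
 note L = loop_eqs[OF u, folded P_def Q_def, unfolded u_def, folded s_def, unfolded PQ]
 have zQ: "z * Q = 1" using z by simp
 have fin: "z * a = c" if "a = Q * c" for a c using that z by simp
 show "z * ((s 1)\<^sup>2 + ep2 (th * v)) = 1 - s 1" by (rule fin) (use L(2) in \<open>simp add: power2_eq_square algebra_simps\<close>)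
 show "z * ((s 2)\<^sup>2 + ep3 (th * v)) = s 1 - s 2" by (rule fin) (use L(3) in \<open>simp add: power2_eq_square algebra_simps\<close>)
 show "z * (2 * s 2 * s 3 - (s 2)\<^sup>2 + ep4 (th * v)) = s 2 - s 3" by (rule fin) (use L(4) in \<open>simp add: power2_eq_square algebra_simps\<close>)
 show "z * (2 * s 2 * s 4 + (s 3)\<^sup>2 - 2 * s 2 * s 3 + ep5 (th * v)) = s 3 - s 4" by (rule fin) (use L(5) in \<open>simp add: power2_eq_square algebra_simps\<close>)
 have "Q * (u * xm 1) = 2 * s 1 - (s 1)\<^sup>2 + ep1 (th * v)" using L(1) by (simp add: power2_eq_square algebra_simps u_def)
 moreover have "Q * (u * xm 1) = xm 1 / v" using v th0 by (simp add: Q_def u_def power2_eq_square)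
 ultimately have "xm 1 / v = 2 * s 1 - (s 1)\<^sup>2 + ep1 (th * v)" by simp
 then show "xm 1 = v * (2 * s 1 - (s 1)\<^sup>2 + ep1 (th * v))" using v by (simp add: field_simps)
 have "2 * s 1 * cv u 1 2 + 2 * s 2 * cv u 1 1 - 2 * s 1 * cv u 1 1 - P * (cv u 1 1 - cv u 1 2) - Q * (cv u 1 2 - 2 * cv u 1 1)
  = (2 * s 2 + Q) * cv u 1 1" unfolding PQ by (simp add: algebra_simps)
 then show "real N * b * (2 * s 2 + 1 / z) * cv (th * v) 1 1 + b * (2 * k3 (th * v) 2 - k3 (th * v) 1) + (1 - b) * (2 * cv (th * v) 1 3 - cv (th * v) 1 2)
   = real N * (s 3 - s 4)"
  using loop_variance[OF u] unfolding P_def[symmetric] Q_def[symmetric] u_def[symmetric] s_def z(2)[symmetric] by (simp add: mult.assoc)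
qed

end

context wall_gas
begin

text \<open>Two conditions on s1 hold at the zero, the vanishing condition and the second loop
  equation; eliminating s1 expresses the displacement (1 - th) v - 1 through \<open>ep2\<close>. In
  the first moment the displacement enters only through its square, the mark of a double root; hence
  \<open>ep1\<close> is needed to precision o(N^-2) but \<open>ep2\<close> only to o(1/N).\<close>

lemma first_moment_at_zero:
 assumes th0: "th > 0" and v: "v > 0" and zero: "2 * th * v\<^sup>2 * sj (th * v) 1 + (1 - 3 * th) * v = 1"
 defines "D \<equiv> 3 - (1 - 9 * th) * v"
 shows "D >= 2" "((1 - th) * v - 1) * D = 4 * th\<^sup>2 * v ^ 4 * ep2 (th * v)"
  "xm 1 = 1 + th + v * ep1 (th * v) - 4 * th\<^sup>2 * v ^ 5 * (1 + 4 * th * v) * (ep2 (th * v))\<^sup>2 / D\<^sup>2"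
proof -
 define S where "S = sj (th * v) 1"
 define y where "y = 1 - (1 - 3 * th) * v"
 define x where "x = (1 - th) * v - 1"
 have S0: "S >= 0" unfolding S_def using sj_bounds[of "th * v" 1] th0 v by simp
 have yS: "2 * th * v\<^sup>2 * S = y" using zero by (simp add: y_def S_def)
 then have "y >= 0" using S0 th0 by (metis mult_nonneg_nonneg less_imp_le zero_le_numeral zero_le_power2)
 moreover have "D - 2 = y + 6 * (th * v)" by (simp add: y_def D_def algebra_simps)
 moreover have "0 <= th * v" using th0 v by simp
 ultimately show D2: "D >= 2" by linarith
 have "th * v\<^sup>2 * (S\<^sup>2 + ep2 (th * v)) = 1 - S" unfolding S_def by (rule eqs_at_zero(2)[OF th0 v zero])
 then have "4 * th * v\<^sup>2 * (th * v\<^sup>2 * (S\<^sup>2 + ep2 (th * v))) = 4 * th * v\<^sup>2 * (1 - S)" by simp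
 then have "(2 * th * v\<^sup>2 * S)\<^sup>2 + 4 * th\<^sup>2 * v ^ 4 * ep2 (th * v) = 4 * th * v\<^sup>2 - 2 * (2 * th * v\<^sup>2 * S)"
  by (simp add: power2_eq_square power4_eq_xxxx algebra_simps)
 then have "y\<^sup>2 + 4 * th\<^sup>2 * v ^ 4 * ep2 (th * v) = 4 * th * v\<^sup>2 - 2 * y" unfolding yS .
 moreover have "4 * th * v\<^sup>2 - 2 * y - y\<^sup>2 = x * D" unfolding y_def x_def D_def by (simp add: power2_eq_square algebra_simps)
 ultimately show xD: "((1 - th) * v - 1) * D = 4 * th\<^sup>2 * v ^ 4 * ep2 (th * v)" unfolding x_def by simp
 have "v * (2 * S - S\<^sup>2) = 1 + th - x\<^sup>2 * (1 + 4 * th * v) / (4 * th\<^sup>2 * v ^ 3)"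
 proof -
  have "4 * th\<^sup>2 * v ^ 3 * (v * (2 * S - S\<^sup>2)) = 4 * th * v\<^sup>2 * (2 * th * v\<^sup>2 * S) - (2 * th * v\<^sup>2 * S)\<^sup>2"
   by (simp add: power2_eq_square power3_eq_cube algebra_simps)
  also have "... = 4 * th\<^sup>2 * v ^ 3 * (1 + th) - x\<^sup>2 * (1 + 4 * th * v)"
   unfolding yS y_def x_def by (simp add: power2_eq_square power3_eq_cube algebra_simps)
  finally show ?thesis using th0 v by (simp add: divide_simps) (simp add: algebra_simps)
 qed
 moreover have "x\<^sup>2 * (1 + 4 * th * v) / (4 * th\<^sup>2 * v ^ 3) = 4 * th\<^sup>2 * v ^ 5 * (1 + 4 * th * v) * (ep2 (th * v))\<^sup>2 / D\<^sup>2"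
 proof -
  have "x = 4 * th\<^sup>2 * v ^ 4 * ep2 (th * v) / D" using xD D2 by (simp add: x_def eq_divide_eq)
  then have "x\<^sup>2 = 16 * th ^ 4 * v ^ 8 * (ep2 (th * v))\<^sup>2 / D\<^sup>2" by (simp add: power_divide power_mult_distrib power_mult[symmetric])
  then show ?thesis using th0 v by (simp add: divide_simps) (simp add: eval_nat_numeral algebra_simps)
 qed
 ultimately show "xm 1 = 1 + th + v * ep1 (th * v) - 4 * th\<^sup>2 * v ^ 5 * (1 + 4 * th * v) * (ep2 (th * v))\<^sup>2 / D\<^sup>2"
  using eqs_at_zero(1)[OF th0 v zero] unfolding S_def[symmetric] by (simp add: algebra_simps)
qed

end

text \<open>In terms of the theorem's parameter, \<open>sg (\<gamma>\<^sup>2 / t) = (s + 1) / (s - 1)\<close>.\<close>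

definition sg :: "real => real" where "sg th = sqrt ((1 + 3 * th) / (1 - th))"

text \<open>What remains of the first moment once its terms of order \<open>1\<close> and \<open>1 / N\<close> are removed.\<close>

definition RN :: "nat => real => real => real" where
 "RN N b th = (real N)\<^sup>2 * (wall_gas.xm N b th 1 - (1 + th)) - real N * (1 / b - 1) * (2 / (sg th + 1))"

text \<open>The limiting discriminant is ((1 - th) v - 1)^2 (1 + 4 th v), and \<open>sg th\<close>
  is the square root of its simple factor at the double root v = 1 / (1 - th). It rationalises the
  problem: \<open>th\<close>, 1 / (1 - th) and all limits below are rational functions of
  it.\<close>

lemma sg_props:
 assumes "0 <= th" "th < 1"
 shows "sg th >= 1" "(sg th)\<^sup>2 = (1 + 3 * th) / (1 - th)" "th = ((sg th)\<^sup>2 - 1) / ((sg th)\<^sup>2 + 3)" "1 / (1 - th) = ((sg th)\<^sup>2 + 3) / 4"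
  "0 < th ==> sg th > 1"
proof -
 show sq: "(sg th)\<^sup>2 = (1 + 3 * th) / (1 - th)" unfolding sg_def using assms by simp
 have "1 <= (1 + 3 * th) / (1 - th)" using assms by (simp add: le_divide_eq)
 then show "sg th >= 1" by (simp add: sg_def)
 show "th = ((sg th)\<^sup>2 - 1) / ((sg th)\<^sup>2 + 3)" unfolding sq using assms by (simp add: divide_simps)
 show "1 / (1 - th) = ((sg th)\<^sup>2 + 3) / 4" unfolding sq using assms by (simp add: divide_simps)
 assume "0 < th"
 then have "1 < (1 + 3 * th) / (1 - th)" using assms by (simp add: less_divide_eq)
 then show "sg th > 1" by (simp add: sg_def)
qed

context wall_gas
begin

text \<open>Subtracting from the equations at the zero \<open>v\<close> their limits at \<open>1 / (1 - th)\<close>.\<close>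

lemma deviations:
 assumes th0: "th > 0" and v: "v > 0" and zero: "2 * th * v\<^sup>2 * sj (th * v) 1 + (1 - 3 * th) * v = 1"
 defines "v0 \<equiv> 1 / (1 - th)" and "S1 \<equiv> 1 - th" and "S2 \<equiv> 2 * (1 - th) / (sg th + 1)"
 shows "v - v0 = ((1 - th) * v - 1) / (1 - th)"
  "sj (th * v) 1 - S1 = (v - v0) * (- (1 - 3 * th) - 2 * th * S1 * (v + v0)) / (2 * th * v\<^sup>2)"
  "sj (th * v) 2 - S2 = ((sj (th * v) 1 - S1) - th * v\<^sup>2 * ep3 (th * v) - th * S2\<^sup>2 * (v + v0) * (v - v0)) / (1 + th * v\<^sup>2 * (sj (th * v) 2 + S2))"
  "RN N b th = real N * (1 / b - 1) * (v * sj (th * v) 2 - v0 * S2) + v * cv (th * v) 1 1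
    - 4 * th\<^sup>2 * v ^ 5 * (1 + 4 * th * v) * (real N * ep2 (th * v))\<^sup>2 / (3 - (1 - 9 * th) * v)\<^sup>2"
proof -
 have w: "1 - th > 0" using th by simp
 have s: "sg th > 1" "th = ((sg th)\<^sup>2 - 1) / ((sg th)\<^sup>2 + 3)" "1 / (1 - th) = ((sg th)\<^sup>2 + 3) / 4" using sg_props[of th] th th0 by auto
 show "v - v0 = ((1 - th) * v - 1) / (1 - th)" using w by (simp add: v0_def diff_divide_distrib)
 have "2 * th * v\<^sup>2 * (sj (th * v) 1 - S1) = (v - v0) * (- (1 - 3 * th) - 2 * th * S1 * (v + v0))"
 proof -
  have z0: "2 * th * v0\<^sup>2 * S1 + (1 - 3 * th) * v0 = 1"
   unfolding v0_def S1_def using w by (simp add: power2_eq_square divide_simps)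
  have "2 * th * v\<^sup>2 * (sj (th * v) 1 - S1) = (1 - (1 - 3 * th) * v) - (1 - (1 - 3 * th) * v0) - 2 * th * S1 * (v\<^sup>2 - v0\<^sup>2)"
   using zero z0 by (simp add: algebra_simps)
  then show ?thesis by (simp add: power2_eq_square algebra_simps)
 qed
 then show "sj (th * v) 1 - S1 = (v - v0) * (- (1 - 3 * th) - 2 * th * S1 * (v + v0)) / (2 * th * v\<^sup>2)"
  using th0 v by (simp add: eq_divide_eq mult.commute)
 \<comment> \<open>\<open>S1\<close> and \<open>S2\<close> are the limits of s1 and s2; this is the
   third loop equation at the zero without its error term.\<close>
 have S2: "th * v0\<^sup>2 * S2\<^sup>2 + S2 = S1"
 proof -
  define g where "g = sg th"
  have g: "g > 1" using s by (simp add: g_def)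
  have v0: "v0 = (g\<^sup>2 + 3) / 4" unfolding v0_def g_def by (rule s(3))
  have w4: "1 - th = 4 / (g\<^sup>2 + 3)"
  proof -
   have "1 - th = 1 / (1 / (1 - th))" by simp
   also have "1 / (1 - th) = (g\<^sup>2 + 3) / 4" unfolding g_def by (rule s(3))
   finally show ?thesis by simp
  qed
  have p: "g\<^sup>2 + 3 ~= 0" using g by (simp add: add_nonneg_eq_0_iff)
  have tv: "th * v0\<^sup>2 = (g - 1) * (g + 1) * (g\<^sup>2 + 3) / 16"
   unfolding v0 using s(2) p unfolding g_def[symmetric] by (simp add: power2_eq_square divide_simps) (simp add: algebra_simps)
  have S2g: "S2 = 8 / ((g + 1) * (g\<^sup>2 + 3))" unfolding S2_def w4 g_def[symmetric] by simp
  show ?thesis unfolding tv S2g S1_def w4 using g p by (simp add: power2_eq_square divide_simps)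
 qed
 have pos: "1 + th * v\<^sup>2 * (sj (th * v) 2 + S2) > 0"
 proof -
  have "S2 >= 0" unfolding S2_def using w s(1) by auto
  then show ?thesis using sj_bounds[of "th * v" 2] th0 v by (intro add_pos_nonneg mult_nonneg_nonneg) auto
 qed
 have "th * v\<^sup>2 * ((sj (th * v) 2)\<^sup>2 + ep3 (th * v)) = sj (th * v) 1 - sj (th * v) 2" by (rule eqs_at_zero(3)[OF th0 v zero])
 then have "(sj (th * v) 2 - S2) * (1 + th * v\<^sup>2 * (sj (th * v) 2 + S2)) = (sj (th * v) 1 - S1) - th * v\<^sup>2 * ep3 (th * v) - th * S2\<^sup>2 * (v + v0) * (v - v0)"
  using S2 by (simp add: power2_eq_square algebra_simps)
 then show "sj (th * v) 2 - S2 = ((sj (th * v) 1 - S1) - th * v\<^sup>2 * ep3 (th * v) - th * S2\<^sup>2 * (v + v0) * (v - v0)) / (1 + th * v\<^sup>2 * (sj (th * v) 2 + S2))"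
  using pos by (simp add: eq_divide_eq)
 have vS: "v0 * S2 = 2 / (sg th + 1)"
 proof -
  have "1 / a * (2 * a / d) = 2 / d" if "a ~= 0" for a d :: real using that by simp
  from this[of "1 - th" "sg th + 1"] show ?thesis unfolding v0_def S2_def using w by simp
 qed
 have n: "real N ~= 0" using N by simp
 have "(real N)\<^sup>2 * (v * ep1 (th * v)) = real N * (1 / b - 1) * (v * sj (th * v) 2) + v * cv (th * v) 1 1"
  unfolding ep1_def dl_def using n by (simp add: power2_eq_square distrib_left)
 then show "RN N b th = real N * (1 / b - 1) * (v * sj (th * v) 2 - v0 * S2) + v * cv (th * v) 1 1
    - 4 * th\<^sup>2 * v ^ 5 * (1 + 4 * th * v) * (real N * ep2 (th * v))\<^sup>2 / (3 - (1 - 9 * th) * v)\<^sup>2"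
  unfolding RN_def first_moment_at_zero(3)[OF th0 v zero] vS by (simp add: algebra_simps power_mult_distrib)
qed

definition K1 where "K1 V = 9 * \<bar>1 / b - 1\<bar> + 340 * (V\<^sup>2 / b)"

text \<open>With u = th v the quotient u^2 / (b th) is th v^2 / b, so N times the error terms is
  bounded uniformly down to th = 0.\<close>

lemma N_ep_bound:
 assumes th0: "th > 0" and v: "0 < v" "v <= V" and e: "\<bar>e\<bar> <= EB (th * v)"
 shows "real N * \<bar>e\<bar> <= K1 V"
proof -
 have "(th * v)\<^sup>2 / (b * th) <= V\<^sup>2 / b"
 proof -
  have "(th * v)\<^sup>2 / (b * th) = th * v\<^sup>2 / b" using th0 by (simp add: power2_eq_square)
  also have "... <= 1 * V\<^sup>2 / b" using th v b by (intro divide_right_mono mult_mono power_mono) auto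
  finally show ?thesis by simp
 qed
 then have "real N * EB (th * v) <= K1 V" using N unfolding EB_def K1_def by simp
 moreover have "real N * \<bar>e\<bar> <= real N * EB (th * v)" using e by (intro mult_left_mono) auto
 ultimately show ?thesis by simp
qed

end

text \<open>The factor \<open>th\<close> is what makes \<open>RN\<close> divided by
  \<open>th\<close> integrable at 0. It comes from the covariance bound, from the two powers of
  \<open>th\<close> in the displacement of the zero, one of which is lost when s1 is recovered by
  dividing by 2 th v^2, and from explicit factors of \<open>th\<close> in the remaining
  terms.\<close>

lemma RN_bound:
 assumes b: "b > 0" and t0: "0 < t0" "t0 < 1"
 obtains K N1 where "!!N th. N >= N1 ==> 0 < th ==> th <= t0 ==> \<bar>RN N b th\<bar> <= K * th"
proof -
 define w where "w = 1 - t0"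
 define V where "V = 2 / w\<^sup>2"
 define A where "A = 9 * \<bar>1 / b - 1\<bar> + 340 * (V\<^sup>2 / b)"
 define K2 where "K2 = 2 * V ^ 4 * A / w"
 define K3 where "K3 = K2 * (4 + 8 * V)"
 define K4 where "K4 = K3 + V\<^sup>2 * A + 2 * V * K2"
 define K where "K = \<bar>1 / b - 1\<bar> * (K2 + V * K4) + 4 * V ^ 3 / b + V ^ 5 * (1 + 4 * V) * A\<^sup>2"
 have w: "0 < w" "w <= 1" using t0 by (auto simp: w_def)
 have V: "V > 0" "1 <= V" "1 / w <= V"
 proof -
  have "1 / w = w / w\<^sup>2" using w by (simp add: power2_eq_square)
  also have "... <= 2 / w\<^sup>2" using w by (intro divide_right_mono) auto
  finally show "1 / w <= V" by (simp add: V_def)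
  moreover have "1 <= 1 / w" using w by simp
  ultimately show "1 <= V" "V > 0" by linarith+
 qed
 have A: "A >= 0" unfolding A_def using b by simp
 \<comment> \<open>The first summand makes the hypothesis of \<open>zero_exists\<close> hold; the
   second bounds the displacement by 1/2 and so keeps \<open>v\<close> at least 1/2.\<close>
 obtain N1 :: nat where N1: "real N1 >= 8 * A / w ^ 4 + 4 * V ^ 4 * A + 1" using real_arch_simple by blast
 show ?thesis
 proof (rule that[of N1 K])
  fix N th assume NN: "N >= N1" and tp: "0 < th" "th <= t0"
  have "0 <= 8 * A / w ^ 4" "0 <= 4 * V ^ 4 * A" using A w V by auto
  then have Nb: "real N >= 8 * A / w ^ 4" "real N >= 4 * V ^ 4 * A" "real N >= 1" using N1 NN by linarith+
  interpret wall_gas N b th by unfold_locales (use Nb b tp t0 in auto)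
  define Vt where "Vt = 2 / (1 - th)\<^sup>2"
  have wt: "w <= 1 - th" using tp by (simp add: w_def)
  have "w\<^sup>2 <= (1 - th)\<^sup>2" using wt w by (intro power_mono) auto
  then have Vt: "0 < Vt" "Vt <= V" unfolding Vt_def V_def using w wt by (auto intro!: divide_left_mono mult_pos_pos)
  have A_eq: "K1 V = A" by (simp add: K1_def A_def)
  have "EB (th * Vt) <= (1 - th) ^ 4 / 8"
  proof -
   have "\<bar>EB (th * Vt)\<bar> <= EB (th * Vt)" using b tp unfolding EB_def by simp
   then have "real N * \<bar>EB (th * Vt)\<bar> <= A" using N_ep_bound[of Vt V "EB (th * Vt)"] Vt tp A_eq by simp
   also have "A <= real N * (w ^ 4 / 8)" using Nb(1) w by (simp add: field_simps)
   finally have "real N * \<bar>EB (th * Vt)\<bar> <= real N * (w ^ 4 / 8)" .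
   then have "EB (th * Vt) <= w ^ 4 / 8" using Nb by (simp add: mult_le_cancel_left_pos)
   also have "w ^ 4 / 8 <= (1 - th) ^ 4 / 8" using wt w by (intro divide_right_mono power_mono) auto
   finally show ?thesis .
  qed
  from zero_exists[OF tp(1), folded Vt_def, OF this] obtain v where v: "0 < v" "v <= Vt" and zero: "2 * th * v\<^sup>2 * sj (th * v) 1 + (1 - 3 * th) * v = 1" by blast
  have vV: "v <= V" using v Vt by simp
  define v0 where "v0 = 1 / (1 - th)"
  define S1 where "S1 = 1 - th"
  define S2 where "S2 = 2 * (1 - th) / (sg th + 1)"
  have sg1: "sg th > 1" using sg_props(5)[of th] tp t0 by simp
  have S12: "0 <= S1" "S1 <= 1" "0 <= S2" "S2 <= 1" using tp t0 sg1 by (auto simp: S1_def S2_def divide_le_eq)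
  have v0: "0 < v0" "v0 <= V" using wt w V(3) tp t0 unfolding v0_def
   by (auto intro: order_trans[OF divide_left_mono[of w "1 - th" 1]])
  have thb: "th <= 1" using tp t0 by simp
  note ep = ep_bounds[OF tp(1), of "th * v"]
  have thv: "th * v > 0" using tp v by simp
  have e2: "real N * \<bar>ep2 (th * v)\<bar> <= A" and e3: "real N * \<bar>ep3 (th * v)\<bar> <= A"
   using N_ep_bound[OF tp(1) v(1) vV ep(2)[OF thv]] N_ep_bound[OF tp(1) v(1) vV ep(3)[OF thv]] A_eq by auto
  define x where "x = (1 - th) * v - 1"
  define D where "D = 3 - (1 - 9 * th) * v"
  note fm = first_moment_at_zero[OF tp(1) v(1) zero, folded D_def x_def]
  have x_le: "real N * \<bar>x\<bar> <= 2 * th\<^sup>2 * V ^ 4 * A"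
  proof -
   have "\<bar>x\<bar> * 2 <= \<bar>x\<bar> * \<bar>D\<bar>" using fm(1) by (intro mult_left_mono) auto
   also have "... = 4 * th\<^sup>2 * v ^ 4 * \<bar>ep2 (th * v)\<bar>" using fm(2) v by (simp add: abs_mult[symmetric]) (simp add: abs_mult)
   finally have "\<bar>x\<bar> <= 2 * th\<^sup>2 * v ^ 4 * \<bar>ep2 (th * v)\<bar>" by simp
   then have "real N * \<bar>x\<bar> <= real N * (2 * th\<^sup>2 * v ^ 4 * \<bar>ep2 (th * v)\<bar>)" by (intro mult_left_mono) auto
   also have "... = 2 * th\<^sup>2 * v ^ 4 * (real N * \<bar>ep2 (th * v)\<bar>)" by simp
   also have "... <= 2 * th\<^sup>2 * V ^ 4 * A" using e2 vV v A tp by (intro mult_mono power_mono) auto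
   finally show ?thesis .
  qed
  have th2: "th\<^sup>2 <= 1" using tp thb by (simp add: power_le_one)
  have "real N * \<bar>x\<bar> <= real N * (1/2)"
  proof -
   have "2 * th\<^sup>2 * V ^ 4 * A <= 2 * 1 * V ^ 4 * A" using th2 V A by (intro mult_right_mono mult_left_mono) auto
   then show ?thesis using x_le Nb(2) by linarith
  qed
  then have "\<bar>x\<bar> <= 1/2" using Nb by (simp add: mult_le_cancel_left_pos)
  then have v_half: "v >= 1/2"
  proof -
   assume "\<bar>x\<bar> <= 1/2"
   then have "1/2 <= (1 - th) * v" unfolding x_def by linarith
   also have "... <= 1 * v" using tp v by (intro mult_right_mono) auto
   finally show ?thesis by simp
  qed
  note dev = deviations[OF tp(1) v(1) zero, folded v0_def S1_def S2_def, folded x_def D_def]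
  have dv: "real N * \<bar>v - v0\<bar> <= th\<^sup>2 * K2"
  proof -
   have "real N * \<bar>v - v0\<bar> = (real N * \<bar>x\<bar>) / (1 - th)" unfolding dev(1) S1_def[symmetric] using tp t0 by (simp add: S1_def abs_divide x_def)
   also have "... <= (2 * th\<^sup>2 * V ^ 4 * A) / w" using x_le wt w V A by (intro frac_le) auto
   finally show ?thesis by (simp add: K2_def mult_ac)
  qed
  have K20: "0 <= K2" using V A w by (simp add: K2_def)
  \<comment> \<open>Division by 2 th v^2 costs one of the two powers of \<open>th\<close> in
    \<open>dv\<close>.\<close>
  have ds1: "real N * \<bar>sj (th * v) 1 - S1\<bar> <= th * K3"
  proof -
   have a: "\<bar>- (1 - 3 * th) - 2 * th * S1 * (v + v0)\<bar> <= 2 + 4 * V"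
   proof -
    have "0 <= th * S1 * (v + v0)" using tp S12 v v0 by simp
    moreover have "th * S1 * (v + v0) <= 1 * 1 * (2 * V)" using thb tp S12 v vV v0 by (intro mult_mono) auto
    ultimately show ?thesis using tp thb by (simp add: abs_le_iff)
   qed
   have b': "2 * th * v\<^sup>2 >= th / 2"
   proof -
    have "(1/2)\<^sup>2 <= v\<^sup>2" using v_half by (intro power_mono) auto
    then have "2 * th * (1/2)\<^sup>2 <= 2 * th * v\<^sup>2" using tp by (intro mult_left_mono) auto
    then show ?thesis by (simp add: power2_eq_square)
   qed
   have "real N * \<bar>sj (th * v) 1 - S1\<bar> = (real N * \<bar>v - v0\<bar>) * \<bar>- (1 - 3 * th) - 2 * th * S1 * (v + v0)\<bar> / (2 * th * v\<^sup>2)"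
    unfolding dev(2) using tp v by (simp add: abs_mult abs_divide)
   also have "... <= (th\<^sup>2 * K2 * (2 + 4 * V)) / (th / 2)"
   proof (rule frac_le)
    show "(real N * \<bar>v - v0\<bar>) * \<bar>- (1 - 3 * th) - 2 * th * S1 * (v + v0)\<bar> <= th\<^sup>2 * K2 * (2 + 4 * V)"
     by (rule mult_mono[OF dv a]) (use K20 in auto)
   qed (use b' tp K20 V in auto)
   also have "... = th * K3" using tp by (simp add: K3_def power2_eq_square field_simps)
   finally show ?thesis .
  qed
  have ds2: "real N * \<bar>sj (th * v) 2 - S2\<bar> <= th * K4"
  proof -
   have pos: "1 <= 1 + th * v\<^sup>2 * (sj (th * v) 2 + S2)"
    using sj_bounds[of "th * v" 2] tp v S12 by simp
   have "real N * \<bar>sj (th * v) 2 - S2\<bar> <= real N * \<bar>(sj (th * v) 1 - S1) - th * v\<^sup>2 * ep3 (th * v) - th * S2\<^sup>2 * (v + v0) * (v - v0)\<bar>"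
    unfolding dev(3) abs_divide using pos by (intro mult_left_mono) (auto simp: divide_le_eq mult_le_cancel_left1)
   also have "... <= real N * (\<bar>sj (th * v) 1 - S1\<bar> + th * v\<^sup>2 * \<bar>ep3 (th * v)\<bar> + th * S2\<^sup>2 * (v + v0) * \<bar>v - v0\<bar>)"
   proof (rule mult_left_mono)
    have "\<bar>th * v\<^sup>2 * ep3 (th * v)\<bar> = th * v\<^sup>2 * \<bar>ep3 (th * v)\<bar>" using tp by (simp add: abs_mult)
    moreover have "\<bar>th * S2\<^sup>2 * (v + v0) * (v - v0)\<bar> = th * S2\<^sup>2 * (v + v0) * \<bar>v - v0\<bar>" using tp v v0 by (simp add: abs_mult)
    ultimately show "\<bar>(sj (th * v) 1 - S1) - th * v\<^sup>2 * ep3 (th * v) - th * S2\<^sup>2 * (v + v0) * (v - v0)\<bar> <= \<bar>sj (th * v) 1 - S1\<bar> + th * v\<^sup>2 * \<bar>ep3 (th * v)\<bar> + th * S2\<^sup>2 * (v + v0) * \<bar>v - v0\<bar>"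
     by linarith
   qed simp
   also have "... = real N * \<bar>sj (th * v) 1 - S1\<bar> + th * v\<^sup>2 * (real N * \<bar>ep3 (th * v)\<bar>) + th * S2\<^sup>2 * (v + v0) * (real N * \<bar>v - v0\<bar>)"
    by (simp add: algebra_simps)
   also have "... <= th * K3 + th * V\<^sup>2 * A + th * 1 * (2 * V) * K2"
   proof (intro add_mono ds1)
    show "th * v\<^sup>2 * (real N * \<bar>ep3 (th * v)\<bar>) <= th * V\<^sup>2 * A"
     using e3 power_mono[OF vV, of 2] v tp by (intro mult_mono) auto
    have "th\<^sup>2 * K2 <= 1 * K2" using th2 K20 by (intro mult_right_mono) auto
    with dv have d: "real N * \<bar>v - v0\<bar> <= K2" by simp
    have "S2\<^sup>2 <= 1" using S12 by (simp add: power_le_one)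
    moreover have "v + v0 <= 2 * V" using vV v0 by simp
    ultimately have "th * S2\<^sup>2 * (v + v0) <= th * 1 * (2 * V)" using tp v v0 by (intro mult_mono) auto
    then show "th * S2\<^sup>2 * (v + v0) * (real N * \<bar>v - v0\<bar>) <= th * 1 * (2 * V) * K2"
     by (rule mult_mono[OF _ d]) (use V tp in auto)
   qed
   finally show ?thesis by (simp add: K4_def algebra_simps)
  qed
  have K40: "0 <= K4" using V A K20 by (simp add: K4_def K3_def)
  have t1: "\<bar>real N * (1 / b - 1) * (v * sj (th * v) 2 - v0 * S2)\<bar> <= \<bar>1 / b - 1\<bar> * (K2 + V * K4) * th"
  proof -
   have "v * sj (th * v) 2 - v0 * S2 = (v - v0) * sj (th * v) 2 + v0 * (sj (th * v) 2 - S2)" by (simp add: algebra_simps)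
   then have "\<bar>v * sj (th * v) 2 - v0 * S2\<bar> <= \<bar>v - v0\<bar> * sj (th * v) 2 + v0 * \<bar>sj (th * v) 2 - S2\<bar>"
    using sj_bounds[of "th * v" 2] tp v v0 by (simp add: abs_mult order_trans[OF abs_triangle_ineq])
   also have "... <= \<bar>v - v0\<bar> * 1 + V * \<bar>sj (th * v) 2 - S2\<bar>"
    using sj_bounds[of "th * v" 2] tp v v0 by (intro add_mono mult_mono) auto
   finally have "real N * \<bar>v * sj (th * v) 2 - v0 * S2\<bar> <= real N * (\<bar>v - v0\<bar> * 1 + V * \<bar>sj (th * v) 2 - S2\<bar>)" by (intro mult_left_mono) auto
   also have "... = real N * \<bar>v - v0\<bar> + V * (real N * \<bar>sj (th * v) 2 - S2\<bar>)" by (simp add: algebra_simps)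
   also have "... <= th * K2 + V * (th * K4)"
   proof (intro add_mono mult_left_mono ds2)
    have "th\<^sup>2 * K2 <= th * K2" using tp thb K20 by (intro mult_right_mono) (auto simp: power2_eq_square mult_left_le)
    then show "real N * \<bar>v - v0\<bar> <= th * K2" using dv by simp
   qed (use V in auto)
   finally have "\<bar>1 / b - 1\<bar> * (real N * \<bar>v * sj (th * v) 2 - v0 * S2\<bar>) <= \<bar>1 / b - 1\<bar> * (th * K2 + V * (th * K4))" by (rule mult_left_mono) simp
   moreover have "\<bar>real N * (1 / b - 1) * (v * sj (th * v) 2 - v0 * S2)\<bar> = \<bar>1 / b - 1\<bar> * (real N * \<bar>v * sj (th * v) 2 - v0 * S2\<bar>)"
    unfolding abs_mult by simp
   moreover have "\<bar>1 / b - 1\<bar> * (th * K2 + V * (th * K4)) = \<bar>1 / b - 1\<bar> * (K2 + V * K4) * th" by (simp add: algebra_simps)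
   ultimately show ?thesis by linarith
  qed
  have t2: "\<bar>v * cv (th * v) 1 1\<bar> <= 4 * V ^ 3 / b * th"
  proof -
   have "\<bar>cv (th * v) 1 1\<bar> <= 4 * ((th * v)\<^sup>2 / (b * th))" using cv_bound[OF tp(1) thv, of 1 1] by simp
   also have "... = 4 * (th * v\<^sup>2 / b)" using tp by (simp add: power2_eq_square)
   finally have "v * \<bar>cv (th * v) 1 1\<bar> <= v * (4 * (th * v\<^sup>2 / b))" using v by (intro mult_left_mono) auto
   then have "\<bar>v * cv (th * v) 1 1\<bar> <= v * (4 * (th * v\<^sup>2 / b))" using v by (simp only: abs_mult abs_of_pos)
   also have "... = 4 * v ^ 3 / b * th" by (simp add: power2_eq_square power3_eq_cube)
   also have "... <= 4 * V ^ 3 / b * th" using v vV b tp by (intro mult_right_mono divide_right_mono mult_left_mono power_mono) auto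
   finally show ?thesis .
  qed
  have t3: "\<bar>4 * th\<^sup>2 * v ^ 5 * (1 + 4 * th * v) * (real N * ep2 (th * v))\<^sup>2 / D\<^sup>2\<bar> <= V ^ 5 * (1 + 4 * V) * A\<^sup>2 * th"
  proof -
   have "(2::real)\<^sup>2 <= D\<^sup>2" using fm(1) by (intro power_mono) auto
   then have D4: "4 <= D\<^sup>2" by simp
   have "(real N * ep2 (th * v))\<^sup>2 <= A\<^sup>2" using e2 A by (metis abs_mult abs_of_nat power2_abs power_mono abs_ge_zero)
   moreover have "th\<^sup>2 <= th" using tp thb by (simp add: power2_eq_square mult_left_le)
   moreover have "1 + 4 * th * v <= 1 + 4 * V" using mult_mono[OF thb vV] tp v by simp
   ultimately have "4 * th\<^sup>2 * v ^ 5 * (1 + 4 * th * v) * (real N * ep2 (th * v))\<^sup>2 <= 4 * th * V ^ 5 * (1 + 4 * V) * A\<^sup>2"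
    using tp v vV V power_mono[OF vV, of 5] by (intro mult_mono) auto
   then have "4 * th\<^sup>2 * v ^ 5 * (1 + 4 * th * v) * (real N * ep2 (th * v))\<^sup>2 / D\<^sup>2 <= 4 * th * V ^ 5 * (1 + 4 * V) * A\<^sup>2 / 4"
    using D4 tp V by (intro frac_le) auto
   moreover have "0 <= 4 * th\<^sup>2 * v ^ 5 * (1 + 4 * th * v) * (real N * ep2 (th * v))\<^sup>2 / D\<^sup>2" using tp v by simp
   ultimately show ?thesis by (simp add: mult_ac)
  qed
  show "\<bar>RN N b th\<bar> <= K * th" unfolding dev(4) K_def distrib_right using t1 t2 t3 by linarith
 qed
qed

section \<open>The limit of the first moment\<close>

lemma tendsto_cong_seq:
 fixes f g :: "nat => real"
 assumes "g \<longlonglongrightarrow> l" "!!n. n >= N1 ==> f n = g n" "l = l'"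
 shows "f \<longlonglongrightarrow> l'"
 using assms(1) unfolding assms(3)
 by (rule Lim_transform_eventually) (use assms(2) in \<open>auto simp: eventually_sequentially intro!: exI[of _ N1]\<close>)

lemma tendsto_bounded_over_n:
 fixes f :: "nat => real"
 assumes "!!n. n >= N1 ==> \<bar>f n\<bar> <= C"
 shows "(%n. f n / real n) \<longlonglongrightarrow> 0"
proof (rule Lim_null_comparison)
 show "\<forall>\<^sub>F n in sequentially. norm (f n / real n) <= C * (1 / real n)"
  using assms by (auto simp: eventually_sequentially abs_divide intro!: exI[of _ N1] divide_right_mono)
 show "(%n. C * (1 / real n)) \<longlonglongrightarrow> 0" using tendsto_mult_right_zero[OF lim_1_over_n, of C] by simp
qed

text \<open>Along the zeros all quantities converge, taken in the right order: the means s1 to s4 to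
  rational functions of g = sg th, then N times the errors \<open>ep2\<close> and \<open>ep3\<close>
  and the variance, then the 1/N corrections of v, s1 and s2. By \<open>deviations\<close>,
  \<open>RN\<close> involves nothing else.\<close>

lemma RN_limit:
 assumes b: "b > 0" and tp: "0 < th" "th < 1"
 defines "g \<equiv> sg th" and "b' \<equiv> 1 / b - 1"
 shows "(%N. RN N b th) \<longlonglongrightarrow> (g\<^sup>2 + 3) * (g - 1) / (64 * g ^ 4) * ((g - 1) * (g + 1)\<^sup>2 / b - b'\<^sup>2 * (g ^ 3 + 5 * g\<^sup>2 - g + 11))"
proof -
 define V where "V = 2 / (1 - th)\<^sup>2"
 define A where "A = 9 * \<bar>1 / b - 1\<bar> + 340 * (V\<^sup>2 / b)"
 define w where "w = 1 - th"
 have w: "0 < w" "w <= 1" using tp by (auto simp: w_def)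
 have V: "V > 0" using w by (simp add: V_def w_def)
 have A: "A >= 0" unfolding A_def using b by simp
 obtain N1 :: nat where N1: "real N1 >= 8 * A / w ^ 4 + 1" using real_arch_simple by blast
 have Nb: "real N >= 8 * A / w ^ 4" "real N >= 1" if "N >= N1" for N
 proof -
  have "0 <= 8 * A / w ^ 4" using A w by auto
  then show "real N >= 8 * A / w ^ 4" "real N >= 1" using N1 that by linarith+
 qed
 have wg: "wall_gas N b th" if "N >= N1" for N
  by unfold_locales (use Nb[OF that] b tp in auto)
 have ex: "\<exists>v. 0 < v \<and> v <= V \<and> 2 * th * v\<^sup>2 * wall_gas.sj N b th (th * v) 1 + (1 - 3 * th) * v = 1" if hN: "N >= N1" for N
 proof -
  interpret wall_gas N b th by (rule wg[OF hN])
  have "EB (th * V) <= (1 - th) ^ 4 / 8"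
  proof -
   have "\<bar>EB (th * V)\<bar> <= EB (th * V)" using b tp unfolding EB_def by simp
   then have "real N * \<bar>EB (th * V)\<bar> <= A" using N_ep_bound[of V V "EB (th * V)"] V tp by (simp add: K1_def A_def)
   also have "A <= real N * (w ^ 4 / 8)" using Nb(1)[OF hN] w by (simp add: field_simps)
   finally have "real N * \<bar>EB (th * V)\<bar> <= real N * (w ^ 4 / 8)" .
   then show ?thesis using Nb(2)[OF hN] by (simp add: mult_le_cancel_left_pos w_def)
  qed
  from zero_exists[OF tp(1), folded V_def, OF this] show ?thesis by blast
 qed
 \<comment> \<open>Neither uniqueness nor regular dependence on N of the zero is known; any choice
   will do.\<close>
 have "\<exists>vv. \<forall>N\<ge>N1. 0 < vv N \<and> vv N <= V \<and> 2 * th * (vv N)\<^sup>2 * wall_gas.sj N b th (th * vv N) 1 + (1 - 3 * th) * vv N = 1"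
  using ex by (intro choice) auto
 then obtain v where v: "!!N. N >= N1 ==> 0 < v N" "!!N. N >= N1 ==> v N <= V"
  and zero: "!!N. N >= N1 ==> 2 * th * (v N)\<^sup>2 * wall_gas.sj N b th (th * v N) 1 + (1 - 3 * th) * v N = 1" by blast
 define s where "s j N = wall_gas.sj N b th (th * v N) j" for j N
 define c where "c i j N = wall_gas.cv N b th (th * v N) i j" for i j N
 define e2 where "e2 N = wall_gas.ep2 N b th (th * v N)" for N
 define e3 where "e3 N = wall_gas.ep3 N b th (th * v N)" for N
 define e4 where "e4 N = wall_gas.ep4 N b th (th * v N)" for N
 define e5 where "e5 N = wall_gas.ep5 N b th (th * v N)" for N
 define r where "r N = b * (2 * wall_gas.k3 N b th (th * v N) 2 - wall_gas.k3 N b th (th * v N) 1) + (1 - b) * (2 * c 1 3 N - c 1 2 N)" for N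
 define z where "z N = th * (v N)\<^sup>2" for N
 define x where "x N = (1 - th) * v N - 1" for N
 define D where "D N = 3 - (1 - 9 * th) * v N" for N
 define v0 where "v0 = 1 / (1 - th)"
 define S1 where "S1 = 1 - th"
 define S2 where "S2 = 2 * (1 - th) / (g + 1)"
 have g1: "g > 1" and thg: "th = (g\<^sup>2 - 1) / (g\<^sup>2 + 3)" and v0g: "v0 = (g\<^sup>2 + 3) / 4"
  using sg_props[of th] tp unfolding g_def v0_def by auto
 have nz: "g ~= 0" "g + 1 ~= 0" "g - 1 ~= 0" "g\<^sup>2 + 3 ~= 0" "g\<^sup>2 - 1 ~= 0" "3 + g\<^sup>2 ~= 0" "1 + g ~= 0"
 proof -
  have "g\<^sup>2 > 1" using g1 by (rule one_less_power) simp
  then show "g ~= 0" "g + 1 ~= 0" "g - 1 ~= 0" "g\<^sup>2 + 3 ~= 0" "g\<^sup>2 - 1 ~= 0" "3 + g\<^sup>2 ~= 0" "1 + g ~= 0" using g1 by linarith+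
 qed
 have S1g: "S1 = 4 / (g\<^sup>2 + 3)" unfolding S1_def using thg nz by (simp add: field_simps)
 have S2g: "S2 = 8 / ((g + 1) * (g\<^sup>2 + 3))" using S1g unfolding S2_def S1_def by simp
 define z0 where "z0 = (g - 1) * (g + 1) * (g\<^sup>2 + 3) / 16"
 have z0: "z0 = th * v0\<^sup>2" unfolding z0_def v0g by (subst thg) (use nz in \<open>simp add: divide_simps eval_nat_numeral, (simp add: algebra_simps)?\<close>)
 have z0nz: "z0 ~= 0" unfolding z0_def using nz by simp
 have facts: "\<bar>e2 N\<bar> * real N <= A" "\<bar>e3 N\<bar> * real N <= A" "\<bar>e4 N\<bar> * real N <= A" "\<bar>e5 N\<bar> * real N <= A"
  "D N >= 2" "x N * D N = 4 * th\<^sup>2 * v N ^ 4 * e2 N"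
  "z N * ((s 2 N)\<^sup>2 + e3 N) = s 1 N - s 2 N"
  "z N * (2 * s 2 N * s 3 N - (s 2 N)\<^sup>2 + e4 N) = s 2 N - s 3 N"
  "z N * (2 * s 2 N * s 4 N + (s 3 N)\<^sup>2 - 2 * s 2 N * s 3 N + e5 N) = s 3 N - s 4 N"
  "real N * b * (2 * s 2 N + 1 / z N) * c 1 1 N + r N = real N * (s 3 N - s 4 N)"
  "e2 N = b' / real N * (2 * s 3 N - s 2 N) + (2 * c 1 2 N - c 1 1 N) / (real N)\<^sup>2"
  "e3 N = b' / real N * (3 * s 4 N - 2 * s 3 N) + (2 * c 1 3 N + c 2 2 N - 2 * c 1 2 N) / (real N)\<^sup>2"
  "v N - v0 = x N / (1 - th)"
  "s 1 N - S1 = (v N - v0) * (- (1 - 3 * th) - 2 * th * S1 * (v N + v0)) / (2 * z N)"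
  "s 2 N - S2 = ((s 1 N - S1) - z N * e3 N - th * S2\<^sup>2 * (v N + v0) * (v N - v0)) / (1 + z N * (s 2 N + S2))"
  "RN N b th = real N * b' * (v N * s 2 N - v0 * S2) + v N * c 1 1 N - 4 * th\<^sup>2 * v N ^ 5 * (1 + 4 * th * v N) * (real N * e2 N)\<^sup>2 / (D N)\<^sup>2"
  "0 <= s 2 N"
  "!!i j. 0 < i ==> 0 < j ==> \<bar>c i j N\<bar> <= 2 * ((real i)\<^sup>2 + (real j)\<^sup>2) * (V\<^sup>2 / b)"
  "\<bar>r N\<bar> <= b * (2 * (36 * (V\<^sup>2 / b)\<^sup>2 + 8 * (V\<^sup>2 / b)) + (36 * (V\<^sup>2 / b)\<^sup>2 + 2 * (V\<^sup>2 / b))) + \<bar>1 - b\<bar> * (2 * (20 * (V\<^sup>2 / b)) + 10 * (V\<^sup>2 / b))"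
  if hN: "N >= N1" for N
 proof -
  interpret wall_gas N b th by (rule wg[OF hN])
  note vN = v(1)[OF hN] v(2)[OF hN] and zN = zero[OF hN]
  have u: "th * v N > 0" using tp vN by simp
  note ep = ep_bounds[OF tp(1) u]
  have KA: "K1 V = A" by (simp add: K1_def A_def)
  show "\<bar>e2 N\<bar> * real N <= A" "\<bar>e3 N\<bar> * real N <= A" "\<bar>e4 N\<bar> * real N <= A" "\<bar>e5 N\<bar> * real N <= A"
   using N_ep_bound[OF tp(1) vN ep(2)] N_ep_bound[OF tp(1) vN ep(3)] N_ep_bound[OF tp(1) vN ep(4)] N_ep_bound[OF tp(1) vN ep(5)]
   unfolding KA e2_def e3_def e4_def e5_def by (simp_all add: mult.commute)
  show "D N >= 2" "x N * D N = 4 * th\<^sup>2 * v N ^ 4 * e2 N"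
   using first_moment_at_zero(1,2)[OF tp(1) vN(1) zN] unfolding D_def x_def e2_def by auto
  show "z N * ((s 2 N)\<^sup>2 + e3 N) = s 1 N - s 2 N"
   "z N * (2 * s 2 N * s 3 N - (s 2 N)\<^sup>2 + e4 N) = s 2 N - s 3 N"
   "z N * (2 * s 2 N * s 4 N + (s 3 N)\<^sup>2 - 2 * s 2 N * s 3 N + e5 N) = s 3 N - s 4 N"
   using eqs_at_zero(3-5)[OF tp(1) vN(1) zN] unfolding z_def s_def e3_def e4_def e5_def by auto
  show "real N * b * (2 * s 2 N + 1 / z N) * c 1 1 N + r N = real N * (s 3 N - s 4 N)"
   using eqs_at_zero(6)[OF tp(1) vN(1) zN] unfolding z_def s_def c_def r_def by simp
  show "e2 N = b' / real N * (2 * s 3 N - s 2 N) + (2 * c 1 2 N - c 1 1 N) / (real N)\<^sup>2"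
   "e3 N = b' / real N * (3 * s 4 N - 2 * s 3 N) + (2 * c 1 3 N + c 2 2 N - 2 * c 1 2 N) / (real N)\<^sup>2"
   unfolding e2_def e3_def ep2_def ep3_def dl_def s_def c_def b'_def by auto
  note dev = deviations[OF tp(1) vN(1) zN]
  show "v N - v0 = x N / (1 - th)" using dev(1) unfolding v0_def x_def .
  show "s 1 N - S1 = (v N - v0) * (- (1 - 3 * th) - 2 * th * S1 * (v N + v0)) / (2 * z N)"
   using dev(2) unfolding v0_def s_def S1_def z_def by (simp add: mult.assoc)
  show "s 2 N - S2 = ((s 1 N - S1) - z N * e3 N - th * S2\<^sup>2 * (v N + v0) * (v N - v0)) / (1 + z N * (s 2 N + S2))"
   using dev(3) unfolding v0_def s_def S1_def S2_def g_def z_def e3_def .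
  show "RN N b th = real N * b' * (v N * s 2 N - v0 * S2) + v N * c 1 1 N - 4 * th\<^sup>2 * v N ^ 5 * (1 + 4 * th * v N) * (real N * e2 N)\<^sup>2 / (D N)\<^sup>2"
   using dev(4) unfolding v0_def s_def S2_def g_def c_def e2_def D_def b'_def .
  show "0 <= s 2 N" unfolding s_def using sj_bounds[of "th * v N" 2] u by simp
  have G: "(th * v N)\<^sup>2 / (b * th) <= V\<^sup>2 / b" "0 <= (th * v N)\<^sup>2 / (b * th)"
  proof -
   have "(th * v N)\<^sup>2 / (b * th) = th * (v N)\<^sup>2 / b" using tp by (simp add: power2_eq_square)
   also have "... <= 1 * V\<^sup>2 / b" using tp vN b by (intro divide_right_mono mult_mono power_mono) auto
   finally show "(th * v N)\<^sup>2 / (b * th) <= V\<^sup>2 / b" by simp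
  qed (use b tp in auto)
  show cb: "\<bar>c i j N\<bar> <= 2 * ((real i)\<^sup>2 + (real j)\<^sup>2) * (V\<^sup>2 / b)" if "0 < i" "0 < j" for i j
   using cv_bound[OF tp(1) u that] mult_left_mono[OF G(1), of "2 * ((real i)\<^sup>2 + (real j)\<^sup>2)"] unfolding c_def by auto
  have kb: "\<bar>k3 (th * v N) j\<bar> <= 36 * (V\<^sup>2 / b)\<^sup>2 + 2 * (real j)\<^sup>2 * (V\<^sup>2 / b)" if "0 < j" for j
  proof -
   have "((th * v N)\<^sup>2 / (b * th))\<^sup>2 <= (V\<^sup>2 / b)\<^sup>2" using G by (intro power_mono) auto
   moreover have "2 * (real j)\<^sup>2 * ((th * v N)\<^sup>2 / (b * th)) <= 2 * (real j)\<^sup>2 * (V\<^sup>2 / b)" using G by (intro mult_left_mono) auto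
   ultimately show ?thesis using k3_bound[OF tp(1) u that] by linarith
  qed
  have "\<bar>r N\<bar> <= b * (2 * \<bar>k3 (th * v N) 2\<bar> + \<bar>k3 (th * v N) 1\<bar>) + \<bar>1 - b\<bar> * (2 * \<bar>c 1 3 N\<bar> + \<bar>c 1 2 N\<bar>)"
  proof -
   have "\<bar>b * (2 * k3 (th * v N) 2 - k3 (th * v N) 1)\<bar> <= b * (2 * \<bar>k3 (th * v N) 2\<bar> + \<bar>k3 (th * v N) 1\<bar>)"
    using b by (simp add: abs_mult)
   moreover have "\<bar>(1 - b) * (2 * c 1 3 N - c 1 2 N)\<bar> <= \<bar>1 - b\<bar> * (2 * \<bar>c 1 3 N\<bar> + \<bar>c 1 2 N\<bar>)"
    unfolding abs_mult by (intro mult_left_mono) auto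
   ultimately show ?thesis unfolding r_def by linarith
  qed
  also have "... <= b * (2 * (36 * (V\<^sup>2 / b)\<^sup>2 + 8 * (V\<^sup>2 / b)) + (36 * (V\<^sup>2 / b)\<^sup>2 + 2 * (V\<^sup>2 / b))) + \<bar>1 - b\<bar> * (2 * (20 * (V\<^sup>2 / b)) + 10 * (V\<^sup>2 / b))"
   using kb[of 2] kb[of 1] cb[of 1 3] cb[of 1 2] b by (intro add_mono mult_left_mono) auto
  finally show "\<bar>r N\<bar> <= b * (2 * (36 * (V\<^sup>2 / b)\<^sup>2 + 8 * (V\<^sup>2 / b)) + (36 * (V\<^sup>2 / b)\<^sup>2 + 2 * (V\<^sup>2 / b))) + \<bar>1 - b\<bar> * (2 * (20 * (V\<^sup>2 / b)) + 10 * (V\<^sup>2 / b))" .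
 qed
 have n0: "real N ~= 0" if "N >= N1" for N using Nb[OF that] by auto
 have to0: "e \<longlonglongrightarrow> 0" if "!!N. N >= N1 ==> \<bar>e N\<bar> * real N <= A" for e
 proof -
  have "(%N. (e N * real N) / real N) \<longlonglongrightarrow> 0"
   by (rule tendsto_bounded_over_n[of N1 _ A]) (use that in \<open>auto simp: abs_mult\<close>)
  then show ?thesis by (rule tendsto_cong_seq[of _ _ N1]) (use n0 in auto)
 qed
 have e0: "e2 \<longlonglongrightarrow> 0" "e3 \<longlonglongrightarrow> 0" "e4 \<longlonglongrightarrow> 0" "e5 \<longlonglongrightarrow> 0" using facts(1-4) by (auto intro!: to0)
 have x0: "x \<longlonglongrightarrow> 0"
 proof (rule Lim_null_comparison)
  show "\<forall>\<^sub>F N in sequentially. norm (x N) <= 2 * th\<^sup>2 * V ^ 4 * \<bar>e2 N\<bar>"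
   unfolding eventually_sequentially
  proof (intro exI allI impI)
   fix N assume N: "N >= N1"
   have "\<bar>x N\<bar> * 2 <= \<bar>x N\<bar> * \<bar>D N\<bar>" using facts(5)[OF N] by (intro mult_left_mono) auto
   also have "... = 4 * th\<^sup>2 * v N ^ 4 * \<bar>e2 N\<bar>" using facts(6)[OF N] v(1)[OF N] by (simp add: abs_mult[symmetric]) (simp add: abs_mult)
   also have "... <= 4 * th\<^sup>2 * V ^ 4 * \<bar>e2 N\<bar>" using v[OF N] by (intro mult_right_mono mult_left_mono power_mono) auto
   finally show "norm (x N) <= 2 * th\<^sup>2 * V ^ 4 * \<bar>e2 N\<bar>" by (simp add: mult_ac)
  qed
  show "(%N. 2 * th\<^sup>2 * V ^ 4 * \<bar>e2 N\<bar>) \<longlonglongrightarrow> 0" using tendsto_mult_right_zero[OF tendsto_rabs_zero[OF e0(1)]] by simp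
 qed
 have lv: "v \<longlonglongrightarrow> v0"
 proof (rule tendsto_cong_seq[of _ _ N1])
  show "(%N. v0 + x N / (1 - th)) \<longlonglongrightarrow> v0 + 0 / (1 - th)" (is "?F \<longlonglongrightarrow> ?L") using tp by (intro tendsto_intros x0) auto
  show "v N = ?F N" if "N >= N1" for N using facts(13)[OF that] by simp
 qed simp
 have v0nz: "v0 ~= 0" using nz v0g by simp
 have lz: "z \<longlonglongrightarrow> z0" unfolding z_def[abs_def] z0 by (intro tendsto_intros lv)
 have ls1: "s 1 \<longlonglongrightarrow> S1"
 proof (rule tendsto_cong_seq[of _ _ N1])
  show "(%N. S1 + (v N - v0) * (- (1 - 3 * th) - 2 * th * S1 * (v N + v0)) / (2 * z N)) \<longlonglongrightarrow> S1 + (v0 - v0) * (- (1 - 3 * th) - 2 * th * S1 * (v0 + v0)) / (2 * z0)" (is "?F \<longlonglongrightarrow> ?L")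
   using z0nz by (intro tendsto_intros lv lz) auto
 qed (use facts(14) in \<open>auto simp: diff_eq_eq add.commute\<close>)
 \<comment> \<open>The limiting discriminant of the quadratic equation for s2 is g^2; since s2 is
   nonnegative, the root with the positive sign is the right one.\<close>
 have sqrt_g: "sqrt (1 + 4 * z0 * (S1 - z0 * 0)) = g"
 proof -
  have "1 + 4 * z0 * (S1 - z0 * 0) = g\<^sup>2" unfolding z0_def S1g using nz by (simp add: divide_simps eval_nat_numeral, (simp add: algebra_simps)?)
  then show ?thesis using g1 by simp
 qed
 have ls2: "s 2 \<longlonglongrightarrow> S2"
 proof (rule tendsto_cong_seq[of _ _ N1])
  show "(%N. (sqrt (1 + 4 * z N * (s 1 N - z N * e3 N)) - 1) / (2 * z N)) \<longlonglongrightarrow> (sqrt (1 + 4 * z0 * (S1 - z0 * 0)) - 1) / (2 * z0)" (is "?F \<longlonglongrightarrow> ?L")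
   using z0nz by (intro tendsto_intros lz ls1 e0) auto
  show "?L = S2"
   unfolding sqrt_g unfolding S2g z0_def using nz by (simp add: divide_simps eval_nat_numeral, (simp add: algebra_simps)?)
  fix N assume N: "N >= N1"
  have zp: "z N > 0" unfolding z_def using tp v(1)[OF N] by simp
  have "(2 * z N * s 2 N + 1)\<^sup>2 = 1 + 4 * z N * (z N * ((s 2 N)\<^sup>2 + e3 N) + s 2 N - z N * e3 N)" by (simp add: power2_eq_square algebra_simps)
  also have "... = 1 + 4 * z N * (s 1 N - z N * e3 N)" unfolding facts(7)[OF N] by simp
  finally have "sqrt (1 + 4 * z N * (s 1 N - z N * e3 N)) = \<bar>2 * z N * s 2 N + 1\<bar>" by (metis real_sqrt_abs)
  also have "... = 2 * z N * s 2 N + 1" using zp facts(17)[OF N] by simp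
  finally show "s 2 N = ?F N" using zp by simp
 qed
 have zs: "1 + 2 * z0 * S2 = g" unfolding S2g z0_def using nz by (simp add: divide_simps eval_nat_numeral, (simp add: algebra_simps)?)
 have den: "1 + 2 * z N * s 2 N > 0" if "N >= N1" for N
  using facts(17)[OF that] tp v(1)[OF that] unfolding z_def by (intro add_pos_nonneg) auto
 have zS: "z0 * S2 = (g - 1) / 2" using zs by simp
 \<comment> \<open>\<open>S3\<close> and \<open>S4\<close>, the limits of s3 and s4, are solved from
   linear equations whose common coefficient 1 + 2 z s2 tends to g.\<close>
 define S3 where "S3 = 4 / (g * (g\<^sup>2 + 3))"
 define S4 where "S4 = (3 * g\<^sup>2 + 1) / (g ^ 3 * (g\<^sup>2 + 3))"
 have ls3: "s 3 \<longlonglongrightarrow> S3"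
 proof (rule tendsto_cong_seq[of _ _ N1])
  show "(%N. (s 2 N + z N * (s 2 N)\<^sup>2 - z N * e4 N) / (1 + 2 * z N * s 2 N)) \<longlonglongrightarrow> (S2 + z0 * S2\<^sup>2 - z0 * 0) / (1 + 2 * z0 * S2)" (is "?F \<longlonglongrightarrow> ?L")
   using zs nz by (intro tendsto_intros lz ls2 e0) auto
  have "z0 * S2\<^sup>2 = (g - 1) / 2 * S2" using zS by (simp add: power2_eq_square)
  then have "S2 + z0 * S2\<^sup>2 - z0 * 0 = S2 * ((g + 1) / 2)" by (simp add: field_simps)
  moreover have "S2 * ((g + 1) / 2) / g = S3" unfolding S2g S3_def using nz by (simp add: divide_simps, simp add: algebra_simps)
  ultimately show "?L = S3" by (simp only: zs)
  fix N assume N: "N >= N1"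
  have "s 3 N * (1 + 2 * z N * s 2 N) = s 2 N + z N * (s 2 N)\<^sup>2 - z N * e4 N" using facts(8)[OF N] by (simp add: algebra_simps)
  then show "s 3 N = ?F N" using den[OF N] by (simp add: eq_divide_eq)
 qed
 have ls4: "s 4 \<longlonglongrightarrow> S4"
 proof (rule tendsto_cong_seq[of _ _ N1])
  show "(%N. (s 3 N - z N * ((s 3 N)\<^sup>2 - 2 * s 2 N * s 3 N + e5 N)) / (1 + 2 * z N * s 2 N)) \<longlonglongrightarrow> (S3 - z0 * (S3\<^sup>2 - 2 * S2 * S3 + 0)) / (1 + 2 * z0 * S2)" (is "?F \<longlonglongrightarrow> ?L")
   using zs nz by (intro tendsto_intros lz ls2 ls3 e0) auto
  have "S3 - z0 * (S3\<^sup>2 - 2 * S2 * S3 + 0) = S3 * (1 + 2 * (z0 * S2) - z0 * S3)" by (simp add: power2_eq_square algebra_simps)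
  also have "z0 * S3 = (g\<^sup>2 - 1) / (4 * g)" unfolding z0_def S3_def using nz by (simp add: divide_simps eval_nat_numeral, (simp add: algebra_simps)?)
  finally have *: "S3 - z0 * (S3\<^sup>2 - 2 * S2 * S3 + 0) = S3 * (g - (g\<^sup>2 - 1) / (4 * g))" using zs by (simp add: mult.assoc)
  have **: "S3 * (g - (g\<^sup>2 - 1) / (4 * g)) / g = S4" unfolding S3_def S4_def using nz by (simp add: divide_simps eval_nat_numeral, (simp add: algebra_simps)?)
  show "?L = S4"
   by (simp only: * zs **)
  fix N assume N: "N >= N1"
  have "s 4 N * (1 + 2 * z N * s 2 N) = s 3 N - z N * ((s 3 N)\<^sup>2 - 2 * s 2 N * s 3 N + e5 N)" using facts(9)[OF N] by (simp add: algebra_simps)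
  then show "s 4 N = ?F N" using den[OF N] by (simp add: eq_divide_eq)
 qed
 have cn: "(%N. c i j N / real N) \<longlonglongrightarrow> 0" if "0 < i" "0 < j" for i j
  by (rule tendsto_bounded_over_n[OF facts(18)[OF _ that]])
 have le2: "(%N. real N * e2 N) \<longlonglongrightarrow> b' * (8 / ((g\<^sup>2 + 3) * g * (g + 1)))"
 proof (rule tendsto_cong_seq[of _ _ N1])
  show "(%N. b' * (2 * s 3 N - s 2 N) + (2 * (c 1 2 N / real N) - c 1 1 N / real N)) \<longlonglongrightarrow> b' * (2 * S3 - S2) + (2 * 0 - 0)" (is "?F \<longlonglongrightarrow> ?L")
   by (intro tendsto_intros ls2 ls3 cn) auto
  have "2 * S3 - S2 = 8 / ((g\<^sup>2 + 3) * g * (g + 1))" unfolding S3_def S2g using nz by (simp add: divide_simps eval_nat_numeral, (simp add: algebra_simps)?)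
  then show "?L = b' * (8 / ((g\<^sup>2 + 3) * g * (g + 1)))" by simp
  fix N assume N: "N >= N1"
  show "real N * e2 N = ?F N"
   unfolding facts(11)[OF N] using n0[OF N] by (simp add: divide_simps eval_nat_numeral, (simp add: algebra_simps)?)
 qed
 have le3: "(%N. real N * e3 N) \<longlonglongrightarrow> b' / g ^ 3"
 proof (rule tendsto_cong_seq[of _ _ N1])
  show "(%N. b' * (3 * s 4 N - 2 * s 3 N) + (2 * (c 1 3 N / real N) + c 2 2 N / real N - 2 * (c 1 2 N / real N))) \<longlonglongrightarrow> b' * (3 * S4 - 2 * S3) + (2 * 0 + 0 - 2 * 0)" (is "?F \<longlonglongrightarrow> ?L")
   by (intro tendsto_intros ls4 ls3 cn) auto
  have "3 * S4 - 2 * S3 = 1 / g ^ 3" unfolding S3_def S4_def using nz by (simp add: divide_simps eval_nat_numeral, (simp add: algebra_simps)?)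
  then show "?L = b' / g ^ 3" by simp
  fix N assume N: "N >= N1"
  show "real N * e3 N = ?F N"
   unfolding facts(12)[OF N] using n0[OF N] by (simp add: divide_simps eval_nat_numeral, (simp add: algebra_simps)?)
 qed
 \<comment> \<open>The variance equation divided by N: third cumulants and the covariances without a
   factor N are bounded, so r N / N tends to 0 and the limit is (S3 - S4) / (b (2 S2 + 1 /
   z0)).\<close>
 have lc: "c 1 1 \<longlonglongrightarrow> (g\<^sup>2 - 1)\<^sup>2 / (16 * b * g ^ 4)"
 proof (rule tendsto_cong_seq[of _ _ N1])
  have "2 * S2 + 1 / z0 = (1 + 2 * z0 * S2) / z0" using z0nz by (simp add: field_simps)
  then have d: "2 * S2 + 1 / z0 = g / z0" unfolding zs .
  show "(%N. ((s 3 N - s 4 N) - r N / real N) / (b * (2 * s 2 N + 1 / z N))) \<longlonglongrightarrow> ((S3 - S4) - 0) / (b * (2 * S2 + 1 / z0))" (is "?F \<longlonglongrightarrow> ?L")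
   using z0nz b d nz by (intro tendsto_intros ls2 ls3 ls4 lz tendsto_bounded_over_n[OF facts(19)]) auto
  have "S3 - S4 = (g\<^sup>2 - 1) / (g ^ 3 * (g\<^sup>2 + 3))" unfolding S3_def S4_def using nz by (simp add: divide_simps eval_nat_numeral, (simp add: algebra_simps)?)
  then have "((S3 - S4) - 0) / (b * (2 * S2 + 1 / z0)) = (g\<^sup>2 - 1) / (g ^ 3 * (g\<^sup>2 + 3)) / (b * (g / z0))" by (simp only: d diff_0_right)
  also have "... = (g\<^sup>2 - 1)\<^sup>2 / (16 * b * g ^ 4)"
   unfolding z0_def using nz b by (simp add: divide_simps eval_nat_numeral, (simp add: algebra_simps)?)
  finally show "?L = (g\<^sup>2 - 1)\<^sup>2 / (16 * b * g ^ 4)" .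
  fix N assume N: "N >= N1"
  have zp: "z N > 0" unfolding z_def using tp v(1)[OF N] by simp
  have pos: "2 * s 2 N + 1 / z N > 0" using zp facts(17)[OF N] by (intro add_nonneg_pos) auto
  have "real N * (b * (2 * s 2 N + 1 / z N) * c 1 1 N) = real N * ((s 3 N - s 4 N) - r N / real N)"
   using facts(10)[OF N] n0[OF N] by (simp add: algebra_simps)
  then have "b * (2 * s 2 N + 1 / z N) * c 1 1 N = (s 3 N - s 4 N) - r N / real N" using n0[OF N] by (subst (asm) mult_cancel_left) auto
  then show "c 1 1 N = ?F N" using pos b by (simp add: eq_divide_eq mult.commute)
 qed
 have D0: "3 - (1 - 9 * th) * v0 = 2 * g\<^sup>2" unfolding v0g by (subst thg) (use nz in \<open>simp add: divide_simps eval_nat_numeral, (simp add: algebra_simps)?\<close>)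
 have lD: "D \<longlonglongrightarrow> 2 * g\<^sup>2" unfolding D_def[abs_def] D0[symmetric] by (intro tendsto_intros lv)
 have lx: "(%N. real N * x N) \<longlonglongrightarrow> b' * ((g - 1)\<^sup>2 * (g + 1) * (g\<^sup>2 + 3) / (16 * g ^ 3))"
 proof (rule tendsto_cong_seq[of _ _ N1])
  show "(%N. 4 * (z N)\<^sup>2 * (real N * e2 N) / D N) \<longlonglongrightarrow> 4 * z0\<^sup>2 * (b' * (8 / ((g\<^sup>2 + 3) * g * (g + 1)))) / (2 * g\<^sup>2)" (is "?F \<longlonglongrightarrow> ?L")
   using nz by (intro tendsto_intros lz le2 lD) auto
  show "?L = b' * ((g - 1)\<^sup>2 * (g + 1) * (g\<^sup>2 + 3) / (16 * g ^ 3))"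
   unfolding z0_def using nz by (simp add: divide_simps eval_nat_numeral)
  fix N assume N: "N >= N1"
  have "real N * x N * D N = 4 * (z N)\<^sup>2 * (real N * e2 N)" using facts(6)[OF N] by (simp add: z_def power2_eq_square power4_eq_xxxx)
  then show "real N * x N = ?F N" using facts(5)[OF N] by (simp add: eq_divide_eq)
 qed
 \<comment> \<open>\<open>V1\<close>, \<open>T1\<close> and \<open>T2\<close> are the limits of N
   times the deviations of v, s1 and s2 from \<open>v0\<close>, \<open>S1\<close> and
   \<open>S2\<close>.\<close>
 define V1 where "V1 = b' * ((g - 1)\<^sup>2 * (g + 1) * (g\<^sup>2 + 3)\<^sup>2 / (64 * g ^ 3))"
 have ldv: "(%N. real N * (v N - v0)) \<longlonglongrightarrow> V1"
 proof (rule tendsto_cong_seq[of _ _ N1])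
  show "(%N. real N * x N * v0) \<longlonglongrightarrow> b' * ((g - 1)\<^sup>2 * (g + 1) * (g\<^sup>2 + 3) / (16 * g ^ 3)) * v0" (is "?F \<longlonglongrightarrow> ?L") by (intro tendsto_intros lx)
  show "?L = V1" unfolding V1_def v0g by (simp add: power2_eq_square)
  show "real N * (v N - v0) = ?F N" if "N >= N1" for N using facts(13)[OF that] by (simp add: v0_def)
 qed
 define T1 where "T1 = - b' * ((g - 1) * (g\<^sup>2 + 1) / (4 * g ^ 3))"
 have lds1: "(%N. real N * (s 1 N - S1)) \<longlonglongrightarrow> T1"
 proof (rule tendsto_cong_seq[of _ _ N1])
  show "(%N. real N * (v N - v0) * (- (1 - 3 * th) - 2 * th * S1 * (v N + v0)) / (2 * z N)) \<longlonglongrightarrow> V1 * (- (1 - 3 * th) - 2 * th * S1 * (v0 + v0)) / (2 * z0)" (is "?F \<longlonglongrightarrow> ?L")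
   using z0nz by (intro tendsto_intros ldv lv lz) auto
  have "- (1 - 3 * th) - 2 * th * S1 * (v0 + v0) = - (1 + th)"
  proof -
   have "S1 * v0 = 1" unfolding S1g v0g using nz by simp
   then have "2 * th * S1 * (v0 + v0) = 4 * th" by (simp add: distrib_left mult.assoc)
   then show ?thesis by simp
  qed
  also have "1 + th = (2 * g\<^sup>2 + 2) / (g\<^sup>2 + 3)" by (subst thg) (use nz in \<open>simp add: divide_simps\<close>)
  finally have f: "- (1 - 3 * th) - 2 * th * S1 * (v0 + v0) = - ((2 * g\<^sup>2 + 2) / (g\<^sup>2 + 3))" .
  show "?L = T1"
   unfolding f V1_def T1_def z0_def using nz by (simp add: divide_simps eval_nat_numeral, (simp add: algebra_simps)?)
  show "real N * (s 1 N - S1) = ?F N" if "N >= N1" for N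
   unfolding facts(14)[OF that] by simp
 qed
 define T2 where "T2 = - b' * ((g - 1) * (g ^ 3 + 13 * g\<^sup>2 - 13 * g + 15) / (16 * g ^ 4))"
 have lds2: "(%N. real N * (s 2 N - S2)) \<longlonglongrightarrow> T2"
 proof (rule tendsto_cong_seq[of _ _ N1])
  have z2: "1 + z0 * (S2 + S2) = g" using zs by (simp add: algebra_simps)
  show "(%N. (real N * (s 1 N - S1) - z N * (real N * e3 N) - th * S2\<^sup>2 * (v N + v0) * (real N * (v N - v0))) / (1 + z N * (s 2 N + S2)))
   \<longlonglongrightarrow> (T1 - z0 * (b' / g ^ 3) - th * S2\<^sup>2 * (v0 + v0) * V1) / (1 + z0 * (S2 + S2))" (is "?F \<longlonglongrightarrow> ?L")
   using z2 nz by (intro tendsto_intros lds1 lz le3 lv ldv ls2) auto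
  have "th * (v0 + v0) = (g\<^sup>2 - 1) / 2" unfolding v0g by (subst thg) (use nz in \<open>simp add: divide_simps\<close>)
  then have "th * S2\<^sup>2 * (v0 + v0) = (g\<^sup>2 - 1) / 2 * S2\<^sup>2" by (simp add: mult_ac)
  then have m: "th * S2\<^sup>2 * (v0 + v0) * V1 = b' * ((g - 1) ^ 3 / (2 * g ^ 3))"
   unfolding S2g V1_def using nz by (simp add: divide_simps eval_nat_numeral, (simp add: algebra_simps)?)
  have m2: "z0 * (b' / g ^ 3) = b' * ((g\<^sup>2 - 1) * (g\<^sup>2 + 3) / (16 * g ^ 3))" unfolding z0_def using nz by (simp add: divide_simps eval_nat_numeral, (simp add: algebra_simps)?)
  have "T1 - z0 * (b' / g ^ 3) - th * S2\<^sup>2 * (v0 + v0) * V1 = b' * (- ((g - 1) * (g\<^sup>2 + 1) / (4 * g ^ 3)) - (g\<^sup>2 - 1) * (g\<^sup>2 + 3) / (16 * g ^ 3) - (g - 1) ^ 3 / (2 * g ^ 3))"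
   unfolding m m2 T1_def by (simp add: right_diff_distrib)
  also have "- ((g - 1) * (g\<^sup>2 + 1) / (4 * g ^ 3)) - (g\<^sup>2 - 1) * (g\<^sup>2 + 3) / (16 * g ^ 3) - (g - 1) ^ 3 / (2 * g ^ 3) = - ((g - 1) * (g ^ 3 + 13 * g\<^sup>2 - 13 * g + 15) / (16 * g ^ 3))"
   using nz by (simp add: divide_simps eval_nat_numeral, (simp add: algebra_simps)?)
  finally have f: "T1 - z0 * (b' / g ^ 3) - th * S2\<^sup>2 * (v0 + v0) * V1 = b' * - ((g - 1) * (g ^ 3 + 13 * g\<^sup>2 - 13 * g + 15) / (16 * g ^ 3))" .
  have "b' * - (X / (16 * g ^ 3)) / g = - b' * (X / (16 * g ^ 4))" for X using nz by (simp add: eval_nat_numeral)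
  then show "?L = T2"
   unfolding f z2 T2_def by this
  show "real N * (s 2 N - S2) = ?F N" if "N >= N1" for N
  proof -
   have "n * ((A - B - C * d) / E) = (n * A - Z * (n * W) - C * (n * d)) / E" if "B = Z * W" for n A B C d E Z W :: real
    unfolding that by (simp add: right_diff_distrib mult.left_commute)
   then show ?thesis unfolding facts(15)[OF that] by blast
  qed
 qed
 show ?thesis
 proof (rule tendsto_cong_seq[of _ _ N1])
  show "(%N. b' * (real N * (v N - v0) * s 2 N + v0 * (real N * (s 2 N - S2))) + v N * c 1 1 N - 4 * (z N)\<^sup>2 * v N * (1 + 4 * th * v N) * (real N * e2 N)\<^sup>2 / (D N)\<^sup>2)
   \<longlonglongrightarrow> b' * (V1 * S2 + v0 * T2) + v0 * ((g\<^sup>2 - 1)\<^sup>2 / (16 * b * g ^ 4)) - 4 * z0\<^sup>2 * v0 * (1 + 4 * th * v0) * (b' * (8 / ((g\<^sup>2 + 3) * g * (g + 1))))\<^sup>2 / (2 * g\<^sup>2)\<^sup>2" (is "?F \<longlonglongrightarrow> ?L")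
   using nz by (intro tendsto_intros ldv ls2 lds2 lv lc lz le2 lD) auto
  have tv: "1 + 4 * th * v0 = g\<^sup>2" unfolding v0g by (subst thg) (use nz in \<open>simp add: divide_simps\<close>)
  have a1: "V1 * S2 = b' * ((g - 1)\<^sup>2 * (g\<^sup>2 + 3) / (8 * g ^ 3))" unfolding V1_def S2g using nz by (simp add: divide_simps eval_nat_numeral)
  have a2: "4 * z0\<^sup>2 * v0 * g\<^sup>2 * (b' * (8 / ((g\<^sup>2 + 3) * g * (g + 1))))\<^sup>2 / (2 * g\<^sup>2)\<^sup>2 = b'\<^sup>2 * ((g - 1)\<^sup>2 * (g\<^sup>2 + 3) / (16 * g ^ 4))"
   unfolding z0_def v0g using nz by (simp add: divide_simps eval_nat_numeral)
  have a3: "v0 * ((g\<^sup>2 - 1)\<^sup>2 / (16 * b * g ^ 4)) = (g\<^sup>2 + 3) * (g - 1) / (64 * g ^ 4) * ((g - 1) * (g + 1)\<^sup>2 / b)"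
   unfolding v0g using nz b by (simp add: divide_simps eval_nat_numeral, (simp add: algebra_simps)?)
  have a4: "(g - 1)\<^sup>2 * (g\<^sup>2 + 3) / (8 * g ^ 3) - v0 * ((g - 1) * (g ^ 3 + 13 * g\<^sup>2 - 13 * g + 15) / (16 * g ^ 4)) - (g - 1)\<^sup>2 * (g\<^sup>2 + 3) / (16 * g ^ 4)
   = - ((g\<^sup>2 + 3) * (g - 1) / (64 * g ^ 4) * (g ^ 3 + 5 * g\<^sup>2 - g + 11))"
   unfolding v0g using nz by (simp add: divide_simps eval_nat_numeral, (simp add: algebra_simps)?)
  have comb: "b' * (b' * P + v0 * (- b' * Q)) + U - b'\<^sup>2 * W = c * (Y / b - b'\<^sup>2 * Z)"
   if "P - v0 * Q - W = - (c * Z)" "U = c * (Y / b)" for P Q U W c Y Z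
  proof -
   have "b' * (b' * P + v0 * (- b' * Q)) + U - b'\<^sup>2 * W = b'\<^sup>2 * (P - v0 * Q - W) + U" by (simp add: power2_eq_square algebra_simps)
   then show ?thesis unfolding that by (simp add: algebra_simps)
  qed
  show "?L
   = (g\<^sup>2 + 3) * (g - 1) / (64 * g ^ 4) * ((g - 1) * (g + 1)\<^sup>2 / b - b'\<^sup>2 * (g ^ 3 + 5 * g\<^sup>2 - g + 11))"
   unfolding tv a1 a2 T2_def by (rule comb[OF a4 a3])
  fix N assume N: "N >= N1"
  have e: "4 * th\<^sup>2 * v N ^ 5 = 4 * (z N)\<^sup>2 * v N" by (simp add: z_def eval_nat_numeral)
  have "n * B * (v * s - v1 * S) = B * (n * (v - v1) * s + v1 * (n * (s - S)))" for n B v s v1 S :: real by (simp add: algebra_simps)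
  then show "RN N b th = ?F N"
   unfolding facts(16)[OF N] e by simp
 qed
qed

section \<open>Integration in the parameter of the potential\<close>

text \<open>A subgradient is nondecreasing, hence integrable. On each of n equal pieces the
  increments of \<open>h\<close> and of the integral differ by at most the increment of
  \<open>s\<close> times the length, and these errors telescope to (s b - s a) (b - a) / n. So the
  partition function need not be differentiated in \<open>th\<close>.\<close>

lemma subgradient_has_integral:
 fixes h s :: "real => real"
 assumes ab: "a <= b" and sub: "!!x y. x \<in> {a..b} ==> y \<in> {a..b} ==> s x * (y - x) <= h y - h x"
 shows "(s has_integral h b - h a) {a..b}"
proof -
 have mono: "s x <= s y" if "x \<in> {a..b}" "y \<in> {a..b}" "x <= y" for x y
 proof (cases "x = y")
  case False
  have "s x * (y - x) <= s y * (y - x)" using sub[OF that(1,2)] sub[OF that(2,1)] by (simp add: algebra_simps)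
  then show ?thesis using False that by simp
 qed simp
 have int: "s integrable_on {x..y}" if "a <= x" "y <= b" for x y
  by (rule integrable_on_mono_on) (use mono that in \<open>auto simp: mono_on_def\<close>)
 define E where "E x = h x - integral {a..x} s" for x
 have step: "\<bar>E y - E x\<bar> <= (s y - s x) * (y - x)" if xy: "a <= x" "x <= y" "y <= b" for x y
 proof -
  have "integral {a..x} s + integral {x..y} s = integral {a..y} s" using xy int by (intro Henstock_Kurzweil_Integration.integral_combine) auto
  moreover have "integral {x..y} (%_. s x) <= integral {x..y} s" using xy by (intro integral_le int mono) auto
  moreover have "integral {x..y} s <= integral {x..y} (%_. s y)" using xy by (intro integral_le int mono) auto
  ultimately have 1: "s x * (y - x) <= integral {a..y} s - integral {a..x} s" "integral {a..y} s - integral {a..x} s <= s y * (y - x)"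
   using xy by (simp_all add: mult.commute)
  have "s x * (y - x) <= h y - h x" "h y - h x <= s y * (y - x)" using sub[of x y] sub[of y x] xy by (auto simp: algebra_simps)
  then show ?thesis using 1 unfolding E_def abs_le_iff left_diff_distrib by linarith
 qed
 have "E b = E a"
 proof (rule ccontr)
  assume "E b ~= E a"
  then obtain n where n: "(s b - s a) * (b - a) < real n * \<bar>E b - E a\<bar>" using ex_less_of_nat_mult[of "\<bar>E b - E a\<bar>"] by auto
  have C: "0 <= (s b - s a) * (b - a)" using mono[of a b] ab by simp
  have n0: "n > 0" using n C by (cases n) auto
  define p where "p i = a + (b - a) * real i / real n" for i
  have p: "p 0 = a" "p n = b" using n0 by (auto simp: p_def)
  have pS: "p (Suc i) - p i = (b - a) / real n" for i by (simp add: p_def algebra_simps add_divide_distrib diff_divide_distrib)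
  have "\<bar>E (p n) - E (p 0)\<bar> <= (\<Sum>i<n. \<bar>E (p (Suc i)) - E (p i)\<bar>)" unfolding sum_lessThan_telescope[of "%i. E (p i)", symmetric] by (rule sum_abs)
  also have "... <= (\<Sum>i<n. (s (p (Suc i)) - s (p i)) * ((b - a) / real n))"
  proof (rule sum_mono)
   fix i assume i: "i \<in> {..<n}"
   have "a <= p i" using ab by (simp add: p_def)
   moreover have "p i <= p (Suc i)" using pS[of i] ab by (smt (verit) divide_nonneg_nonneg of_nat_0_le_iff)
   moreover have "p (Suc i) <= b"
   proof -
    have "(b - a) * real (Suc i) <= (b - a) * real n" using i ab by (intro mult_left_mono) auto
    then have "(b - a) * real (Suc i) / real n <= b - a" using n0 by (simp add: divide_le_eq)
    then show ?thesis unfolding p_def by linarith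
   qed
   ultimately show "\<bar>E (p (Suc i)) - E (p i)\<bar> <= (s (p (Suc i)) - s (p i)) * ((b - a) / real n)" using step[of "p i" "p (Suc i)"] unfolding pS by simp
  qed
  also have "... = (s b - s a) * ((b - a) / real n)" unfolding sum_distrib_right[symmetric] sum_lessThan_telescope[of "%i. s (p i)"] p ..
  finally have "real n * \<bar>E b - E a\<bar> <= (s b - s a) * (b - a)" using n0 by (simp add: p field_simps)
  with n show False by simp
 qed
 then have "integral {a..b} s = h b - h a" by (simp add: E_def)
 then show ?thesis using int[of a b] by (metis integrable_integral order_refl)
qed

context wall_gas
begin

text \<open>Jensen for the tilt between the two potentials, in the form exp z >= 1 + z around the
  mean; y^2 / 2 - 3 y is the derivative of \<open>gpot\<close> in \<open>th\<close>.\<close>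

lemma ln_gZ_subgradient:
 assumes th': "0 <= th'" "th' < 1"
 shows "- ((real N)\<^sup>2 * b * (xm 2 / 2 - 3 * xm 1)) * (th' - th) <= ln (gZ N b th') - ln (gZ N b th)"
proof -
 interpret w': wall_gas N b th' by unfold_locales (use N b th' in auto)
 define Q where "Q x = (\<Sum>i<N. x i ^ 2) / 2 - 3 * (\<Sum>i<N. x i ^ 1)" for x :: "nat => real"
 define m where "m = - ((real N)\<^sup>2 * b * (xm 2 / 2 - 3 * xm 1)) * (th' - th)"
 define c where "c = - (real N * b * (th' - th))"
 have Qm[measurable]: "Q \<in> borel_measurable (leb N)" unfolding Q_def[abs_def] by measurable
 have EQ: "expectation Q = real N * (xm 2 / 2 - 3 * xm 1)"
  unfolding Q_def[abs_def] using xpow_integrable[of 1] xpow_integrable[of 2] N by (simp add: xm_def field_simps)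
 have iQ: "integrable (gP N b th) Q" unfolding Q_def[abs_def] using xpow_integrable[of 1] xpow_integrable[of 2] by simp
 have mc: "m = c * expectation Q" unfolding EQ m_def c_def by (simp add: power2_eq_square)
 have W': "w'.W x = exp (c * Q x) * W x" for x
 proof -
  have g: "gwt N b th' y = exp (c * (y ^ 2 / 2 - 3 * y ^ 1)) * gwt N b th y" for y
   unfolding gwt_def gpot_def c_def by (simp add: mult_exp_exp) (simp add: algebra_simps add_divide_distrib diff_divide_distrib)
  have "(\<Prod>i<N. gwt N b th' (x i)) = exp (\<Sum>i<N. c * (x i ^ 2 / 2 - 3 * x i ^ 1)) * (\<Prod>i<N. gwt N b th (x i))"
   unfolding g prod.distrib exp_sum[OF finite_lessThan] ..
  also have "(\<Sum>i<N. c * (x i ^ 2 / 2 - 3 * x i ^ 1)) = c * Q x"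
   by (simp add: Q_def sum_distrib_left[symmetric] sum_subtractf sum_divide_distrib)
  finally show ?thesis by (simp add: gasw_def)
 qed
 have iW: "integrable (leb N) (%x. Q x * W x)"
 proof -
  have "integrable (leb N) (%x. W x / gZ N b th * Q x)"
   using iQ W_nonneg Z_pos unfolding gP_def by (subst (asm) integrable_real_density) auto
  then have "integrable (leb N) (%x. gZ N b th * (W x / gZ N b th * Q x))" by (intro Bochner_Integration.integrable_mult_right)
  moreover have "(%x. gZ N b th * (W x / gZ N b th * Q x)) = (%x. Q x * W x)" using Z_pos by (auto simp: mult.commute)
  ultimately show ?thesis by simp
 qed
 have EQ': "(\<integral>x. Q x * W x \<partial>leb N) = gZ N b th * expectation Q"
  unfolding expectation_gP[OF Qm] using Z_pos by simp
 have "exp m * gZ N b th = exp m * (gZ N b th + (c * (\<integral>x. Q x * W x \<partial>leb N) - m * gZ N b th))"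
  unfolding EQ' mc by simp
 also have "... = (\<integral>x. exp m * (W x + (c * (Q x * W x) - m * W x)) \<partial>leb N)"
  using W_integrable iW by (simp add: gZ_def)
 also have "... <= (\<integral>x. w'.W x \<partial>leb N)"
 proof (rule integral_mono)
  show "integrable (leb N) (%x. exp m * (W x + (c * (Q x * W x) - m * W x)))" using W_integrable iW by auto
  show "integrable (leb N) w'.W" by (rule w'.W_integrable)
  fix x
  have "exp m * (1 + (c * Q x - m)) <= exp m * exp (c * Q x - m)" using exp_ge_add_one_self[of "c * Q x - m"] by (intro mult_left_mono) auto
  also have "... = exp (c * Q x)" by (simp add: mult_exp_exp)
  finally have "exp m * (1 + (c * Q x - m)) * W x <= exp (c * Q x) * W x" using W_nonneg by (intro mult_right_mono) auto
  then show "exp m * (W x + (c * (Q x * W x) - m * W x)) <= w'.W x" unfolding W' by (simp add: algebra_simps)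
 qed
 also have "... = gZ N b th'" by (simp add: gZ_def)
 finally have "ln (exp m * gZ N b th) <= ln (gZ N b th')" using Z_pos w'.Z_pos by (subst ln_le_cancel_iff) auto
 then show ?thesis using Z_pos unfolding m_def by (simp add: ln_mult)
qed

end

text \<open>The coefficient of N (b - 1) in ln \<open>gZ\<close>, up to a constant, as a function of
  sg th. The constant is the one that matches \<open>F01\<close> in \<open>coefficients\<close>; it
  gives Bf 1 = 1.\<close>

definition Bf :: "real => real" where
 "Bf g = 2 * ln (g + 1) - ln (g\<^sup>2 + 3) + 1 / 2 - 2 / (g + 1) + 12 / ((g\<^sup>2 + 3) * (g + 1))"

text \<open>The bounded term of ln \<open>gZ\<close> in the same variable; up to multiples of ln 2
  it is F10 + (b + 1/b - 2) F02.\<close>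

definition Cf :: "real => real => real" where
 "Cf b g = - (1/12) * ln g + (1/6) * ln (g\<^sup>2 + 3) + (b + 1 / b - 2) * (ln (g + 1) - (11/12) * ln g - (1/6) * ln (g\<^sup>2 + 3))"

lemma Bf_has_derivative:
 assumes "g >= 1"
 shows "(Bf has_real_derivative 4 * g * (g\<^sup>2 - 6 * g - 3) / ((g + 1)\<^sup>2 * (g\<^sup>2 + 3)\<^sup>2)) (at g)"
proof -
 have g: "g > 0" "g + 1 > 0" "g\<^sup>2 + 3 > 0" using assms by (auto intro: add_nonneg_pos)
 define q where "q = g\<^sup>2 + 3"
 have q: "q > 0" "g\<^sup>2 = q - 3" using g(3) by (auto simp: q_def)
 have "(Bf has_real_derivative 2 * (1 / (g + 1)) - 2 * g / q + 2 / ((g + 1) * (g + 1)) - 12 * (2 * g * (g + 1) + q) / ((q * (g + 1)) * (q * (g + 1)))) (at g)"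
  unfolding Bf_def[abs_def] using g by (auto intro!: derivative_eq_intros simp: q_def[symmetric]) (simp add: diff_divide_distrib add_divide_distrib)
 moreover have "2 * (1 / (g + 1)) - 2 * g / q + 2 / ((g + 1) * (g + 1)) - 12 * (2 * g * (g + 1) + q) / ((q * (g + 1)) * (q * (g + 1)))
   = 4 * g * (g\<^sup>2 - 6 * g - 3) / ((g + 1)\<^sup>2 * q\<^sup>2)"
  using g q(1) by (simp add: divide_simps) (simp add: q_def eval_nat_numeral algebra_simps)
 ultimately show ?thesis unfolding q_def by simp
qed

lemma Cf_has_derivative:
 assumes "g >= 1" "b > 0"
 shows "(Cf b has_real_derivative (g\<^sup>2 - 1) / (4 * g * (g\<^sup>2 + 3)) - (b + 1 / b - 2) * ((g ^ 3 + 5 * g\<^sup>2 - g + 11) / (4 * g * (g + 1) * (g\<^sup>2 + 3)))) (at g)"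
proof -
 have g: "g > 0" "g + 1 > 0" "g\<^sup>2 + 3 > 0" using assms by (auto intro: add_nonneg_pos)
 define q where "q = g\<^sup>2 + 3"
 have q: "q > 0" using g(3) by (auto simp: q_def)
 have "(Cf b has_real_derivative - (1/12) * (1 / g) + (1/6) * (2 * g / q) + (b + 1 / b - 2) * (1 / (g + 1) - (11/12) * (1 / g) - (1/6) * (2 * g / q))) (at g)"
  unfolding Cf_def[abs_def] using g by (auto intro!: derivative_eq_intros simp: q_def[symmetric])
 moreover have "- (1/12) * (1 / g) + (1/6) * (2 * g / q) = (g\<^sup>2 - 1) / (4 * g * q)" "1 / (g + 1) - (11/12) * (1 / g) - (1/6) * (2 * g / q) = - ((g ^ 3 + 5 * g\<^sup>2 - g + 11) / (4 * g * (g + 1) * q))"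
  using g q by (simp_all add: divide_simps) (simp_all add: q_def eval_nat_numeral algebra_simps)
 ultimately show ?thesis unfolding q_def by simp
qed

lemma sg_has_derivative:
 assumes "0 <= th" "th < 1"
 shows "(sg has_real_derivative ((sg th)\<^sup>2 + 3)\<^sup>2 / (8 * sg th)) (at th)"
proof -
 have p: "(1 + 3 * th) / (1 - th) > 0" using assms by simp
 have s: "sg th > 0" using sg_props(1)[OF assms] by simp
 have 1: "(sg has_real_derivative inverse (sqrt ((1 + 3 * th) / (1 - th))) / 2 * ((3 * (1 - th) - (1 + 3 * th) * - 1) / ((1 - th) * (1 - th)))) (at th)"
  unfolding sg_def[abs_def]
 proof (rule DERIV_chain2[where f = sqrt and g = "%x. (1 + 3 * x) / (1 - x)", OF DERIV_real_sqrt[OF p]])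
  show "((%x. (1 + 3 * x) / (1 - x)) has_real_derivative (3 * (1 - th) - (1 + 3 * th) * - 1) / ((1 - th) * (1 - th))) (at th)"
   by (rule derivative_eq_intros refl | use assms in simp)+
 qed
 have 2: "(3 * (1 - th) - (1 + 3 * th) * - 1) / ((1 - th) * (1 - th)) = 4 * (1 / (1 - th))\<^sup>2"
  using assms by (simp add: power2_eq_square field_simps)
 have 3: "inverse S / 2 * (4 * (T / 4)\<^sup>2) = T\<^sup>2 / (8 * S)" for S T :: real by (simp add: power2_eq_square inverse_eq_divide)
 have "inverse (sqrt ((1 + 3 * th) / (1 - th))) / 2 * ((3 * (1 - th) - (1 + 3 * th) * - 1) / ((1 - th) * (1 - th))) = ((sg th)\<^sup>2 + 3)\<^sup>2 / (8 * sg th)"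
  by (subst 2, subst sg_props(4)[OF assms], subst sg_def[of th, symmetric], rule 3)
 with 1 show ?thesis by (rule back_subst[of "%d. (sg has_real_derivative d) (at th)"])
qed

text \<open>Removing the terms of order \<open>N\<^sup>2\<close> and \<open>N\<close> from the derivative of \<open>ln (gZ N b x)\<close> in \<open>x\<close> leaves
 \<open>b (1 + 3 x) / (2 x) RN N b x\<close>, which \<open>RN_bound\<close> dominates uniformly in \<open>N\<close>.\<close>

lemma gas_ratio_limit:
 assumes b: "b > 0" and th: "0 < th" "th < 1"
 shows "(%N. ln (gZ N b th) - ln (gZ N b 0) - (real N)\<^sup>2 * b * (2 * th + 3 * th\<^sup>2 / 4) - real N * (b - 1) * (Bf (sg th) - Bf 1)) \<longlonglongrightarrow> Cf b (sg th) - Cf b 1"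
proof -
 obtain K N0 where RB: "!!N x. N >= N0 ==> 0 < x ==> x <= th ==> \<bar>RN N b x\<bar> <= K * x"
  by (rule RN_bound[OF b th]) (rule that)
 define N1 where "N1 = max N0 1"
 \<comment> \<open>The antiderivative of the two leading orders; \<open>f\<close> is what remains of
   the derivative of ln \<open>gZ\<close> and \<open>g\<close> is its limit, both set to 0 at the
   single point x = 0.\<close>
 define G where "G N x = (real N)\<^sup>2 * b * (2 * x + 3 * x\<^sup>2 / 4) + real N * (b - 1) * Bf (sg x)" for N x
 define f where "f N x = (if x = 0 then 0 else b * (1 + 3 * x) / (2 * x) * RN N b x)" for N x
 define g where "g x = (if x = 0 then 0 else b * (1 + 3 * x) / (2 * x) * (((sg x)\<^sup>2 + 3) * (sg x - 1) / (64 * sg x ^ 4) * ((sg x - 1) * (sg x + 1)\<^sup>2 / b - (1 / b - 1)\<^sup>2 * (sg x ^ 3 + 5 * (sg x)\<^sup>2 - sg x + 11))))" for x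
 have sg0: "sg 0 = 1" by (simp add: sg_def)
 have sgc: "continuous_on {0..th} sg"
  using th by (intro continuous_at_imp_continuous_on ballI DERIV_isCont[OF sg_has_derivative]) auto
 have sgn: "sg x > 0" "sg x + 1 > 0" "(sg x)\<^sup>2 + 3 > 0" "x = ((sg x)\<^sup>2 - 1) / ((sg x)\<^sup>2 + 3)" if "0 <= x" "x < 1" for x
  using sg_props(1,3)[OF that] by (auto intro: add_nonneg_pos)
 have sgn1: "(sg x)\<^sup>2 - 1 > 0" "1 + 3 * x = 4 * (sg x)\<^sup>2 / ((sg x)\<^sup>2 + 3)" if "0 < x" "x < 1" for x
 proof -
  show "(sg x)\<^sup>2 - 1 > 0" using one_less_power[OF sg_props(5), of x 2] that by simp
  have "1 + 3 * x = 1 + 3 * (((sg x)\<^sup>2 - 1) / ((sg x)\<^sup>2 + 3))" using sgn(4)[of x] that by simp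
  also have "... = 4 * (sg x)\<^sup>2 / ((sg x)\<^sup>2 + 3)" using sgn(3)[of x] that by (simp add: divide_simps)
  finally show "1 + 3 * x = 4 * (sg x)\<^sup>2 / ((sg x)\<^sup>2 + 3)" .
 qed
 \<comment> \<open>The subgradient \<open>s\<close> of ln \<open>gZ\<close> integrates to its
   increment; off x = 0 its difference from the derivative \<open>G'\<close> of \<open>G\<close> is
   the explicit \<open>f\<close>.\<close>
 have intf: "(f N has_integral ln (gZ N b th) - ln (gZ N b 0) - (G N th - G N 0)) {0..th}" if N: "N >= N1" for N
 proof -
  define s where "s x = - ((real N)\<^sup>2 * b * (wall_gas.xm N b x 2 / 2 - 3 * wall_gas.xm N b x 1))" for x
  have N': "real N > 0" using N by (simp add: N1_def)
  have wg: "wall_gas N b x" if "0 <= x" "x < 1" for x by unfold_locales (use N' b that in auto)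
  have 1: "(s has_integral ln (gZ N b th) - ln (gZ N b 0)) {0..th}"
  proof (rule subgradient_has_integral)
   fix x y assume "x \<in> {0..th}" "y \<in> {0..th}"
   then show "s x * (y - x) <= ln (gZ N b y) - ln (gZ N b x)"
    unfolding s_def using th by (intro wall_gas.ln_gZ_subgradient[OF wg]) auto
  qed (use th in simp)
  define G' where "G' x = (real N)\<^sup>2 * b * (2 + 3 * x / 2) + real N * (b - 1) * ((4 * sg x * ((sg x)\<^sup>2 - 6 * sg x - 3) / ((sg x + 1)\<^sup>2 * ((sg x)\<^sup>2 + 3)\<^sup>2)) * (((sg x)\<^sup>2 + 3)\<^sup>2 / (8 * sg x)))" for x
  have 2: "(G' has_integral G N th - G N 0) {0..th}"
  proof (rule fundamental_theorem_of_calculus)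
   fix x assume x: "x \<in> {0..th}"
   then have x': "0 <= x" "x < 1" using th by auto
   have "(G N has_real_derivative G' x) (at x)"
    unfolding G_def[abs_def] G'_def
    by (rule derivative_eq_intros DERIV_chain2[OF Bf_has_derivative sg_has_derivative] sg_props(1) x' refl | simp)+
   then show "(G N has_vector_derivative G' x) (at x within {0..th})"
    by (simp add: has_real_derivative_iff_has_vector_derivative has_vector_derivative_at_within)
  qed (use th in simp)
  have "((%x. s x - G' x) has_integral (ln (gZ N b th) - ln (gZ N b 0)) - (G N th - G N 0)) {0..th}" by (rule has_integral_diff[OF 1 2])
  then show ?thesis
  proof (rule has_integral_spike_finite[rotated 2, of _ _ _ "{0}"])
   fix x assume "x \<in> {0..th} - {0}"
   then have x: "0 < x" "x < 1" using th by auto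
   interpret wall_gas N b x by (rule wg) (use x in auto)
   note sn = sgn[of x, OF less_imp_le[OF x(1)] x(2)]
   note sn1 = sgn1[OF x]
   define m where "m = xm 1"
   define k where "k = sg x"
   define n where "n = real N"
   have n: "n > 0" using N' by (simp add: n_def)
   \<comment> \<open>\<open>loop_0\<close> replaces the second moment, at the price of a later
     division by 2 x.\<close>
   have l0: "2 * x * (xm 2 / 2 - 3 * m) = 1 + (1 / b - 1) / n - (1 + 3 * x) * m" using loop_0 by (simp add: m_def dl_def n_def algebra_simps)
   define c where "c = 1 / b - 1"
   define e where "e = 2 / (k + 1)"
   define r where "r = RN N b x"
   have bc: "b * c = 1 - b" using b by (simp add: c_def field_simps)
   have "r = n\<^sup>2 * (m - (1 + x)) - n * c * e" by (simp add: r_def RN_def m_def n_def c_def e_def k_def)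
   then have R: "m = 1 + x + c * e / n + r / n\<^sup>2" using n by (simp add: field_simps power2_eq_square)
   \<comment> \<open>The apparent pole at x = 0 in the coefficient of order N cancels, since sg 0 =
     1.\<close>
   have k: "(1 - 2 * (1 + 3 * x) / (k + 1)) / (2 * x) = (k\<^sup>2 - 6 * k - 3) / (2 * (k + 1)\<^sup>2)"
   proof -
    have k1: "k > 1" using sg_props(5)[of x] x by (simp add: k_def)
    have "2 * x = 2 * ((k\<^sup>2 - 1) / (k\<^sup>2 + 3))" using sn(4) by (simp add: k_def)
    then have "(1 - 2 * (1 + 3 * x) / (k + 1)) / (2 * x) = (1 - 2 * (4 * k\<^sup>2 / (k\<^sup>2 + 3)) / (k + 1)) / (2 * ((k\<^sup>2 - 1) / (k\<^sup>2 + 3)))"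
     using sn1(2) unfolding k_def by presburger
    also have "... = (k - 1) * (k\<^sup>2 - 6 * k - 3) / (2 * (k\<^sup>2 - 1) * (k + 1))"
     using sn(2,3) sn1(1) unfolding k_def[symmetric] by (simp add: divide_simps) (simp add: eval_nat_numeral algebra_simps)
    also have "... = (k\<^sup>2 - 6 * k - 3) / (2 * (k + 1)\<^sup>2)"
    proof -
     have "2 * (k\<^sup>2 - 1) * (k + 1) = (k - 1) * (2 * (k + 1)\<^sup>2)" by (simp add: power2_eq_square algebra_simps)
     then show ?thesis using k1 by simp
    qed
    finally show ?thesis .
   qed
   have "s x = - (n\<^sup>2 * b * (2 * x * (xm 2 / 2 - 3 * m))) / (2 * x)" using x by (simp add: s_def m_def n_def)
   also have "... = - (n\<^sup>2 * b * (1 + c / n - (1 + 3 * x) * (1 + x + c * e / n + r / n\<^sup>2))) / (2 * x)"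
    unfolding l0 using R by (simp add: c_def)
   also have "... = n\<^sup>2 * b * (2 + 3 * x / 2) - n * (b * c) * ((1 - (1 + 3 * x) * e) / (2 * x)) + b * (1 + 3 * x) / (2 * x) * r"
    using x n by (simp add: field_simps power2_eq_square)
   also have "... = n\<^sup>2 * b * (2 + 3 * x / 2) + n * (b - 1) * ((1 - 2 * (1 + 3 * x) / (k + 1)) / (2 * x)) + b * (1 + 3 * x) / (2 * x) * RN N b x"
   proof -
    have "A - n * (1 - b) * Z + C = A + n * (b - 1) * Z + C" "(1 + 3 * x) * (2 / y) = 2 * (1 + 3 * x) / y" for A Z C y :: real by (simp add: algebra_simps, simp)
    then show ?thesis unfolding bc e_def r_def by presburger
   qed
   also have "n\<^sup>2 * b * (2 + 3 * x / 2) + n * (b - 1) * ((1 - 2 * (1 + 3 * x) / (k + 1)) / (2 * x)) = G' x"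
   proof -
    have "4 * k * Q / (A * B\<^sup>2) * (B\<^sup>2 / (8 * k)) = Q / (2 * A)" if "B > 0" "A > 0" for Q A B
     using that sn(1) unfolding k_def[symmetric] by simp
    from this[of "k\<^sup>2 + 3" "(k + 1)\<^sup>2"] show ?thesis unfolding k G'_def n_def k_def[symmetric] using sn(2,3) by (simp add: k_def[symmetric])
   qed
   finally show "f N x = s x - G' x" using x by (simp add: f_def)
  qed simp
 qed
 have intg: "(g has_integral Cf b (sg th) - Cf b (sg 0)) {0..th}"
 proof (rule fundamental_theorem_of_calculus_strong[of "{0}"])
  show "continuous_on {0..th} (%x. Cf b (sg x))"
   by (rule continuous_on_compose2[OF _ sgc, of "{1..}"])
    (use th sg_props(1) b in \<open>auto intro!: continuous_at_imp_continuous_on DERIV_isCont[OF Cf_has_derivative]\<close>)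
  fix x assume "x \<in> {0..th} - {0}"
  then have x: "0 < x" "x < 1" using th by auto
  note sn = sgn[of x, OF less_imp_le[OF x(1)] x(2)]
  note sn1 = sgn1[OF x]
  define k where "k = sg x"
  have "((%x. Cf b (sg x)) has_real_derivative ((k\<^sup>2 - 1) / (4 * k * (k\<^sup>2 + 3)) - (b + 1 / b - 2) * ((k ^ 3 + 5 * k\<^sup>2 - k + 11) / (4 * k * (k + 1) * (k\<^sup>2 + 3)))) * ((k\<^sup>2 + 3)\<^sup>2 / (8 * k))) (at x)"
   unfolding k_def using x b by (intro DERIV_chain2[OF Cf_has_derivative sg_has_derivative] sg_props(1)) auto
  also have "((k\<^sup>2 - 1) / (4 * k * (k\<^sup>2 + 3)) - (b + 1 / b - 2) * ((k ^ 3 + 5 * k\<^sup>2 - k + 11) / (4 * k * (k + 1) * (k\<^sup>2 + 3)))) * ((k\<^sup>2 + 3)\<^sup>2 / (8 * k)) = g x"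
  proof -
   define P where "P = k ^ 3 + 5 * k\<^sup>2 - k + 11"
   define q where "q = k\<^sup>2 + 3"
   define r where "r = k - 1"
   define p where "p = k + 1"
   have nz: "k > 0" "q > 0" "p > 0" "r > 0" using sn sg_props(5)[of x] x by (auto simp: k_def q_def r_def p_def)
   have kk: "k\<^sup>2 - 1 = r * p" by (simp add: r_def p_def power2_eq_square algebra_simps)
   have "x = r * p / q" using sn(4) unfolding k_def[symmetric] q_def[symmetric] kk .
   then have fr: "b * (1 + 3 * x) / (2 * x) = b * (4 * k\<^sup>2 / q) / (2 * (r * p / q))" unfolding sn1(2) k_def[symmetric] q_def[symmetric] by simp
   have bb: "b + 1 / b - 2 = b * (1 / b - 1)\<^sup>2" using b by (simp add: power2_eq_square field_simps)
   have "g x = b * (4 * k\<^sup>2 / q) / (2 * (r * p / q)) * (q * r / (64 * k ^ 4) * (r * p\<^sup>2 / b - (1 / b - 1)\<^sup>2 * P))"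
    unfolding g_def fr using x by (simp add: k_def[symmetric] P_def[symmetric] q_def[symmetric] r_def[symmetric] p_def[symmetric])
   also have "... = (r * p / (4 * k * q) - b * (1 / b - 1)\<^sup>2 * (P / (4 * k * p * q))) * (q\<^sup>2 / (8 * k))"
   proof -
    have "b * (4 * k\<^sup>2 / q) / (2 * (r * p / q)) * (q * r / (64 * k ^ 4) * (r * p\<^sup>2 / b - B * P)) = (r * p / (4 * k * q) - b * B * (P / (4 * k * p * q))) * (q\<^sup>2 / (8 * k))" for B
     using nz b by (simp add: divide_simps) (simp add: eval_nat_numeral algebra_simps)
    then show ?thesis .
   qed
   finally show ?thesis unfolding bb kk P_def[symmetric] q_def[symmetric] p_def[symmetric] ..
  qed
  finally show "((%x. Cf b (sg x)) has_vector_derivative g x) (at x)" by (simp add: has_real_derivative_iff_has_vector_derivative)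
 qed (use th in auto)
 have "(%n. integral {0..th} (f (n + N1))) \<longlonglongrightarrow> integral {0..th} g"
 proof (rule dominated_convergence)
  show "f (n + N1) integrable_on {0..th}" for n using intf[of "n + N1"] by (auto simp: integrable_on_def)
  show "(%_. 2 * b * \<bar>K\<bar>) integrable_on {0..th}" by (rule integrable_const_ivl)
  fix x assume x: "x \<in> {0..th}"
  show "norm (f (n + N1) x) <= 2 * b * \<bar>K\<bar>" for n
  proof (cases "x = 0")
   case False
   then have x: "0 < x" "x <= th" "x < 1" using x th by auto
   have "norm (f (n + N1) x) = b * (1 + 3 * x) / (2 * x) * \<bar>RN (n + N1) b x\<bar>" using x b by (simp add: f_def abs_mult)
   also have "... <= b * (1 + 3 * x) / (2 * x) * (\<bar>K\<bar> * x)"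
   proof (rule mult_left_mono)
    have "\<bar>RN (n + N1) b x\<bar> <= K * x" using RB[of "n + N1" x] x by (simp add: N1_def)
    also have "... <= \<bar>K\<bar> * x" using x by (intro mult_right_mono) auto
    finally show "\<bar>RN (n + N1) b x\<bar> <= \<bar>K\<bar> * x" .
   qed (use x b in auto)
   also have "... = b * \<bar>K\<bar> * ((1 + 3 * x) / 2)" using x by simp
   also have "... <= b * \<bar>K\<bar> * 2" using x b by (intro mult_left_mono) auto
   finally show ?thesis by simp
  qed (use b in \<open>simp add: f_def\<close>)
  show "(%n. f (n + N1) x) \<longlonglongrightarrow> g x"
  proof (cases "x = 0")
   case False
   then have x: "0 < x" "x < 1" using x th by auto
   have "(%N. f N x) \<longlonglongrightarrow> g x" unfolding f_def g_def if_not_P[OF False] by (intro tendsto_mult tendsto_const RN_limit[OF b x])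
   then show ?thesis by (rule LIMSEQ_ignore_initial_segment)
  qed (simp add: f_def g_def)
 qed
 then have "(%N. integral {0..th} (f N)) \<longlonglongrightarrow> integral {0..th} g" by (rule LIMSEQ_offset)
 then show ?thesis
 proof (rule tendsto_cong_seq[of _ _ N1])
  show "integral {0..th} g = Cf b (sg th) - Cf b 1" using integral_unique[OF intg] by (simp add: sg0)
  fix N assume N: "N >= N1"
  show "ln (gZ N b th) - ln (gZ N b 0) - (real N)\<^sup>2 * b * (2 * th + 3 * th\<^sup>2 / 4) - real N * (b - 1) * (Bf (sg th) - Bf 1) = integral {0..th} (f N)"
   unfolding integral_unique[OF intf[OF N]] G_def sg0 by (simp add: algebra_simps)
 qed
qed

section \<open>The Selberg integrals of Laguerre and Mehta\<close>

text \<open>Generating polynomial whose coefficients are the elementary symmetric functions.\<close>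

definition ff :: "nat set => (nat => real) => real poly" where
 "ff S x = (\<Prod>i\<in>S. [:1, x i:])"

abbreviation elem :: "nat set => (nat => real) => nat => real" where
 "elem S x k \<equiv> coeff (ff S x) k"

lemma elem_insert: "finite S ==> i \<notin> S ==> elem (insert i S) x k = elem S x k + x i * (case k of 0 => 0 | Suc k => elem S x k)"
 by (auto simp: ff_def split: nat.split)

lemma elem_remove:
 assumes "finite S" "i \<in> S"
 shows "elem S x k = elem (S - {i}) x k + x i * (case k of 0 => 0 | Suc k => elem (S - {i}) x k)"
 using elem_insert[of "S - {i}" i x k] assms by (simp add: insert_absorb)

text \<open>Compare coefficients in the derivative of the generating polynomial.\<close>

lemma sum_elem_remove_mult:
 assumes "finite S"
 shows "(\<Sum>i\<in>S. x i * elem (S - {i}) x k) = real (Suc k) * elem S x (Suc k)"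
proof -
 have "pderiv (ff S x) = (\<Sum>i\<in>S. ff (S - {i}) x * [:x i:])" unfolding ff_def pderiv_prod by (simp add: pderiv_pCons)
 then have "coeff (pderiv (ff S x)) k = (\<Sum>i\<in>S. coeff (ff (S - {i}) x * [:x i:]) k)" by (simp add: coeff_sum)
 then show ?thesis by (simp add: coeff_pderiv mult.commute)
qed

lemma sum_elem_remove:
 assumes "finite S"
 shows "(\<Sum>i\<in>S. elem (S - {i}) x k) = (real (card S) - real k) * elem S x k"
proof -
 have "(\<Sum>i\<in>S. elem (S - {i}) x k) = (\<Sum>i\<in>S. elem S x k - x i * (case k of 0 => 0 | Suc k => elem (S - {i}) x k))"
  by (intro sum.cong refl) (use elem_remove[OF assms] in simp)
 also have "... = real (card S) * elem S x k - (case k of 0 => 0 | Suc k => (\<Sum>i\<in>S. x i * elem (S - {i}) x k))"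
  by (simp add: sum_subtractf split: nat.split)
 also have "... = (real (card S) - real k) * elem S x k"
  by (cases k) (simp_all add: sum_elem_remove_mult[OF assms] algebra_simps)
 finally show ?thesis .
qed

lemma abs_elem_le: "finite S ==> \<bar>elem S x k\<bar> <= (\<Prod>i\<in>S. 1 + \<bar>x i\<bar>)"
proof (induction S arbitrary: k rule: finite_induct)
 case (insert i S)
 have "\<bar>elem (insert i S) x k\<bar> <= \<bar>elem S x k\<bar> + \<bar>x i\<bar> * \<bar>case k of 0 => 0 | Suc k => elem S x k\<bar>"
  unfolding elem_insert[OF insert(1,2)] abs_mult[symmetric] by (rule abs_triangle_ineq)
 also have "... <= (\<Prod>i\<in>S. 1 + \<bar>x i\<bar>) + \<bar>x i\<bar> * (\<Prod>i\<in>S. 1 + \<bar>x i\<bar>)"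
  using insert.IH by (intro add_mono mult_left_mono) (auto split: nat.split intro: prod_nonneg)
 finally show ?case using insert by (simp add: algebra_simps)
qed (auto simp: ff_def coeff_pCons split: nat.split)

lemma degree_ff: "finite S ==> degree (ff S x) <= card S"
proof -
 assume "finite S"
 then have "degree (ff S x) <= sum (degree \<circ> (%i. [:1, x i:])) S" unfolding ff_def by (rule degree_prod_sum_le)
 also have "... <= (\<Sum>i\<in>S. 1)" by (intro sum_mono) auto
 finally show ?thesis by simp
qed

lemma elem_measurable [measurable]: "(%x. elem {..<N} x k) \<in> borel_measurable (leb N)"
proof -
 have "finite S ==> S \<subseteq> {..<N} ==> (%x. elem S x k) \<in> borel_measurable (leb N)" for S
 proof (induction S arbitrary: k rule: finite_induct)
  case (insert i S)
  have "(%x. x i) \<in> borel_measurable (leb N)" using insert by (intro leb_component_measurable[of "%y. y"]) auto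
  then show ?case unfolding elem_insert[OF insert(1,2)] using insert by (cases k) auto
 qed (simp add: ff_def)
 then show ?thesis by simp
qed

lemma poly_ff: "poly (ff S x) z = (\<Prod>i\<in>S. 1 + z * x i)"
 by (simp add: ff_def poly_prod)

lemma poly_elem: "finite S ==> card S <= n ==> (\<Sum>k\<le>n. elem S x k * z ^ k) = poly (ff S x) z"
 by (subst (2) poly_as_sum_of_monoms'[symmetric, of _ n]) (auto simp: poly_sum poly_monom intro: order_trans[OF degree_ff])

definition lw :: "nat => real => real" where
 "lw c y = (if y > 0 then y ^ c * exp (- y) else 0)"

lemma ln_one_plus_ge: "\<bar>u\<bar> <= 1 / 2 ==> ln (1 + u) >= u - 2 * u\<^sup>2" for u :: real
 using ln_one_plus_pos_lower_bound[of u] ln_one_minus_pos_lower_bound[of "- u"] by (cases "u >= 0") (auto intro: order_trans[rotated])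

lemma all_moments_lw: "all_moments (lw c)" "z >= 0 ==> all_moments (%y. (1 + z * y) * lw c y)"
proof -
 have le: "y ^ m * exp (- y) <= fact m * 2 ^ m * exp (- (1 / 2 * \<bar>y\<bar>))" if "y > 0" for y :: real and m
 proof -
  have "(y / 2) ^ m * exp (- y) <= fact m * exp (y / 2) * exp (- y)" using that by (intro mult_right_mono power_le_fact_mult_exp) auto
  then have "2 ^ m * ((y / 2) ^ m * exp (- y)) <= 2 ^ m * (fact m * (exp (y / 2) * exp (- y)))" by (simp add: mult.assoc)
  then show ?thesis using that by (simp add: power_divide mult_exp_exp mult_ac)
 qed
 have [measurable]: "lw c \<in> borel_measurable borel" unfolding lw_def[abs_def] by measurable
 show "all_moments (lw c)"
  by (rule all_moments_exp_bound[where c = "1 / 2" and C = "fact c * 2 ^ c"]) (use le in \<open>auto simp: lw_def\<close>)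
 assume z: "z >= 0"
 show "all_moments (%y. (1 + z * y) * lw c y)"
 proof (rule all_moments_exp_bound[where c = "1 / 2" and C = "fact c * 2 ^ c + z * (fact (Suc c) * 2 ^ Suc c)"])
  show "0 <= (1 + z * y) * lw c y" for y using z by (simp add: lw_def)
  show "(1 + z * y) * lw c y <= (fact c * 2 ^ c + z * (fact (Suc c) * 2 ^ Suc c)) * exp (- (1 / 2 * \<bar>y\<bar>))" for y
  proof (cases "y > 0")
   case True
   have "(1 + z * y) * lw c y = y ^ c * exp (- y) + z * (y ^ Suc c * exp (- y))" using True by (simp add: lw_def algebra_simps)
   also have "... <= fact c * 2 ^ c * exp (- (1 / 2 * \<bar>y\<bar>)) + z * (fact (Suc c) * 2 ^ Suc c * exp (- (1 / 2 * \<bar>y\<bar>)))"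
    using z by (intro add_mono mult_left_mono le True)
   finally show ?thesis by (simp add: algebra_simps)
  qed (use z in \<open>simp add: lw_def\<close>)
 qed auto
qed

text \<open>Tilting the weight by \<open>1 + z y\<close> turns the loop equation for the vector field \<open>y / (1 + z y)\<close> into a
 polynomial identity in \<open>z\<close>; its coefficients are Aomoto's recursion for the elementary symmetric functions.\<close>

lemma aomoto:
 assumes b: "b >= 0" and k: "k < N"
 shows "real (Suc k) * (\<integral>x. elem {..<N} x (Suc k) * gasw N b (lw c) x \<partial>leb N)
  = (real N - real k) * (1 + real c + b * (real N - 1 - real k)) * (\<integral>x. elem {..<N} x k * gasw N b (lw c) x \<partial>leb N)"
proof -
 define G where "G = gasw N b (lw c)"
 \<comment> \<open>The coefficient of z^k in the integrand of the loop equation once the tilt is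
   multiplied out; the claim is that its integral vanishes.\<close>
 define r where "r k x = (real N - real k) * (1 + real c + b * (real N - 1 - real k)) * elem {..<N} x k - real (Suc k) * elem {..<N} x (Suc k)" for k x
 have ie: "integrable (leb N) (%x. elem {..<N} x k * G x)" for k
  unfolding G_def using abs_elem_le[of "{..<N}"] by (intro integrable_gasw_bounded[OF b all_moments_lw(1), where C = 1 and k = 1]) (auto simp: spread_def)
 have ir: "integrable (leb N) (%x. r k x * G x)" for k
  unfolding r_def left_diff_distrib mult.assoc using ie by (intro Bochner_Integration.integrable_diff integrable_mult_right)
 define p where "p = (\<Sum>k\<le>N. monom (\<integral>x. r k x * G x \<partial>leb N) k)"
 have "poly p z = 0" if z: "z > 0" for z
 proof -
  define w where "w y = (1 + z * y) * lw c y" for y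
  define L where "L y = real c * ln y + ln (1 + z * y) - y" for y
  define phi where "phi y = y * tt z y" for y
  define lam where "lam y = real c * tt z y + z * y * (tt z y)\<^sup>2 - y * tt z y" for y
  define C where "C = 2 * real c + 2"
  have t: "0 < tt z y" "tt z y <= 1" "z * y * tt z y = 1 - tt z y" "1 + z * y > 0" if "y > 0" for y
  proof -
   show p: "1 + z * y > 0" using z that by (simp add: add_pos_pos)
   show "0 < tt z y" "tt z y <= 1" using tt_bounds[of z y] z that by auto
   show "z * y * tt z y = 1 - tt z y" unfolding tt_def using p by (simp add: field_simps)
  qed
  have t2: "(tt z y)\<^sup>2 <= 1" if "y > 0" for y using t[OF that] by (intro power_le_one) auto
  have zy: "0 <= z * y * (tt z y)\<^sup>2" "z * y * (tt z y)\<^sup>2 <= 1" if "y > 0" for y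
  proof -
   have e: "z * y * (tt z y)\<^sup>2 = (1 - tt z y) * tt z y" using t(3)[OF that] by (simp add: power2_eq_square)
   show "0 <= z * y * (tt z y)\<^sup>2" using z that by simp
   show "z * y * (tt z y)\<^sup>2 <= 1" unfolding e using t[OF that] by (intro mult_le_one) auto
  qed
  have "(\<integral>x. (1 * ((\<Sum>i<N. (tt z (x i))\<^sup>2) + 2 * b * (\<Sum>(i, j)\<in>{(i, j). i < j \<and> j < N}. tt z (x i) * tt z (x j)) + (\<Sum>i<N. lam (x i))) + 0) * gasw N b w x \<partial>leb N) = 0"
  proof (rule gas_loop_equation[where L = L and phi = phi and C = C and ?e0.0 = "1/2" and m = 1 and K = 1])
   show "all_moments w" unfolding w_def[abs_def] using z by (intro all_moments_lw(2)) auto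
   show "w y = exp (L y)" if "0 < y" for y
    using that t(4)[OF that] by (simp add: w_def lw_def L_def exp_diff exp_add exp_minus exp_of_nat_mult divide_inverse)
   show "phi \<in> borel_measurable borel" unfolding phi_def[abs_def] by measurable
   show "lam \<in> borel_measurable borel" unfolding lam_def[abs_def] by measurable
   show "(phi has_real_derivative (tt z y)\<^sup>2) (at y)" if "0 <= y" for y
    using power_tt_has_derivative[of z y 0] z that by (simp add: phi_def[abs_def] numeral_2_eq_2)
   have "continuous_on {0..} (tt z)"
    using tt_has_derivative[of z] z by (intro continuous_at_imp_continuous_on) (auto intro!: DERIV_isCont)
   then show "continuous_on {0..} (%y. (tt z y)\<^sup>2)" by (intro continuous_intros)
   show "\<bar>(tt z y)\<^sup>2\<bar> <= C" if "0 <= y" for y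
    using t2[of y] that by (cases "y = 0") (auto simp: C_def tt_def)
   show "\<bar>phi y\<bar> <= C * y" if "0 <= y" for y
   proof (cases "y = 0")
    case False
    then have "\<bar>phi y\<bar> <= 1 * y" using t[of y] that by (simp add: phi_def abs_mult)
    also have "... <= C * y" using that by (intro mult_right_mono) (auto simp: C_def)
    finally show ?thesis .
   qed (simp add: phi_def)
   show "phi y - phi u = (y - u) * (tt z y * tt z u)" if "0 < y" "0 < u" for y u
    using t(4)[OF that(1)] t(4)[OF that(2)] unfolding phi_def tt_def by (simp add: field_simps)
   show "\<bar>tt z y * tt z u\<bar> <= C" if "0 < y" "0 < u" for y u
   proof -
    have "\<bar>tt z y * tt z u\<bar> <= 1 * 1" unfolding abs_mult using t[OF that(1)] t[OF that(2)] by (intro mult_mono) auto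
    then show ?thesis by (simp add: C_def)
   qed
   show "e * lam y - e\<^sup>2 * (C * (1 + y) ^ 1) <= L (y + e * phi y) - L y" if y: "0 < y" and e: "\<bar>e\<bar> <= 1 / 2" for y e
   proof -
    have a: "\<bar>e * T\<bar> <= 1 / 2" "e * T - 2 * e\<^sup>2 <= ln (1 + e * T)" if T: "0 <= T" "T <= 1" for T
    proof -
     have "\<bar>e\<bar> * T <= 1 / 2 * 1" using T e by (intro mult_mono) auto
     then show 1: "\<bar>e * T\<bar> <= 1 / 2" using T by (simp add: abs_mult)
     have "(e * T)\<^sup>2 <= e\<^sup>2 * 1" unfolding power_mult_distrib using T by (intro mult_left_mono power_le_one) auto
     then show "e * T - 2 * e\<^sup>2 <= ln (1 + e * T)" using ln_one_plus_ge[OF 1] by linarith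
    qed
    note a1 = a[of "tt z y"] and a2 = a[OF zy[OF y]]
    have T: "0 <= tt z y" "tt z y <= 1" using t[OF y] by auto
    have e1: "y + e * phi y = y * (1 + e * tt z y)" by (simp add: phi_def algebra_simps)
    have e2: "1 + z * (y + e * phi y) = (1 + z * y) * (1 + e * (z * y * (tt z y)\<^sup>2))"
    proof -
     have "(1 + z * y) * tt z y = 1" using t(4)[OF y] by (simp add: tt_def)
     then have "(1 + z * y) * (e * (z * y * (tt z y)\<^sup>2)) = e * z * y * tt z y" by (simp add: power2_eq_square mult_ac)
     then show ?thesis by (simp add: phi_def algebra_simps)
    qed
    have p: "1 + e * tt z y > 0" "1 + e * (z * y * (tt z y)\<^sup>2) > 0" using a1(1)[OF T] a2(1) by (simp_all add: abs_le_iff)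
    have "L (y + e * phi y) - L y = real c * ln (1 + e * tt z y) + ln (1 + e * (z * y * (tt z y)\<^sup>2)) - e * phi y"
    proof -
     have "ln (y + e * phi y) = ln y + ln (1 + e * tt z y)" unfolding e1 using p y by (simp add: ln_mult)
     moreover have "ln (1 + z * (y + e * phi y)) = ln (1 + z * y) + ln (1 + e * (z * y * (tt z y)\<^sup>2))" unfolding e2 by (rule ln_mult_pos[OF t(4)[OF y] p(2)])
     ultimately show ?thesis unfolding L_def by (simp add: distrib_left)
    qed
    moreover have "real c * (e * tt z y - 2 * e\<^sup>2) <= real c * ln (1 + e * tt z y)" using a1(2)[OF T] by (intro mult_left_mono) auto
    moreover have "e * lam y - e\<^sup>2 * C = real c * (e * tt z y - 2 * e\<^sup>2) + (e * (z * y * (tt z y)\<^sup>2) - 2 * e\<^sup>2) - e * phi y"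
     by (simp add: lam_def phi_def C_def algebra_simps)
    moreover have "e\<^sup>2 * C <= e\<^sup>2 * (C * (1 + y) ^ 1)" using y by (intro mult_left_mono) (auto simp: C_def)
    ultimately show ?thesis using a2(2) by linarith
   qed
   show "\<bar>lam y\<bar> <= C * (1 + y) ^ 1" if y: "0 < y" for y
   proof -
    have "0 <= real c * tt z y" "real c * tt z y <= real c * 1" using t[OF y] by (simp, intro mult_left_mono) auto
    moreover have "0 <= y * tt z y" "y * tt z y <= y * 1" using t[OF y] y by (auto intro!: mult_left_mono)
    moreover have "0 <= real c * y" using y by simp
    moreover have "(2 * real c + 2) * (1 + y) ^ 1 = 2 * real c + 2 + 2 * (real c * y) + 2 * y" by (simp add: algebra_simps)
    ultimately show ?thesis using zy[OF y] y unfolding lam_def C_def by linarith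
   qed
  qed (use b in \<open>auto simp: w_def lw_def phi_def C_def\<close>)
  also have "(%x. (1 * ((\<Sum>i<N. (tt z (x i))\<^sup>2) + 2 * b * (\<Sum>(i, j)\<in>{(i, j). i < j \<and> j < N}. tt z (x i) * tt z (x j)) + (\<Sum>i<N. lam (x i))) + 0) * gasw N b w x)
   = (%x. (\<Sum>k\<le>N. r k x * z ^ k) * G x)"
  proof
   fix x :: "nat => real"
   have gw: "gasw N b w x = poly (ff {..<N} x) z * G x"
    by (simp add: gasw_def G_def w_def prod.distrib poly_ff)
   define LL where "LL = (\<Sum>i<N. (tt z (x i))\<^sup>2) + 2 * b * (\<Sum>(i, j)\<in>{(i, j). i < j \<and> j < N}. tt z (x i) * tt z (x j)) + (\<Sum>i<N. lam (x i))"
   have "LL * poly (ff {..<N} x) z = (\<Sum>k\<le>N. r k x * z ^ k)" if pos: "\<forall>i<N. x i > 0"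
   proof -
    \<comment> \<open>Each factor \<open>tt\<close> cancels one factor 1 + z x i of the tilt, so
      products of \<open>tt\<close> with the tilt are generating polynomials of the remaining
      variables.\<close>
    define q where "q S = poly (ff S x) z" for S
    have q1: "tt z (x i) * q S = q (S - {i})" if "finite S" "i \<in> S" "i < N" for i S
    proof -
     have "q S = (1 + z * x i) * q (S - {i})" using that(1,2) unfolding q_def poly_ff by (rule prod.remove)
     then show ?thesis using t(4)[of "x i"] pos that by (simp add: tt_def)
    qed
    have 1: "(\<Sum>i<N. tt z (x i)) * q {..<N} = (\<Sum>i<N. q ({..<N} - {i}))"
     unfolding sum_distrib_right by (intro sum.cong refl q1) auto
    have 2: "(\<Sum>i<N. x i * tt z (x i)) * q {..<N} = (\<Sum>i<N. x i * q ({..<N} - {i}))"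
     unfolding sum_distrib_right mult.assoc by (intro sum.cong refl arg_cong2[of _ _ _ _ "(*)"] q1) auto
    have 3: "(2 * (\<Sum>(i, j)\<in>{(i, j). i < j \<and> j < N}. tt z (x i) * tt z (x j))) * q {..<N} = (\<Sum>i<N. \<Sum>j\<in>{..<N} - {i}. q ({..<N} - {i} - {j}))"
    proof -
     have "2 * (\<Sum>(i, j)\<in>{(i, j). i < j \<and> j < N}. tt z (x i) * tt z (x j)) = (\<Sum>i<N. (\<Sum>j<N. tt z (x j) * tt z (x i)) - tt z (x i) * tt z (x i))"
      unfolding sum_subtractf by (subst sum_pairs_symmetric) (simp_all add: mult.commute)
     also have "... = (\<Sum>i<N. \<Sum>j\<in>{..<N} - {i}. tt z (x j) * tt z (x i))"
      by (intro sum.cong refl) (simp add: sum_diff1)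
     also have "... * q {..<N} = (\<Sum>i<N. \<Sum>j\<in>{..<N} - {i}. q ({..<N} - {i} - {j}))"
      unfolding sum_distrib_right mult.assoc by (intro sum.cong refl) (simp add: q1)
     finally show ?thesis .
    qed
    \<comment> \<open>The Jacobian term tt^2 and the contribution z y tt^2 of the tilt to
      \<open>lam\<close> add up to tt.\<close>
    have lam: "(tt z (x i))\<^sup>2 + lam (x i) = (1 + real c) * tt z (x i) - x i * tt z (x i)" if "i < N" for i
    proof -
     have "(tt z (x i))\<^sup>2 + z * x i * (tt z (x i))\<^sup>2 = tt z (x i) * (tt z (x i) + z * x i * tt z (x i))" by (simp add: power2_eq_square algebra_simps)
     also have "... = tt z (x i)" using t(3)[of "x i"] pos that by simp
     finally show ?thesis unfolding lam_def by (simp add: algebra_simps)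
    qed
    have AL: "(\<Sum>i<N. (tt z (x i))\<^sup>2) + (\<Sum>i<N. lam (x i)) = (1 + real c) * (\<Sum>i<N. tt z (x i)) - (\<Sum>i<N. x i * tt z (x i))"
     unfolding sum.distrib[symmetric] sum_distrib_left sum_subtractf[symmetric] by (intro sum.cong refl lam) auto
    from this have "LL * q {..<N} = (1 + real c) * ((\<Sum>i<N. tt z (x i)) * q {..<N}) - (\<Sum>i<N. x i * tt z (x i)) * q {..<N}
     + b * ((2 * (\<Sum>(i, j)\<in>{(i, j). i < j \<and> j < N}. tt z (x i) * tt z (x j))) * q {..<N})"
    proof -
     have "(A + 2 * b * P + L) * Q = (1 + real c) * (S * Q) - U * Q + b * ((2 * P) * Q)" if "A + L = (1 + real c) * S - U" for A P L Q S U
     proof -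
      have "(A + 2 * b * P + L) * Q = (A + L) * Q + b * ((2 * P) * Q)" by (simp add: algebra_simps)
      then show ?thesis unfolding that by (simp add: algebra_simps)
     qed
     from this[OF AL] show ?thesis unfolding LL_def .
    qed
    also have "... = (1 + real c) * (\<Sum>i<N. q ({..<N} - {i})) - (\<Sum>i<N. x i * q ({..<N} - {i})) + b * (\<Sum>i<N. \<Sum>j\<in>{..<N} - {i}. q ({..<N} - {i} - {j}))"
     unfolding 1 2 3 ..
    also have "... = (\<Sum>k\<le>N. r k x * z ^ k)"
    proof -
     have qe: "q S = (\<Sum>k\<le>N. elem S x k * z ^ k)" if "S \<subseteq> {..<N}" for S
      unfolding q_def using card_mono[OF _ that] finite_subset[OF that] by (intro poly_elem[symmetric]) auto
     have a: "(\<Sum>i<N. q ({..<N} - {i})) = (\<Sum>k\<le>N. ((real N - real k) * elem {..<N} x k) * z ^ k)"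
     proof -
      have "(\<Sum>i<N. q ({..<N} - {i})) = (\<Sum>i<N. \<Sum>k\<le>N. elem ({..<N} - {i}) x k * z ^ k)" by (intro sum.cong refl qe) auto
      also have "... = (\<Sum>k\<le>N. (\<Sum>i<N. elem ({..<N} - {i}) x k) * z ^ k)" unfolding sum_distrib_right by (rule sum.swap)
      finally show ?thesis by (simp add: sum_elem_remove)
     qed
     have b: "(\<Sum>i<N. x i * q ({..<N} - {i})) = (\<Sum>k\<le>N. (real (Suc k) * elem {..<N} x (Suc k)) * z ^ k)"
     proof -
      have "(\<Sum>i<N. x i * q ({..<N} - {i})) = (\<Sum>i<N. \<Sum>k\<le>N. x i * elem ({..<N} - {i}) x k * z ^ k)"
       by (intro sum.cong refl) (simp add: qe[OF Diff_subset] sum_distrib_left mult.assoc)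
      also have "... = (\<Sum>k\<le>N. (\<Sum>i<N. x i * elem ({..<N} - {i}) x k) * z ^ k)" unfolding sum_distrib_right by (rule sum.swap)
      finally show ?thesis by (simp only: sum_elem_remove_mult[OF finite_lessThan])
     qed
     have c: "(\<Sum>i<N. \<Sum>j\<in>{..<N} - {i}. q ({..<N} - {i} - {j})) = (\<Sum>k\<le>N. ((real N - 1 - real k) * ((real N - real k) * elem {..<N} x k)) * z ^ k)"
     proof -
      have "(\<Sum>i<N. \<Sum>j\<in>{..<N} - {i}. q ({..<N} - {i} - {j})) = (\<Sum>i<N. \<Sum>j\<in>{..<N} - {i}. \<Sum>k\<le>N. elem ({..<N} - {i} - {j}) x k * z ^ k)"
       by (intro sum.cong refl qe) auto
      also have "... = (\<Sum>i<N. \<Sum>k\<le>N. (\<Sum>j\<in>{..<N} - {i}. elem ({..<N} - {i} - {j}) x k) * z ^ k)"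
       unfolding sum_distrib_right by (intro sum.cong refl sum.swap)
      also have "... = (\<Sum>k\<le>N. (\<Sum>i<N. \<Sum>j\<in>{..<N} - {i}. elem ({..<N} - {i} - {j}) x k) * z ^ k)" unfolding sum_distrib_right by (rule sum.swap)
      also have "... = (\<Sum>k\<le>N. ((real N - 1 - real k) * ((real N - real k) * elem {..<N} x k)) * z ^ k)"
      proof (intro sum.cong refl arg_cong2[of _ _ _ _ "(*)"])
       fix k
       show "(\<Sum>i<N. \<Sum>j\<in>{..<N} - {i}. elem ({..<N} - {i} - {j}) x k) = (real N - 1 - real k) * ((real N - real k) * elem {..<N} x k)"
      proof -
       have "(\<Sum>i<N. \<Sum>j\<in>{..<N} - {i}. elem ({..<N} - {i} - {j}) x k) = (\<Sum>i<N. (real N - 1 - real k) * elem ({..<N} - {i}) x k)"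
        by (intro sum.cong refl) (simp add: sum_elem_remove of_nat_diff)
       then show ?thesis by (simp add: sum_distrib_left[symmetric] sum_elem_remove)
       qed
      qed
      finally show ?thesis .
     qed
     show ?thesis unfolding a b c sum_distrib_left sum_subtractf[symmetric] sum.distrib[symmetric] r_def
      by (intro sum.cong refl) (simp add: algebra_simps)
    qed
    finally show ?thesis by (simp add: q_def)
   qed
   moreover have "G x = 0" if "\<not> (\<forall>i<N. x i > 0)"
    using that by (auto simp: G_def gasw_def lw_def intro!: prod_zero)
   ultimately show "(1 * ((\<Sum>i<N. (tt z (x i))\<^sup>2) + 2 * b * (\<Sum>(i, j)\<in>{(i, j). i < j \<and> j < N}. tt z (x i) * tt z (x j)) + (\<Sum>i<N. lam (x i))) + 0) * gasw N b w x = (\<Sum>k\<le>N. r k x * z ^ k) * G x"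
    unfolding gw LL_def[symmetric] by (cases "\<forall>i<N. x i > 0") (simp_all add: mult.assoc[symmetric])
  qed
  also have "(\<integral>x. (\<Sum>k\<le>N. r k x * z ^ k) * G x \<partial>leb N) = (\<integral>x. (\<Sum>k\<le>N. z ^ k * (r k x * G x)) \<partial>leb N)"
   unfolding sum_distrib_right by (simp add: mult_ac)
  also have "... = (\<Sum>k\<le>N. z ^ k * (\<integral>x. r k x * G x \<partial>leb N))"
   using ir by (subst Bochner_Integration.integral_sum) auto
  finally show ?thesis by (simp add: p_def poly_sum poly_monom mult.commute)
 qed
 \<comment> \<open>The identity holds for all z > 0, more values than a nonzero polynomial has
   roots.\<close>
 then have "{0<..} \<subseteq> {z. poly p z = 0}" by auto
 then have "infinite {z. poly p z = 0}" using infinite_Ioi[of "0::real"] finite_subset by blast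
 then have "p = 0" using poly_roots_finite by blast
 then have "coeff p k = 0" by simp
 then have "(\<integral>x. r k x * G x \<partial>leb N) = 0" using k by (simp add: p_def coeff_sum if_distrib sum.delta cong: if_cong)
 moreover have "(\<integral>x. r k x * G x \<partial>leb N) = (real N - real k) * (1 + real c + b * (real N - 1 - real k)) * (\<integral>x. elem {..<N} x k * G x \<partial>leb N)
  - real (Suc k) * (\<integral>x. elem {..<N} x (Suc k) * G x \<partial>leb N)"
  unfolding r_def left_diff_distrib mult.assoc using ie by simp
 ultimately show ?thesis by (simp add: G_def)
qed

definition ZL :: "nat => real => nat => real" where
 "ZL N b c = (\<integral>x. gasw N b (lw c) x \<partial>leb N)"

text \<open>Aomoto's recursion leads from e_0 = 1 to e_N, the product of all coordinates, which
  raises the exponent of the weight by one. The binomial coefficient carried along is 1 at both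
  ends.\<close>

lemma ZL_Suc:
 assumes b: "b >= 0"
 shows "ZL N b (Suc c) = (\<Prod>j<N. 1 + real c + b * real j) * ZL N b c"
proof -
 define E where "E k = (\<integral>x. elem {..<N} x k * gasw N b (lw c) x \<partial>leb N)" for k
 have E: "k <= N ==> E k = of_nat (N choose k) * (\<Prod>j<k. 1 + real c + b * (real N - 1 - real j)) * E 0" for k
 proof (induction k)
  case (Suc k)
  have ch: "real (Suc k) * real (N choose Suc k) = (real N - real k) * real (N choose k)"
  proof -
   have "Suc k * (N choose Suc k) = (N - k) * (N choose k)" unfolding binomial_absorption binomial_absorb_comp ..
   then have "real (Suc k * (N choose Suc k)) = real ((N - k) * (N choose k))" by simp
   then show ?thesis using Suc.prems by (simp add: of_nat_diff distrib_right)
  qed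
  have "real (Suc k) * E (Suc k) = (real N - real k) * (1 + real c + b * (real N - 1 - real k)) * E k"
   unfolding E_def by (rule aomoto[OF b]) (use Suc in simp)
  also have "... = ((real N - real k) * real (N choose k)) * ((\<Prod>j<k. 1 + real c + b * (real N - 1 - real j)) * (1 + real c + b * (real N - 1 - real k))) * E 0"
   using Suc by (simp add: mult_ac)
  also have "... = real (Suc k) * (real (N choose Suc k) * (\<Prod>j<Suc k. 1 + real c + b * (real N - 1 - real j)) * E 0)"
   unfolding ch[symmetric] by (simp only: prod.lessThan_Suc mult_ac)
  finally show ?case by (simp del: of_nat_Suc)
 qed (simp add: E_def)
 have "elem {..<N} x 0 = 1" for x by (simp add: ff_def poly_0_coeff_0[symmetric] poly_prod)
 then have "E 0 = ZL N b c" by (simp add: E_def ZL_def)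
 moreover have "E N = ZL N b (Suc c)"
 proof -
  have "elem {..<n} x n = (\<Prod>i<n. x i)" for x n
  proof (induction n)
   case (Suc n)
   have "elem {..<n} x (Suc n) = 0" using degree_ff[of "{..<n}" x] by (intro coeff_eq_0) simp
   then show ?case using elem_insert[of "{..<n}" n x "Suc n"] Suc by (simp add: lessThan_Suc mult.commute)
  qed (simp add: ff_def)
  moreover have "(\<Prod>i<N. x i) * gasw N b (lw c) x = gasw N b (lw (Suc c)) x" for x
  proof -
   have "y * lw c y = lw (Suc c) y" for y by (simp add: lw_def)
   then show ?thesis unfolding gasw_def by (simp add: prod.distrib[symmetric] mult.left_commute)
  qed
  ultimately show ?thesis by (simp add: E_def ZL_def)
 qed
 moreover have "(\<Prod>j<N. 1 + real c + b * (real N - 1 - real j)) = (\<Prod>j<N. 1 + real c + b * real j)"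
  by (subst prod.nat_diff_reindex[symmetric]) (auto intro!: prod.cong simp: of_nat_diff algebra_simps)
 ultimately show ?thesis using E[of N] by simp
qed

lemma card_pairs: "2 * real (card {(i, j). i < j \<and> j < N}) = real N * (real N - 1)"
 using sum_pairs_symmetric[of N "%_ _. 1"] by (simp add: case_prod_unfold algebra_simps)

lemma vdm_affine:
 assumes "c ~= 0"
 shows "vdm N b (\<lambda>i\<in>{..<N}. a + c * x i) = \<bar>c\<bar> powr (b * (real N * (real N - 1))) * vdm N b x"
proof -
 have "vdm N b (\<lambda>i\<in>{..<N}. a + c * x i) = (\<Prod>(i, j)\<in>{(i, j). i < j \<and> j < N}. \<bar>c\<bar> powr (2 * b) * \<bar>x i - x j\<bar> powr (2 * b))"
  unfolding vdm_def by (intro prod.cong refl) (auto simp: abs_mult[symmetric] powr_mult[symmetric] right_diff_distrib)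
 also have "... = (\<bar>c\<bar> powr (2 * b)) ^ card {(i, j). i < j \<and> j < N} * vdm N b x"
  unfolding vdm_def by (simp add: case_prod_unfold prod.distrib)
 also have "(\<bar>c\<bar> powr (2 * b)) ^ card {(i, j). i < j \<and> j < N} = \<bar>c\<bar> powr (b * (2 * real (card {(i, j). i < j \<and> j < N})))"
  using assms by (subst powr_realpow[symmetric]) (simp_all add: powr_powr mult_ac)
 finally show ?thesis unfolding card_pairs .
qed

lemma gas_affine:
 assumes c: "c ~= 0" and [measurable]: "w \<in> borel_measurable borel" and w0: "!!y. 0 <= w y"
 shows "(\<integral>x. gasw N b w x \<partial>leb N) = \<bar>c\<bar> ^ N * \<bar>c\<bar> powr (b * (real N * (real N - 1))) * (\<integral>x. gasw N b (%y. w (a + c * y)) x \<partial>leb N)"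
proof -
 define K where "K = \<bar>c\<bar> ^ N * \<bar>c\<bar> powr (b * (real N * (real N - 1)))"
 have K: "K >= 0" by (simp add: K_def)
 have g0: "0 <= gasw N b w x" "0 <= gasw N b (%y. w (a + c * y)) x" for x
  by (rule gasw_nonneg, rule w0)+
 have g: "gasw N b w (\<lambda>i\<in>{..<N}. a + c * x i) = \<bar>c\<bar> powr (b * (real N * (real N - 1))) * gasw N b (%y. w (a + c * y)) x" for x
  unfolding gasw_def vdm_affine[OF c] by simp
 have "(\<integral>\<^sup>+x. ennreal (gasw N b w x) \<partial>leb N) = (\<integral>\<^sup>+x. ennreal (gasw N b w x) * (\<Prod>i<N. 1) \<partial>leb N)" by simp
 also have "... = (\<integral>\<^sup>+x. ennreal (gasw N b w (\<lambda>i\<in>{..<N}. a + c * x i)) * (\<Prod>i<N. ennreal \<bar>c\<bar>) \<partial>leb N)"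
 proof (rule nn_integral_leb_substitution[symmetric, where G = "%x. ennreal (gasw N b w x)"])
  fix g :: "real => ennreal" assume [measurable]: "g \<in> borel_measurable borel"
  show "(\<integral>\<^sup>+y. g (a + c * y) * ennreal \<bar>c\<bar> \<partial>lborel) = (\<integral>\<^sup>+y. g y * 1 \<partial>lborel)"
   using nn_integral_real_affine[OF _ c, of g a] by (simp add: nn_integral_cmult mult.commute)
 qed measurable
 also have "... = (\<integral>\<^sup>+x. ennreal (K * gasw N b (%y. w (a + c * y)) x) \<partial>leb N)"
  unfolding g by (intro nn_integral_cong) (simp add: ennreal_mult'[symmetric] ennreal_power K_def mult_ac)
 finally have "(\<integral>x. gasw N b w x \<partial>leb N) = (\<integral>x. K * gasw N b (%y. w (a + c * y)) x \<partial>leb N)"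
  using g0 K by (subst (1 2) integral_eq_nn_integral) auto
 then show ?thesis by (simp add: K_def)
qed

definition Meh :: "nat => real => real" where
 "Meh N b = (\<integral>x. gasw N b (%y. exp (- (y\<^sup>2 / 2))) x \<partial>leb N)"

text \<open>A Laguerre weight, centred and rescaled so as to converge to \<open>exp (- x\<^sup>2 / 2)\<close>.\<close>

definition wn :: "nat => real => real" where
 "wn n x = (if x > - sqrt (real n) then (1 + x / sqrt (real n)) ^ n * exp (- (sqrt (real n) * x)) else 0)"

lemma ln_one_plus_upper:
 fixes u :: real
 shows "- 1 < u ==> u <= 0 ==> ln (1 + u) - u <= - (u\<^sup>2 / 2)" "u >= 0 ==> ln (1 + u) - u <= - (u\<^sup>2 / (2 * (1 + u)))"
proof -
 show "ln (1 + u) - u <= - (u\<^sup>2 / 2)" if u: "- 1 < u" "u <= 0"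
 proof -
  have "ln (1 + u) - u + u\<^sup>2 / 2 <= ln (1 + 0) - 0 + 0\<^sup>2 / 2"
  proof (rule DERIV_nonneg_imp_nondecreasing[OF u(2)])
   fix v assume v: "u <= v" "v <= (0::real)"
   have "((%v. ln (1 + v) - v + v\<^sup>2 / 2) has_real_derivative 1 / (1 + v) - 1 + v) (at v)"
    using u v by (auto intro!: derivative_eq_intros)
   moreover have "1 / (1 + v) - 1 + v = v\<^sup>2 / (1 + v)" using u v by (simp add: field_simps power2_eq_square)
   ultimately show "\<exists>y. ((%v. ln (1 + v) - v + v\<^sup>2 / 2) has_real_derivative y) (at v) \<and> y >= 0" using u v by (intro exI[of _ "v\<^sup>2 / (1 + v)"]) auto
  qed
  then show ?thesis by simp
 qed
 show "ln (1 + u) - u <= - (u\<^sup>2 / (2 * (1 + u)))" if u: "u >= 0"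
 proof -
  have "ln (1 + u) - u + u\<^sup>2 / (2 * (1 + u)) <= ln (1 + 0) - 0 + 0\<^sup>2 / (2 * (1 + 0))"
  proof (rule DERIV_nonpos_imp_nonincreasing[OF u])
   fix v assume v: "0 <= v" "v <= u"
   have "((%v. ln (1 + v) - v + v\<^sup>2 / (2 * (1 + v))) has_real_derivative 1 / (1 + v) - 1 + (2 * v * (2 * (1 + v)) - v\<^sup>2 * 2) / (2 * (1 + v) * (2 * (1 + v)))) (at v)"
    using v by (auto intro!: derivative_eq_intros)
   moreover have "1 / (1 + v) - 1 + (2 * v * (2 * (1 + v)) - v\<^sup>2 * 2) / (2 * (1 + v) * (2 * (1 + v))) = - (v\<^sup>2 / (2 * (1 + v)\<^sup>2))"
    using v by (simp add: divide_simps) (simp add: power2_eq_square algebra_simps)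
   ultimately show "\<exists>y. ((%v. ln (1 + v) - v + v\<^sup>2 / (2 * (1 + v))) has_real_derivative y) (at v) \<and> y <= 0" by auto
  qed
  then show ?thesis by simp
 qed
qed

lemma wn_eq_exp: "n > 0 ==> x > - sqrt (real n) ==> wn n x = exp (real n * (ln (1 + x / sqrt (real n)) - x / sqrt (real n)))"
proof -
 assume n: "n > 0" and x: "x > - sqrt (real n)"
 have p: "1 + x / sqrt (real n) > 0" using n x by (simp add: field_simps)
 have "real n * (x / sqrt (real n)) = sqrt (real n) * x" using n by (simp add: field_simps)
 then have "real n * (ln (1 + x / sqrt (real n)) - x / sqrt (real n)) = real n * ln (1 + x / sqrt (real n)) + - (sqrt (real n) * x)" by (simp add: right_diff_distrib)
 then show ?thesis using x p by (simp add: wn_def exp_add exp_of_nat_mult del: add_uminus_conv_diff)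
qed

text \<open>A dominating function uniform in n: Gaussian decay to the left of 0 and exponential
  decay to the right, by the two parts of \<open>ln_one_plus_upper\<close>.\<close>

lemma wn_bound: "n > 0 ==> wn n x <= exp (1 / 2) * exp (- (1 / 2 * \<bar>x\<bar>))"
proof (cases "x > - sqrt (real n)")
 case True
 assume n: "n > 0"
 define s where "s = sqrt (real n)"
 have s: "s >= 1" "real n = s\<^sup>2" using n by (auto simp: s_def)
 have "real n * (ln (1 + x / s) - x / s) <= 1 / 2 - 1 / 2 * \<bar>x\<bar>"
 proof (cases "x <= 0")
  case neg: True
  have "real n * (ln (1 + x / s) - x / s) <= real n * - ((x / s)\<^sup>2 / 2)"
   using True neg s by (intro mult_left_mono ln_one_plus_upper(1)) (auto simp: s_def[symmetric] field_simps)
  also have "... = - (x\<^sup>2 / 2)" using s by (simp add: power_divide)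
  also have "... <= 1 / 2 - 1 / 2 * \<bar>x\<bar>"
  proof -
   have "0 <= (\<bar>x\<bar> - 1 / 2)\<^sup>2" by simp
   then show ?thesis by (simp add: power2_eq_square algebra_simps)
  qed
  finally show ?thesis .
 next
  case False
  have "real n * (ln (1 + x / s) - x / s) <= real n * - ((x / s)\<^sup>2 / (2 * (1 + x / s)))"
   using False s by (intro mult_left_mono ln_one_plus_upper(2)) auto
  also have "... = - (x\<^sup>2 / (2 * (1 + x / s)))" using s by (simp add: power_divide)
  also have "... <= - (x\<^sup>2 / (2 * (1 + x)))"
  proof -
   have "x / s <= x / 1" using s False by (intro divide_left_mono) auto
   then have "x\<^sup>2 / (2 * (1 + x)) <= x\<^sup>2 / (2 * (1 + x / s))" using False s by (intro divide_left_mono) (auto intro!: mult_pos_pos add_pos_pos)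
   then show ?thesis by simp
  qed
  also have "... <= 1 / 2 - 1 / 2 * \<bar>x\<bar>" using False by (simp add: field_simps power2_eq_square)
  finally show ?thesis .
 qed
 then show ?thesis unfolding wn_eq_exp[OF n True] s_def mult_exp_exp by simp
qed (simp add: wn_def)

lemma wn_limit: "(%n. wn n x) \<longlonglongrightarrow> exp (- (x\<^sup>2 / 2))"
proof -
 have "(%n. real n * (ln (1 + x / sqrt (real n)) - x / sqrt (real n))) \<longlonglongrightarrow> - (x * x / 2)"
  by real_asymp
 then have lim: "(%n. exp (real n * (ln (1 + x / sqrt (real n)) - x / sqrt (real n)))) \<longlonglongrightarrow> exp (- (x\<^sup>2 / 2))" unfolding power2_eq_square by (rule tendsto_exp)
 have "filterlim (%n. sqrt (real n)) at_top sequentially" by real_asymp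
 then have "eventually (%n. sqrt (real n) > - x) sequentially" by (simp add: filterlim_at_top_dense)
 then have "eventually (%n. exp (real n * (ln (1 + x / sqrt (real n)) - x / sqrt (real n))) = wn n x) sequentially"
  using eventually_gt_at_top[of 0] by eventually_elim (simp add: wn_eq_exp)
 with lim show ?thesis by (rule Lim_transform_eventually)
qed

lemma wn_gas_limit:
 assumes "b >= 0"
 shows "(%n. \<integral>x. gasw N b (wn n) x \<partial>leb N) \<longlonglongrightarrow> Meh N b"
proof -
 define w where "w x = exp (1 / 2) * exp (- (1 / 2 * \<bar>x\<bar>))" for x :: real
 have w: "all_moments w" by (rule all_moments_exp_bound[where c = "1 / 2" and C = "exp (1 / 2)"]) (auto simp: w_def[abs_def])
 have [measurable]: "wn n \<in> borel_measurable borel" for n unfolding wn_def[abs_def] by measurable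
 have wn0: "0 <= wn n x" for n x by (auto simp: wn_def field_simps intro!: mult_nonneg_nonneg zero_le_power) (cases "n = 0"; simp add: field_simps)
 have "(%n. \<integral>x. gasw N b (wn (n + 1)) x \<partial>leb N) \<longlonglongrightarrow> Meh N b"
  unfolding Meh_def
 proof (rule integral_dominated_convergence[where w = "gasw N b w"])
  show "integrable (leb N) (gasw N b w)" using integrable_spread_gasw[OF assms w, of N 0] by simp
  show "AE x in leb N. (%n. gasw N b (wn (n + 1)) x) \<longlonglongrightarrow> gasw N b (%y. exp (- (y\<^sup>2 / 2))) x"
   unfolding gasw_def by (intro AE_I2 tendsto_mult tendsto_const tendsto_prod LIMSEQ_ignore_initial_segment[OF wn_limit])
  show "AE x in leb N. norm (gasw N b (wn (n + 1)) x) <= gasw N b w x" for n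
  proof (rule AE_I2)
   fix x
   have "gasw N b (wn (n + 1)) x <= gasw N b w x" unfolding gasw_def w_def
    by (intro mult_left_mono prod_mono vdm_nonneg conjI wn0 wn_bound) auto
   moreover have "0 <= gasw N b (wn (n + 1)) x" unfolding gasw_def by (intro mult_nonneg_nonneg vdm_nonneg prod_nonneg) (simp add: wn0)
   ultimately show "norm (gasw N b (wn (n + 1)) x) <= gasw N b w x" by simp
  qed
 qed measurable
 then show ?thesis by (rule LIMSEQ_offset)
qed

text \<open>Ratio of n! to Stirling's approximation without its constant; the constant itself is
  found in \<open>stir_limit\<close>.\<close>

definition stir :: "nat => real" where
 "stir n = fact n / (sqrt (real n) * (real n ^ n * exp (- real n)))"

lemma ZL_pochhammer:
 assumes "b >= 0"
 shows "ZL N b n = (\<Prod>j<N. pochhammer (1 + b * real j) n) * ZL N b 0"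
proof (induction n)
 case (Suc n)
 then show ?case unfolding ZL_Suc[OF assms] by (simp add: pochhammer_Suc prod.distrib add_ac)
qed simp

text \<open>An exact identity for every n > 0: under y = n + sqrt n x the Laguerre weight
  \<open>lw n\<close> becomes a constant times \<open>wn n\<close>. The factors are grouped so that
  each of them converges as n grows.\<close>

lemma wn_gas_eq:
 assumes b: "b >= 0" and n: "n > 0"
 shows "(\<integral>x. gasw N b (wn n) x \<partial>leb N) = ZL N b 0 * (\<Prod>j<N. pochhammer (1 + b * real j) n / (fact n * real n powr (b * real j))) * stir n ^ N"
proof -
 define s where "s = sqrt (real n)"
 have s: "s > 0" "s * s = real n" using n by (auto simp: s_def)
 define q where "q = real n ^ n * exp (- real n)"
 have q: "q > 0" using n by (simp add: q_def)
 define J where "J = (\<integral>x. gasw N b (wn n) x \<partial>leb N)"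
 have lwn: "lw n (real n + s * y) = q * wn n y" for y
 proof -
  have e: "real n + s * y = real n * (1 + y / s)" "real n + s * y = s * (s + y)" using s n by (simp_all add: field_simps)
  have p: "real n + s * y > 0 \<longleftrightarrow> y > - s" unfolding e(2) using s by (auto simp: zero_less_mult_iff)
  have "(real n + s * y) ^ n = real n ^ n * (1 + y / s) ^ n" unfolding e(1) power_mult_distrib ..
  moreover have "exp (- (real n + s * y)) = exp (- real n) * exp (- (s * y))" by (simp add: mult_exp_exp)
  ultimately show ?thesis unfolding lw_def wn_def s_def[symmetric] p q_def by simp
 qed
 \<comment> \<open>The scaling factor of the repulsion is distributed over the N Pochhammer factors,
   n^(b j) to the j-th.\<close>
 have sp: "s powr (b * (real N * (real N - 1))) = (\<Prod>j<N. real n powr (b * real j))"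
 proof -
  have 1: "(\<Prod>j<N. real n powr (b * real j)) = real n powr (b * (\<Sum>j<N. real j))" using n by (simp add: powr_sum sum_distrib_left)
  have "2 * (\<Sum>j<N. real j) = real N * (real N - 1)" by (induction N) (simp_all add: algebra_simps)
  then have 2: "(\<Sum>j<N. real j) = real N * (real N - 1) / 2" by simp
  have 3: "s powr (b * (real N * (real N - 1))) = (s powr 2) powr (b * (real N * (real N - 1) / 2))" by (simp add: powr_powr)
  have 4: "s powr 2 = real n" using s by (simp add: power2_eq_square)
  show ?thesis unfolding 1 2 3 4 ..
 qed
 have "(%x. gasw N b (%y. lw n (real n + s * y)) x) = (%x. q ^ N * gasw N b (wn n) x)"
  unfolding lwn by (auto simp: gasw_def prod.distrib)
 then have I: "(\<integral>x. gasw N b (%y. lw n (real n + s * y)) x \<partial>leb N) = q ^ N * J" by (simp add: J_def)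
 have m: "lw n \<in> borel_measurable borel" "0 <= lw n y" for y using all_moments_lw(1)[of n] by (simp_all add: all_moments_def)
 have "ZL N b n = s ^ N * s powr (b * (real N * (real N - 1))) * (\<integral>x. gasw N b (%y. lw n (real n + s * y)) x \<partial>leb N)"
 proof -
  have "s ~= 0" "\<bar>s\<bar> = s" using s by auto
  then show ?thesis unfolding ZL_def using gas_affine[where c = s and w = "lw n" and N = N and b = b and a = "real n"] m by presburger
 qed
 then have Z: "(\<Prod>j<N. pochhammer (1 + b * real j) n) * ZL N b 0 = s ^ N * (\<Prod>j<N. real n powr (b * real j)) * (q ^ N * J)"
  unfolding ZL_pochhammer[OF b, of N n] sp I .
 have "stir n = fact n / (s * q)" by (simp add: stir_def s_def q_def)
 then have "ZL N b 0 * (\<Prod>j<N. pochhammer (1 + b * real j) n / (fact n * real n powr (b * real j))) * stir n ^ N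
  = ((\<Prod>j<N. pochhammer (1 + b * real j) n) * ZL N b 0) / ((\<Prod>j<N. real n powr (b * real j)) * (s * q) ^ N)"
  by (simp add: prod_dividef prod.distrib power_divide)
 also have "... = J"
  unfolding Z using s q n by (simp add: power_mult_distrib)
 finally show ?thesis by (simp add: J_def)
qed

lemma pochhammer_Gamma_limit:
 fixes z :: real
 assumes "z >= 0"
 shows "(%n. pochhammer (1 + z) n / (fact n * real n powr z)) \<longlonglongrightarrow> 1 / Gamma (1 + z)"
proof -
 \<comment> \<open>\<open>rGamma_series\<close> at 1 + z has one more Pochhammer factor, 1 + z + n,
   and the power n^(1 + z) in place of n^z; the ratio of the two changes tends to 1.\<close>
 have "(%n. rGamma_series (1 + z) n * (real n / (1 + z + real n))) \<longlonglongrightarrow> rGamma (1 + z) * 1"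
  by (intro tendsto_mult rGamma_series_LIMSEQ) real_asymp
 then have "(%n. rGamma_series (1 + z) n * (real n / (1 + z + real n))) \<longlonglongrightarrow> 1 / Gamma (1 + z)"
  by (simp add: rGamma_inverse_Gamma inverse_eq_divide)
 then show ?thesis
 proof (rule Lim_transform_eventually)
  show "eventually (%n. rGamma_series (1 + z) n * (real n / (1 + z + real n)) = pochhammer (1 + z) n / (fact n * real n powr z)) sequentially"
   using eventually_gt_at_top[of 0]
  proof eventually_elim
   case (elim n)
   have nz: "1 + z + real n > 0" using assms by simp
   have "exp ((1 + z) * ln (real n)) = real n * real n powr z" using elim by (simp add: distrib_right exp_add powr_def)
   then show ?case using elim nz unfolding rGamma_series_def by (simp add: pochhammer_Suc)
  qed
 qed
qed

text \<open>One particle without repulsion: \<open>wn_gas_eq\<close> reduces to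
  \<open>stir n\<close>, and the limit is the Gaussian integral. Stirling's constant thus comes from
  the same limit as Mehta's integral.\<close>

lemma stir_limit: "stir \<longlonglongrightarrow> sqrt (2 * pi)"
proof -
 interpret product_sigma_finite "%i::nat. lborel :: real measure" ..
 have vdm1: "vdm 1 0 x = 1" for x
 proof -
  have "{(i, j). i < j \<and> j < (1::nat)} = {}" by auto
  then show ?thesis by (simp only: vdm_def prod.empty)
 qed
 have g1: "(\<integral>x. gasw 1 0 w x \<partial>leb 1) = integral\<^sup>L lborel w" if "integrable lborel w" for w
  using product_integral_prod[of "{..<1::nat}" "%_. w"] that by (simp add: gasw_def vdm1[unfolded One_nat_def])
 have Z: "ZL 1 0 0 = 1"
 proof -
  have i: "integrable lborel (lw 0)" using all_moments_lw(1)[of 0] unfolding all_moments_def by (auto dest: spec[of _ "0::nat"])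
  have "lw 0 = (%x. indicator {0<..} x *\<^sub>R exp (- (x * 1)))" by (auto simp: lw_def indicator_def)
  then have "integral\<^sup>L lborel (lw 0) = 1" using LBINT_I0i_exp_mscale[of 1] unfolding interval_lebesgue_integral_0_infty by (simp add: set_lebesgue_integral_def)
  then show ?thesis unfolding ZL_def g1[OF i] .
 qed
 have M: "Meh 1 0 = sqrt (2 * pi)"
 proof -
  have e: "(%y. exp (- (y\<^sup>2 / 2))) = (%y. sqrt (2 * pi) * std_normal_density y)" by (auto simp: std_normal_density_def)
  have "integrable lborel (%y::real. exp (- (y\<^sup>2 / 2)))" unfolding e using integrable_normal_density[of 1 0] by simp
  from g1[OF this] show ?thesis unfolding Meh_def unfolding e by simp
 qed
 have "(%n. (\<integral>x. gasw 1 0 (wn n) x \<partial>leb 1)) \<longlonglongrightarrow> sqrt (2 * pi)" using wn_gas_limit[of 0 1] M by simp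
 then show ?thesis
 proof (rule Lim_transform_eventually)
  show "eventually (%n. (\<integral>x. gasw 1 0 (wn n) x \<partial>leb 1) = stir n) sequentially"
   using eventually_gt_at_top[of 0]
  proof eventually_elim
   case (elim n)
   show ?case using wn_gas_eq[of 0 n 1] elim Z by (simp add: pochhammer_fact[symmetric])
  qed
 qed
qed

text \<open>\<open>ZL N b 0\<close> is left uncomputed: up to scaling it is also the partition
  function \<open>gZ N b 0\<close>, and it cancels in \<open>ln_max_cdf\<close>.\<close>

theorem Meh_eq:
 assumes b: "b >= 0"
 shows "Meh N b = ZL N b 0 * sqrt (2 * pi) ^ N / (\<Prod>j<N. Gamma (1 + b * real j))"
proof -
 have "(%n. ZL N b 0 * (\<Prod>j<N. pochhammer (1 + b * real j) n / (fact n * real n powr (b * real j))) * stir n ^ N)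
  \<longlonglongrightarrow> ZL N b 0 * (\<Prod>j<N. 1 / Gamma (1 + b * real j)) * sqrt (2 * pi) ^ N"
  using b by (intro tendsto_intros tendsto_prod pochhammer_Gamma_limit stir_limit) auto
 then have "(%n. \<integral>x. gasw N b (wn n) x \<partial>leb N) \<longlonglongrightarrow> ZL N b 0 * (\<Prod>j<N. 1 / Gamma (1 + b * real j)) * sqrt (2 * pi) ^ N"
  by (rule Lim_transform_eventually) (rule eventually_mono[OF eventually_gt_at_top[of 0]], simp add: wn_gas_eq[OF b])
 from LIMSEQ_unique[OF this wn_gas_limit[OF b]] show ?thesis by (simp add: prod_dividef)
qed

section \<open>Binet's formula\<close>

text \<open>The kernel of Binet's integral for the remainder in Stirling's formula; it extends
  continuously to 0 with value 1/12.\<close>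

definition binet :: "real => real" where
 "binet u = (1 / (exp u - 1) - 1 / u + 1 / 2) / u"

abbreviation half :: "(real => real) => real => real" where
 "half f \<equiv> (%u. f u * indicator {0<..} u)"

lemma half_exp:
 assumes "x > 0"
 shows "integrable lborel (half (%u. exp (- (x * u))))" "integral\<^sup>L lborel (half (%u. exp (- (x * u)))) = 1 / x"
 using integrable_I0i_exp_mscale[OF assms] LBINT_I0i_exp_mscale[OF assms] unfolding interval_lebesgue_integral_0_infty
 by (simp_all add: set_lebesgue_integral_def set_integrable_def mult_ac)

text \<open>The factor 1 - exp(-u) is what the difference JB x - JB (x + 1) puts next to the kernel.
  Written as an integral over v, the product lets that difference be evaluated by exchanging
  integrals.\<close>

lemma binet_K:
 assumes u: "u > 0"
 shows "has_bochner_integral lborel (%v. (1 / 2 - v) * exp (- (v * u)) * indicator {0..1} v) (binet u * (1 - exp (- u)))"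
proof -
 have "has_bochner_integral lborel (%v. (1 / 2 - v) * exp (- (v * u)) * indicator {0..1} v)
  (((1 - 1 / 2) * exp (- (1 * u)) / u + exp (- (1 * u)) / u\<^sup>2) - ((0 - 1 / 2) * exp (- (0 * u)) / u + exp (- (0 * u)) / u\<^sup>2))"
  using u by (intro has_bochner_integral_FTC_Icc_real[where F = "%v. (v - 1 / 2) * exp (- (v * u)) / u + exp (- (v * u)) / u\<^sup>2"])
   (auto intro!: derivative_eq_intros continuous_intros simp: field_simps power2_eq_square)
 also have "((1 - 1 / 2) * exp (- (1 * u)) / u + exp (- (1 * u)) / u\<^sup>2) - ((0 - 1 / 2) * exp (- (0 * u)) / u + exp (- (0 * u)) / u\<^sup>2) = binet u * (1 - exp (- u))"
  using u unfolding binet_def by (simp add: exp_minus divide_simps power2_eq_square) (simp add: algebra_simps)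
 finally show ?thesis .
qed

text \<open>Averages over \<open>[0, 1]\<close> with density proportional to \<open>exp (- u v)\<close>: \<open>binet u\<close> is the mean of
 \<open>v (1 - v) / 2\<close>, whose mean at \<open>u = 0\<close> is \<open>1 / 12\<close>.\<close>

lemma binet_bounds:
 assumes u: "u > 0"
 shows "\<bar>binet u\<bar> <= 1" "\<bar>binet u - 1 / 12\<bar> <= u / 2"
proof -
 define I where "I = (1 - exp (- u)) / u"
 have I: "I > 0" using u by (simp add: I_def)
 have i0: "has_bochner_integral lborel (%v. exp (- (v * u)) * indicator {0..1} v) I"
 proof -
  have "has_bochner_integral lborel (%v. exp (- (v * u)) * indicator {0..1} v) (- exp (- (1 * u)) / u - - exp (- (0 * u)) / u)"
   using u by (intro has_bochner_integral_FTC_Icc_real[where F = "%v. - exp (- (v * u)) / u"])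
    (auto intro!: derivative_eq_intros continuous_intros)
  then show ?thesis by (simp add: I_def diff_divide_distrib)
 qed
 have i1: "has_bochner_integral lborel (%v. v * (1 - v) / 2 * exp (- (v * u)) * indicator {0..1} v) (binet u * I)"
 proof -
  define A B C where "A = 1 / (2 * u)" and "B = 1 / u\<^sup>2" and "C = 1 / u ^ 3"
  define F where "F v = - ((v - v\<^sup>2) * A + (1 / 2 - v) * B - C) * exp (- (v * u))" for v
  have "has_bochner_integral lborel (%v. v * (1 - v) / 2 * exp (- (v * u)) * indicator {0..1} v) (F 1 - F 0)"
  proof (rule has_bochner_integral_FTC_Icc_real)
   fix v :: real
   have 1: "(F has_real_derivative - ((1 - 2 * v) * A - B) * exp (- (v * u)) + - u * exp (- (v * u)) * - ((v - v\<^sup>2) * A + (1 / 2 - v) * B - C)) (at v)"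
    unfolding F_def[abs_def] by (auto intro!: derivative_eq_intros)
   have 2: "- ((1 - 2 * v) * A - B) * exp (- (v * u)) + - u * exp (- (v * u)) * - ((v - v\<^sup>2) * A + (1 / 2 - v) * B - C) = v * (1 - v) / 2 * exp (- (v * u))"
    using u unfolding A_def B_def C_def by (simp add: divide_simps eval_nat_numeral) (simp add: algebra_simps)
   show "(F has_real_derivative v * (1 - v) / 2 * exp (- (v * u))) (at v)" using 1 unfolding 2 .
  qed (auto intro!: continuous_intros)
  also have "F 1 - F 0 = binet u * I"
   using u unfolding F_def A_def B_def C_def binet_def I_def by (simp add: exp_minus divide_simps eval_nat_numeral) (simp add: algebra_simps)
  finally show ?thesis .
 qed
 \<comment> \<open>An antiderivative of v (1 - v) / 2 - 1/12 that vanishes at 0 and 1: integrating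
   by parts gains the factor u of the second bound.\<close>
 define q where "q v = v\<^sup>2 / 4 - v ^ 3 / 6 - v / 12" for v :: real
 have i2: "has_bochner_integral lborel (%v. (v * (1 - v) / 2 - 1 / 12 - u * q v) * exp (- (v * u)) * indicator {0..1} v) (q 1 * exp (- (1 * u)) - q 0 * exp (- (0 * u)))"
 proof (intro has_bochner_integral_FTC_Icc_real[where F = "%v. q v * exp (- (v * u))"])
  fix v :: real
  have A: "((%v. q v * exp (- (v * u))) has_real_derivative (v / 2 - v\<^sup>2 / 2 - 1 / 12) * exp (- (v * u)) + - u * exp (- (v * u)) * q v) (at v)"
   unfolding q_def[abs_def] by (auto intro!: derivative_eq_intros)
  have B: "(v / 2 - v\<^sup>2 / 2 - 1 / 12) * exp (- (v * u)) + - u * exp (- (v * u)) * q v = (v * (1 - v) / 2 - 1 / 12 - u * q v) * exp (- (v * u))"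
   by (simp add: power2_eq_square algebra_simps diff_divide_distrib)
  show "((%v. q v * exp (- (v * u))) has_real_derivative (v * (1 - v) / 2 - 1 / 12 - u * q v) * exp (- (v * u))) (at v)" using A unfolding B .
 qed (auto intro!: continuous_intros simp: q_def)
 have i3: "has_bochner_integral lborel (%v. u * q v * exp (- (v * u)) * indicator {0..1} v) ((binet u - 1 / 12) * I)"
  using has_bochner_integral_diff[OF has_bochner_integral_diff[OF i1 has_bochner_integral_mult_right[OF i0, of "1 / 12"]] i2]
  by (simp add: q_def algebra_simps)
 have q: "\<bar>q v\<bar> <= 1 / 2" if "0 <= v" "v <= 1" for v
 proof -
  have "0 <= v\<^sup>2" "v\<^sup>2 <= 1" "0 <= v ^ 3" "v ^ 3 <= 1" using that by (auto intro: power_le_one)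
  then show ?thesis using that unfolding q_def abs_le_iff by linarith
 qed
 have bound: "\<bar>c\<bar> <= C" if "has_bochner_integral lborel (%v. f v * exp (- (v * u)) * indicator {0..1} v) (c * I)" "!!v. 0 <= v ==> v <= 1 ==> \<bar>f v\<bar> <= C" for f c C
 proof -
  have "c * I <= C * I" "- (C * I) <= c * I"
  proof -
   have "integral\<^sup>L lborel (%v. f v * exp (- (v * u)) * indicator {0..1} v) <= integral\<^sup>L lborel (%v. C * (exp (- (v * u)) * indicator {0..1} v))"
    using that(2) has_bochner_integral_mult_right[OF i0, of C] that(1)
    by (intro integral_mono) (auto simp: has_bochner_integral_iff indicator_def abs_le_iff)
   then show "c * I <= C * I" using that(1) i0 by (simp add: has_bochner_integral_iff)
   have "integral\<^sup>L lborel (%v. - C * (exp (- (v * u)) * indicator {0..1} v)) <= integral\<^sup>L lborel (%v. f v * exp (- (v * u)) * indicator {0..1} v)"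
   proof (intro integral_mono)
    fix v :: real
    show "- C * (exp (- (v * u)) * indicator {0..1} v) <= f v * exp (- (v * u)) * indicator {0..1} v"
     using that(2)[of v] mult_right_mono[of "- C" "f v" "exp (- (v * u))"] by (auto simp: indicator_def abs_le_iff)
   qed (use i0 that(1) in \<open>auto simp: has_bochner_integral_iff\<close>)
   then show "- (C * I) <= c * I" using that(1) i0 by (simp add: has_bochner_integral_iff)
  qed
  then show ?thesis using I by (simp add: abs_le_iff) (metis minus_le_iff mult_le_cancel_right_pos mult_minus_left)
 qed
 show "\<bar>binet u\<bar> <= 1"
 proof (rule bound[OF i1])
  fix v :: real assume v: "0 <= v" "v <= 1"
  have "v * (1 - v) <= 1 * 1" using v by (intro mult_mono) auto
  moreover have "0 <= v * (1 - v)" using v by simp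
  ultimately show "\<bar>v * (1 - v) / 2\<bar> <= 1" by simp
 qed
 show "\<bar>binet u - 1 / 12\<bar> <= u / 2"
 proof (rule bound[OF i3])
  fix v :: real assume v: "0 <= v" "v <= 1"
  show "\<bar>u * q v\<bar> <= u / 2" using mult_left_mono[OF q[OF v], of u] u by (simp add: abs_mult)
 qed
qed

definition JB :: "real => real" where
 "JB x = integral\<^sup>L lborel (half (%u. binet u * exp (- (x * u))))"

lemma binet_measurable [measurable]: "binet \<in> borel_measurable borel"
 unfolding binet_def[abs_def] by measurable

lemma JB_integrable: "x > 0 ==> integrable lborel (half (%u. binet u * exp (- (x * u))))"
 by (rule Bochner_Integration.integrable_bound[OF half_exp(1)])
  (use binet_bounds(1) in \<open>auto simp: indicator_def abs_mult intro!: mult_left_le_one_le\<close>)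

lemma JB_bound: "x > 0 ==> \<bar>JB x\<bar> <= 1 / x"
proof -
 assume x: "x > 0"
 have "norm (JB x) <= integral\<^sup>L lborel (half (%u. exp (- (x * u))))"
  unfolding JB_def using binet_bounds(1)
  by (intro Bochner_Integration.integral_norm_bound_integral JB_integrable half_exp x) (auto simp: indicator_def abs_mult intro!: mult_left_le_one_le)
 then show ?thesis unfolding half_exp(2)[OF x] by simp
qed

text \<open>By \<open>binet_K\<close> and Fubini the difference is the elementary integral of (1/2 -
  v) / (x + v) over [0, 1]. It is the discrepancy between Stirling's approximation and the
  functional equation of Gamma.\<close>

lemma JB_diff:
 assumes x: "x > 0"
 shows "JB x - JB (x + 1) = (x + 1 / 2) * ln (1 + 1 / x) - 1"
proof -
 define f where "f u v = exp (- (x * u)) * indicator {0<..} u * ((1 / 2 - v) * exp (- (v * u)) * indicator {0..1} v)" for u v :: real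
 have iv: "has_bochner_integral lborel (f u) (binet u * exp (- (x * u)) * indicator {0<..} u - binet u * exp (- ((x + 1) * u)) * indicator {0<..} u)" for u
 proof (cases "u > 0")
  case True
  have "exp (- ((x + 1) * u)) = exp (- (x * u)) * exp (- u)" by (simp add: mult_exp_exp algebra_simps)
  then show ?thesis using has_bochner_integral_mult_right[OF binet_K[OF True], of "exp (- (x * u))"] True
   unfolding f_def by (simp add: algebra_simps)
 next
  case False
  then have "f u = (%_. 0)" by (auto simp: f_def)
  then show ?thesis using False by (simp add: has_bochner_integral_iff)
 qed
 have [measurable]: "case_prod f \<in> borel_measurable (lborel \<Otimes>\<^sub>M lborel)" unfolding f_def by measurable
 have int: "integrable (lborel \<Otimes>\<^sub>M lborel) (case_prod f)"
 proof (rule lborel_pair.Fubini_integrable)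
  show "AE u in lborel. integrable lborel (%v. case_prod f (u, v))" using iv by (simp add: has_bochner_integral_iff)
  show "integrable lborel (%u. \<integral>v. norm (case_prod f (u, v)) \<partial>lborel)"
  proof (rule Bochner_Integration.integrable_bound[OF half_exp(1)[OF x]])
   show "AE u in lborel. norm (\<integral>v. norm (case_prod f (u, v)) \<partial>lborel) <= norm (exp (- (x * u)) * indicator {0<..} u :: real)"
   proof (rule AE_I2)
    fix u :: real
    have "(\<integral>v. norm (f u v) \<partial>lborel) <= (\<integral>v. exp (- (x * u)) * indicator {0<..} u * indicator {0..1::real} v \<partial>lborel)"
    proof (rule integral_mono)
     show "integrable lborel (%v. norm (f u v))" using iv[of u] by (simp add: has_bochner_integral_iff)
     fix v :: real
     have "\<bar>1 / 2 - v\<bar> * exp (- (v * u)) <= 1 * 1" if "u > 0" "0 <= v" "v <= 1" using that by (intro mult_mono) auto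
     then show "norm (f u v) <= exp (- (x * u)) * indicator {0<..} u * indicator {0..1} v"
      by (auto simp: f_def indicator_def abs_mult)
    qed auto
    also have "(\<integral>v. exp (- (x * u)) * indicator {0<..} u * indicator {0..1::real} v \<partial>lborel) = exp (- (x * u)) * indicator {0<..} u * measure lborel {0..1::real}"
     by (subst integral_mult_right_zero) simp
    also have "measure lborel {0..1::real} = 1" by (subst measure_lborel_Icc) auto
    finally show "norm (\<integral>v. norm (case_prod f (u, v)) \<partial>lborel) <= norm (exp (- (x * u)) * indicator {0<..} u :: real)" by simp
   qed
  qed measurable
 qed measurable
 have "JB x - JB (x + 1) = (\<integral>u. (\<integral>v. f u v \<partial>lborel) \<partial>lborel)"
  unfolding JB_def has_bochner_integral_integral_eq[OF iv] using JB_integrable[of x] JB_integrable[of "x + 1"] x by simp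
 also have "... = (\<integral>v. (\<integral>u. f u v \<partial>lborel) \<partial>lborel)" by (rule lborel_pair.Fubini_integral[OF int, symmetric])
 also have "... = (\<integral>v. (1 / 2 - v) / (x + v) * indicator {0..1} v \<partial>lborel)"
 proof (rule Bochner_Integration.integral_cong[OF refl])
  fix v :: real
  show "(\<integral>u. f u v \<partial>lborel) = (1 / 2 - v) / (x + v) * indicator {0..1} v"
  proof (cases "0 <= v \<and> v <= 1")
   case True
   have "f u v = (1 / 2 - v) * (exp (- ((x + v) * u)) * indicator {0<..} u)" for u
    using True by (simp add: f_def mult_exp_exp distrib_right)
   then show ?thesis using half_exp(2)[of "x + v"] x True by simp
  qed (auto simp: f_def indicator_def)
 qed
 also have "... = ((x + 1 / 2) * ln (x + 1) - 1) - ((x + 1 / 2) * ln (x + 0) - 0)"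
  using x by (intro integral_FTC_Icc_real[where F = "%v. (x + 1 / 2) * ln (x + v) - v"])
   (auto intro!: derivative_eq_intros continuous_intros simp: field_simps)
 also have "... = (x + 1 / 2) * ln (1 + 1 / x) - 1"
 proof -
  have "1 + 1 / x = (x + 1) / x" using x by (simp add: field_simps)
  then have l: "ln (1 + 1 / x) = ln (x + 1) - ln x" using x by (simp add: ln_div)
  show ?thesis unfolding l by (simp add: algebra_simps)
 qed
 finally show ?thesis .
qed

lemma ln_fact_limit: "(%n. ln (fact n) - ((real n + 1 / 2) * ln (real n) - real n)) \<longlonglongrightarrow> ln (2 * pi) / 2"
proof -
 have "(%n. ln (stir n)) \<longlonglongrightarrow> ln (sqrt (2 * pi))" by (intro tendsto_ln stir_limit) simp
 then have "(%n. ln (stir n)) \<longlonglongrightarrow> ln (2 * pi) / 2" by (simp add: ln_sqrt)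
 then show ?thesis
 proof (rule tendsto_cong_seq[of _ _ 1])
  fix n :: nat assume "n >= 1"
  then show "ln (fact n) - ((real n + 1 / 2) * ln (real n) - real n) = ln (stir n)"
   by (simp add: stir_def ln_div ln_mult ln_realpow ln_sqrt algebra_simps)
 qed simp
qed

text \<open>The difference of the two sides is unchanged by x -> x + 1, by the functional equation
  and \<open>JB_diff\<close>, and tends to 0 along x + n by Euler's limit for Gamma and Stirling's
  formula for n!.\<close>

theorem binet_formula:
 assumes x: "x > 0"
 shows "ln (Gamma (1 + x)) = x * ln x - x + ln (2 * pi * x) / 2 + JB x"
proof -
 define E where "E x = ln (Gamma (1 + x)) - (x * ln x - x + ln (2 * pi * x) / 2) - JB x" for x
 have step: "E (y + 1) = E y" if y: "y > 0" for y
 proof -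
  have "Gamma (1 + y + 1) = (1 + y) * Gamma (1 + y)" using y by (intro Gamma_plus1) (auto dest: nonpos_Ints_nonpos)
  then have "ln (Gamma (1 + (y + 1))) = ln (1 + y) + ln (Gamma (1 + y))"
   using y ln_mult_pos[of "1 + y" "Gamma (1 + y)"] by (simp add: add_ac)
  moreover have "JB (y + 1) = JB y - ((y + 1 / 2) * ln (1 + 1 / y) - 1)" using JB_diff[OF y] by simp
  moreover have "ln (1 + 1 / y) = ln (1 + y) - ln y"
  proof -
   have "1 + 1 / y = (1 + y) / y" using y by (simp add: field_simps)
   then show ?thesis using y by (simp add: ln_div)
  qed
  moreover have "ln (2 * pi * (y + 1)) = ln (2 * pi) + ln (1 + y)" "ln (2 * pi * y) = ln (2 * pi) + ln y" using y by (simp_all add: ln_mult add_ac)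
  ultimately show ?thesis unfolding E_def by (simp add: algebra_simps add_divide_distrib)
 qed
 have E: "E (x + real n) = E x" for n
 proof (induction n)
  case (Suc n)
  then show ?case using step[of "x + real n"] x by (simp add: add_ac)
 qed simp
 have "(%n. E (x + real n)) \<longlonglongrightarrow> 0"
 proof -
  define p where "p n = pochhammer (1 + x) n / (fact n * real n powr x)" for n
  have G: "Gamma (1 + x) > 0" "Gamma (1 + x) ~= 0" using Gamma_real_pos[of "1 + x"] x by linarith+
  have "(%n. ln (p n)) \<longlonglongrightarrow> ln (1 / Gamma (1 + x))"
   unfolding p_def by (intro tendsto_ln pochhammer_Gamma_limit) (use x G in auto)
  from tendsto_add[OF this tendsto_const[of "ln (Gamma (1 + x))"]] have l1: "(%n. ln (p n) + ln (Gamma (1 + x))) \<longlonglongrightarrow> 0"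
   using G by (simp add: ln_div)
  have l2: "(%n. JB (x + real n)) \<longlonglongrightarrow> 0"
  proof (rule Lim_null_comparison)
   show "eventually (%n. norm (JB (x + real n)) <= 1 / (x + real n)) sequentially" using JB_bound x by (intro always_eventually) simp
   show "(%n. 1 / (x + real n)) \<longlonglongrightarrow> 0" by real_asymp
  qed
  have l3: "(%n. x * ln (real n) + ((real n + 1 / 2) * ln (real n) - real n) - ((x + real n) * ln (x + real n) - (x + real n) + ln (x + real n) / 2)) \<longlonglongrightarrow> 0"
   by real_asymp
  have "(%n. (ln (p n) + ln (Gamma (1 + x))) + (ln (fact n) - ((real n + 1 / 2) * ln (real n) - real n)) + (x * ln (real n) + ((real n + 1 / 2) * ln (real n) - real n) - ((x + real n) * ln (x + real n) - (x + real n) + ln (x + real n) / 2)) - ln (2 * pi) / 2 - JB (x + real n)) \<longlonglongrightarrow> 0 + ln (2 * pi) / 2 + 0 - ln (2 * pi) / 2 - 0"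
   by (intro tendsto_intros l1 l2 l3 ln_fact_limit)
  then show ?thesis
  proof (rule tendsto_cong_seq[of _ _ 1])
   fix n :: nat assume n: "n >= 1"
   have pp: "pochhammer (1 + x) n > 0" using x by (intro pochhammer_pos) simp
   have "Gamma (1 + x + real n) = pochhammer (1 + x) n * Gamma (1 + x)"
    using x G(2) by (subst pochhammer_Gamma) (auto dest: nonpos_Ints_nonpos)
   then have "ln (Gamma (1 + (x + real n))) = ln (pochhammer (1 + x) n) + ln (Gamma (1 + x))" using pp G by (simp add: ln_mult add.assoc[symmetric])
   moreover have "ln (p n) = ln (pochhammer (1 + x) n) - (ln (fact n) + x * ln (real n))"
    using pp n by (simp add: p_def ln_div ln_mult ln_powr)
   moreover have "ln (2 * pi * (x + real n)) = ln (2 * pi) + ln (x + real n)" using x by (intro ln_mult_pos) auto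
   ultimately show "E (x + real n) = (ln (p n) + ln (Gamma (1 + x))) + (ln (fact n) - ((real n + 1 / 2) * ln (real n) - real n)) + (x * ln (real n) + ((real n + 1 / 2) * ln (real n) - real n) - ((x + real n) * ln (x + real n) - (x + real n) + ln (x + real n) / 2)) - ln (2 * pi) / 2 - JB (x + real n)"
    unfolding E_def by (simp add: add_divide_distrib)
  qed simp
 qed
 then have "E x = 0" unfolding E using LIMSEQ_unique tendsto_const by blast
 then show ?thesis by (simp add: E_def)
qed

text \<open>Summing exp(-j b u) over j gives 1 / (exp(b u) - 1), singular like 1/u at 0. Splitting
  off the value 1/12 of the kernel makes the integrand integrable; the part split off sums to
  harmonic numbers, the source of the logarithm and of \<open>euler_mascheroni\<close>.\<close>

lemma sum_JB_limit:
 assumes b: "b > 0"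
 shows "(%N. (\<Sum>j=1..<N. JB (real j * b)) - ln (real N) / (12 * b)) \<longlonglongrightarrow>
  euler_mascheroni / (12 * b) + (LBINT u:{0<..}. 1 / u\<^sup>2 * (1 / (exp (b * u) - 1)) * (u / (exp u - 1) - 1 + u / 2 - u\<^sup>2 / 12))"
proof -
 define d where "d u = binet u - 1 / 12" for u
 have [measurable]: "d \<in> borel_measurable borel" unfolding d_def[abs_def] by measurable
 have q: "0 < exp (- (b * u))" "exp (- (b * u)) < 1" if "u > 0" for u using b that by auto
 have E: "exp (- (real j * b * u)) = exp (- (b * u)) ^ j" for j u by (simp add: exp_of_nat_mult[symmetric] mult_ac)
 have geo: "(%N. \<Sum>j=1..<N. exp (- (real j * b * u))) \<longlonglongrightarrow> 1 / (exp (b * u) - 1)" "(\<Sum>j=1..<N. exp (- (real j * b * u))) <= 1 / (exp (b * u) - 1)" if u: "u > 0" for u N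
 proof -
  have "(%n. exp (- (b * u)) ^ Suc n) sums (exp (- (b * u)) * (1 / (1 - exp (- (b * u)))))"
   unfolding power_Suc using q[OF u] by (intro sums_mult geometric_sums) auto
  also have "exp (- (b * u)) * (1 / (1 - exp (- (b * u)))) = 1 / (exp (b * u) - 1)" using b u by (simp add: exp_minus field_simps)
  finally have s: "(%n. exp (- (b * u)) ^ Suc n) sums (1 / (exp (b * u) - 1))" .
  have e: "(\<Sum>j=1..<N. exp (- (real j * b * u))) = (\<Sum>n<N - 1. exp (- (b * u)) ^ Suc n)" for N
   unfolding E by (rule sum.reindex_bij_witness[of _ Suc "%j. j - 1"]) auto
  have "(%N. \<Sum>j=1..<Suc N. exp (- (real j * b * u))) \<longlonglongrightarrow> 1 / (exp (b * u) - 1)" unfolding e using s by (simp add: sums_def)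
  then show "(%N. \<Sum>j=1..<N. exp (- (real j * b * u))) \<longlonglongrightarrow> 1 / (exp (b * u) - 1)" by (rule LIMSEQ_imp_Suc)
  show "(\<Sum>j=1..<N. exp (- (real j * b * u))) <= 1 / (exp (b * u) - 1)" unfolding e
   using sum_le_suminf[of "%n. exp (- (b * u)) ^ Suc n" "{..<N - 1}"] s by (simp add: sums_iff)
 qed
 \<comment> \<open>Here |d u| is at most u/2 and exp(b u) - 1 at least (b u / 2) exp(b u / 2), which
   cancels the singularity and leaves exponential decay.\<close>
 have dom: "\<bar>d u\<bar> * (1 / (exp (b * u) - 1)) <= 1 / b * exp (- (b / 2 * u))" if u: "u > 0" for u
 proof -
  have bu: "b * u > 0" using b u by simp
  have "exp (b / 2 * u) * (b * u / 2) <= exp (b / 2 * u) * (exp (b / 2 * u) - exp (- (b / 2 * u)))"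
  proof (rule mult_left_mono)
   have "1 + b / 2 * u <= exp (b / 2 * u)" by (rule exp_ge_add_one_self)
   moreover have "exp (- (b / 2 * u)) <= 1" using bu by simp
   ultimately show "b * u / 2 <= exp (b / 2 * u) - exp (- (b / 2 * u))" unfolding times_divide_eq_left by linarith
  qed simp
  also have "... = exp (b * u) - 1" by (simp add: right_diff_distrib mult_exp_exp)
  finally have le: "exp (b / 2 * u) * (b * u / 2) <= exp (b * u) - 1" .
  have pos: "exp (b / 2 * u) * (b * u / 2) > 0" using bu by simp
  have "1 / (exp (b * u) - 1) <= 1 / (exp (b / 2 * u) * (b * u / 2))" "0 <= 1 / (exp (b * u) - 1)"
  proof -
   have "exp (b * u) - 1 > 0" using le pos by linarith
   then show "1 / (exp (b * u) - 1) <= 1 / (exp (b / 2 * u) * (b * u / 2))" "0 <= 1 / (exp (b * u) - 1)"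
    using divide_left_mono[OF le, of 1] mult_pos_pos[OF _ pos] by auto
  qed
  then have "\<bar>d u\<bar> * (1 / (exp (b * u) - 1)) <= (u / 2) * (1 / (exp (b / 2 * u) * (b * u / 2)))"
   using binet_bounds(2)[OF u] u by (intro mult_mono) (auto simp: d_def)
  also have "... = 1 / b * exp (- (b / 2 * u))" using b u by (simp add: exp_minus field_simps)
  finally show ?thesis .
 qed
 have jb: "JB (real j * b) - 1 / (12 * (real j * b)) = integral\<^sup>L lborel (half (%u. d u * exp (- (real j * b * u))))"
  and ij: "integrable lborel (half (%u. d u * exp (- (real j * b * u))))" if "j \<in> {1..<N}" for j N
 proof -
  have p: "real j * b > 0" using that b by simp
  have e: "half (%u. d u * exp (- (real j * b * u))) = (%u. half (%u. binet u * exp (- (real j * b * u))) u - 1 / 12 * half (%u. exp (- (real j * b * u))) u)"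
   by (auto simp: d_def algebra_simps)
  show "integrable lborel (half (%u. d u * exp (- (real j * b * u))))"
   unfolding e by (intro Bochner_Integration.integrable_diff integrable_mult_right JB_integrable half_exp p)
  show "JB (real j * b) - 1 / (12 * (real j * b)) = integral\<^sup>L lborel (half (%u. d u * exp (- (real j * b * u))))"
   unfolding e using JB_integrable[OF p] half_exp[OF p] by (simp add: JB_def)
 qed
 have "(%N. integral\<^sup>L lborel (half (%u. d u * (\<Sum>j=1..<N. exp (- (real j * b * u)))))) \<longlonglongrightarrow> integral\<^sup>L lborel (half (%u. d u * (1 / (exp (b * u) - 1))))"
 proof (rule integral_dominated_convergence[where w = "%u. 1 / b * half (%u. exp (- (b / 2 * u))) u"])
  show "integrable lborel (%u. 1 / b * half (%u. exp (- (b / 2 * u))) u)" using b by (intro integrable_mult_right half_exp) simp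
  show "AE u in lborel. (%N. half (%u. d u * (\<Sum>j=1..<N. exp (- (real j * b * u)))) u) \<longlonglongrightarrow> half (%u. d u * (1 / (exp (b * u) - 1))) u"
  proof (rule AE_I2)
   fix u :: real
   show "(%N. half (%u. d u * (\<Sum>j=1..<N. exp (- (real j * b * u)))) u) \<longlonglongrightarrow> half (%u. d u * (1 / (exp (b * u) - 1))) u"
    using tendsto_mult[OF tendsto_const[of "d u"] geo(1)[of u]] by (cases "u > 0") simp_all
  qed
  show "AE u in lborel. norm (half (%u. d u * (\<Sum>j=1..<N. exp (- (real j * b * u)))) u) <= 1 / b * half (%u. exp (- (b / 2 * u))) u" for N
  proof (rule AE_I2)
   fix u :: real
   show "norm (half (%u. d u * (\<Sum>j=1..<N. exp (- (real j * b * u)))) u) <= 1 / b * half (%u. exp (- (b / 2 * u))) u"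
   proof (cases "u > 0")
    case True
    have "\<bar>d u\<bar> * (\<Sum>j=1..<N. exp (- (real j * b * u))) <= \<bar>d u\<bar> * (1 / (exp (b * u) - 1))" using geo(2)[OF True] by (intro mult_left_mono) auto
    then show ?thesis using dom[OF True] True by (simp add: abs_mult sum_nonneg)
   qed simp
  qed
 qed measurable
 moreover have "integral\<^sup>L lborel (half (%u. d u * (\<Sum>j=1..<N. exp (- (real j * b * u))))) = (\<Sum>j=1..<N. JB (real j * b)) - (\<Sum>j=1..<N. 1 / (12 * (real j * b)))" for N
 proof -
  have "half (%u. d u * (\<Sum>j=1..<N. exp (- (real j * b * u)))) = (%u. \<Sum>j=1..<N. half (%u. d u * exp (- (real j * b * u))) u)"
   by (auto simp: sum_distrib_left sum_distrib_right)
  then have "integral\<^sup>L lborel (half (%u. d u * (\<Sum>j=1..<N. exp (- (real j * b * u))))) = (\<Sum>j=1..<N. integral\<^sup>L lborel (half (%u. d u * exp (- (real j * b * u)))))"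
   by (simp only:) (rule Bochner_Integration.integral_sum, rule ij)
  also have "... = (\<Sum>j=1..<N. JB (real j * b) - 1 / (12 * (real j * b)))" by (intro sum.cong refl jb[symmetric])
  finally show ?thesis by (simp add: sum_subtractf)
 qed
 ultimately have L1: "(%N. (\<Sum>j=1..<N. JB (real j * b)) - (\<Sum>j=1..<N. 1 / (12 * (real j * b)))) \<longlonglongrightarrow> integral\<^sup>L lborel (half (%u. d u * (1 / (exp (b * u) - 1))))" by simp
 have I: "integral\<^sup>L lborel (half (%u. d u * (1 / (exp (b * u) - 1)))) = (LBINT u:{0<..}. 1 / u\<^sup>2 * (1 / (exp (b * u) - 1)) * (u / (exp u - 1) - 1 + u / 2 - u\<^sup>2 / 12))"
  unfolding set_lebesgue_integral_def
 proof (rule Bochner_Integration.integral_cong[OF refl])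
  fix u :: real
  show "half (%u. d u * (1 / (exp (b * u) - 1))) u = indicator {0<..} u *\<^sub>R (1 / u\<^sup>2 * (1 / (exp (b * u) - 1)) * (u / (exp u - 1) - 1 + u / 2 - u\<^sup>2 / 12))"
  proof (cases "u > 0")
   case True
   have "d u = 1 / u\<^sup>2 * (u / (exp u - 1) - 1 + u / 2 - u\<^sup>2 / 12)"
    using True unfolding d_def binet_def by (simp add: field_simps power2_eq_square)
   then show ?thesis using True by simp
  qed simp
 qed
 have L2: "(%N. (\<Sum>j=1..<N. 1 / (12 * (real j * b))) - ln (real N) / (12 * b)) \<longlonglongrightarrow> euler_mascheroni / (12 * b)"
 proof -
  have "(%N. (harm N - ln (real N) - 1 / real N) / (12 * b)) \<longlonglongrightarrow> (euler_mascheroni - 0) / (12 * b)"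
   by (intro tendsto_intros euler_mascheroni_LIMSEQ lim_1_over_n) (use b in simp)
  then show ?thesis
  proof (rule tendsto_cong_seq[of _ _ 1])
   fix N :: nat assume N: "N >= 1"
   have "harm N = (\<Sum>j=1..<N. 1 / real j) + 1 / real N"
   proof -
    have "{1..N} = insert N {1..<N}" using N by auto
    then show ?thesis by (simp add: harm_def inverse_eq_divide)
   qed
   then have "harm N - 1 / real N = (\<Sum>j=1..<N. 1 / real j)" by simp
   moreover have "(\<Sum>j=1..<N. 1 / (12 * (real j * b))) = (\<Sum>j=1..<N. 1 / real j) / (12 * b)"
    unfolding sum_divide_distrib by (intro sum.cong) (auto simp: mult_ac)
   ultimately show "(\<Sum>j=1..<N. 1 / (12 * (real j * b))) - ln (real N) / (12 * b) = (harm N - ln (real N) - 1 / real N) / (12 * b)"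
    by (simp add: diff_divide_distrib[symmetric])
  qed simp
 qed
 show ?thesis using tendsto_add[OF L2 L1] unfolding I by simp
qed

section \<open>Euler-Maclaurin summation and the derivative of the zeta function at -1\<close>

text \<open>The power x^(-s) for x > 0, written so that it is visibly entire in
  \<open>s\<close>.\<close>

definition XP :: "complex => real => complex" where
 "XP s x = exp (- s * of_real (ln x))"

lemma XP_Suc: "x > 0 ==> XP (s + 1) x = XP s x / of_real x"
proof -
 assume x: "x > 0"
 have "- (s + 1) * complex_of_real (ln x) = - s * of_real (ln x) - of_real (ln x)" by (simp add: algebra_simps)
 moreover have "exp (complex_of_real (ln x)) = of_real x" using x by (simp add: exp_of_real)
 ultimately show ?thesis by (simp only: XP_def exp_diff)
qed

lemma XP_deriv:
 assumes "x > 0"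
 shows "((%x. XP s x) has_vector_derivative - s * XP (s + 1) x) (at x)"
proof -
 have "((%x. - s * of_real (ln x)) has_vector_derivative - s * of_real (1 / x)) (at x)"
  using assms by (auto intro!: derivative_eq_intros has_vector_derivative_of_real simp: has_real_derivative_iff_has_vector_derivative[symmetric])
 then have "((%x. exp (- s * of_real (ln x))) has_vector_derivative (- s * of_real (1 / x)) * exp (- s * of_real (ln x))) (at x)"
  by (rule field_vector_diff_chain_at[unfolded o_def]) (rule DERIV_exp)
 moreover have "(- s * of_real (1 / x)) * exp (- s * of_real (ln x)) = - s * XP (s + 1) x"
  unfolding XP_Suc[OF assms] unfolding XP_def by simp
 ultimately show ?thesis unfolding XP_def[abs_def] by simp
qed

lemma XP_deriv_shift:
 assumes "0 < x + v"
 shows "((%v. XP s (x + v)) has_vector_derivative - s * XP (s + 1) (x + v)) (at v within S)"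
proof -
 have "((%v. x + v) has_vector_derivative 1) (at v)"
  by (auto intro!: derivative_eq_intros simp: has_real_derivative_iff_has_vector_derivative[symmetric])
 from vector_diff_chain_at[OF this XP_deriv[OF assms]]
 have "((%v. XP s (x + v)) has_vector_derivative - s * XP (s + 1) (x + v)) (at v)" by (simp only: o_def scaleR_one)
 then show ?thesis by (rule has_vector_derivative_at_within)
qed

lemma norm_XP: "x > 0 ==> norm (XP s x) = x powr (- Re s)"
 by (simp add: XP_def powr_def)

lemma XP_nat: "n > 0 ==> of_nat n powr (- s) = XP s (real n)"
 by (simp add: XP_def powr_def Ln_of_nat)

lemma XP_holomorphic [holomorphic_intros]: "f holomorphic_on A ==> (%s. XP (f s) x) holomorphic_on A"
 unfolding XP_def by (intro holomorphic_intros)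

lemma poly_antiderivative: "\<exists>A. pderiv A = (p :: real poly)"
proof
 define A where "A = (\<Sum>i\<le>degree p. monom (coeff p i / real (Suc i)) (Suc i))"
 show "pderiv A = p"
 proof (rule poly_eqI)
  fix n
  have "coeff A (Suc n) = (if n <= degree p then coeff p n / real (Suc n) else 0)"
   by (simp add: A_def coeff_sum if_distrib cong: if_cong)
  then show "coeff (pderiv A) n = coeff p n" by (simp add: coeff_pderiv coeff_eq_0 not_le del: of_nat_Suc)
 qed
qed

text \<open>A shifted and rescaled sequence of Bernoulli polynomials, starting from \<open>B\<^sub>3 / 6\<close>.\<close>

lemma bernoulli_sequence:
 obtains P :: "nat => real poly" where "P 0 = [:0, 1 / 12, - 1 / 4, 1 / 6:]" "!!k. pderiv (P (Suc k)) = P k" "!!k. poly (P (Suc k)) 1 = poly (P (Suc k)) 0"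
proof -
 \<comment> \<open>Zero mean over [0, 1], expressed by an antiderivative with equal end values.
   Carried through the recursion, it makes each next polynomial take equal values at 0 and 1, so
   that the boundary terms of successive unit intervals telescope.\<close>
 define ZM where "ZM p \<longleftrightarrow> (\<exists>r. pderiv r = p \<and> poly r 0 = poly r 1)" for p :: "real poly"
 have "\<exists>P. \<forall>k. (ZM (P k) \<and> (k = 0 --> P k = [:0, 1 / 12, - 1 / 4, 1 / 6:])) \<and> (pderiv (P (Suc k)) = P k \<and> poly (P (Suc k)) 1 = poly (P (Suc k)) 0)"
 proof (rule dependent_nat_choice)
  have "pderiv [:0, 0, 1 / 24, - 1 / 12, 1 / 24:] = [:0, 1 / 12, - 1 / 4, 1 / 6::real:]" by (simp add: pderiv_pCons)
  moreover have "poly [:0, 0, 1 / 24, - 1 / 12, 1 / 24:] 0 = poly [:0, 0, 1 / 24, - 1 / 12, 1 / 24::real:] 1" by simp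
  ultimately show "\<exists>p. ZM p \<and> ((0::nat) = 0 --> p = [:0, 1 / 12, - 1 / 4, 1 / 6:])" unfolding ZM_def by blast
  fix p and n :: nat assume "ZM p \<and> (n = 0 --> p = [:0, 1 / 12, - 1 / 4, 1 / 6:])"
  then obtain r where r: "pderiv r = p" "poly r 0 = poly r 1" by (auto simp: ZM_def)
  obtain A where A: "pderiv A = r" using poly_antiderivative by blast
  define c where "c = poly A 1 - poly A 0"
  have "pderiv (A - [:0, c:]) = r - [:c:]" "poly (A - [:0, c:]) 0 = poly (A - [:0, c:]) 1" using A by (simp_all add: pderiv_diff pderiv_pCons c_def)
  then have "ZM (r - [:c:])" unfolding ZM_def by blast
  then show "\<exists>q. (ZM q \<and> (Suc n = 0 --> q = [:0, 1 / 12, - 1 / 4, 1 / 6:])) \<and> pderiv q = p \<and> poly q 1 = poly q 0"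
   using r by (intro exI[of _ "r - [:c:]"]) (auto simp: pderiv_diff pderiv_pCons)
 qed
 then show ?thesis using that by blast
qed

text \<open>The partial sum of the Dirichlet series with its Euler-Maclaurin corrections up to the
  B_2 term; it converges for Re s > -2 away from 1, which includes the point -1.\<close>

definition em3 :: "nat => complex => complex" where
 "em3 N s = (\<Sum>n=1..N. XP s (real n)) + XP (s - 1) (real N) / (s - 1) - XP s (real N) / 2 + s * XP (s + 1) (real N) / 12"

lemma em3_holomorphic: "em3 N holomorphic_on - {1}"
 unfolding em3_def[abs_def] by (intro holomorphic_intros) auto

text \<open>Three integrations by parts on a unit interval, bundled in the antiderivative
  \<open>F\<close>; the polynomial \<open>[:0, 1 / 12, - 1 / 4, 1 / 6:]\<close> is B_3 / 6, which
  vanishes at both ends.\<close>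

lemma em3_step:
 assumes s: "s ~= 1" and N: "N > 0"
 shows "((%v. of_real (poly [:0, 1 / 12, - 1 / 4, 1 / 6:] v) * (- s * (s + 1) * (s + 2) * XP (s + 3) (real N + v))) has_integral em3 (Suc N) s - em3 N s) {0..1}"
proof -
 define F where "F v = of_real (v ^ 3 / 6 - v\<^sup>2 / 4 + v / 12) * (s * (s + 1) * XP (s + 2) (real N + v)) - of_real (v\<^sup>2 / 2 - v / 2 + 1 / 12) * (- s * XP (s + 1) (real N + v))
  + of_real (v - 1 / 2) * XP s (real N + v) + XP (s - 1) (real N + v) / (s - 1)" for v
 have "((%v. of_real (poly [:0, 1 / 12, - 1 / 4, 1 / 6:] v) * (- s * (s + 1) * (s + 2) * XP (s + 3) (real N + v))) has_integral F 1 - F 0) {0..1}"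
 proof (rule fundamental_theorem_of_calculus)
  fix v :: real assume v: "v \<in> {0..1}"
  then have p: "0 < real N + v" using N by simp
  have d: "((%v. XP (s + 2) (real N + v)) has_vector_derivative - (s + 2) * XP (s + 3) (real N + v)) (at v within {0..1})"
   "((%v. XP (s + 1) (real N + v)) has_vector_derivative - (s + 1) * XP (s + 2) (real N + v)) (at v within {0..1})"
   "((%v. XP s (real N + v)) has_vector_derivative - s * XP (s + 1) (real N + v)) (at v within {0..1})"
   "((%v. XP (s - 1) (real N + v)) has_vector_derivative - (s - 1) * XP s (real N + v)) (at v within {0..1})"
   using XP_deriv_shift[OF p, of "s + 2"] XP_deriv_shift[OF p, of "s + 1"] XP_deriv_shift[OF p, of s] XP_deriv_shift[OF p, of "s - 1"] by (simp_all add: add.assoc)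
  have q: "((%v. complex_of_real (v ^ 3 / 6 - v\<^sup>2 / 4 + v / 12)) has_vector_derivative of_real (v\<^sup>2 / 2 - v / 2 + 1 / 12)) (at v within {0..1})"
   "((%v. complex_of_real (v\<^sup>2 / 2 - v / 2 + 1 / 12)) has_vector_derivative of_real (v - 1 / 2)) (at v within {0..1})"
   "((%v. complex_of_real (v - 1 / 2)) has_vector_derivative of_real 1) (at v within {0..1})"
   by (intro has_vector_derivative_of_real; auto simp: has_real_derivative_iff_has_vector_derivative[symmetric] intro!: derivative_eq_intros)+
  have "(F has_vector_derivative
   (of_real (v ^ 3 / 6 - v\<^sup>2 / 4 + v / 12) * (s * (s + 1) * (- (s + 2) * XP (s + 3) (real N + v))) + of_real (v\<^sup>2 / 2 - v / 2 + 1 / 12) * (s * (s + 1) * XP (s + 2) (real N + v)))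
   - (of_real (v\<^sup>2 / 2 - v / 2 + 1 / 12) * (- s * (- (s + 1) * XP (s + 2) (real N + v))) + of_real (v - 1 / 2) * (- s * XP (s + 1) (real N + v)))
   + (of_real (v - 1 / 2) * (- s * XP (s + 1) (real N + v)) + of_real 1 * XP s (real N + v)) + - (s - 1) * XP s (real N + v) / (s - 1)) (at v within {0..1})"
   unfolding F_def[abs_def] divide_inverse[of _ "s - 1"]
   by (intro has_vector_derivative_add has_vector_derivative_diff has_vector_derivative_mult has_vector_derivative_mult_right has_vector_derivative_mult_left d q)
  moreover have "(of_real (v ^ 3 / 6 - v\<^sup>2 / 4 + v / 12) * (s * (s + 1) * (- (s + 2) * XP (s + 3) (real N + v))) + of_real (v\<^sup>2 / 2 - v / 2 + 1 / 12) * (s * (s + 1) * XP (s + 2) (real N + v)))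
   - (of_real (v\<^sup>2 / 2 - v / 2 + 1 / 12) * (- s * (- (s + 1) * XP (s + 2) (real N + v))) + of_real (v - 1 / 2) * (- s * XP (s + 1) (real N + v)))
   + (of_real (v - 1 / 2) * (- s * XP (s + 1) (real N + v)) + of_real 1 * XP s (real N + v)) + - (s - 1) * XP s (real N + v) / (s - 1)
   = of_real (v ^ 3 / 6 - v\<^sup>2 / 4 + v / 12) * (- s * (s + 1) * (s + 2) * XP (s + 3) (real N + v))"
  proof -
   have "A * (s * (s + 1) * (- (s + 2) * X3)) + B * (s * (s + 1) * X2) - (B * (- s * (- (s + 1) * X2)) + C * (- s * X1)) + (C * (- s * X1) + 1 * X0) + - (s - 1) * X0 / (s - 1)
    = A * (- s * (s + 1) * (s + 2) * X3)" for A B C X0 X1 X2 X3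
   proof -
    have "- (s - 1) * X0 / (s - 1) = - X0" using s by (simp add: field_simps)
    then show ?thesis by (simp only:) (simp add: algebra_simps)
   qed
   then show ?thesis by simp
  qed
  moreover have "poly [:0, 1 / 12, - 1 / 4, 1 / 6:] v = v ^ 3 / 6 - v\<^sup>2 / 4 + v / 12" by (simp add: eval_nat_numeral algebra_simps)
  ultimately show "(F has_vector_derivative of_real (poly [:0, 1 / 12, - 1 / 4, 1 / 6:] v) * (- s * (s + 1) * (s + 2) * XP (s + 3) (real N + v))) (at v within {0..1})" by simp
 qed simp
 also have "F 1 - F 0 = em3 (Suc N) s - em3 N s"
  unfolding F_def em3_def by (simp add: add.commute[of "real N" 1] diff_divide_distrib algebra_simps)
 finally show ?thesis .
qed

text \<open>\<open>riemann_zeta\<close> is chosen among functions holomorphic off 1, so a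
  continuation to the whole punctured plane is needed for the choice to succeed, although only the
  derivative at -1 enters the result. Each further Euler-Maclaurin correction moves the half plane
  of locally uniform convergence one unit to the left, and the limits agree where they
  overlap.\<close>

theorem zeta_continuation:
 obtains Z where "Z holomorphic_on - {1}" "!!s. 1 < Re s ==> (%n. of_nat (Suc n) powr (- s)) sums Z s"
  "(%m. deriv (em3 (Suc m)) (- 1)) \<longlonglongrightarrow> deriv Z (- 1)"
proof -
 obtain P :: "nat => real poly" where P: "P 0 = [:0, 1 / 12, - 1 / 4, 1 / 6:]" "!!k. pderiv (P (Suc k)) = P k" "!!k. poly (P (Suc k)) 1 = poly (P (Suc k)) 0"
  using bernoulli_sequence by blast
 define c where "c k = complex_of_real (poly (P (Suc k)) 0)" for k
 \<comment> \<open>\<open>em3\<close> with k further corrections; \<open>J\<close> is the integral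
   in the remainder of one step in N.\<close>
 define f where "f k N s = em3 N s + (\<Sum>j<k. c j * pochhammer s (j + 3) * XP (s + of_nat (j + 3)) (real N))" for k N s
 define J where "J k N s = integral {0..1} (%v. of_real (poly (P k) v) * XP (s + of_nat (k + 3)) (real N + v))" for k N s
 have int: "(%v. of_real (poly p v) * XP s (real N + v)) integrable_on {0..1}" if "N > 0" for p s N
 proof -
  have "continuous_on {0..1} (%v. XP s (real N + v))" unfolding continuous_on_eq_continuous_within
   by (intro ballI has_vector_derivative_continuous[OF XP_deriv_shift]) (use that in auto)
  then show ?thesis by (intro integrable_continuous_real continuous_intros)
 qed
 have step: "f k (Suc N) s - f k N s = - (pochhammer s (k + 3) * J k N s)" if s: "s ~= 1" and N: "N > 0" for s N k
 proof (induction k)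
  case 0
  have "((%v. - s * (s + 1) * (s + 2) * (of_real (poly (P 0) v) * XP (s + of_nat (0 + 3)) (real N + v))) has_integral em3 (Suc N) s - em3 N s) {0..1}"
   using em3_step[OF s N] by (simp add: P(1) mult_ac)
  moreover have "((%v. - s * (s + 1) * (s + 2) * (of_real (poly (P 0) v) * XP (s + of_nat (0 + 3)) (real N + v))) has_integral - s * (s + 1) * (s + 2) * J 0 N s) {0..1}"
   unfolding J_def by (intro has_integral_mult_right integrable_integral int N)
  ultimately have "em3 (Suc N) s - em3 N s = - s * (s + 1) * (s + 2) * J 0 N s" by (rule has_integral_unique)
  then show ?case by (simp add: f_def pochhammer_Suc numeral_3_eq_3 mult_ac)
 next
  case (Suc k)
  define t where "t = s + of_nat (k + 3)"
  have "((%v. of_real (poly (P (Suc k)) v) * (- t * XP (t + 1) (real N + v)) + of_real (poly (P k) v) * XP t (real N + v)) has_integral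
    of_real (poly (P (Suc k)) 1) * XP t (real N + 1) - of_real (poly (P (Suc k)) 0) * XP t (real N + 0)) {0..1}"
  proof (rule fundamental_theorem_of_calculus)
   fix v :: real assume "v \<in> {0..1}"
   then have p: "0 < real N + v" using N by simp
   have "((%v. complex_of_real (poly (P (Suc k)) v)) has_vector_derivative of_real (poly (P k) v)) (at v within {0..1})"
    using poly_DERIV[of "P (Suc k)" v] unfolding P(2)
    by (intro has_vector_derivative_of_real) (auto simp: has_real_derivative_iff_has_vector_derivative has_vector_derivative_at_within)
   then show "((%v. of_real (poly (P (Suc k)) v) * XP t (real N + v)) has_vector_derivative
     of_real (poly (P (Suc k)) v) * (- t * XP (t + 1) (real N + v)) + of_real (poly (P k) v) * XP t (real N + v)) (at v within {0..1})"
    by (intro has_vector_derivative_mult XP_deriv_shift p)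
  qed simp
  moreover have "((%v. - t * (of_real (poly (P (Suc k)) v) * XP (t + 1) (real N + v)) + of_real (poly (P k) v) * XP t (real N + v)) has_integral - t * J (Suc k) N s + J k N s) {0..1}"
   using integrable_integral[OF int[OF N, of "P (Suc k)" "t + 1"]] integrable_integral[OF int[OF N, of "P k" t]]
   unfolding J_def t_def by (intro has_integral_add has_integral_mult_right) (simp_all add: add_ac)
  ultimately have e: "c k * (XP t (real N + 1) - XP t (real N)) = - t * J (Suc k) N s + J k N s"
   by (intro has_integral_unique) (auto simp: P(3) c_def right_diff_distrib mult_ac)
  have p: "pochhammer s (Suc k + 3) = pochhammer s (k + 3) * t" using pochhammer_Suc[of s "k + 3"] by (simp add: t_def)
  have "pochhammer s (k + 3) * (c k * (XP t (real N + 1) - XP t (real N))) = pochhammer s (k + 3) * J k N s - pochhammer s (Suc k + 3) * J (Suc k) N s"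
   unfolding p e by (simp add: algebra_simps)
  moreover have "f (Suc k) M s = f k M s + pochhammer s (k + 3) * (c k * XP t (real M))" for M by (simp add: f_def t_def mult_ac)
  then have "f (Suc k) (Suc N) s - f (Suc k) N s = (f k (Suc N) s - f k N s) + pochhammer s (k + 3) * (c k * (XP t (real N + 1) - XP t (real N)))"
   by (simp add: right_diff_distrib add.commute[of "real N" 1])
  ultimately show ?case unfolding Suc.IH by simp
 qed
 have fhol: "f k N holomorphic_on - {1}" for k N
  unfolding f_def[abs_def] pochhammer_prod by (intro holomorphic_intros em3_holomorphic)
 \<comment> \<open>On this set the increments in N are of order N^-(Re s + k + 3), which is
   summable.\<close>
 define S where "S k = {s. Re s > - 2 - real k} - {1}" for k :: nat
 have openS: "open (S k)" for k unfolding S_def by (intro open_Diff open_halfspace_Re_gt) auto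
 \<comment> \<open>Weierstrass test for the telescoping series of increments; the distance of the
   disc from the line Re s = -2 - k is the margin \<open>de\<close>.\<close>
 have unif: "\<exists>g. uniform_limit (cball z d) (%m. f k (Suc m)) g sequentially" if zd: "cball z d \<subseteq> S k" "d > 0" for z d k
 proof -
  define de where "de = Re z - d + real k + 2"
  have "z - of_real d \<in> S k" using zd by (intro subsetD[OF zd(1)]) (simp add: dist_norm)
  then have de: "de > 0" by (simp add: S_def de_def)
  have Re: "Re s + real k + 3 >= 1 + de" if "s \<in> cball z d" for s
  proof -
   have "\<bar>Re (z - s)\<bar> <= norm (z - s)" by (rule abs_Re_le_cmod)
   then show ?thesis using that by (simp add: dist_norm de_def)
  qed
  have "compact ((%s. pochhammer s (k + 3)) ` cball z d)"
   unfolding pochhammer_prod by (intro compact_continuous_image continuous_intros compact_cball)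
  then have "bounded ((%s. pochhammer s (k + 3)) ` cball z d)" by (rule compact_imp_bounded)
  then obtain M where M: "!!s. s \<in> cball z d ==> norm (pochhammer s (k + 3)) <= M" unfolding bounded_iff by blast
  have "compact (poly (P k) ` {0..1})" by (intro compact_continuous_image continuous_intros compact_Icc)
  then have "bounded (poly (P k) ` {0..1})" by (rule compact_imp_bounded)
  then obtain B where "\<forall>y\<in>poly (P k) ` {0..1}. norm y <= B" unfolding bounded_iff by blast
  then have B: "\<bar>poly (P k) v\<bar> <= B" if "0 <= v" "v <= 1" for v using that by simp
  have "z \<in> cball z d" using zd by simp
  from M[OF this] have M0: "M >= 0" by (rule order_trans[OF norm_ge_zero])
  have B0: "B >= 0" using B[of 0] by (rule order_trans[OF abs_ge_zero]) auto
  have bd: "norm (f k (Suc (Suc m)) s - f k (Suc m) s) <= M * (B * real (Suc m) powr - (1 + de))" if s: "s \<in> cball z d" for s m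
  proof -
   have s1: "s ~= 1" using s zd by (auto simp: S_def)
   have "norm (J k (Suc m) s) <= integral {0..1} (%v::real. B * real (Suc m) powr - (1 + de))"
    unfolding J_def
   proof (rule Henstock_Kurzweil_Integration.integral_norm_bound_integral[OF int[OF zero_less_Suc] integrable_const_ivl])
    fix v :: real assume v: "v \<in> {0..1}"
    have "norm (XP (s + of_nat (k + 3)) (real (Suc m) + v)) = (real (Suc m) + v) powr - (Re s + real k + 3)"
     using v by (subst norm_XP) (auto simp: add_ac)
    also have "... <= (real (Suc m) + v) powr - (1 + de)" using v Re[OF s] by (intro powr_mono) auto
    also have "... <= real (Suc m) powr - (1 + de)" using v de by (intro powr_mono2') auto
    finally show "norm (of_real (poly (P k) v) * XP (s + of_nat (k + 3)) (real (Suc m) + v)) <= B * real (Suc m) powr - (1 + de)"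
     unfolding norm_mult using B[of v] v by (intro mult_mono) auto
   qed
   then have "norm (J k (Suc m) s) <= B * real (Suc m) powr - (1 + de)" by simp
   then show ?thesis unfolding step[OF s1 zero_less_Suc] norm_minus_cancel norm_mult using M[OF s] M0 by (intro mult_mono) auto
  qed
  have "summable (%m. real m powr - (1 + de))" using de by (subst summable_real_powr_iff) simp
  then have "summable (%m. M * (B * real (Suc m) powr - (1 + de)))" by (intro summable_mult) (subst summable_Suc_iff)
  from Weierstrass_m_test[OF bd this]
  have "uniform_limit (cball z d) (%n s. \<Sum>m<n. f k (Suc (Suc m)) s - f k (Suc m) s) (%s. \<Sum>m. f k (Suc (Suc m)) s - f k (Suc m) s) sequentially" .
  then have "uniform_limit (cball z d) (%n s. f k (Suc n) s - f k 1 s) (%s. \<Sum>m. f k (Suc (Suc m)) s - f k (Suc m) s) sequentially"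
   unfolding sum_lessThan_telescope[of "%m. f k (Suc m) _"] by simp
  from uniform_limit_add[OF this uniform_limit_const[where c = "f k 1"]]
  have U: "uniform_limit (cball z d) (%n. f k (Suc n)) (%s. (\<Sum>m. f k (Suc (Suc m)) s - f k (Suc m) s) + f k 1 s) sequentially" by (simp only: diff_add_cancel)
  show ?thesis by (rule exI, rule U)
 qed
 have lim: "convergent (%m. f k (Suc m) s)" if "s \<in> S k" for s k
 proof -
  from openS[of k, unfolded open_contains_cball, rule_format, OF that] obtain d where d: "d > 0" "cball s d \<subseteq> S k" by (elim exE conjE)
  from unif[OF d(2,1)] obtain g where "uniform_limit (cball s d) (%m. f k (Suc m)) g sequentially" by (elim exE)
  then have "(%m. f k (Suc m) s) \<longlonglongrightarrow> g s" by (rule tendsto_uniform_limitI) (use d in simp)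
  then show ?thesis by (rule convergentI)
 qed
 have XP0: "(%m. XP t (real (Suc m))) \<longlonglongrightarrow> 0" if "Re t > 0" for t
 proof (rule tendsto_norm_zero_cancel)
  have "(%m. real (Suc m) powr - Re t) \<longlonglongrightarrow> 0" using that by real_asymp
  then show "(%m. norm (XP t (real (Suc m)))) \<longlonglongrightarrow> 0" by (simp add: norm_XP del: of_nat_Suc)
 qed
 \<comment> \<open>Additional corrections tend to 0 wherever k of them already suffice, so the limit
   does not depend on k.\<close>
 have same: "(%m. f (k + i) (Suc m) s - f k (Suc m) s) \<longlonglongrightarrow> 0" if "s \<in> S k" for s k i
 proof -
  have "(%m. \<Sum>j\<in>{k..<k + i}. c j * pochhammer s (j + 3) * XP (s + of_nat (j + 3)) (real (Suc m))) \<longlonglongrightarrow> (\<Sum>j\<in>{k..<k + i}. c j * pochhammer s (j + 3) * 0)"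
   using that by (intro tendsto_intros XP0) (auto simp: S_def)
  moreover have "{..<k + i} = {..<k} \<union> {k..<k + i}" by auto
  then have "f (k + i) (Suc m) s - f k (Suc m) s = (\<Sum>j\<in>{k..<k + i}. c j * pochhammer s (j + 3) * XP (s + of_nat (j + 3)) (real (Suc m)))" for m
   unfolding f_def by (simp add: sum.union_disjoint ivl_disj_int del: of_nat_Suc)
  ultimately show ?thesis by simp
 qed
 \<comment> \<open>A number of corrections that suffices at \<open>s\<close>; the limit formed with
   it is shown below to be the limit for every admissible k.\<close>
 define kk where "kk s = nat \<lceil>- Re s\<rceil>" for s
 have kk: "s \<in> S (kk s)" if "s ~= 1" for s
 proof -
  have "- Re s <= real (kk s)" unfolding kk_def by linarith
  then show ?thesis using that by (simp add: S_def)
 qed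
 define Z where "Z s = Topological_Spaces.lim (%m. f (kk s) (Suc m) s)" for s
 have Z: "(%m. f k (Suc m) s) \<longlonglongrightarrow> Z s" if s: "s \<in> S k" for s k
 proof -
  have s': "s \<in> S (kk s)" using s kk by (auto simp: S_def)
  have l: "(%m. f (kk s) (Suc m) s) \<longlonglongrightarrow> Z s" unfolding Z_def using lim[OF s'] by (simp add: convergent_LIMSEQ_iff)
  show ?thesis
  proof (cases "k <= kk s")
   case True
   then obtain i where "kk s = k + i" using le_Suc_ex by blast
   then show ?thesis using tendsto_diff[OF l same[OF s, of i]] by simp
  next
   case False
   then obtain i where "k = kk s + i" by (metis le_Suc_ex nat_le_linear)
   then show ?thesis using tendsto_add[OF l same[OF s', of i]] by simp
  qed
 qed
 have ulim: "uniform_limit (cball z d) (%m. f k (Suc m)) Z sequentially" if zd: "cball z d \<subseteq> S k" "d > 0" for z d k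
 proof -
  from unif[OF zd] obtain g where g: "uniform_limit (cball z d) (%m. f k (Suc m)) g sequentially" by (elim exE)
  have "g s = Z s" if "s \<in> cball z d" for s
   by (rule LIMSEQ_unique[OF tendsto_uniform_limitI[OF g that] Z]) (use zd that in auto)
  with g show ?thesis using uniform_limit_cong'[of "cball z d" "%m. f k (Suc m)" "%m. f k (Suc m)" g Z] by auto
 qed
 have holS: "Z holomorphic_on S k" for k
 proof (rule holomorphic_uniform_sequence[OF openS])
  show "f k (Suc m) holomorphic_on S k" for m by (rule holomorphic_on_subset[OF fhol]) (auto simp: S_def)
  fix z assume "z \<in> S k"
  from openS[of k, unfolded open_contains_cball, rule_format, OF this] obtain d where d: "d > 0" "cball z d \<subseteq> S k" by (elim exE conjE)
  show "\<exists>d>0. cball z d \<subseteq> S k \<and> uniform_limit (cball z d) (%m. f k (Suc m)) Z sequentially"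
   by (rule exI[of _ d]) (intro conjI d ulim)
 qed
 have "Z holomorphic_on (\<Union>k. S k)" by (rule holomorphic_on_UN_open) (use holS openS in auto)
 moreover have "(\<Union>k. S k) = - {1}" using kk by (auto simp: S_def)
 ultimately have 1: "Z holomorphic_on - {1}" by simp
 have 2: "(%n. of_nat (Suc n) powr (- s)) sums Z s" if s: "1 < Re s" for s
 proof -
  have "s \<in> S 0" using s by (auto simp: S_def)
  from Z[OF this] have l: "(%m. em3 (Suc m) s) \<longlonglongrightarrow> Z s" by (simp add: f_def)
  have "(%m. em3 (Suc m) s - XP (s - 1) (real (Suc m)) / (s - 1) + XP s (real (Suc m)) / 2 - s * XP (s + 1) (real (Suc m)) / 12) \<longlonglongrightarrow> Z s - 0 / (s - 1) + 0 / 2 - s * 0 / 12"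
   using s by (intro tendsto_intros l XP0) auto
  moreover have "em3 (Suc m) s - XP (s - 1) (real (Suc m)) / (s - 1) + XP s (real (Suc m)) / 2 - s * XP (s + 1) (real (Suc m)) / 12 = (\<Sum>n<Suc m. of_nat (Suc n) powr (- s))" for m
  proof -
   have "(\<Sum>n<Suc m. of_nat (Suc n) powr (- s)) = (\<Sum>n=1..Suc m. of_nat n powr (- s))"
    by (rule sum.reindex_bij_witness[of _ "%n. n - 1" Suc]) auto
   also have "... = (\<Sum>n=1..Suc m. XP s (real n))" by (intro sum.cong refl XP_nat) auto
   finally show ?thesis by (simp add: em3_def del: of_nat_Suc)
  qed
  ultimately have "(%m. \<Sum>n<Suc m. of_nat (Suc n) powr (- s)) \<longlonglongrightarrow> Z s" by simp
  then show ?thesis unfolding sums_def by (rule LIMSEQ_imp_Suc)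
 qed
 have 3: "(%m. deriv (em3 (Suc m)) (- 1)) \<longlonglongrightarrow> deriv Z (- 1)"
 proof -
  have "- 1 \<in> S 0" by (auto simp: S_def)
  from openS[of 0, unfolded open_contains_cball, rule_format, OF this] obtain d where d: "d > 0" "cball (- 1) d \<subseteq> S 0" by (elim exE conjE)
  have "(%m. deriv (f 0 (Suc m)) (- 1)) \<longlonglongrightarrow> deriv Z (- 1)"
  proof (rule deriv_complex_uniform_limit)
   show "uniform_limit (ball (- 1) d) (%m. f 0 (Suc m)) Z sequentially" by (rule uniform_limit_on_subset[OF ulim[OF d(2,1)]]) auto
   show "\<forall>\<^sub>F m in sequentially. f 0 (Suc m) holomorphic_on ball (- 1) d"
    using d by (intro always_eventually allI holomorphic_on_subset[OF fhol]) (auto simp: S_def subset_iff)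
  qed (use d in auto)
  then show ?thesis by (simp add: f_def[abs_def])
 qed
 show ?thesis by (rule that[OF 1 2 3])
qed

text \<open>The derivative of \<open>em3 N\<close> at -1 is explicit and contains the sum of n ln n,
  and it converges to the derivative of zeta. The limit here is the logarithm of the
  Glaisher-Kinkelin constant.\<close>

theorem glaisher_limit:
 "(%N. (\<Sum>j<N. real j * ln (real j)) - (((real N)\<^sup>2 / 2 - real N / 2 + 1 / 12) * ln (real N) - (real N)\<^sup>2 / 4)) \<longlonglongrightarrow> 1 / 12 - Re (deriv riemann_zeta (- 1))"
proof -
 obtain Z where Z: "Z holomorphic_on - {1}" "!!s. 1 < Re s ==> (%n. of_nat (Suc n) powr (- s)) sums Z s"
  "(%m. deriv (em3 (Suc m)) (- 1)) \<longlonglongrightarrow> deriv Z (- 1)" by (rule zeta_continuation) (rule that)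
 have "riemann_zeta holomorphic_on (- {1}) \<and> (\<forall>s. 1 < Re s --> (%n. of_nat (Suc n) powr (- s)) sums riemann_zeta s)"
  unfolding riemann_zeta_def by (rule someI[of _ Z]) (intro conjI allI impI Z(1,2))
 then have rz: "riemann_zeta holomorphic_on (- {1})" "!!s. 1 < Re s ==> (%n. of_nat (Suc n) powr (- s)) sums riemann_zeta s" by (rule conjunct1, simp)
 \<comment> \<open>\<open>riemann_zeta\<close> is known only through its two defining properties;
   the identity theorem on the connected punctured plane identifies it with
   \<open>Z\<close>.\<close>
 have eq: "riemann_zeta s = Z s" if "s \<in> - {1}" for s
 proof (rule analytic_continuation_open[OF _ _ _ _ _ rz(1) Z(1) _ that, of "{s. Re s > 1}"])
  show "{s. Re s > 1} ~= {}" by (auto intro!: exI[of _ 2])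
  show "connected (- {1::complex})" by (rule connected_punctured_universe) simp
  show "riemann_zeta z = Z z" if "z \<in> {s. Re s > 1}" for z using rz(2)[of z] Z(2)[of z] that sums_unique2 by blast
 qed (auto simp: open_halfspace_Re_gt)
 have "deriv riemann_zeta (- 1) = deriv Z (- 1)"
 proof (rule deriv_cong_ev[OF _ refl])
  have "eventually (%s. s \<in> - {1::complex}) (nhds (- 1))" by (rule eventually_nhds_in_open) auto
  then show "eventually (%s. riemann_zeta s = Z s) (nhds (- 1))" by eventually_elim (rule eq)
 qed
 then have L: "(%m. Re (deriv (em3 (Suc m)) (- 1))) \<longlonglongrightarrow> Re (deriv riemann_zeta (- 1))" using Z(3) by (simp add: tendsto_Re)
 have d: "deriv (em3 N) (- 1) = of_real (- (\<Sum>n=1..N. real n * ln (real n)) + (real N)\<^sup>2 * ln (real N) / 2 - (real N)\<^sup>2 / 4 + real N * ln (real N) / 2 + 1 / 12 + ln (real N) / 12)" if N: "N > 0" for N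
 proof -
  have X: "XP (- 1) x = of_real x" "XP (- 2) x = of_real (x\<^sup>2)" "XP 0 x = 1" if "x > 0" for x
  proof -
   show "XP (- 1) x = of_real x" using that by (simp add: XP_def exp_of_real)
   have "exp (2 * ln x) = x\<^sup>2" using that by (simp add: exp_double)
   moreover have "exp (2 * complex_of_real (ln x)) = of_real (exp (2 * ln x))" using exp_of_real[of "2 * ln x", where 'a = complex] by simp
   ultimately show "XP (- 2) x = of_real (x\<^sup>2)" by (simp add: XP_def)
  qed (simp add: XP_def)
  have Xd: "((%s. XP (s + a) x) has_field_derivative - of_real (ln x) * XP (s + a) x) (at s)" for s a x
   unfolding XP_def by (auto intro!: derivative_eq_intros)
  have "em3 N = (%s. (\<Sum>n=1..N. XP (s + 0) (real n)) + XP (s + - 1) (real N) / (s - 1) - XP (s + 0) (real N) / 2 + (s * XP (s + 1) (real N)) / 12)"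
   by (auto simp: em3_def)
  moreover have "(... has_field_derivative (\<Sum>n=1..N. - of_real (ln (real n)) * XP (- 1 + 0) (real n)) + ((- of_real (ln (real N)) * XP (- 1 + - 1) (real N)) * (- 1 - 1) - XP (- 1 + - 1) (real N) * (1 - 0)) / ((- 1 - 1) * (- 1 - 1))
    - (- of_real (ln (real N)) * XP (- 1 + 0) (real N)) / 2 + (- 1 * (- of_real (ln (real N)) * XP (- 1 + 1) (real N)) + 1 * XP (- 1 + 1) (real N)) / 12) (at (- 1))"
   by (intro DERIV_add DERIV_diff DERIV_sum DERIV_cdivide DERIV_divide DERIV_mult' Xd DERIV_ident DERIV_const) simp
  ultimately have "(em3 N has_field_derivative (\<Sum>n=1..N. - of_real (ln (real n)) * XP (- 1 + 0) (real n)) + ((- of_real (ln (real N)) * XP (- 1 + - 1) (real N)) * (- 1 - 1) - XP (- 1 + - 1) (real N) * (1 - 0)) / ((- 1 - 1) * (- 1 - 1))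
    - (- of_real (ln (real N)) * XP (- 1 + 0) (real N)) / 2 + (- 1 * (- of_real (ln (real N)) * XP (- 1 + 1) (real N)) + 1 * XP (- 1 + 1) (real N)) / 12) (at (- 1))" by (simp only:)
  then have "deriv (em3 N) (- 1) = (\<Sum>n=1..N. - of_real (ln (real n)) * XP (- 1) (real n)) + (2 * of_real (ln (real N)) * XP (- 2) (real N) - XP (- 2) (real N)) / 4
    + of_real (ln (real N)) * XP (- 1) (real N) / 2 + (XP 0 (real N) + of_real (ln (real N)) * XP 0 (real N)) / 12" by (simp add: DERIV_imp_deriv mult_ac add_ac)
  also have "(\<Sum>n=1..N. - of_real (ln (real n)) * XP (- 1) (real n)) = of_real (- (\<Sum>n=1..N. real n * ln (real n)))"
   unfolding of_real_minus of_real_sum sum_negf[symmetric] by (intro sum.cong) (auto simp: X)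
  also have "of_real (- (\<Sum>n=1..N. real n * ln (real n))) + (2 * of_real (ln (real N)) * XP (- 2) (real N) - XP (- 2) (real N)) / 4
    + of_real (ln (real N)) * XP (- 1) (real N) / 2 + (XP 0 (real N) + of_real (ln (real N)) * XP 0 (real N)) / 12
    = complex_of_real (- (\<Sum>n=1..N. real n * ln (real n)) + (2 * ln (real N) * (real N)\<^sup>2 - (real N)\<^sup>2) / 4 + ln (real N) * real N / 2 + (1 + ln (real N)) / 12)"
   using N by (simp add: X)
  also have "- (\<Sum>n=1..N. real n * ln (real n)) + (2 * ln (real N) * (real N)\<^sup>2 - (real N)\<^sup>2) / 4 + ln (real N) * real N / 2 + (1 + ln (real N)) / 12
   = - (\<Sum>n=1..N. real n * ln (real n)) + (real N)\<^sup>2 * ln (real N) / 2 - (real N)\<^sup>2 / 4 + real N * ln (real N) / 2 + 1 / 12 + ln (real N) / 12"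
   by (simp add: field_simps)
  finally show ?thesis .
 qed
 have "(%m. 1 / 12 - Re (deriv (em3 (Suc m)) (- 1))) \<longlonglongrightarrow> 1 / 12 - Re (deriv riemann_zeta (- 1))" by (intro tendsto_intros L)
 moreover have "1 / 12 - Re (deriv (em3 (Suc m)) (- 1)) = (\<Sum>j<Suc m. real j * ln (real j)) - (((real (Suc m))\<^sup>2 / 2 - real (Suc m) / 2 + 1 / 12) * ln (real (Suc m)) - (real (Suc m))\<^sup>2 / 4)" for m
 proof -
  define x where "x = real (Suc m)"
  have "{1..Suc m} = insert (Suc m) {1..<Suc m}" "{..<Suc m} = insert 0 {1..<Suc m}" by auto
  then have "(\<Sum>n=1..Suc m. real n * ln (real n)) = (\<Sum>j<Suc m. real j * ln (real j)) + x * ln x" by (simp add: x_def del: of_nat_Suc)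
  then show ?thesis unfolding d[OF zero_less_Suc] Re_complex_of_real x_def[symmetric] by (simp add: algebra_simps)
 qed
 ultimately have "(%m. (\<Sum>j<Suc m. real j * ln (real j)) - (((real (Suc m))\<^sup>2 / 2 - real (Suc m) / 2 + 1 / 12) * ln (real (Suc m)) - (real (Suc m))\<^sup>2 / 4)) \<longlonglongrightarrow> 1 / 12 - Re (deriv riemann_zeta (- 1))"
  by (simp only:)
 then show ?thesis by (rule LIMSEQ_imp_Suc)
qed

section \<open>The distribution of the largest eigenvalue\<close>

text \<open>The substitution lemma with the identity map. It is needed because the wall belongs to
  the event y <= a, whereas \<open>gwt\<close> gives weight 0 to its image y = 0.\<close>

lemma gas_cong_AE:
 assumes [measurable]: "w \<in> borel_measurable borel" "w' \<in> borel_measurable borel" and nn: "!!y. 0 <= w y" "!!y. 0 <= w' y"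
  and AE: "AE y in lborel. w y = w' y"
 shows "(\<integral>x. gasw N b w x \<partial>leb N) = (\<integral>x. gasw N b w' x \<partial>leb N)"
proof -
 have g: "ennreal (gasw N b u x) = ennreal (vdm N b (\<lambda>i\<in>{..<N}. x i)) * (\<Prod>i<N. ennreal (u (x i)))" if "!!y. 0 <= u y" for u and x :: "nat => real"
 proof -
  have "vdm N b (\<lambda>i\<in>{..<N}. x i) = vdm N b x" unfolding vdm_def by (intro prod.cong) auto
  then show ?thesis using that by (simp add: gasw_def ennreal_mult'' prod_nonneg prod_ennreal)
 qed
 have "(\<integral>\<^sup>+x. ennreal (gasw N b w x) \<partial>leb N) = (\<integral>\<^sup>+x. ennreal (vdm N b x) * (\<Prod>i<N. ennreal (w' (x i))) \<partial>leb N)"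
  unfolding g[of w, OF nn(1)]
 proof (rule nn_integral_leb_substitution[where T = "%y. y" and G = "%x. ennreal (vdm N b x)"])
  fix h :: "real => ennreal" assume "h \<in> borel_measurable borel"
  show "(\<integral>\<^sup>+y. h y * ennreal (w y) \<partial>lborel) = (\<integral>\<^sup>+y. h y * ennreal (w' y) \<partial>lborel)"
   by (rule nn_integral_cong_AE) (use AE in \<open>auto elim!: eventually_mono\<close>)
 qed measurable
 also have "... = (\<integral>\<^sup>+x. ennreal (gasw N b w' x) \<partial>leb N)"
  using nn(2) by (intro nn_integral_cong) (simp add: gasw_def ennreal_mult'' prod_nonneg prod_ennreal)
 finally have "(\<integral>\<^sup>+x. ennreal (gasw N b w x) \<partial>leb N) = (\<integral>\<^sup>+x. ennreal (gasw N b w' x) \<partial>leb N)" .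
 moreover have "0 <= gasw N b w x" "0 <= gasw N b w' x" for x by (rule gasw_nonneg, rule nn)+
 ultimately show ?thesis by (subst (1 2) integral_eq_nn_integral) auto
qed

lemma max_cdf_eq:
 assumes N: "N > 0" and b: "b > 0" and t: "t > 0"
 defines "w \<equiv> %y. exp (- (real N * b / t * (y\<^sup>2 / 2)))"
 shows "max_cdf N b t a = (\<integral>x. gasw N b (%y. if y <= a then w y else 0) x \<partial>leb N) / (\<integral>x. gasw N b w x \<partial>leb N)"
proof -
 define wa where "wa y = (if y <= a then w y else 0)" for y
 define k where "k = real N * b / t"
 have k: "k > 0" using N b t by (simp add: k_def)
 have gw: "gas_weight N b t gauss_potential = gasw N b w"
  by (auto simp: gas_weight_def gasw_def vdm_def gauss_potential_def w_def power2_eq_square)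
 have [measurable]: "w \<in> borel_measurable borel" "wa \<in> borel_measurable borel" unfolding w_def wa_def[abs_def] by measurable
 have le: "w y <= exp (k / 2) * exp (- (k / 2 * \<bar>y\<bar>))" for y
 proof -
  have "0 <= (\<bar>y\<bar> - 1 / 2)\<^sup>2" by simp
  then have "\<bar>y\<bar> - 1 <= y\<^sup>2" by (simp add: power2_eq_square algebra_simps)
  then have "k / 2 * (\<bar>y\<bar> - 1) <= k / 2 * y\<^sup>2" using k by (intro mult_left_mono) auto
  then show ?thesis unfolding w_def k_def[symmetric] mult_exp_exp by (simp add: algebra_simps)
 qed
 have am: "all_moments w" "all_moments wa"
  by (rule all_moments_exp_bound[OF _ _ _, where c = "k / 2" and C = "exp (k / 2)"];
    use k le in \<open>auto simp: wa_def w_def intro: order_trans\<close>)+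
 have g0: "0 <= gasw N b w x" "0 <= gasw N b wa x" for x by (rule gasw_nonneg; simp add: w_def wa_def)+
 have sp: "space (leb N) = (\<Pi>\<^sub>E i\<in>{..<N}. UNIV)" by (simp add: space_PiM)
 define Z where "Z = (\<integral>x. gasw N b w x \<partial>leb N)"
 have Z: "Z > 0" unfolding Z_def using b am(1) by (intro integral_gasw_pos) (auto simp: w_def)
 have gp: "gas_partition N b t gauss_potential UNIV = Z"
  unfolding gas_partition_def gw set_lebesgue_integral_def Z_def by (intro Bochner_Integration.integral_cong) (auto simp: sp)
 define M where "M = gas_law N b t gauss_potential UNIV"
 have M: "M = density (leb N) (%x. ennreal (indicator (\<Pi>\<^sub>E i\<in>{..<N}. UNIV) x * gasw N b w x / Z))" unfolding M_def gas_law_def gw gp ..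
 have spM: "space M = space (leb N)" by (simp add: M)
 define A where "A = {x \<in> space M. Max (x ` {..<N}) <= a}"
 have A: "A = {x \<in> space (leb N). \<forall>i\<in>{..<N}. x i <= a}"
  unfolding A_def spM using N by (auto simp: lessThan_empty_iff)
 have Am [measurable]: "A \<in> sets (leb N)"
 proof -
  have "A = (\<Inter>i\<in>{..<N}. (%x. x i) -` {..a} \<inter> space (leb N))" unfolding A using N by auto
  then show ?thesis using N by (auto intro!: sets.finite_INT measurable_sets[OF leb_component_measurable[of "%y. y"]] simp: lessThan_empty_iff)
 qed
 have ind: "gasw N b w x * indicator A x = gasw N b wa x" if "x \<in> space (leb N)" for x
 proof (cases "\<forall>i\<in>{..<N}. x i <= a")
  case True
  then show ?thesis using that by (auto simp: A gasw_def wa_def intro!: prod.cong)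
 next
  case False
  then have "(\<Prod>i<N. wa (x i)) = 0" by (intro prod_zero) (auto simp: wa_def)
  then show ?thesis using False by (simp add: A gasw_def)
 qed
 have "emeasure M A = (\<integral>\<^sup>+x. ennreal (indicator (\<Pi>\<^sub>E i\<in>{..<N}. UNIV) x * gasw N b w x / Z) * indicator A x \<partial>leb N)"
  unfolding M
 proof (rule emeasure_density[OF _ Am])
  have "(\<Pi>\<^sub>E i\<in>{..<N}. UNIV) \<in> sets (leb N)" unfolding sp[symmetric] by (rule sets.top)
  then show "(%x. ennreal (indicator (\<Pi>\<^sub>E i\<in>{..<N}. UNIV) x * gasw N b w x / Z)) \<in> borel_measurable (leb N)" by measurable
 qed
 also have "... = (\<integral>\<^sup>+x. ennreal (gasw N b wa x / Z) \<partial>leb N)"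
  by (intro nn_integral_cong, subst ind[symmetric]) (auto simp: sp indicator_def)
 also have "... = ennreal (\<integral>x. gasw N b wa x / Z \<partial>leb N)"
  using integrable_spread_gasw[OF less_imp_le[OF b] am(2), of N 0] g0(2) Z by (intro nn_integral_eq_integral) auto
 finally have "measure M A = (\<integral>x. gasw N b wa x / Z \<partial>leb N)"
  using g0(2) Z by (simp add: measure_def Bochner_Integration.integral_nonneg)
 then show ?thesis unfolding max_cdf_def Let_def M_def[symmetric] A_def[symmetric] by (simp add: Z_def wa_def[abs_def])
qed

text \<open>\<gamma> is the positive root of 3 \<gamma>^2 = a \<gamma> + t. This turns the linear
  coefficient -a \<gamma> of the shifted potential into t (1 - 3 th), and \<alpha> is the centre of
  the limiting support [a - 4 \<gamma>, a].\<close>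

lemma edge_parameters:
 fixes t a :: real
 assumes t: "t > 0" and a: "a < 2 * sqrt t"
 defines "\<gamma> \<equiv> gamma_par t a"
 shows "\<gamma> > 0" "\<gamma>\<^sup>2 < t" "3 * \<gamma>\<^sup>2 = a * \<gamma> + t" "alpha_par t a = a - 2 * \<gamma>"
proof -
 define r where "r = sqrt (a\<^sup>2 + 12 * t)"
 have r2: "r\<^sup>2 = a\<^sup>2 + 12 * t" using t by (simp add: r_def)
 have "\<bar>a\<bar> < r" unfolding r_def using t by (intro real_less_rsqrt) simp
 then show g: "\<gamma> > 0" by (simp add: \<gamma>_def gamma_par_def r_def[symmetric])
 have g6: "6 * \<gamma> = a + r" by (simp add: \<gamma>_def gamma_par_def r_def)
 then have "(6 * \<gamma> - a)\<^sup>2 = a\<^sup>2 + 12 * t" using r2 by simp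
 then show g3: "3 * \<gamma>\<^sup>2 = a * \<gamma> + t" by (simp add: power2_eq_square algebra_simps)
 show "alpha_par t a = a - 2 * \<gamma>" using g6 by (simp add: alpha_par_def r_def[symmetric])
 have "\<gamma> < sqrt t"
 proof (rule ccontr)
  assume "\<not> \<gamma> < sqrt t"
  then have le: "sqrt t <= \<gamma>" by simp
  then have "\<gamma> * \<gamma> < \<gamma> * (3 * \<gamma> - a)" using a g by (intro mult_strict_left_mono) linarith+
  also have "... = t" using g3 by (simp add: power2_eq_square algebra_simps)
  also have "t <= \<gamma>\<^sup>2" using power_mono[OF le, of 2] t by simp
  finally show False by (simp add: power2_eq_square)
 qed
 then have "\<gamma>\<^sup>2 < (sqrt t)\<^sup>2" using g by (intro power_strict_mono) auto
 then show "\<gamma>\<^sup>2 < t" using t by simp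
qed

text \<open>In terms of g: s = (g + 1) / (g - 1), \<alpha> = -4 \<gamma> / (g^2 - 1) and \<alpha> -
  4 \<gamma> = \<alpha> g^2. So the square root in \<open>s_par\<close> disappears, and the
  logarithms split into those of \<gamma>, g, g + 1, g^2 + 3 and constants.\<close>

lemma coefficients:
 fixes t a :: real
 assumes t: "t > 0" and a: "a < 2 * sqrt t"
 defines "\<gamma> \<equiv> gamma_par t a"
 defines "th \<equiv> \<gamma>\<^sup>2 / t"
 defines "g \<equiv> sg th"
 shows "F00 t a / t\<^sup>2 = 2 * th + 3 * th\<^sup>2 / 4 - 3 / 2 - a\<^sup>2 / (2 * t) + ln \<gamma>"
  "F01 t a / t = Bf g - ln \<gamma> - ln (2 * pi)"
  "F10 t a = - (1 / 12) * ln g + 1 / 6 * ln (g\<^sup>2 + 3) - ln 2 / 2"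
  "F02 t a = ln (g + 1) - 11 / 12 * ln g - 1 / 6 * ln (g\<^sup>2 + 3) - ln 2 / 3"
proof -
 note ep = edge_parameters[OF t a, folded \<gamma>_def]
 define \<alpha> where "\<alpha> = alpha_par t a"
 have th: "0 < th" "th < 1" using ep(1,2) t by (auto simp: th_def)
 note sgp = sg_props[OF less_imp_le[OF th(1)] th(2)]
 have g: "g > 1" using sgp(5)[OF th(1)] by (simp add: g_def)
 define q where "q = g\<^sup>2 + 3"
 define r where "r = g - 1"
 define p where "p = g + 1"
 have pos: "g > 0" "q > 0" "r > 0" "p > 0" using g by (auto simp: q_def r_def p_def add_nonneg_pos)
 have rp: "g\<^sup>2 - 1 = r * p" by (simp add: r_def p_def power2_eq_square algebra_simps)
 have thg: "th = r * p / q" using sgp(3) unfolding g_def[symmetric] rp q_def .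
 have tg: "t = \<gamma>\<^sup>2 * q / (r * p)"
 proof -
  have "\<gamma>\<^sup>2 / t = r * p / q" using thg by (simp add: th_def)
  then show ?thesis using t pos by (simp add: field_simps)
 qed
 have ta: "t = \<gamma> * (\<gamma> - \<alpha>)" unfolding \<alpha>_def ep(4) using ep(3) by (simp add: power2_eq_square algebra_simps)
 have al: "\<alpha> = - (4 * \<gamma> / (r * p))"
 proof -
  have "\<gamma> * (\<gamma> - \<alpha>) = \<gamma> * (\<gamma> * q / (r * p))" using ta tg by (simp add: power2_eq_square)
  then have "\<gamma> - \<alpha> = \<gamma> * q / (r * p)" using ep(1) by (subst (asm) mult_left_cancel) auto
  moreover have "q = r * p + 4" using rp by (simp add: q_def)
  ultimately show ?thesis using pos by (simp add: field_simps)
 qed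
 have a4: "\<alpha> - 4 * \<gamma> = \<alpha> * g\<^sup>2"
  using pos rp unfolding al by (simp add: field_simps)
 have a_neg: "\<alpha> < 0" unfolding al using pos ep(1) by simp
 have sq: "sqrt (\<alpha> * (\<alpha> - 4 * \<gamma>)) = - \<alpha> * g"
 proof -
  have "\<alpha> * (\<alpha> - 4 * \<gamma>) = (- \<alpha> * g)\<^sup>2" unfolding a4 by (simp add: power2_eq_square)
  then show ?thesis using a_neg pos by (simp only: real_sqrt_abs) (simp add: abs_mult)
 qed
 have s: "s_par t a = p / r"
 proof -
  have "s_par t a = (2 * \<gamma> - \<alpha> * p) / (2 * \<gamma>)"
   unfolding s_par_def Let_def \<gamma>_def[symmetric] \<alpha>_def[symmetric] sq p_def by (simp add: algebra_simps)
  also have "... = 1 + 2 / r" unfolding al using ep(1) pos by (simp add: field_simps)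
  also have "... = p / r" using pos by (simp add: field_simps) (simp add: r_def p_def)
  finally show ?thesis .
 qed
 have at: "a = 2 * \<gamma> + \<alpha>" using ep(4) by (simp add: \<alpha>_def)
 show "F00 t a / t\<^sup>2 = 2 * th + 3 * th\<^sup>2 / 4 - 3 / 2 - a\<^sup>2 / (2 * t) + ln \<gamma>"
 proof -
  define d where "d = \<gamma> - \<alpha>"
  have d: "d > 0" "\<alpha> = \<gamma> - d" "t = \<gamma> * d" using a_neg ep(1) ta by (auto simp: d_def)
  show ?thesis unfolding F00_def Let_def \<gamma>_def[symmetric] \<alpha>_def[symmetric] unfolding th_def at unfolding d(2,3)
   using d(1) ep(1) by (simp add: divide_simps) (simp add: eval_nat_numeral algebra_simps)
 qed
 show "F01 t a / t = Bf g - ln \<gamma> - ln (2 * pi)"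
 proof -
  have "\<gamma> * s_par t a / (2 * pi * t) = p\<^sup>2 / (2 * pi * \<gamma> * q)"
   unfolding s unfolding tg using pos ep(1) by (simp add: field_simps power2_eq_square)
  then have l: "ln (\<gamma> * s_par t a / (2 * pi * t)) = 2 * ln p - (ln (2 * pi) + ln \<gamma> + ln q)"
   using pos ep(1) by (simp add: ln_div ln_mult ln_realpow)
  have 1: "\<alpha> * \<gamma> / t = - (4 / q)" "\<gamma>\<^sup>2 / t = r * p / q" unfolding al tg using pos ep(1) by (simp_all add: field_simps power2_eq_square)
  have "F01 t a / t = ln (\<gamma> * s_par t a / (2 * pi * t)) - (\<alpha> * \<gamma> / t + \<gamma>\<^sup>2 / t / 2) + (\<alpha> * \<gamma> / t / 2 + \<gamma>\<^sup>2 / t) * (r / p)"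
   unfolding F01_def Let_def \<gamma>_def[symmetric] \<alpha>_def[symmetric] s using t pos by (simp add: field_simps)
  also have "... = 2 * ln p - (ln (2 * pi) + ln \<gamma> + ln q) + (4 / q - r * p / q / 2 + (r * p / q - 2 / q) * (r / p))"
   unfolding 1 l by simp
  also have "4 / q - r * p / q / 2 + (r * p / q - 2 / q) * (r / p) = 1 / 2 - 2 / p + 12 / (q * p)"
  proof -
   have "p = r + 2" "q = r * p + 4" using rp by (auto simp: p_def r_def q_def)
   then have qq: "q = r\<^sup>2 + 2 * r + 4" and pp: "p = r + 2" by (auto simp: power2_eq_square algebra_simps)
   have nz: "q ~= 0" "p ~= 0" using pos by auto
   show ?thesis using nz by (simp add: divide_simps) (simp add: qq pp eval_nat_numeral algebra_simps)
  qed
  finally show ?thesis unfolding Bf_def q_def[symmetric] p_def[symmetric] by simp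
 qed
 show "F10 t a = - (1 / 12) * ln g + 1 / 6 * ln (g\<^sup>2 + 3) - ln 2 / 2"
 proof -
  have "16 * t powi (- 4) * \<gamma> ^ 4 * \<alpha> ^ 3 * (\<alpha> - 4 * \<gamma>) = 16 * (\<gamma> * \<alpha> / t) ^ 4 * g\<^sup>2"
   unfolding a4 by (simp add: power_int_minus power_mult_distrib power_divide divide_inverse eval_nat_numeral mult_ac)
  also have "\<gamma> * \<alpha> / t = - (4 / q)" unfolding al tg using pos ep(1) by (simp add: field_simps power2_eq_square)
  also have "16 * (- (4 / q)) ^ 4 * g\<^sup>2 = 2 ^ 12 * g ^ 2 / q ^ 4" by (simp add: power_divide)
  finally have e: "16 * t powi (- 4) * \<gamma> ^ 4 * \<alpha> ^ 3 * (\<alpha> - 4 * \<gamma>) = 2 ^ 12 * g ^ 2 / q ^ 4" .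
  have "ln (2 ^ 12 * g ^ 2 / q ^ 4) = 12 * ln 2 + 2 * ln g - 4 * ln q"
   using pos by (simp add: ln_div ln_mult ln_realpow del: power_numeral)
  then show ?thesis unfolding F10_def Let_def \<gamma>_def[symmetric] \<alpha>_def[symmetric] e q_def[symmetric] by (simp add: field_simps)
 qed
 show "F02 t a = ln (g + 1) - 11 / 12 * ln g - 1 / 6 * ln (g\<^sup>2 + 3) - ln 2 / 3"
 proof -
  have s1: "p / r - 1 = 2 / r" "p / r + 1 = 2 * g / r" using pos by (simp_all add: field_simps) (simp_all add: p_def r_def)
  have tq: "t powi (- 2) * \<gamma> ^ 4 = (r * p / q)\<^sup>2"
   unfolding tg using pos ep(1) by (simp add: power_int_minus field_simps power2_eq_square eval_nat_numeral)
  have "16 * t powi (- 2) * \<gamma> ^ 4 * (s_par t a ^ 10 * (s_par t a - 1) ^ 3 / (s_par t a + 1) ^ 11) = 16 * (r * p / q)\<^sup>2 * ((p / r) ^ 10 * (2 / r) ^ 3 / (2 * g / r) ^ 11)"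
   unfolding s s1 tq[symmetric] by (simp add: mult_ac)
  also have "... = p ^ 12 / (2 ^ 4 * g ^ 11 * q\<^sup>2)"
   using pos by (simp add: power_divide power_mult_distrib divide_simps) (simp add: eval_nat_numeral)
  finally have e: "16 * t powi (- 2) * \<gamma> ^ 4 * (s_par t a ^ 10 * (s_par t a - 1) ^ 3 / (s_par t a + 1) ^ 11) = p ^ 12 / (2 ^ 4 * g ^ 11 * q\<^sup>2)" .
  have "ln (p ^ 12 / (2 ^ 4 * g ^ 11 * q\<^sup>2)) = 12 * ln p - (4 * ln 2 + 11 * ln g + 2 * ln q)"
   using pos by (simp add: ln_div ln_mult ln_realpow del: power_numeral)
  then show ?thesis unfolding F02_def Let_def \<gamma>_def[symmetric] e q_def[symmetric] p_def[symmetric] by (simp add: field_simps)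
 qed
qed

text \<open>Numerator, denominator and the gas at th = 0 are brought to standard weights by affine
  maps; \<open>D\<close> is the degree of homogeneity of the partition function, 1 for each particle
  and 2 b for each pair. The common factor \<open>ZL N b 0\<close> of Mehta's integral and of
  \<open>gZ N b 0\<close> cancels.\<close>

lemma ln_max_cdf:
 assumes t: "t > 0" and b: "b > 0" and a: "a < 2 * sqrt t" and N: "N > 0"
 defines "\<gamma> \<equiv> gamma_par t a"
 defines "th \<equiv> \<gamma>\<^sup>2 / t"
 defines "D \<equiv> real N + b * (real N * (real N - 1))"
 shows "ln (max_cdf N b t a) = - (real N)\<^sup>2 * b * (a\<^sup>2 / (2 * t)) + D * ln \<gamma> + (ln (gZ N b th) - ln (gZ N b 0)) - D / 2 * (ln (real N) + ln b + ln t)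
  - real N / 2 * ln (2 * pi) + (\<Sum>j<N. ln (Gamma (1 + b * real j)))"
proof -
 note ep = edge_parameters[OF t a, folded \<gamma>_def]
 have th: "0 < th" "th < 1" using ep(1,2) t by (auto simp: th_def)
 define k where "k = real N * b / t"
 have k: "k > 0" using N b t by (simp add: k_def)
 define w where "w y = exp (- (k * (y\<^sup>2 / 2)))" for y
 define wa where "wa y = (if y <= a then w y else 0)" for y
 have [measurable]: "w \<in> borel_measurable borel" "wa \<in> borel_measurable borel" unfolding w_def wa_def[abs_def] by measurable
 have nn: "0 <= w y" "0 <= wa y" for y by (auto simp: w_def wa_def)
 define fac where "fac c = c ^ N * c powr (b * (real N * (real N - 1)))" for c :: real
 have fac: "fac c > 0" "ln (fac c) = D * ln c" if "c > 0" for c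
  using that by (simp_all add: fac_def D_def ln_mult ln_realpow ln_powr algebra_simps)
 interpret g0: wall_gas N b 0 by unfold_locales (use N b in auto)
 interpret gt: wall_gas N b th by unfold_locales (use N b th in auto)
 have cdf: "max_cdf N b t a = (\<integral>x. gasw N b wa x \<partial>leb N) / (\<integral>x. gasw N b w x \<partial>leb N)"
  unfolding max_cdf_eq[OF N b t] wa_def[abs_def] w_def[abs_def] k_def ..
 have num: "(\<integral>x. gasw N b wa x \<partial>leb N) = fac \<gamma> * (exp (- (k * (a\<^sup>2 / 2))) ^ N * gZ N b th)"
 proof -
  have "(\<integral>x. gasw N b wa x \<partial>leb N) = fac \<gamma> * (\<integral>x. gasw N b (%y. wa (a + - \<gamma> * y)) x \<partial>leb N)"
   unfolding fac_def using gas_affine[of "- \<gamma>" wa N b a] ep(1) nn by simp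
  also have "(\<integral>x. gasw N b (%y. wa (a + - \<gamma> * y)) x \<partial>leb N) = (\<integral>x. gasw N b (%y. exp (- (k * (a\<^sup>2 / 2))) * gwt N b th y) x \<partial>leb N)"
  proof (rule gas_cong_AE)
   show "AE y in lborel. wa (a + - \<gamma> * y) = exp (- (k * (a\<^sup>2 / 2))) * gwt N b th y"
    using AE_lborel_singleton[of 0]
   proof eventually_elim
    case (elim y)
    have le: "a + - \<gamma> * y <= a \<longleftrightarrow> y > 0" using ep(1) elim by (auto simp: zero_le_mult_iff not_less)
    have kk: "k * ((a + - \<gamma> * y)\<^sup>2 / 2) = k * (a\<^sup>2 / 2) + real N * b * gpot th y"
    proof -
     have "real N * b * gpot th y = k * (t * gpot th y)" using t by (simp add: k_def)
     also have "t * gpot th y = (t - 3 * \<gamma>\<^sup>2) * y + \<gamma>\<^sup>2 * y\<^sup>2 / 2" unfolding gpot_def th_def using t by (simp add: field_simps)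
     also have "t - 3 * \<gamma>\<^sup>2 = - (a * \<gamma>)" using ep(3) by simp
     finally show ?thesis by (simp add: power2_eq_square algebra_simps add_divide_distrib diff_divide_distrib)
    qed
    show ?case
    proof (cases "y > 0")
     case True
     have "wa (a + - \<gamma> * y) = exp (- (k * ((a + - \<gamma> * y)\<^sup>2 / 2)))" using le True by (simp only: wa_def w_def if_True)
     then show ?thesis unfolding kk using True by (simp add: gwt_def mult_exp_exp)
    next
     case False
     then have "wa (a + - \<gamma> * y) = 0" using le by (simp only: wa_def if_False)
     then show ?thesis using False by (simp add: gwt_def)
    qed
   qed
  qed (use nn gt.gwt_nonneg in auto)
  also have "... = exp (- (k * (a\<^sup>2 / 2))) ^ N * gZ N b th"
  proof -
   have "gasw N b (%y. exp (- (k * (a\<^sup>2 / 2))) * gwt N b th y) x = exp (- (k * (a\<^sup>2 / 2))) ^ N * gasw N b (gwt N b th) x" for x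
    by (simp add: gasw_def prod.distrib)
   then show ?thesis by (simp add: gZ_def)
  qed
  finally show ?thesis .
 qed
 have den: "(\<integral>x. gasw N b w x \<partial>leb N) = fac (1 / sqrt k) * Meh N b"
 proof -
  have "(%y. w (0 + 1 / sqrt k * y)) = (%y. exp (- (y\<^sup>2 / 2)))" using k by (auto simp: w_def power_mult_distrib power_divide)
  then show ?thesis unfolding fac_def Meh_def using gas_affine[of "1 / sqrt k" w N b 0] k nn by simp
 qed
 have zl: "gZ N b 0 = fac (1 / (real N * b)) * ZL N b 0"
 proof -
  have Nb: "real N * b > 0" using N b by simp
  have "(%y. gwt N b 0 (0 + 1 / (real N * b) * y)) = lw 0"
  proof (rule ext)
   fix y :: real
   have "0 + 1 / (real N * b) * y > 0 \<longleftrightarrow> y > 0" using Nb by (simp add: zero_less_divide_iff)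
   then show "gwt N b 0 (0 + 1 / (real N * b) * y) = lw 0 y" using N b by (simp add: gwt_def lw_def gpot_def)
  qed
  moreover have "gwt N b 0 \<in> borel_measurable borel" by (rule g0.gwt_measurable)
  ultimately show ?thesis unfolding gZ_def ZL_def fac_def
   using gas_affine[of "1 / (real N * b)" "gwt N b 0" N b 0] Nb g0.gwt_nonneg b N by simp
 qed
 have ZL: "ZL N b 0 > 0" using g0.Z_pos fac(1)[of "1 / (real N * b)"] N b unfolding zl by (simp add: zero_less_mult_iff)
 have G: "(\<Prod>j<N. Gamma (1 + b * real j)) > 0" "Gamma (1 + b * real j) > 0" for j using b by (auto intro!: prod_pos Gamma_real_pos add_pos_nonneg)
 have Meh: "Meh N b > 0" "ln (Meh N b) = ln (ZL N b 0) + real N / 2 * ln (2 * pi) - (\<Sum>j<N. ln (Gamma (1 + b * real j)))"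
 proof -
  show "Meh N b > 0" unfolding Meh_eq[OF less_imp_le[OF b]] using ZL G by simp
  have "ln (\<Prod>j<N. Gamma (1 + b * real j)) = (\<Sum>j<N. ln (Gamma (1 + b * real j)))" using less_imp_neq[OF G(2)] by (intro ln_prod) auto
  then show "ln (Meh N b) = ln (ZL N b 0) + real N / 2 * ln (2 * pi) - (\<Sum>j<N. ln (Gamma (1 + b * real j)))"
   unfolding Meh_eq[OF less_imp_le[OF b]] using ln_divide_pos[OF mult_pos_pos[OF ZL] G(1), of "sqrt (2 * pi) ^ N"] ln_mult_pos[OF ZL, of "sqrt (2 * pi) ^ N"] by (simp add: ln_realpow ln_sqrt)
 qed
 have l1: "ln (max_cdf N b t a) = (D * ln \<gamma> + (real N * - (k * (a\<^sup>2 / 2)) + ln (gZ N b th))) - (D * ln (1 / sqrt k) + ln (Meh N b))"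
 proof -
  have p: "fac \<gamma> > 0" "fac (1 / sqrt k) > 0" "gZ N b th > 0" using fac(1) ep(1) k gt.Z_pos by auto
  have "ln (fac \<gamma> * (exp (- (k * (a\<^sup>2 / 2))) ^ N * gZ N b th)) = ln (fac \<gamma>) + (real N * - (k * (a\<^sup>2 / 2)) + ln (gZ N b th))"
   using p by (simp add: ln_mult_pos ln_realpow)
  moreover have "ln (fac (1 / sqrt k) * Meh N b) = ln (fac (1 / sqrt k)) + ln (Meh N b)" using p Meh(1) by (intro ln_mult_pos) auto
  ultimately show ?thesis unfolding cdf num den using p Meh(1) fac(2) ep(1) k by (subst ln_divide_pos) auto
 qed
 have l2: "ln (gZ N b 0) = D * ln (1 / (real N * b)) + ln (ZL N b 0)"
  unfolding zl using fac[of "1 / (real N * b)"] ZL N b by (subst ln_mult_pos) auto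
 have l3: "ln (1 / sqrt k) = - (ln (real N) + ln b - ln t) / 2" "ln (1 / (real N * b)) = - (ln (real N) + ln b)"
  using k N b t by (simp_all add: ln_div ln_sqrt k_def ln_mult field_simps)
 have l4: "real N * - (k * (a\<^sup>2 / 2)) = - (real N)\<^sup>2 * b * (a\<^sup>2 / (2 * t))" by (simp add: k_def power2_eq_square)
 show ?thesis unfolding l1 Meh(2) l3 l4 using l2 unfolding l3 by (simp add: field_simps)
qed

text \<open>Binet's formula term by term for j >= 1; the term j = 0 is ln (Gamma 1) = 0 and lies
  outside its range.\<close>

lemma sum_ln_Gamma:
 assumes b: "b > 0" and N: "N > 0"
 shows "(\<Sum>j<N. ln (Gamma (1 + b * real j))) = b * (\<Sum>j<N. real j * ln (real j)) + (b * ln b - b) * (real N * (real N - 1) / 2)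
  + (real N - 1) / 2 * (ln (2 * pi) + ln b) + (ln (fact N) - ln (real N)) / 2 + (\<Sum>j=1..<N. JB (real j * b))"
proof -
 have s: "(\<Sum>j<N. f j) = f 0 + (\<Sum>j=1..<N. f j)" for f :: "nat => real"
 proof -
  have "{..<N} = insert 0 {1..<N}" using N by auto
  then show ?thesis by simp
 qed
 have "ln (Gamma (1 + b * real j)) = b * (real j * ln (real j)) + (b * ln b - b) * real j + (ln (2 * pi) + ln b) / 2 + ln (real j) / 2 + JB (real j * b)" if "j \<in> {1..<N}" for j
 proof -
  have p: "b * real j > 0" "real j > 0" using that b by auto
  have "ln (b * real j) = ln b + ln (real j)" using p b by (intro ln_mult_pos) auto
  moreover have "ln (2 * pi * (b * real j)) = ln (2 * pi) + (ln b + ln (real j))" using p b by (simp add: ln_mult)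
  ultimately show ?thesis unfolding binet_formula[OF p(1)] by (simp add: algebra_simps add_divide_distrib)
 qed
 then have "(\<Sum>j=1..<N. ln (Gamma (1 + b * real j))) = (\<Sum>j=1..<N. b * (real j * ln (real j)) + (b * ln b - b) * real j + (ln (2 * pi) + ln b) / 2 + ln (real j) / 2 + JB (real j * b))"
  by (intro sum.cong) auto
 also have "... = b * (\<Sum>j=1..<N. real j * ln (real j)) + (b * ln b - b) * (\<Sum>j=1..<N. real j) + (real N - 1) * ((ln (2 * pi) + ln b) / 2) + (\<Sum>j=1..<N. ln (real j)) / 2 + (\<Sum>j=1..<N. JB (real j * b))"
  using N by (simp add: sum.distrib sum_distrib_left sum_divide_distrib of_nat_diff)
 also have "(\<Sum>j=1..<N. real j) = real N * (real N - 1) / 2"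
 proof -
  have "2 * (\<Sum>j<n. real j) = real n * (real n - 1)" for n by (induction n) (simp_all add: algebra_simps)
  from this[of N] show ?thesis unfolding s[of real] by simp
 qed
 also have "(\<Sum>j=1..<N. ln (real j)) = ln (fact N) - ln (real N)"
 proof -
  have "(\<Sum>j=1..N. ln (real j)) = ln (fact N)" by (induction N) (simp_all add: ln_mult)
  moreover have "{1..N} = insert N {1..<N}" using N by auto
  ultimately show ?thesis by simp
 qed
 finally show ?thesis unfolding s by simp
qed

theorem mainTheorem2:
  fixes t \<beta> a :: real
  assumes "t > 0" and "\<beta> > 0" and "a < 2 * sqrt t"
    and "one_over_N_expansion"
  shows "(\<lambda>N. ln (max_cdf N \<beta> t a) -
      ((real N)\<^sup>2 * \<beta> / t\<^sup>2 * F00 t a + real N * (\<beta> - 1) / t * F01 t a + F10 t a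
       + (\<beta> + 1 / \<beta> - 2) * F02 t a
       + \<beta> * (real N)\<^sup>2 * (3 / 4 - ln t / 2)
       + real N * (\<beta> - 1) * (- 1 / 2 + ln (2 * pi) + ln t / 2)
       + (\<beta> + 1 / \<beta> - 3) / 12 * ln (real N)
       + (5 - 2 * (\<beta> + 1 / \<beta>)) / 6 * ln 2
       - ln (2 * pi) / 2 - ln \<beta> / 2 + kappa \<beta>))
    \<longlonglongrightarrow> 0"
proof -
 note t = assms(1) and b = assms(2) and a = assms(3)
 define \<gamma> where "\<gamma> = gamma_par t a"
 define th where "th = \<gamma>\<^sup>2 / t"
 define g where "g = sg th"
 define B where "B = \<beta> + 1 / \<beta> - 2"
 have th: "0 < th" "th < 1" using edge_parameters(1,2)[OF t a] t by (auto simp: th_def \<gamma>_def)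
 note co = coefficients[OF t a, folded \<gamma>_def, folded th_def, folded g_def]
 \<comment> \<open>The remainders \<open>e1\<close> to \<open>e4\<close> carry all the limits: the
   ratio of partition functions, the sum of j ln j, the factorial and the sum of Binet terms.
   Everything else in ln \<open>max_cdf\<close> cancels against the claimed expansion by an identity
   valid for every N >= 1.\<close>
 define e1 where "e1 N = ln (gZ N \<beta> th) - ln (gZ N \<beta> 0) - (real N)\<^sup>2 * \<beta> * (2 * th + 3 * th\<^sup>2 / 4) - real N * (\<beta> - 1) * (Bf g - Bf 1)" for N
 define e2 where "e2 N = (\<Sum>j<N. real j * ln (real j)) - (((real N)\<^sup>2 / 2 - real N / 2 + 1 / 12) * ln (real N) - (real N)\<^sup>2 / 4)" for N
 define e3 where "e3 N = ln (fact N) - ((real N + 1 / 2) * ln (real N) - real N)" for N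
 define e4 where "e4 N = (\<Sum>j=1..<N. JB (real j * \<beta>)) - ln (real N) / (12 * \<beta>)" for N
 define z where "z = 1 / 12 - Re (deriv riemann_zeta (- 1))"
 define K where "K = euler_mascheroni / (12 * \<beta>) + (LBINT u:{0<..}. 1 / u\<^sup>2 * (1 / (exp (\<beta> * u) - 1)) * (u / (exp u - 1) - 1 + u / 2 - u\<^sup>2 / 12))"
 have kappa: "kappa \<beta> = ln (2 * pi) / 4 + \<beta> * z + K" by (simp add: kappa_def z_def K_def)
 have lim: "e1 \<longlonglongrightarrow> Cf \<beta> g - Cf \<beta> 1" "e2 \<longlonglongrightarrow> z" "e3 \<longlonglongrightarrow> ln (2 * pi) / 2" "e4 \<longlonglongrightarrow> K"
  unfolding e1_def[abs_def] e2_def[abs_def] e3_def[abs_def] e4_def[abs_def] z_def K_def g_def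
  by (rule gas_ratio_limit[OF b th] glaisher_limit ln_fact_limit sum_JB_limit[OF b])+
 have ln4: "ln (4::real) = 2 * ln 2" using ln_realpow[of 2 2] by simp
 have Bf1: "Bf 1 = 1" by (simp add: Bf_def ln4)
 have Cf: "Cf \<beta> g - Cf \<beta> 1 = F10 t a + B * F02 t a + (1 - 2 * B) / 6 * ln 2"
  unfolding Cf_def co(3,4) B_def[symmetric] by (simp add: ln4 algebra_simps add_divide_distrib diff_divide_distrib)
 have "(%N. e1 N - (Cf \<beta> g - Cf \<beta> 1) + \<beta> * (e2 N - z) + (e3 N - ln (2 * pi) / 2) / 2 + (e4 N - K))
  \<longlonglongrightarrow> (Cf \<beta> g - Cf \<beta> 1) - (Cf \<beta> g - Cf \<beta> 1) + \<beta> * (z - z) + (ln (2 * pi) / 2 - ln (2 * pi) / 2) / 2 + (K - K)"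
  by (intro tendsto_intros lim) simp
 then show ?thesis
 proof (rule tendsto_cong_seq[of _ _ 1])
  fix N :: nat assume "N >= 1"
  then have N: "N > 0" by simp
  define n where "n = real N"
  define L where "L = ln n"
  define lg where "lg = ln \<gamma>"
  define lt where "lt = ln t"
  define lb where "lb = ln \<beta>"
  define lp where "lp = ln (2 * pi)"
  define A2 where "A2 = a\<^sup>2 / (2 * t)"
  define Q where "Q = 2 * th + 3 * th\<^sup>2 / 4"
  define bi where "bi = 1 / \<beta>"
  have 1: "ln (max_cdf N \<beta> t a) = - n\<^sup>2 * \<beta> * A2 + (n + \<beta> * (n * (n - 1))) * lg + (ln (gZ N \<beta> th) - ln (gZ N \<beta> 0)) - (n + \<beta> * (n * (n - 1))) / 2 * (L + lb + lt)
   - n / 2 * lp + (\<Sum>j<N. ln (Gamma (1 + \<beta> * real j)))"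
   unfolding n_def L_def lg_def lt_def lb_def lp_def A2_def th_def \<gamma>_def by (rule ln_max_cdf[OF t b a N])
  have 2: "ln (gZ N \<beta> th) - ln (gZ N \<beta> 0) = e1 N + n\<^sup>2 * \<beta> * Q + n * (\<beta> - 1) * (Bf g - 1)"
   unfolding e1_def n_def Q_def Bf1 by simp
  have 3: "(\<Sum>j<N. ln (Gamma (1 + \<beta> * real j))) = \<beta> * (e2 N + ((n\<^sup>2 / 2 - n / 2 + 1 / 12) * L - n\<^sup>2 / 4)) + (\<beta> * lb - \<beta>) * (n * (n - 1) / 2)
   + (n - 1) / 2 * (lp + lb) + (e3 N + ((n + 1 / 2) * L - n) - L) / 2 + (e4 N + L * bi / 12)"
   unfolding sum_ln_Gamma[OF b N] e2_def e3_def e4_def n_def L_def lb_def lp_def bi_def by simp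
  have 4: "n\<^sup>2 * \<beta> / t\<^sup>2 * F00 t a = n\<^sup>2 * \<beta> * (Q - 3 / 2 - A2 + lg)" "n * (\<beta> - 1) / t * F01 t a = n * (\<beta> - 1) * (Bf g - lg - lp)"
   using co(1,2) unfolding Q_def A2_def lg_def lp_def by (metis times_divide_eq_left times_divide_eq_right)+
  have 5: "F10 t a + B * F02 t a = (Cf \<beta> g - Cf \<beta> 1) - (1 - 2 * B) / 6 * ln 2" unfolding Cf by simp
  \<comment> \<open>After this, logarithms, 1 / \<beta> and the remaining constants are atoms, and
    what is left is a polynomial identity.\<close>
  define X where "X = Cf \<beta> g - Cf \<beta> 1"
  have "- n\<^sup>2 * \<beta> * A2 + (n + \<beta> * (n * (n - 1))) * lg + (e1 N + n\<^sup>2 * \<beta> * Q + n * (\<beta> - 1) * (Bf g - 1)) - (n + \<beta> * (n * (n - 1))) / 2 * (L + lb + lt)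
   - n / 2 * lp + (\<beta> * (e2 N + ((n\<^sup>2 / 2 - n / 2 + 1 / 12) * L - n\<^sup>2 / 4)) + (\<beta> * lb - \<beta>) * (n * (n - 1) / 2)
   + (n - 1) / 2 * (lp + lb) + (e3 N + ((n + 1 / 2) * L - n) - L) / 2 + (e4 N + L * bi / 12))
   - (n\<^sup>2 * \<beta> * (Q - 3 / 2 - A2 + lg) + n * (\<beta> - 1) * (Bf g - lg - lp) + (X - (1 - 2 * (\<beta> + bi - 2)) / 6 * ln 2) + \<beta> * n\<^sup>2 * (3 / 4 - lt / 2) + n * (\<beta> - 1) * (- 1 / 2 + lp + lt / 2)
    + (\<beta> + bi - 3) / 12 * L + (5 - 2 * (\<beta> + bi)) / 6 * ln 2 - lp / 2 - lb / 2 + (lp / 4 + \<beta> * z + K))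
   = e1 N - X + \<beta> * (e2 N - z) + (e3 N - lp / 2) / 2 + (e4 N - K)"
   by (simp add: field_simps power2_eq_square)
  then show "ln (max_cdf N \<beta> t a) - ((real N)\<^sup>2 * \<beta> / t\<^sup>2 * F00 t a + real N * (\<beta> - 1) / t * F01 t a + F10 t a + (\<beta> + 1 / \<beta> - 2) * F02 t a
    + \<beta> * (real N)\<^sup>2 * (3 / 4 - ln t / 2) + real N * (\<beta> - 1) * (- 1 / 2 + ln (2 * pi) + ln t / 2) + (\<beta> + 1 / \<beta> - 3) / 12 * ln (real N) + (5 - 2 * (\<beta> + 1 / \<beta>)) / 6 * ln 2
    - ln (2 * pi) / 2 - ln \<beta> / 2 + kappa \<beta>) = e1 N - (Cf \<beta> g - Cf \<beta> 1) + \<beta> * (e2 N - z) + (e3 N - ln (2 * pi) / 2) / 2 + (e4 N - K)"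
   unfolding n_def[symmetric] 1 2 3 4 B_def[symmetric] kappa L_def[symmetric] lt_def[symmetric] lb_def[symmetric] lp_def[symmetric] X_def[symmetric]
   using 5 unfolding X_def[symmetric] B_def bi_def[symmetric] by (simp add: add.assoc[symmetric])
 qed simp
qed

end
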